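(* Let $\mathcal{M}$ be a graded manifold, $\mathcal{E}$ a graded vector bundle over $\mathcal{M}$ and $k\in\mathbb{N}_0$. Let $(U,\varphi)$ be a graded local chart for $\mathcal{M}$ with coordinate functions $z^1,\dots,z^n$ and let $\{\Phi_\lambda\}_{\lambda=1}^{r}$ be a local frame for $\mathcal{E}$ over $U$. Then the finite collection $\{\boldsymbol{\delta}^{\mathbf I}{}_{\lambda}\}$, where $\mathbf I$ ranges over $\bigcup_{q=0}^{k}\overline{\mathbb N}{}^{n}(q)$ and $\lambda$ over $\{1,\dots,r\}$, freely and finitely generates $\mathrm{gpJet}^k_{\mathcal E}|_U$ with respect to the action $\triangleright$ (that is, for every open $V\subseteq U$, the restrictions of its elements to $V$ freely generate the graded $\mathcal{C}^\infty_{\mathcal M}(V)$-module $\mathrm{gpJet}^k_{\mathcal E}(V)$). Consequently, $\mathrm{gpJet}^k_{\mathcal E}|_U$ is a sheaf, and $\mathrm{Jet}^k_{\mathcal E}$ is a locally freely and finitely generated sheaf of graded $\mathcal{C}^\infty_{\mathcal M}$-modules of a constant graded rank (hence the sheaf of sections of a graded vector bundle $\mathfrak{J}^k_{\mathcal E}$).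
   Context: Graded means $\mathbb{Z}$-graded. Graded vector spaces and modules are sequences indexed by $j\in\mathbb Z$; all elements are homogeneous and $|v|$ is the degree. A graded linear map $F$ of degree $|F|$ raises degree by $|F|$; it is linear over a graded commutative algebra if $F(f\cdot v)=(-1)^{|F||f|}f\cdot F(v)$. Graded manifold $\mathcal M$: a second countable Hausdorff space $M$ with a sheaf $\mathcal{C}^\infty_{\mathcal M}$ of graded commutative associative unital real algebras, locally isomorphic to the following model: an open subset of $\mathbb R^{n_0}$ with the sheaf of formal power series in graded commuting variables of nonzero degrees ($n_j$ of degree $j\neq 0$), with smooth coefficients. The total dimension $n=\sum_j n_j$ is finite. Each function $f$ has a body $\underline f$ (a smooth function, zero if $|f|\neq0$), and $f(m):=\underline f(m)$. A graded local chart over $U$ gives coordinate functions $z^1,\dots,z^n$. Graded vector bundle $\mathcal E$: a sheaf $\Gamma_{\mathcal E}$ of graded $\mathcal{C}^\infty_{\mathcal M}$-modules locally isomorphic to $\mathcal{C}^\infty_{\mathcal M}\otimes_{\mathbb R}K$ for a fixed finite-dimensional graded vector space $K$ (its graded dimension is the graded rank). A local frame over $U$ is a collection $\Phi_1,\dots,\Phi_r\in\Gamma_{\mathcal E}(U)$, $|\Phi_\lambda|=|\vartheta_\lambda|$ for a fixed homogeneous basis $(\vartheta_\lambda)$ of $K$, such that over every open $V\subseteq U$ every section is uniquely $\psi=\psi^\lambda\cdot\Phi_\lambda|_V$ (repeated indices are summed). Multi-indices: $\overline{\mathbb N}{}^n$ is the set of $\mathbf I=(i_1,\dots,i_n)\in(\mathbb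 N_0)^n$ with $i_A\in\{0,1\}$ whenever $|z^A|$ is odd; $w(\mathbf I)=\sum_A i_A$; $\overline{\mathbb N}{}^n(q)=\{\mathbf I\in\overline{\mathbb N}{}^n: w(\mathbf I)=q\}$; $\mathbf 0=(0,\dots,0)$. Geometrization: for $a\in U$ let $\mathcal J^a_{\mathcal M}(U)=\{f\in\mathcal{C}^\infty_{\mathcal M}(U): f(a)=0\}$. For a graded $\mathcal{C}^\infty_{\mathcal M}(U)$-module $P$ let $P^\bullet=\bigcap_{q\in\mathbb N}\bigcap_{a\in U}(\mathcal J^a_{\mathcal M}(U))^q P$. For a presheaf $\mathcal F$ of graded $\mathcal{C}^\infty_{\mathcal M}$-modules, $\mathrm{Geo}(\mathcal F)(U)=\mathcal F(U)/\mathcal F(U)^\bullet$, and $[\psi]^\bullet$ denotes the class of $\psi$. Jets: for open $U\subseteq M$ let $\mathcal X(U)=\mathcal{C}^\infty_{\mathcal M}(U)\otimes_{\mathbb R}\Gamma_{\mathcal E}(U)$ with two actions $f\triangleright(g\otimes\psi)=(fg)\otimes\psi$ and $f\blacktriangleright(g\otimes\psi)=(-1)^{|f||g|}g\otimes(f\cdot\psi)$; let $\delta_f(x)=f\triangleright x-f\blacktriangleright x$. Let $\mathcal V_{(k)}(U)$ be the real span of all $\delta_{f_1}\cdots\delta_{f_{k+1}}(g\otimes\psi)$, $\mathrm{pJet}^k_{\mathcal E}(U)=\mathcal X(U)/\mathcal V_{(k)}(U)$, and let $g\otimes_{(k)}\psi$ be the class of $g\otimes\psi$; $\delta_f$ descends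 to $\mathrm{pJet}^k_{\mathcal E}(U)$. Put $\mathrm{gpJet}^k_{\mathcal E}=\mathrm{Geo}(\mathrm{pJet}^k_{\mathcal E})$ (with respect to $\triangleright$) and let $\mathrm{Jet}^k_{\mathcal E}$ be the sheafification of $\mathrm{gpJet}^k_{\mathcal E}$. Module structures are with respect to $\triangleright$ unless said otherwise. Generators: $\boldsymbol\delta^{\mathbf 0}{}_\lambda=[1\otimes_{(k)}\Phi_\lambda]^\bullet$, and for $\mathbf I\in\overline{\mathbb N}{}^n(q)$, $q\ge1$, $\boldsymbol\delta^{\mathbf I}{}_\lambda=[(\delta_{z^1})^{i_1}\cdots(\delta_{z^n})^{i_n}(1\otimes_{(k)}\Phi_\lambda)]^\bullet\in\mathrm{gpJet}^k_{\mathcal E}(U)$. *)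

theory Defs
  imports
    "HOL-Analysis.Analysis"
    "HOL-Library.Poly_Mapping"
    "HOL-Algebra.Module"
    "HOL-Algebra.AbelCoset"
begin

section \<open>Graded vector spaces\<close>

definition real_ring :: "real ring" where
  "real_ring = \<lparr>carrier = UNIV, mult = (*), one = 1, zero = 0, add = (+)\<rparr>"

text \<open>
  A graded vector space is a sequence of real vector spaces. The components are HOL-Algebra
  modules over \<^const>\<open>real_ring\<close>; the ring multiplication and unit contained in the module
  record are never used. As an element does not determine its degree, operations take the
  degrees of their arguments as extra parameters.
\<close>

type_synonym 'a gvs = "int \<Rightarrow> (real, 'a) module"

definition graded_vs :: "'a gvs \<Rightarrow> bool" where
  "graded_vs V \<longleftrightarrow> (\<forall>j. Module.module real_ring (V j))"

definition real_linear :: "(real, 'a) module \<Rightarrow> (real, 'b) module \<Rightarrow> ('a \<Rightarrow> 'b) \<Rightarrow> bool" where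
  "real_linear V W f \<longleftrightarrow> f \<in> carrier V \<rightarrow> carrier W \<and>
     (\<forall>x\<in>carrier V. \<forall>y\<in>carrier V. f (x \<oplus>\<^bsub>V\<^esub> y) = f x \<oplus>\<^bsub>W\<^esub> f y) \<and>
     (\<forall>r. \<forall>x\<in>carrier V. f (r \<odot>\<^bsub>V\<^esub> x) = r \<odot>\<^bsub>W\<^esub> f x)"

definition real_span :: "(real, 'a) module \<Rightarrow> 'a set \<Rightarrow> 'a set" where
  "real_span V S = (\<lambda>W. submodule W real_ring V) hull S"

definition quotient_vs :: "(real, 'a) module \<Rightarrow> 'a set \<Rightarrow> (real, 'a set) module" where
  "quotient_vs V W =
     \<lparr>carrier = a_rcosets\<^bsub>V\<^esub> W, mult = undefined, one = undefined,
      zero = W, add = (\<lambda>A B. A <+>\<^bsub>V\<^esub> B),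
      smult = (\<lambda>r A. W <+>\<^bsub>V\<^esub> ((\<lambda>x. r \<odot>\<^bsub>V\<^esub> x) ` A))\<rparr>"

text \<open>
  The map that \<open>f\<close> induces between quotients, with values in the quotient of \<open>V\<close> by \<open>W\<close>:
  if the images of the elements of the coset \<open>A\<close> are congruent modulo \<open>W\<close>, the result is
  their common coset.
\<close>

definition descend :: "(real, 'b) module \<Rightarrow> 'b set \<Rightarrow> ('a \<Rightarrow> 'b) \<Rightarrow> 'a set \<Rightarrow> 'b set" where
  "descend V W f A = W <+>\<^bsub>V\<^esub> (f ` A)"

definition koszul :: "int \<Rightarrow> real" where
  "koszul m = (if even m then 1 else - 1)"


section \<open>Tensor products over the reals\<close>

text \<open>
  A basis vector \<open>(p, a, b)\<close> of the free vector space stands for \<open>a \<otimes> b\<close>, where \<open>a\<close> has degree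
  \<open>p\<close>; in degree \<open>j\<close> of the tensor product, \<open>b\<close> has degree \<open>j - p\<close>.
\<close>

definition free_vs :: "'g set \<Rightarrow> (real, 'g \<Rightarrow>\<^sub>0 real) module" where
  "free_vs G = \<lparr>carrier = {x. Poly_Mapping.keys x \<subseteq> G}, mult = undefined, one = undefined,
     zero = 0, add = (+), smult = (\<lambda>r. Poly_Mapping.map ((*) r))\<rparr>"

definition tensor_basis :: "'a gvs \<Rightarrow> 'b gvs \<Rightarrow> int \<Rightarrow> (int \<times> 'a \<times> 'b) set" where
  "tensor_basis V W j = {(p, a, b). a \<in> carrier (V p) \<and> b \<in> carrier (W (j - p))}"

definition tensor_free :: "'a gvs \<Rightarrow> 'b gvs \<Rightarrow> int \<Rightarrow> (real, (int \<times> 'a \<times> 'b) \<Rightarrow>\<^sub>0 real) module" where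
  "tensor_free V W j = free_vs (tensor_basis V W j)"

definition bilinear_relations :: "'a gvs \<Rightarrow> 'b gvs \<Rightarrow> int \<Rightarrow> ((int \<times> 'a \<times> 'b) \<Rightarrow>\<^sub>0 real) set" where
  "bilinear_relations V W j =
     {Poly_Mapping.single (p, a \<oplus>\<^bsub>V p\<^esub> a', b) 1
        - Poly_Mapping.single (p, a, b) 1 - Poly_Mapping.single (p, a', b) 1 | p a a' b.
        a \<in> carrier (V p) \<and> a' \<in> carrier (V p) \<and> b \<in> carrier (W (j - p))} \<union>
     {Poly_Mapping.single (p, a, b \<oplus>\<^bsub>W (j - p)\<^esub> b') 1
        - Poly_Mapping.single (p, a, b) 1 - Poly_Mapping.single (p, a, b') 1 | p a b b'.
        a \<in> carrier (V p) \<and> b \<in> carrier (W (j - p)) \<and> b' \<in> carrier (W (j - p))} \<union>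
     {Poly_Mapping.single (p, r \<odot>\<^bsub>V p\<^esub> a, b) 1 - Poly_Mapping.single (p, a, b) r | p r a b.
        a \<in> carrier (V p) \<and> b \<in> carrier (W (j - p))} \<union>
     {Poly_Mapping.single (p, a, r \<odot>\<^bsub>W (j - p)\<^esub> b) 1 - Poly_Mapping.single (p, a, b) r | p r a b.
        a \<in> carrier (V p) \<and> b \<in> carrier (W (j - p))}"

definition tensor_null :: "'a gvs \<Rightarrow> 'b gvs \<Rightarrow> int \<Rightarrow> ((int \<times> 'a \<times> 'b) \<Rightarrow>\<^sub>0 real) set" where
  "tensor_null V W j = real_span (tensor_free V W j) (bilinear_relations V W j)"

definition tensor :: "'a gvs \<Rightarrow> 'b gvs \<Rightarrow> ((int \<times> 'a \<times> 'b) \<Rightarrow>\<^sub>0 real) set gvs" where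
  "tensor V W j = quotient_vs (tensor_free V W j) (tensor_null V W j)"

definition tens ::
  "'a gvs \<Rightarrow> 'b gvs \<Rightarrow> int \<Rightarrow> int \<Rightarrow> 'a \<Rightarrow> 'b \<Rightarrow> ((int \<times> 'a \<times> 'b) \<Rightarrow>\<^sub>0 real) set" where
  "tens V W p q a b =
     tensor_null V W (p + q) +>\<^bsub>tensor_free V W (p + q)\<^esub> Poly_Mapping.single (p, a, b) 1"

text \<open>
  The linear map on a tensor product that sends \<open>a \<otimes> b\<close> to \<open>h (p, a, b)\<close>: the linear extension
  of \<open>h\<close> to the free vector space is constant on cosets whenever \<open>h\<close> is bilinear.
\<close>

definition tensor_lift ::
  "(real, 'c) module \<Rightarrow> (int \<times> 'a \<times> 'b \<Rightarrow> 'c) \<Rightarrow> ((int \<times> 'a \<times> 'b) \<Rightarrow>\<^sub>0 real) set \<Rightarrow> 'c" where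
  "tensor_lift N h A = the_elem
     ((\<lambda>x. finsum N (\<lambda>g. Poly_Mapping.lookup x g \<odot>\<^bsub>N\<^esub> h g) (Poly_Mapping.keys x)) ` A)"


section \<open>Sheaves of graded vector spaces, algebras and modules\<close>

text \<open>
  \<open>res F U V j\<close> restricts sections of degree \<open>j\<close> from \<open>U\<close> to \<open>V\<close>; \<open>gmul C U i j\<close> multiplies
  functions of degrees \<open>i\<close> and \<open>j\<close>; \<open>act F U i j\<close> lets a function of degree \<open>i\<close> act on a
  section of degree \<open>j\<close>.
\<close>

record ('m, 'a) psh =
  sec :: "'m set \<Rightarrow> 'a gvs"
  res :: "'m set \<Rightarrow> 'm set \<Rightarrow> int \<Rightarrow> 'a \<Rightarrow> 'a"

record ('m, 'a) apsh = "('m, 'a) psh" +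
  gmul :: "'m set \<Rightarrow> int \<Rightarrow> int \<Rightarrow> 'a \<Rightarrow> 'a \<Rightarrow> 'a"
  gunit :: "'m set \<Rightarrow> 'a"

record ('m, 'f, 'a) mpsh = "('m, 'a) psh" +
  act :: "'m set \<Rightarrow> int \<Rightarrow> int \<Rightarrow> 'f \<Rightarrow> 'a \<Rightarrow> 'a"

locale graded_presheaf =
  fixes X :: "'m topology" and F :: "('m, 'a, 'z) psh_scheme"
  assumes sec_vs: "openin X U \<Longrightarrow> graded_vs (sec F U)"
    and res_linear: "\<lbrakk>openin X U; openin X V; V \<subseteq> U\<rbrakk> \<Longrightarrow>
      real_linear (sec F U j) (sec F V j) (res F U V j)"
    and res_id: "\<lbrakk>openin X U; s \<in> carrier (sec F U j)\<rbrakk> \<Longrightarrow> res F U U j s = s"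
    and res_comp: "\<lbrakk>openin X U; openin X V; openin X W; W \<subseteq> V; V \<subseteq> U; s \<in> carrier (sec F U j)\<rbrakk>
      \<Longrightarrow> res F V W j (res F U V j s) = res F U W j s"

locale graded_sheaf = graded_presheaf X F
  for X :: "'m topology" and F :: "('m, 'a, 'z) psh_scheme" +
  assumes locality: "\<lbrakk>\<forall>U\<in>\<U>. openin X U; s \<in> carrier (sec F (\<Union>\<U>) j); t \<in> carrier (sec F (\<Union>\<U>) j);
      \<forall>U\<in>\<U>. res F (\<Union>\<U>) U j s = res F (\<Union>\<U>) U j t\<rbrakk> \<Longrightarrow> s = t"
    and gluing: "\<lbrakk>\<forall>U\<in>\<U>. openin X U; \<forall>U\<in>\<U>. \<sigma> U \<in> carrier (sec F U j);
      \<forall>U\<in>\<U>. \<forall>V\<in>\<U>. res F U (U \<inter> V) j (\<sigma> U) = res F V (U \<inter> V) j (\<sigma> V)\<rbrakk> \<Longrightarrow>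
      \<exists>s\<in>carrier (sec F (\<Union>\<U>) j). \<forall>U\<in>\<U>. res F (\<Union>\<U>) U j s = \<sigma> U"

locale graded_algebra_sheaf = graded_sheaf X C
  for X :: "'m topology" and C :: "('m, 'f) apsh" +
  assumes gmul_linear_left: "\<lbrakk>openin X U; g \<in> carrier (sec C U j)\<rbrakk> \<Longrightarrow>
      real_linear (sec C U i) (sec C U (i + j)) (\<lambda>f. gmul C U i j f g)"
    and gmul_linear_right: "\<lbrakk>openin X U; f \<in> carrier (sec C U i)\<rbrakk> \<Longrightarrow>
      real_linear (sec C U j) (sec C U (i + j)) (gmul C U i j f)"
    and gmul_assoc: "\<lbrakk>openin X U; f \<in> carrier (sec C U i); g \<in> carrier (sec C U j);
      h \<in> carrier (sec C U l)\<rbrakk> \<Longrightarrow>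
      gmul C U (i + j) l (gmul C U i j f g) h = gmul C U i (j + l) f (gmul C U j l g h)"
    and gmul_commute: "\<lbrakk>openin X U; f \<in> carrier (sec C U i); g \<in> carrier (sec C U j)\<rbrakk> \<Longrightarrow>
      gmul C U i j f g = koszul (i * j) \<odot>\<^bsub>sec C U (i + j)\<^esub> gmul C U j i g f"
    and gunit_closed: "openin X U \<Longrightarrow> gunit C U \<in> carrier (sec C U 0)"
    and gmul_gunit: "\<lbrakk>openin X U; f \<in> carrier (sec C U i)\<rbrakk> \<Longrightarrow> gmul C U 0 i (gunit C U) f = f"
    and res_gmul: "\<lbrakk>openin X U; openin X V; V \<subseteq> U; f \<in> carrier (sec C U i); g \<in> carrier (sec C U j)\<rbrakk>
      \<Longrightarrow> res C U V (i + j) (gmul C U i j f g) = gmul C V i j (res C U V i f) (res C U V j g)"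
    and res_gunit: "\<lbrakk>openin X U; openin X V; V \<subseteq> U\<rbrakk> \<Longrightarrow> res C U V 0 (gunit C U) = gunit C V"

locale graded_module_presheaf = graded_presheaf X F
  for X :: "'m topology" and C :: "('m, 'f) apsh" and F :: "('m, 'f, 'a) mpsh" +
  assumes act_linear_left: "\<lbrakk>openin X U; s \<in> carrier (sec F U j)\<rbrakk> \<Longrightarrow>
      real_linear (sec C U i) (sec F U (i + j)) (\<lambda>f. act F U i j f s)"
    and act_linear_right: "\<lbrakk>openin X U; f \<in> carrier (sec C U i)\<rbrakk> \<Longrightarrow>
      real_linear (sec F U j) (sec F U (i + j)) (act F U i j f)"
    and act_assoc: "\<lbrakk>openin X U; f \<in> carrier (sec C U i); g \<in> carrier (sec C U j);
      s \<in> carrier (sec F U l)\<rbrakk> \<Longrightarrow>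
      act F U (i + j) l (gmul C U i j f g) s = act F U i (j + l) f (act F U j l g s)"
    and act_gunit: "\<lbrakk>openin X U; s \<in> carrier (sec F U j)\<rbrakk> \<Longrightarrow> act F U 0 j (gunit C U) s = s"
    and res_act: "\<lbrakk>openin X U; openin X V; V \<subseteq> U; f \<in> carrier (sec C U i); s \<in> carrier (sec F U j)\<rbrakk>
      \<Longrightarrow> res F U V (i + j) (act F U i j f s) = act F V i j (res C U V i f) (res F U V j s)"

locale graded_module_sheaf = graded_module_presheaf X C F + graded_sheaf X F
  for X :: "'m topology" and C :: "('m, 'f) apsh" and F :: "('m, 'f, 'a) mpsh"

definition quotient_psh ::
  "('m, 'f, 'a) mpsh \<Rightarrow> ('m set \<Rightarrow> int \<Rightarrow> 'a set) \<Rightarrow> ('m, 'f, 'a set) mpsh" where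
  "quotient_psh F N =
     \<lparr>sec = (\<lambda>U j. quotient_vs (sec F U j) (N U j)),
      res = (\<lambda>U V j. descend (sec F V j) (N V j) (res F U V j)),
      act = (\<lambda>U i j f. descend (sec F U (i + j)) (N U (i + j)) (act F U i j f))\<rparr>"

text \<open>
  \<open>U \<mapsto> C(U) \<otimes> B(U)\<close> with the left action \<open>f \<cdot> (g \<otimes> b) = (f g) \<otimes> b\<close>.
\<close>

definition tensor_psh ::
  "('m, 'f) apsh \<Rightarrow> ('m, 'b, 'z) psh_scheme \<Rightarrow>
   ('m, 'f, ((int \<times> 'f \<times> 'b) \<Rightarrow>\<^sub>0 real) set) mpsh" where
  "tensor_psh C B =
     \<lparr>sec = (\<lambda>U. tensor (sec C U) (sec B U)),
      res = (\<lambda>U V j. tensor_lift (tensor (sec C V) (sec B V) j)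
        (\<lambda>(p, g, b). tens (sec C V) (sec B V) p (j - p) (res C U V p g) (res B U V (j - p) b))),
      act = (\<lambda>U i j f. tensor_lift (tensor (sec C U) (sec B U) (i + j))
        (\<lambda>(p, g, b). tens (sec C U) (sec B U) (i + p) (j - p) (gmul C U i p f g) b))\<rparr>"

text \<open>
  The sheafification consists of the maps that assign to every point of \<open>U\<close> a germ at this point
  and are locally given by the germs of a section. A germ is represented by the set of all
  sections \<open>(W, t)\<close> that define it.
\<close>

definition germ ::
  "'m topology \<Rightarrow> ('m, 'a, 'z) psh_scheme \<Rightarrow> int \<Rightarrow> 'm \<Rightarrow> 'm set \<Rightarrow> 'a \<Rightarrow> ('m set \<times> 'a) set" where
  "germ X F j x V s = {(W, t). openin X W \<and> x \<in> W \<and> t \<in> carrier (sec F W j) \<and>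
     (\<exists>N. openin X N \<and> x \<in> N \<and> N \<subseteq> V \<inter> W \<and> res F V N j s = res F W N j t)}"

definition germ_add :: "'m topology \<Rightarrow> ('m, 'a, 'z) psh_scheme \<Rightarrow> int \<Rightarrow> 'm \<Rightarrow>
    ('m set \<times> 'a) set \<Rightarrow> ('m set \<times> 'a) set \<Rightarrow> ('m set \<times> 'a) set" where
  "germ_add X F j x \<alpha> \<beta> = (THE \<gamma>. \<exists>V s t. openin X V \<and> x \<in> V \<and>
     s \<in> carrier (sec F V j) \<and> t \<in> carrier (sec F V j) \<and>
     \<alpha> = germ X F j x V s \<and> \<beta> = germ X F j x V t \<and> \<gamma> = germ X F j x V (s \<oplus>\<^bsub>sec F V j\<^esub> t))"

definition germ_scale :: "'m topology \<Rightarrow> ('m, 'a, 'z) psh_scheme \<Rightarrow> int \<Rightarrow> 'm \<Rightarrow>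
    real \<Rightarrow> ('m set \<times> 'a) set \<Rightarrow> ('m set \<times> 'a) set" where
  "germ_scale X F j x r \<alpha> = (THE \<gamma>. \<exists>V s. openin X V \<and> x \<in> V \<and> s \<in> carrier (sec F V j) \<and>
     \<alpha> = germ X F j x V s \<and> \<gamma> = germ X F j x V (r \<odot>\<^bsub>sec F V j\<^esub> s))"

definition germ_act :: "'m topology \<Rightarrow> ('m, 'f) apsh \<Rightarrow> ('m, 'f, 'a) mpsh \<Rightarrow> int \<Rightarrow> int \<Rightarrow> 'm \<Rightarrow>
    'm set \<Rightarrow> 'f \<Rightarrow> ('m set \<times> 'a) set \<Rightarrow> ('m set \<times> 'a) set" where
  "germ_act X C F i j x U f \<alpha> = (THE \<gamma>. \<exists>V s. openin X V \<and> x \<in> V \<and> V \<subseteq> U \<and>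
     s \<in> carrier (sec F V j) \<and> \<alpha> = germ X F j x V s \<and>
     \<gamma> = germ X F (i + j) x V (act F V i j (res C U V i f) s))"

definition sheafification ::
  "'m topology \<Rightarrow> ('m, 'f) apsh \<Rightarrow> ('m, 'f, 'a) mpsh \<Rightarrow>
   ('m, 'f, 'm \<Rightarrow> ('m set \<times> 'a) set) mpsh" where
  "sheafification X C F =
     \<lparr>sec = (\<lambda>U j.
        \<lparr>carrier = {\<sigma> \<in> extensional U. \<forall>x\<in>U. \<exists>V s. openin X V \<and> x \<in> V \<and> V \<subseteq> U \<and>
           s \<in> carrier (sec F V j) \<and> (\<forall>y\<in>V. \<sigma> y = germ X F j y V s)},
         mult = undefined, one = undefined,
         zero = (\<lambda>x\<in>U. germ X F j x U \<zero>\<^bsub>sec F U j\<^esub>),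
         add = (\<lambda>\<sigma> \<tau>. \<lambda>x\<in>U. germ_add X F j x (\<sigma> x) (\<tau> x)),
         smult = (\<lambda>r \<sigma>. \<lambda>x\<in>U. germ_scale X F j x r (\<sigma> x))\<rparr>),
      res = (\<lambda>U V j \<sigma>. restrict \<sigma> V),
      act = (\<lambda>U i j f \<sigma>. \<lambda>x\<in>U. germ_act X C F i j x U f (\<sigma> x))\<rparr>"


section \<open>Freely generated modules and graded vector bundles\<close>

text \<open>
  The family \<open>b\<close>, whose members have the degrees \<open>d\<close>, freely generates the graded module of
  sections of \<open>F\<close> over \<open>U\<close>.
\<close>

definition freely_generates ::
  "('m, 'f) apsh \<Rightarrow> ('m, 'f, 'a) mpsh \<Rightarrow> 'm set \<Rightarrow> 'i set \<Rightarrow> ('i \<Rightarrow> int) \<Rightarrow> ('i \<Rightarrow> 'a) \<Rightarrow> bool" where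
  "freely_generates C F U L d b \<longleftrightarrow> finite L \<and> (\<forall>l\<in>L. b l \<in> carrier (sec F U (d l))) \<and>
     (\<forall>j. \<forall>\<psi>\<in>carrier (sec F U j). \<exists>!c. c \<in> (\<Pi>\<^sub>E l\<in>L. carrier (sec C U (j - d l))) \<and>
        \<psi> = finsum (sec F U j) (\<lambda>l. act F U (j - d l) (d l) (c l) (b l)) L)"

definition freely_generates_on ::
  "'m topology \<Rightarrow> ('m, 'f) apsh \<Rightarrow> ('m, 'f, 'a) mpsh \<Rightarrow> 'm set \<Rightarrow>
   'i set \<Rightarrow> ('i \<Rightarrow> int) \<Rightarrow> ('i \<Rightarrow> 'a) \<Rightarrow> bool" where
  "freely_generates_on X C F U L d b \<longleftrightarrow> openin X U \<and> (\<forall>l\<in>L. b l \<in> carrier (sec F U (d l))) \<and>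
     (\<forall>V. openin X V \<and> V \<subseteq> U \<longrightarrow> freely_generates C F V L d (\<lambda>l. res F U V (d l) (b l)))"

text \<open>
  A finite-dimensional graded vector space \<open>K\<close> with a homogeneous basis is given, up to
  isomorphism, by the list \<open>es\<close> of the degrees of the basis vectors.
\<close>

definition coord_gvs :: "int list \<Rightarrow> (nat \<Rightarrow> real) gvs" where
  "coord_gvs es j =
     \<lparr>carrier = {v. \<forall>l. \<not> (l < length es \<and> es ! l = j) \<longrightarrow> v l = 0},
      mult = undefined, one = undefined, zero = (\<lambda>_. 0),
      add = (\<lambda>u v l. u l + v l), smult = (\<lambda>r v l. r * v l)\<rparr>"

definition constant_psh :: "'a gvs \<Rightarrow> ('m, 'a) psh" where
  "constant_psh K = \<lparr>sec = (\<lambda>U. K), res = (\<lambda>U V j v. v)\<rparr>"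

definition module_iso_on ::
  "'m topology \<Rightarrow> ('m, 'f) apsh \<Rightarrow> ('m, 'f, 'a) mpsh \<Rightarrow> ('m, 'f, 'b) mpsh \<Rightarrow> 'm set \<Rightarrow>
   ('m set \<Rightarrow> int \<Rightarrow> 'a \<Rightarrow> 'b) \<Rightarrow> bool" where
  "module_iso_on X C F G U \<tau> \<longleftrightarrow> (\<forall>V. openin X V \<and> V \<subseteq> U \<longrightarrow>
     (\<forall>j. real_linear (sec F V j) (sec G V j) (\<tau> V j) \<and>
        bij_betw (\<tau> V j) (carrier (sec F V j)) (carrier (sec G V j))) \<and>
     (\<forall>i j. \<forall>f\<in>carrier (sec C V i). \<forall>s\<in>carrier (sec F V j).
        \<tau> V (i + j) (act F V i j f s) = act G V i j f (\<tau> V j s)) \<and>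
     (\<forall>W j. openin X W \<and> W \<subseteq> V \<longrightarrow> (\<forall>s\<in>carrier (sec F V j).
        \<tau> W j (res F V W j s) = res G V W j (\<tau> V j s))))"

definition graded_vector_bundle ::
  "'m topology \<Rightarrow> ('m, 'f) apsh \<Rightarrow> ('m, 'f, 'a) mpsh \<Rightarrow> int list \<Rightarrow> bool" where
  "graded_vector_bundle X C E es \<longleftrightarrow> graded_module_sheaf X C E \<and>
     (\<forall>m\<in>topspace X. \<exists>U \<tau>. openin X U \<and> m \<in> U \<and>
        module_iso_on X C (tensor_psh C (constant_psh (coord_gvs es))) E U \<tau>)"

definition local_frame ::
  "'m topology \<Rightarrow> ('m, 'f) apsh \<Rightarrow> ('m, 'f, 'a) mpsh \<Rightarrow> int list \<Rightarrow> 'm set \<Rightarrow> (nat \<Rightarrow> 'a) \<Rightarrow> bool" where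
  "local_frame X C E es U \<Phi> \<longleftrightarrow> freely_generates_on X C E U {..<length es} ((!) es) \<Phi>"

definition locally_freely_generated ::
  "'m topology \<Rightarrow> ('m, 'f) apsh \<Rightarrow> ('m, 'f, 'a) mpsh \<Rightarrow> int list \<Rightarrow> bool" where
  "locally_freely_generated X C F es \<longleftrightarrow>
     (\<forall>m\<in>topspace X. \<exists>U \<Phi>. m \<in> U \<and> local_frame X C F es U \<Phi>)"


section \<open>Graded manifolds\<close>

text \<open>
  A list \<open>ds\<close> of degrees of coordinates, in any order, describes the model with
  \<open>n\<^sub>j = count_list ds j\<close>. The points of Euclidean space are families of reals
  supported on the positions of the coordinates of degree 0; for
  \<open>{A. A < length ds \<and> ds ! A = 0} = {..<n}\<close> this is \<^term>\<open>Euclidean_space n\<close>.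
\<close>

definition body_space :: "int list \<Rightarrow> (nat \<Rightarrow> real) topology" where
  "body_space ds = subtopology (powertop_real UNIV)
     {x. \<forall>A. \<not> (A < length ds \<and> ds ! A = 0) \<longrightarrow> x A = 0}"

primrec Ck_on :: "int list \<Rightarrow> nat \<Rightarrow> (nat \<Rightarrow> real) set \<Rightarrow> ((nat \<Rightarrow> real) \<Rightarrow> real) \<Rightarrow> bool" where
  "Ck_on ds 0 W f \<longleftrightarrow> continuous_map (subtopology (body_space ds) W) euclideanreal f"
| "Ck_on ds (Suc k) W f \<longleftrightarrow> continuous_map (subtopology (body_space ds) W) euclideanreal f \<and>
     (\<forall>A<length ds. ds ! A = 0 \<longrightarrow> (\<exists>g. Ck_on ds k W g \<and>
        (\<forall>x\<in>W. ((\<lambda>t. f (x(A := t))) has_real_derivative g x) (at (x A)))))"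

definition smooth_on :: "int list \<Rightarrow> (nat \<Rightarrow> real) set \<Rightarrow> ((nat \<Rightarrow> real) \<Rightarrow> real) \<Rightarrow> bool" where
  "smooth_on ds W f \<longleftrightarrow> (\<forall>k. Ck_on ds k W f)"

definition multiindices :: "int list \<Rightarrow> (nat \<Rightarrow> nat) set" where
  "multiindices ds = {I. (\<forall>A. A \<ge> length ds \<longrightarrow> I A = 0) \<and>
     (\<forall>A<length ds. odd (ds ! A) \<longrightarrow> I A \<in> {0, 1})}"

definition mi_weight :: "int list \<Rightarrow> (nat \<Rightarrow> nat) \<Rightarrow> nat" where
  "mi_weight ds I = (\<Sum>A<length ds. I A)"

definition mi_degree :: "int list \<Rightarrow> (nat \<Rightarrow> nat) \<Rightarrow> int" where
  "mi_degree ds I = (\<Sum>A<length ds. int (I A) * ds ! A)"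

definition multiindices_of_weight :: "int list \<Rightarrow> nat \<Rightarrow> (nat \<Rightarrow> nat) set" where
  "multiindices_of_weight ds q = {I \<in> multiindices ds. mi_weight ds I = q}"

text \<open>
  The multi-indices of the monomials of a power series of degree \<open>j\<close> involve only the
  coordinates of nonzero degree. A series is the family \<open>f\<close> of its coefficient functions
  \<open>f I\<close>, which are extended by zero outside the open set.
\<close>

definition series_indices :: "int list \<Rightarrow> int \<Rightarrow> (nat \<Rightarrow> nat) set" where
  "series_indices ds j =
     {I \<in> multiindices ds. (\<forall>A<length ds. ds ! A = 0 \<longrightarrow> I A = 0) \<and> mi_degree ds I = j}"

text \<open>The sign in \<open>\<xi>\<^sup>I \<xi>\<^sup>J = \<plusminus>\<xi>\<^sup>I\<^sup>+\<^sup>J\<close>, where \<open>\<xi>\<^sup>I\<close> is the monomial ordered by increasing positions.\<close>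

definition monomial_sign :: "int list \<Rightarrow> (nat \<Rightarrow> nat) \<Rightarrow> (nat \<Rightarrow> nat) \<Rightarrow> real" where
  "monomial_sign ds I J =
     koszul (\<Sum>A<length ds. \<Sum>B<A. (int (I A) * ds ! A) * (int (J B) * ds ! B))"

definition model_sheaf ::
  "int list \<Rightarrow> (nat \<Rightarrow> real, (nat \<Rightarrow> nat) \<Rightarrow> (nat \<Rightarrow> real) \<Rightarrow> real) apsh" where
  "model_sheaf ds =
     \<lparr>sec = (\<lambda>W j.
        \<lparr>carrier = {f. (\<forall>I. I \<notin> series_indices ds j \<longrightarrow> f I = (\<lambda>_. 0)) \<and>
            (\<forall>I\<in>series_indices ds j. smooth_on ds W (f I) \<and> (\<forall>x. x \<notin> W \<longrightarrow> f I x = 0))},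
         mult = undefined, one = undefined, zero = (\<lambda>I x. 0),
         add = (\<lambda>f g I x. f I x + g I x), smult = (\<lambda>r f I x. r * f I x)\<rparr>),
      res = (\<lambda>W W' j f I x. if x \<in> W' then f I x else 0),
      gmul = (\<lambda>W i j f g K x. if K \<in> multiindices ds
         then (\<Sum>I | \<forall>A. I A \<le> K A.
            monomial_sign ds I (\<lambda>A. K A - I A) * f I x * g (\<lambda>A. K A - I A) x)
         else 0),
      gunit = (\<lambda>W I x. if I = (\<lambda>_. 0) \<and> x \<in> W then 1 else 0)\<rparr>"

definition model_coordinate ::
  "int list \<Rightarrow> (nat \<Rightarrow> real) set \<Rightarrow> nat \<Rightarrow> (nat \<Rightarrow> nat) \<Rightarrow> (nat \<Rightarrow> real) \<Rightarrow> real" where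
  "model_coordinate ds W A I x =
     (if x \<notin> W then 0
      else if ds ! A = 0 then (if I = (\<lambda>_. 0) then x A else 0)
      else (if I = (\<lambda>_. 0)(A := 1) then 1 else 0))"

text \<open>
  A graded local chart over \<open>U\<close> is a homeomorphism \<open>\<phi>\<close> onto an open set together with an
  isomorphism \<open>\<theta>\<close> from the model sheaf over \<open>\<phi> ` U\<close> to the structure sheaf over \<open>U\<close>; its
  component over an open \<open>V \<subseteq> U\<close> maps power series over \<open>\<phi> ` V\<close> to functions over \<open>V\<close>.
\<close>

definition graded_chart ::
  "'m topology \<Rightarrow> ('m, 'f) apsh \<Rightarrow> int list \<Rightarrow> 'm set \<Rightarrow> ('m \<Rightarrow> nat \<Rightarrow> real) \<Rightarrow>
   ('m set \<Rightarrow> int \<Rightarrow> ((nat \<Rightarrow> nat) \<Rightarrow> (nat \<Rightarrow> real) \<Rightarrow> real) \<Rightarrow> 'f) \<Rightarrow> bool" where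
  "graded_chart X C ds U \<phi> \<theta> \<longleftrightarrow>
     openin X U \<and> openin (body_space ds) (\<phi> ` U) \<and>
     homeomorphic_map (subtopology X U) (subtopology (body_space ds) (\<phi> ` U)) \<phi> \<and>
     (\<forall>V. openin X V \<and> V \<subseteq> U \<longrightarrow>
        (\<forall>j. real_linear (sec (model_sheaf ds) (\<phi> ` V) j) (sec C V j) (\<theta> V j) \<and>
           bij_betw (\<theta> V j) (carrier (sec (model_sheaf ds) (\<phi> ` V) j)) (carrier (sec C V j))) \<and>
        (\<forall>i j. \<forall>f\<in>carrier (sec (model_sheaf ds) (\<phi> ` V) i).
           \<forall>g\<in>carrier (sec (model_sheaf ds) (\<phi> ` V) j).
           \<theta> V (i + j) (gmul (model_sheaf ds) (\<phi> ` V) i j f g) = gmul C V i j (\<theta> V i f) (\<theta> V j g)) \<and>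
        \<theta> V 0 (gunit (model_sheaf ds) (\<phi> ` V)) = gunit C V \<and>
        (\<forall>W j. openin X W \<and> W \<subseteq> V \<longrightarrow> (\<forall>f\<in>carrier (sec (model_sheaf ds) (\<phi> ` V) j).
           \<theta> W j (res (model_sheaf ds) (\<phi> ` V) (\<phi> ` W) j f) = res C V W j (\<theta> V j f))))"

definition graded_manifold :: "'m topology \<Rightarrow> ('m, 'f) apsh \<Rightarrow> int list \<Rightarrow> bool" where
  "graded_manifold X C ds \<longleftrightarrow> Hausdorff_space X \<and> second_countable X \<and>
     graded_algebra_sheaf X C \<and>
     (\<forall>m\<in>topspace X. \<exists>U \<phi> \<theta>. m \<in> U \<and> graded_chart X C ds U \<phi> \<theta>)"

definition chart_coordinate ::
  "int list \<Rightarrow> 'm set \<Rightarrow> ('m \<Rightarrow> nat \<Rightarrow> real) \<Rightarrow>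
   ('m set \<Rightarrow> int \<Rightarrow> ((nat \<Rightarrow> nat) \<Rightarrow> (nat \<Rightarrow> real) \<Rightarrow> real) \<Rightarrow> 'f) \<Rightarrow> nat \<Rightarrow> 'f" where
  "chart_coordinate ds U \<phi> \<theta> A = \<theta> U (ds ! A) (model_coordinate ds (\<phi> ` U) A)"

text \<open>
  The value at \<open>a\<close> of a function \<open>f\<close> of degree \<open>j\<close> over \<open>U\<close>, i.e. the value of its body: in any
  chart around \<open>a\<close> it is the value of the coefficient of the monomial 1.
\<close>

definition fun_value ::
  "'m topology \<Rightarrow> ('m, 'f) apsh \<Rightarrow> int list \<Rightarrow> 'm set \<Rightarrow> int \<Rightarrow> 'f \<Rightarrow> 'm \<Rightarrow> real" where
  "fun_value X C ds U j f a = (THE v. \<exists>W \<phi> \<theta> h. graded_chart X C ds W \<phi> \<theta> \<and> a \<in> W \<and>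
     h \<in> carrier (sec (model_sheaf ds) (\<phi> ` (U \<inter> W)) j) \<and>
     \<theta> (U \<inter> W) j h = res C U (U \<inter> W) j f \<and> v = h (\<lambda>_. 0) (\<phi> a))"


section \<open>Geometrization\<close>

definition vanishing_ideal ::
  "'m topology \<Rightarrow> ('m, 'f) apsh \<Rightarrow> int list \<Rightarrow> 'm set \<Rightarrow> 'm \<Rightarrow> int \<Rightarrow> 'f set" where
  "vanishing_ideal X C ds U a j = {f \<in> carrier (sec C U j). fun_value X C ds U j f a = 0}"

definition ideal_times ::
  "(int \<Rightarrow> 'f set) \<Rightarrow> 'a gvs \<Rightarrow> (int \<Rightarrow> int \<Rightarrow> 'f \<Rightarrow> 'a \<Rightarrow> 'a) \<Rightarrow> (int \<Rightarrow> 'a set) \<Rightarrow> int \<Rightarrow> 'a set" where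
  "ideal_times J P ac N j =
     real_span (P j) {ac i (j - i) f x | i f x. f \<in> J i \<and> x \<in> N (j - i)}"

definition bullet ::
  "'m topology \<Rightarrow> ('m, 'f) apsh \<Rightarrow> int list \<Rightarrow> ('m, 'f, 'a) mpsh \<Rightarrow> 'm set \<Rightarrow> int \<Rightarrow> 'a set" where
  "bullet X C ds F U j = {x \<in> carrier (sec F U j). \<forall>q. \<forall>a\<in>U.
     x \<in> (ideal_times (vanishing_ideal X C ds U a) (sec F U) (act F U) ^^ q)
           (\<lambda>i. carrier (sec F U i)) j}"

definition Geo ::
  "'m topology \<Rightarrow> ('m, 'f) apsh \<Rightarrow> int list \<Rightarrow> ('m, 'f, 'a) mpsh \<Rightarrow> ('m, 'f, 'a set) mpsh" where
  "Geo X C ds F = quotient_psh F (bullet X C ds F)"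


section \<open>Jets\<close>

type_synonym ('f, 'e) jet_tensor = "((int \<times> 'f \<times> 'e) \<Rightarrow>\<^sub>0 real) set"

text \<open>
  The action \<open>\<triangleright>\<close> is the action of \<^term>\<open>tensor_psh C E\<close>; the following is \<open>\<blacktriangleright>\<close>.
\<close>

definition right_act ::
  "('m, 'f) apsh \<Rightarrow> ('m, 'f, 'e) mpsh \<Rightarrow> 'm set \<Rightarrow> int \<Rightarrow> int \<Rightarrow> 'f \<Rightarrow>
   ('f, 'e) jet_tensor \<Rightarrow> ('f, 'e) jet_tensor" where
  "right_act C E U i j f = tensor_lift (sec (tensor_psh C E) U (i + j))
     (\<lambda>(p, g, \<psi>). koszul (i * p) \<odot>\<^bsub>sec (tensor_psh C E) U (i + j)\<^esub>
        tens (sec C U) (sec E U) p (i + (j - p)) g (act E U i (j - p) f \<psi>))"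

definition jdelta ::
  "('m, 'f) apsh \<Rightarrow> ('m, 'f, 'e) mpsh \<Rightarrow> 'm set \<Rightarrow> int \<Rightarrow> int \<Rightarrow> 'f \<Rightarrow>
   ('f, 'e) jet_tensor \<Rightarrow> ('f, 'e) jet_tensor" where
  "jdelta C E U i j f x =
     act (tensor_psh C E) U i j f x \<ominus>\<^bsub>sec (tensor_psh C E) U (i + j)\<^esub> right_act C E U i j f x"

text \<open>The elements \<open>\<delta>\<^bsub>f1\<^esub> \<dots> \<delta>\<^bsub>fm\<^esub> (g \<otimes> \<psi>)\<close> of degree \<open>j\<close>.\<close>

primrec delta_products ::
  "('m, 'f) apsh \<Rightarrow> ('m, 'f, 'e) mpsh \<Rightarrow> 'm set \<Rightarrow> nat \<Rightarrow> int \<Rightarrow> ('f, 'e) jet_tensor set" where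
  "delta_products C E U 0 = (\<lambda>j. {tens (sec C U) (sec E U) p (j - p) g \<psi> | p g \<psi>.
     g \<in> carrier (sec C U p) \<and> \<psi> \<in> carrier (sec E U (j - p))})"
| "delta_products C E U (Suc m) = (\<lambda>j. {jdelta C E U i (j - i) f x | i f x.
     f \<in> carrier (sec C U i) \<and> x \<in> delta_products C E U m (j - i)})"

definition jet_null ::
  "('m, 'f) apsh \<Rightarrow> ('m, 'f, 'e) mpsh \<Rightarrow> nat \<Rightarrow> 'm set \<Rightarrow> int \<Rightarrow> ('f, 'e) jet_tensor set" where
  "jet_null C E k U j = real_span (sec (tensor_psh C E) U j) (delta_products C E U (k + 1) j)"

definition pJet ::
  "('m, 'f) apsh \<Rightarrow> ('m, 'f, 'e) mpsh \<Rightarrow> nat \<Rightarrow> ('m, 'f, ('f, 'e) jet_tensor set) mpsh" where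
  "pJet C E k = quotient_psh (tensor_psh C E) (jet_null C E k)"

definition gpJet ::
  "'m topology \<Rightarrow> ('m, 'f) apsh \<Rightarrow> int list \<Rightarrow> ('m, 'f, 'e) mpsh \<Rightarrow> nat \<Rightarrow>
   ('m, 'f, ('f, 'e) jet_tensor set set) mpsh" where
  "gpJet X C ds E k = Geo X C ds (pJet C E k)"

definition Jet ::
  "'m topology \<Rightarrow> ('m, 'f) apsh \<Rightarrow> int list \<Rightarrow> ('m, 'f, 'e) mpsh \<Rightarrow> nat \<Rightarrow>
   ('m, 'f, 'm \<Rightarrow> ('m set \<times> ('f, 'e) jet_tensor set set) set) mpsh" where
  "Jet X C ds E k = sheafification X C (gpJet X C ds E k)"

definition jet_tens ::
  "('m, 'f) apsh \<Rightarrow> ('m, 'f, 'e) mpsh \<Rightarrow> nat \<Rightarrow> 'm set \<Rightarrow> int \<Rightarrow> int \<Rightarrow> 'f \<Rightarrow> 'e \<Rightarrow>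
   ('f, 'e) jet_tensor set" where
  "jet_tens C E k U p q g \<psi> =
     jet_null C E k U (p + q) +>\<^bsub>sec (tensor_psh C E) U (p + q)\<^esub> tens (sec C U) (sec E U) p q g \<psi>"

definition pjet_delta ::
  "('m, 'f) apsh \<Rightarrow> ('m, 'f, 'e) mpsh \<Rightarrow> nat \<Rightarrow> 'm set \<Rightarrow> int \<Rightarrow> int \<Rightarrow> 'f \<Rightarrow>
   ('f, 'e) jet_tensor set \<Rightarrow> ('f, 'e) jet_tensor set" where
  "pjet_delta C E k U i j f =
     descend (sec (tensor_psh C E) U (i + j)) (jet_null C E k U (i + j)) (jdelta C E U i j f)"

text \<open>
  \<open>\<delta>\<^bsub>f1\<^esub> \<dots> \<delta>\<^bsub>fm\<^esub> x\<close> for \<open>x\<close> of degree \<open>j\<close> and the list of the functions \<open>f1, \<dots>, fm\<close> paired with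
  their degrees.
\<close>

primrec pjet_deltas ::
  "('m, 'f) apsh \<Rightarrow> ('m, 'f, 'e) mpsh \<Rightarrow> nat \<Rightarrow> 'm set \<Rightarrow> (int \<times> 'f) list \<Rightarrow> int \<Rightarrow>
   ('f, 'e) jet_tensor set \<Rightarrow> ('f, 'e) jet_tensor set" where
  "pjet_deltas C E k U [] j x = x"
| "pjet_deltas C E k U (w # ws) j x =
     pjet_delta C E k U (fst w) (sum_list (map fst ws) + j) (snd w) (pjet_deltas C E k U ws j x)"

definition gen_degree :: "int list \<Rightarrow> int list \<Rightarrow> (nat \<Rightarrow> nat) \<times> nat \<Rightarrow> int" where
  "gen_degree ds es = (\<lambda>(I, l). mi_degree ds I + es ! l)"

text \<open>The generator with multi-index \<open>I\<close> and frame index \<open>l\<close>, for coordinate functions \<open>z\<close>.\<close>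

definition jet_generator ::
  "'m topology \<Rightarrow> ('m, 'f) apsh \<Rightarrow> int list \<Rightarrow> ('m, 'f, 'e) mpsh \<Rightarrow> int list \<Rightarrow> nat \<Rightarrow> 'm set \<Rightarrow>
   (nat \<Rightarrow> 'f) \<Rightarrow> (nat \<Rightarrow> 'e) \<Rightarrow> (nat \<Rightarrow> nat) \<times> nat \<Rightarrow> ('f, 'e) jet_tensor set set" where
  "jet_generator X C ds E es k U z \<Phi> = (\<lambda>(I, l).
     bullet X C ds (pJet C E k) U (gen_degree ds es (I, l))
       +>\<^bsub>sec (pJet C E k) U (gen_degree ds es (I, l))\<^esub>
     pjet_deltas C E k U (concat (map (\<lambda>A. replicate (I A) (ds ! A, z A)) [0..<length ds])) (es ! l)
       (jet_tens C E k U 0 (es ! l) (gunit C U) (\<Phi> l)))"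

end

theory Submission
 imports Defs
begin

text \<open>
 The partial derivatives of the coefficients with respect to a frame extend to operators on the
 second factor of \<open>C \<otimes> E\<close>. They satisfy Weyl relations with the \<open>\<delta>\<close> of the coordinates and lower
 the number of \<open>\<delta>\<close>-factors by at most one, so that together with the product map \<open>C \<otimes> E \<rightarrow> C\<close> they yield
 functionals on jets dual to the generators. This gives independence, because a function all of whose
 Taylor expansions vanish is zero. For generation, Hadamard's lemma shows that every element
 is, modulo products of \<open>N\<close> factors from the ideal of a point or of the form \<open>\<delta>\<close>, a combination of
 \<open>\<delta>\<close>-monomials; hence it differs from its expansion in the dual functionals by an element
 that the geometrization kills.
\<close>

text \<open>The count that decides generation: in a product of \<open>q + k\<close> factors,
  \<open>p\<close> of them from the ideal of a point and the others of the form \<delta>, either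
  \<open>p \<ge> q\<close> or there are at least \<open>k + 1\<close> factors \<delta>. In the first
  case the product lies in the q-th power of the ideal, in the second it vanishes in the k-th jets.
  As \<open>q\<close> and the point are arbitrary, such remainders die in the geometrization.
  Hadamard's lemma alone would never remove them: each use only adds one more factor. The opposite
  danger is that the geometrization kills too much. The dual functionals exclude this: they are
  linear for \<open>\<triangleright>\<close> and vanish on products of \<open>k + 1\<close> factors
  \<delta>, so they send powers of the ideal of a point into a filtration of the functions whose
  intersection over all points is zero. Values of functions are defined through arbitrary charts.
  Their independence of the chart is not assumed; it rests on the algebra structure, because a body
  coordinate minus a constant other than its value is invertible near the point.\<close>

abbreviation (input) "lin == real_linear"
abbreviation (input) "pder A x f D == ((\<lambda>t. f (x(A := t))) has_real_derivative D) (at (x A))"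
abbreviation (input) "sect F U j == carrier (sec F U j)"

abbreviation (input) add_in ("(_/ \<oplus>[_]/ _)" [65, 0, 66] 65) where "x \<oplus>[V] y == x \<oplus>\<^bsub>V\<^esub> y"
abbreviation (input) smult_in ("(_/ \<odot>[_]/ _)" [70, 0, 71] 70) where "r \<odot>[V] x == r \<odot>\<^bsub>V\<^esub> x"
abbreviation (input) zero_in ("\<zero>[_]") where "\<zero>[V] == \<zero>\<^bsub>V\<^esub>"

section \<open>Real vector spaces as modules\<close>

lemma real_ring_simps [simp]:
 "carrier real_ring = UNIV" "add real_ring = (+)" "mult real_ring = (*)"
 "one real_ring = 1" "zero real_ring = 0"
 by (simp_all add: real_ring_def)

lemma cring_real_ring: "cring real_ring"
proof (rule cringI)
 show "abelian_group real_ring"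
 proof (rule abelian_groupI)
  fix x :: real assume "x \<in> carrier real_ring"
  show "\<exists>y\<in>carrier real_ring. y \<oplus>[real_ring] x = \<zero>[real_ring]"
   by (auto intro: exI[of _ "- x"])
 qed auto
 show "comm_monoid real_ring" by (rule comm_monoidI) auto
qed (auto simp: algebra_simps)

abbreviation rmod :: "(real, 'a) module => bool" where
 "rmod V == Module.module real_ring V"

abbreviation rsub :: "'a set => (real, 'a) module => bool" where
 "rsub W V == submodule W real_ring V"

text \<open>No negatives are asked for: \<open>(-1) \<odot> x\<close> is one, since
  \<open>l\<close>, \<open>one\<close> and \<open>null\<close> give
  \<open>(-1) \<odot> x \<oplus> x = \<zero>\<close>.\<close>

lemma rmodI:
 assumes "!!x y. [|x \<in> carrier V; y \<in> carrier V|] ==> x \<oplus>[V] y \<in> carrier V"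
  and "\<zero>[V] \<in> carrier V"
  and "!!r x. x \<in> carrier V ==> r \<odot>[V] x \<in> carrier V"
  and "!!x y z. [|x \<in> carrier V; y \<in> carrier V; z \<in> carrier V|] ==>
   (x \<oplus>[V] y) \<oplus>[V] z = x \<oplus>[V] (y \<oplus>[V] z)"
  and "!!x y. [|x \<in> carrier V; y \<in> carrier V|] ==> x \<oplus>[V] y = y \<oplus>[V] x"
  and "!!x. x \<in> carrier V ==> \<zero>[V] \<oplus>[V] x = x"
  and null: "!!x. x \<in> carrier V ==> 0 \<odot>[V] x = \<zero>[V]"
  and l: "!!r s x. x \<in> carrier V ==> (r + s) \<odot>[V] x = r \<odot>[V] x \<oplus>[V] s \<odot>[V] x"
  and "!!r x y. [|x \<in> carrier V; y \<in> carrier V|] ==>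
   r \<odot>[V] (x \<oplus>[V] y) = r \<odot>[V] x \<oplus>[V] r \<odot>[V] y"
  and "!!r s x. x \<in> carrier V ==> (r * s) \<odot>[V] x = r \<odot>[V] (s \<odot>[V] x)"
  and one: "!!x. x \<in> carrier V ==> 1 \<odot>[V] x = x"
 shows "rmod V"
proof (rule moduleI[OF cring_real_ring abelian_groupI])
 fix x assume x: "x \<in> carrier V"
 have "(-1) \<odot>[V] x \<oplus>[V] x = \<zero>[V]"
  using l[OF x, of "-1" 1] one[OF x] null[OF x] by simp
 then show "\<exists>y\<in>carrier V. y \<oplus>[V] x = \<zero>[V]" using assms(3)[OF x] by blast
qed (use assms in auto)

context
 fixes V :: "(real, 'a) module"
 assumes V: "rmod V"
begin

interpretation module real_ring V by (rule V)

lemma rm_add_closed [simp]: "[|x \<in> carrier V; y \<in> carrier V|] ==> x \<oplus>[V] y \<in> carrier V"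
 and rm_zero_closed [simp]: "\<zero>[V] \<in> carrier V"
 and rm_smult_closed [simp]: "x \<in> carrier V ==> r \<odot>[V] x \<in> carrier V"
 and rm_assoc: "[|x \<in> carrier V; y \<in> carrier V; z \<in> carrier V|] ==>
  (x \<oplus>[V] y) \<oplus>[V] z = x \<oplus>[V] (y \<oplus>[V] z)"
 and rm_comm: "[|x \<in> carrier V; y \<in> carrier V|] ==> x \<oplus>[V] y = y \<oplus>[V] x"
 and rm_lcomm: "[|x \<in> carrier V; y \<in> carrier V; z \<in> carrier V|] ==>
  x \<oplus>[V] (y \<oplus>[V] z) = y \<oplus>[V] (x \<oplus>[V] z)"
 and rm_zero_left [simp]: "x \<in> carrier V ==> \<zero>[V] \<oplus>[V] x = x"
 and rm_zero_right [simp]: "x \<in> carrier V ==> x \<oplus>[V] \<zero>[V] = x"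
 and rm_smult_l: "x \<in> carrier V ==> (r + s) \<odot>[V] x = r \<odot>[V] x \<oplus>[V] s \<odot>[V] x"
 and rm_smult_r: "[|x \<in> carrier V; y \<in> carrier V|] ==>
  r \<odot>[V] (x \<oplus>[V] y) = r \<odot>[V] x \<oplus>[V] r \<odot>[V] y"
 and rm_smult_smult [simp]: "x \<in> carrier V ==> r \<odot>[V] (s \<odot>[V] x) = (r * s) \<odot>[V] x"
 and rm_smult_one [simp]: "x \<in> carrier V ==> 1 \<odot>[V] x = x"
 and rm_smult_null [simp]: "x \<in> carrier V ==> 0 \<odot>[V] x = \<zero>[V]"
 and rm_smult_zero [simp]: "r \<odot>[V] \<zero>[V] = \<zero>[V]"
 using smult_l_distr[of r s x] smult_r_distr[of r x y] smult_assoc1[of r s x] smult_one[of x]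
  smult_l_null[of x] smult_r_null[of r]
 by (auto simp: M.a_assoc M.a_comm M.a_lcomm)

text \<open>Makes every difference a combination of \<open>\<oplus>\<close> and
  \<open>\<odot>\<close>, the operations in which the later calculations are carried out.\<close>

lemma rm_inv: "x \<in> carrier V ==> \<ominus>\<^bsub>V\<^esub> x = (-1) \<odot>[V] x"
proof (rule M.minus_equality)
 assume x: "x \<in> carrier V"
 show "(-1) \<odot>[V] x \<oplus>[V] x = \<zero>[V]"
  using x rm_smult_l[of x "-1" 1] by simp
qed auto

lemma rm_minus: "[|x \<in> carrier V; y \<in> carrier V|] ==> x \<ominus>\<^bsub>V\<^esub> y = x \<oplus>[V] (-1) \<odot>[V] y"
 by (simp add: a_minus_def rm_inv)

lemma rm_cancel_self [simp]:
 "x \<in> carrier V ==> x \<oplus>[V] (-1) \<odot>[V] x = \<zero>[V]"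
 "x \<in> carrier V ==> (-1) \<odot>[V] x \<oplus>[V] x = \<zero>[V]"
 using rm_smult_l[of x 1 "-1"] rm_smult_l[of x "-1" 1] by auto

lemma rm_cancel_self_left [simp]:
 "[|x \<in> carrier V; y \<in> carrier V|] ==> x \<oplus>[V] ((-1) \<odot>[V] x \<oplus>[V] y) = y"
 "[|x \<in> carrier V; y \<in> carrier V|] ==> (-1) \<odot>[V] x \<oplus>[V] (x \<oplus>[V] y) = y"
 by (simp_all add: rm_assoc[symmetric])

lemma rm_cancel_scaled [simp]:
 "x \<in> carrier V ==> r \<odot>[V] x \<oplus>[V] (- r) \<odot>[V] x = \<zero>[V]"
 "x \<in> carrier V ==> (- r) \<odot>[V] x \<oplus>[V] r \<odot>[V] x = \<zero>[V]"
 using rm_smult_l[of x r "- r"] rm_smult_l[of x "- r" r] by auto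

lemma rm_cancel_mid [simp]:
 "[|x \<in> carrier V; y \<in> carrier V; z \<in> carrier V|] ==> x \<oplus>[V] (y \<oplus>[V] ((-1) \<odot>[V] x \<oplus>[V] z)) = y \<oplus>[V] z"
 by (simp add: rm_lcomm[of y])

lemma rm_add_left_cancel [simp]:
 "[|x \<in> carrier V; y \<in> carrier V; z \<in> carrier V|] ==> x \<oplus>[V] y = x \<oplus>[V] z \<longleftrightarrow> y = z"
 by (metis rm_cancel_self_left(2))

lemma rm_add_right_cancel [simp]:
 "[|x \<in> carrier V; y \<in> carrier V; z \<in> carrier V|] ==> y \<oplus>[V] x = z \<oplus>[V] x \<longleftrightarrow> y = z"
 by (simp add: rm_comm[of _ x])

lemma rm_minus_eq_zero:
 "[|x \<in> carrier V; y \<in> carrier V|] ==> x \<oplus>[V] (-1) \<odot>[V] y = \<zero>[V] \<longleftrightarrow> x = y"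
 using rm_add_right_cancel[of "(-1) \<odot>[V] y" x y] by simp

lemma rsub_iff:
 "rsub W V \<longleftrightarrow> W <= carrier V & \<zero>[V] \<in> W & (\<forall>x\<in>W. \<forall>y\<in>W. x \<oplus>[V] y \<in> W) &
  (ALL r. \<forall>x\<in>W. r \<odot>[V] x \<in> W)"
proof
 assume "rsub W V"
 then interpret W: submodule W real_ring V .
 show "W <= carrier V & \<zero>[V] \<in> W & (\<forall>x\<in>W. \<forall>y\<in>W. x \<oplus>[V] y \<in> W) & (ALL r. \<forall>x\<in>W. r \<odot>[V] x \<in> W)"
  using W.subset W.m_closed W.one_closed W.smult_closed by auto
next
 assume W: "W <= carrier V & \<zero>[V] \<in> W & (\<forall>x\<in>W. \<forall>y\<in>W. x \<oplus>[V] y \<in> W) &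
  (ALL r. \<forall>x\<in>W. r \<odot>[V] x \<in> W)"
 show "rsub W V"
 proof (rule submoduleI)
  fix a assume "a \<in> W" then show "\<ominus>\<^bsub>V\<^esub> a \<in> W" using W by (subst rm_inv) auto
 qed (use W in auto)
qed

lemma finsum_closed_rm [simp]: "f \<in> A \<rightarrow> carrier V ==> finsum V f A \<in> carrier V"
 by (rule M.finsum_closed)

lemma finsum_insert_rm: "[|finite F; a \<notin> F; f \<in> F \<rightarrow> carrier V; f a \<in> carrier V|] ==>
  finsum V f (insert a F) = f a \<oplus>[V] finsum V f F"
 by (rule M.finsum_insert)

lemma finsum_add_rm: "[|f \<in> A \<rightarrow> carrier V; g \<in> A \<rightarrow> carrier V|] ==>
  finsum V (%i. f i \<oplus>[V] g i) A = finsum V f A \<oplus>[V] finsum V g A"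
 by (rule M.finsum_addf)

lemma finsum_smult_rm:
 assumes "f \<in> A \<rightarrow> carrier V"
 shows "finsum V (%i. r \<odot>[V] f i) A = r \<odot>[V] finsum V f A"
proof (cases "finite A")
 case True
 then show ?thesis using finsum_smult_ldistr[OF True, of r f] assms by simp
qed (simp add: M.finsum_infinite)

lemma sum_cong_rm: "[|A = B; !!i. i \<in> B ==> f i = g i; g \<in> B \<rightarrow> carrier V|] ==>
  finsum V f A = finsum V g B"
 by (rule M.finsum_cong') auto

lemma finsum_zero_rm: "(!!i. i \<in> A ==> f i = \<zero>[V]) ==> finsum V f A = \<zero>[V]"
 using sum_cong_rm[of A A f "%_. \<zero>[V]"] M.finsum_zero by auto

lemma finsum_single_rm:
 assumes "finite A" "a \<in> A" "f a \<in> carrier V" "!!i. [|i \<in> A; i ~= a|] ==> f i = \<zero>[V]"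
 shows "finsum V f A = f a"
proof -
 have "finsum V f (insert a (A - {a})) = f a \<oplus>[V] finsum V f (A - {a})"
  by (rule finsum_insert_rm) (use assms in auto)
 moreover have "finsum V f (A - {a}) = \<zero>[V]" by (rule finsum_zero_rm) (use assms in auto)
 moreover have "insert a (A - {a}) = A" using assms by blast
 ultimately show ?thesis using assms by simp
qed

lemma finsum_mono_rm:
 assumes "finite B" "A <= B" "f \<in> A \<rightarrow> carrier V" "!!i. i \<in> B - A ==> f i = \<zero>[V]"
 shows "finsum V f B = finsum V f A"
proof -
 have "finsum V f (A Un (B - A)) = finsum V f A \<oplus>[V] finsum V f (B - A)"
  by (rule M.finsum_Un_disjoint) (use assms in \<open>auto intro: finite_subset\<close>)
 moreover have "finsum V f (B - A) = \<zero>[V]" by (rule finsum_zero_rm) (use assms in auto)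
 moreover have "A Un (B - A) = B" using assms by blast
 ultimately show ?thesis using assms by simp
qed

lemma finsum_reindex_rm: "[|f \<in> h ` A \<rightarrow> carrier V; inj_on h A|] ==>
  finsum V f (h ` A) = finsum V (%x. f (h x)) A"
 by (rule M.finsum_reindex)

lemma finsum_empty_rm [simp]: "finsum V f {} = \<zero>[V]"
 by (rule M.finsum_empty)

lemma rsub_finsum:
 assumes W: "rsub W V" and f: "f \<in> A \<rightarrow> W"
 shows "finsum V f A \<in> W"
proof (cases "finite A")
 case True
 have W': "W <= carrier V" "\<zero>[V] \<in> W" "\<forall>x\<in>W. \<forall>y\<in>W. x \<oplus>[V] y \<in> W" using W rsub_iff by auto
 from True f show ?thesis
 proof (induction A)
  case (insert a A)
  then have "finsum V f (insert a A) = f a \<oplus>[V] finsum V f A"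
   using W' by (intro finsum_insert_rm) auto
  then show ?case using insert W' by auto
 qed (use W' in simp)
next
 case False
 then show ?thesis using W rsub_iff by (auto simp: M.finsum_infinite)
qed

end

lemma rm_lin4:
 assumes "rmod V" "a \<in> carrier V" "b \<in> carrier V" "c \<in> carrier V" "d \<in> carrier V"
 shows "(a \<oplus>[V] b) \<oplus>[V] (c \<oplus>[V] d) = (a \<oplus>[V] c) \<oplus>[V] (b \<oplus>[V] d)"
 using assms by (simp add: rm_assoc rm_lcomm)


subsection \<open>Linear maps\<close>

lemma real_linearI:
 assumes "!!x. x \<in> carrier V ==> f x \<in> carrier W"
  and "!!x y. [|x \<in> carrier V; y \<in> carrier V|] ==> f (x \<oplus>[V] y) = f x \<oplus>[W] f y"
  and "!!r x. x \<in> carrier V ==> f (r \<odot>[V] x) = r \<odot>[W] f x"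
 shows "lin V W f"
 using assms by (auto simp: real_linear_def)

lemma rl_closed: "lin V W f ==> x \<in> carrier V ==> f x \<in> carrier W"
 and rl_add: "lin V W f ==> x \<in> carrier V ==> y \<in> carrier V ==>
  f (x \<oplus>[V] y) = f x \<oplus>[W] f y"
 and rl_smult: "lin V W f ==> x \<in> carrier V ==> f (r \<odot>[V] x) = r \<odot>[W] f x"
 by (auto simp: real_linear_def)

lemma rl_zero:
 assumes "rmod V" "rmod W" "lin V W f"
 shows "f \<zero>[V] = \<zero>[W]"
proof -
 have "f (0 \<odot>[V] \<zero>[V]) = 0 \<odot>[W] f \<zero>[V]" using assms(1) by (intro rl_smult[OF assms(3)]) auto
 moreover have "f \<zero>[V] \<in> carrier W" using assms(1) by (intro rl_closed[OF assms(3)]) auto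
 ultimately show ?thesis using assms by simp
qed

lemma rl_comp: "lin V W f ==> lin W Z g ==> lin V Z (%x. g (f x))"
 by (auto simp: real_linear_def Pi_iff)

lemma rl_id: "lin V V (%x. x)"
 by (auto simp: real_linear_def)

lemma rl_const_zero: "rmod W ==> lin V W (%x. \<zero>[W])"
 by (auto simp: real_linear_def)

lemma rl_fun_add:
 assumes W: "rmod W" and f: "lin V W f" and g: "lin V W g"
 shows "lin V W (%x. f x \<oplus>[W] g x)"
 using rl_closed[OF f] rl_closed[OF g] W
 by (intro real_linearI)
  (auto simp: rl_add[OF f] rl_add[OF g] rl_smult[OF f] rl_smult[OF g] rm_lin4[OF W] rm_smult_r)

lemma rl_fun_smult:
 assumes W: "rmod W" and f: "lin V W f"
 shows "lin V W (%x. r \<odot>[W] f x)"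
 using rl_closed[OF f] W
 by (intro real_linearI) (auto simp: rl_add[OF f] rl_smult[OF f] rm_smult_r mult.commute)

lemma rl_cong: "lin V W f ==> rmod V ==> (!!x. x \<in> carrier V ==> f x = g x) ==> lin V W g"
 by (simp add: real_linear_def Pi_iff)

lemma rl_finsum:
 assumes "rmod V" "rmod W" "lin V W f" "finite A" "g \<in> A \<rightarrow> carrier V"
 shows "f (finsum V g A) = finsum W (%i. f (g i)) A"
 using assms(4,5)
proof (induction A)
 case empty
 then show ?case using assms by (simp add: rl_zero)
next
 case (insert a A)
 have "f (finsum V g (insert a A)) = f (g a) \<oplus>[W] f (finsum V g A)"
  using insert assms by (subst finsum_insert_rm) (auto simp: rl_add[OF assms(3)])
 also have "\<dots> = finsum W (%i. f (g i)) (insert a A)"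
  using insert assms by (subst finsum_insert_rm) (auto simp: Pi_iff intro!: rl_closed[OF assms(3)])
 finally show ?case .
qed

lemma rl_fun_finsum:
 assumes W: "rmod W" and f: "!!i. i \<in> A ==> lin V W (f i)" and A: "finite A"
 shows "lin V W (%x. finsum W (%i. f i x) A)"
proof (rule real_linearI)
 fix x y r assume x: "x \<in> carrier V" and y: "y \<in> carrier V"
 have c: "!!i z. i \<in> A ==> z \<in> carrier V ==> f i z \<in> carrier W" using rl_closed[OF f] by auto
 show "finsum W (%i. f i x) A \<in> carrier W" using c x W by (intro finsum_closed_rm) auto
 show "finsum W (%i. f i (x \<oplus>[V] y)) A = finsum W (%i. f i x) A \<oplus>[W] finsum W (%i. f i y) A"
  using c x y W f by (subst finsum_add_rm[symmetric]) (auto intro!: sum_cong_rm simp: rl_add[OF f])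
next
 fix x r assume x: "x \<in> carrier V"
 have c: "!!i z. i \<in> A ==> z \<in> carrier V ==> f i z \<in> carrier W" using rl_closed[OF f] by auto
 show "finsum W (%i. f i (r \<odot>[V] x)) A = r \<odot>[W] finsum W (%i. f i x) A"
  using c x W f by (subst finsum_smult_rm[symmetric]) (auto intro!: sum_cong_rm simp: rl_smult[OF f])
qed

lemma rsub_kernel:
 assumes "rmod V" "rmod W" "lin V W f"
 shows "rsub {x \<in> carrier V. f x = \<zero>[W]} V"
 unfolding rsub_iff[OF assms(1)]
 using assms(1,2) by (auto simp: rl_zero[OF assms] rl_add[OF assms(3)] rl_smult[OF assms(3)])

lemma rsub_vimage:
 assumes "rmod V" "rmod W" "lin V W f" "rsub S W"
 shows "rsub {x \<in> carrier V. f x \<in> S} V"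
 unfolding rsub_iff[OF assms(1)]
 using assms(1,2) assms(4)[unfolded rsub_iff[OF assms(2)]]
 by (auto simp: rl_zero[OF assms(1,2,3)] rl_add[OF assms(3)] rl_smult[OF assms(3)])

lemma rsub_carrier: "rmod V ==> rsub (carrier V) V"
 by (simp add: rsub_iff)

lemma rsub_Inter_rm:
 assumes "rmod V" "!!i. i \<in> I ==> rsub (S i) V"
 shows "rsub {x \<in> carrier V. \<forall>i\<in>I. x \<in> S i} V"
 unfolding rsub_iff[OF assms(1)]
 using assms(1) assms(2)[unfolded rsub_iff[OF assms(1)]] by auto


subsection \<open>Spans\<close>

lemma span_superset: "S <= real_span V S"
 by (simp add: real_span_def hull_subset)

lemma span_rsub:
 assumes "rmod V" "S <= carrier V"
 shows "rsub (real_span V S) V"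
proof -
 \<comment> \<open>The hull is the intersection of all submodules that contain \<open>S\<close>; the
   carrier is one of them and keeps the intersection inside the space.\<close>
 have C: "rsub (carrier V) V" by (rule rsub_carrier) fact
 show ?thesis
  unfolding rsub_iff[OF assms(1)] real_span_def hull_def
  using assms C by (auto simp: rsub_iff)
qed

lemma span_minimal: "rsub W V ==> S <= W ==> real_span V S <= W"
 by (simp add: real_span_def hull_minimal)

lemma rl_span:
 assumes "rmod V" "rmod W" "lin V W f" "S <= carrier V" "rsub T W" "!!x. x \<in> S ==> f x \<in> T"
 shows "x \<in> real_span V S ==> f x \<in> T"
 using span_minimal[OF rsub_vimage[OF assms(1,2,3,5)], of S] assms(4,6) by auto


subsection \<open>Quotients\<close>

lemma coset_eq: "W +>\<^bsub>V\<^esub> x = (%w. w \<oplus>[V] x) ` W"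
 by (auto simp: a_r_coset_def')

context
 fixes V :: "(real, 'a) module" and W :: "'a set"
 assumes V: "rmod V" and W: "rsub W V"
begin

lemma rsub_facts:
 shows rsub_sub: "W <= carrier V" and rsub_zero: "\<zero>[V] \<in> W"
  and rsub_add: "x \<in> W ==> y \<in> W ==> x \<oplus>[V] y \<in> W"
  and rsub_smult: "x \<in> W ==> r \<odot>[V] x \<in> W"
 using W rsub_iff[OF V] by auto

private lemma wc: "x \<in> W ==> x \<in> carrier V"
 using rsub_sub by auto

lemma coset_mem_iff: "x \<in> carrier V ==> y \<in> W +>\<^bsub>V\<^esub> x \<longleftrightarrow> y \<in> carrier V & y \<oplus>[V] (-1) \<odot>[V] x \<in> W"
proof safe
 assume x: "x \<in> carrier V" and "y \<in> W +>\<^bsub>V\<^esub> x"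
 then obtain w where w: "w \<in> W" "y = w \<oplus>[V] x" by (auto simp: coset_eq)
 show "y \<in> carrier V" using w x wc V by auto
 show "y \<oplus>[V] (-1) \<odot>[V] x \<in> W" using w x wc V by (simp add: rm_assoc)
next
 assume x: "x \<in> carrier V" and y: "y \<in> carrier V" and "y \<oplus>[V] (-1) \<odot>[V] x \<in> W"
 moreover have "y = (y \<oplus>[V] (-1) \<odot>[V] x) \<oplus>[V] x" using x y V by (simp add: rm_assoc)
 ultimately show "y \<in> W +>\<^bsub>V\<^esub> x" unfolding coset_eq by (rule_tac image_eqI)
qed

lemma coset_self: "x \<in> carrier V ==> x \<in> W +>\<^bsub>V\<^esub> x"
 using V rsub_zero by (simp add: coset_mem_iff)

lemma coset_eq_iff:
 assumes x: "x \<in> carrier V" and y: "y \<in> carrier V"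
 shows "W +>\<^bsub>V\<^esub> x = W +>\<^bsub>V\<^esub> y \<longleftrightarrow> x \<oplus>[V] (-1) \<odot>[V] y \<in> W"
proof
 assume "W +>\<^bsub>V\<^esub> x = W +>\<^bsub>V\<^esub> y"
 then show "x \<oplus>[V] (-1) \<odot>[V] y \<in> W" using coset_self[OF x] coset_mem_iff[OF y] by auto
next
 assume *: "x \<oplus>[V] (-1) \<odot>[V] y \<in> W"
 have **: "y \<oplus>[V] (-1) \<odot>[V] x \<in> W"
  using rsub_smult[OF *, of "-1"] x y V by (simp add: rm_smult_r rm_comm)
 have t: "z \<oplus>[V] (-1) \<odot>[V] v \<in> W" if "z \<in> carrier V" "u \<in> carrier V" "v \<in> carrier V"
  "z \<oplus>[V] (-1) \<odot>[V] u \<in> W" "u \<oplus>[V] (-1) \<odot>[V] v \<in> W" for z u v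
  using rsub_add[OF that(4,5)] that V by (simp add: rm_assoc)
 show "W +>\<^bsub>V\<^esub> x = W +>\<^bsub>V\<^esub> y"
  using t[OF _ x y] t[OF _ y x] * ** by (auto simp: coset_mem_iff x y)
qed

lemma coset_zero: "x \<in> carrier V ==> W +>\<^bsub>V\<^esub> x = W \<longleftrightarrow> x \<in> W"
proof -
 assume x: "x \<in> carrier V"
 have "W +>\<^bsub>V\<^esub> \<zero>[V] = W" using V wc by (auto simp: coset_eq image_def)
 then show ?thesis using coset_eq_iff[OF x, of "\<zero>[V]"] V x by simp
qed

lemma quotient_carrier: "carrier (quotient_vs V W) = (%x. W +>\<^bsub>V\<^esub> x) ` carrier V"
 by (auto simp: quotient_vs_def A_RCOSETS_def')

lemma quotient_zero: "\<zero>[quotient_vs V W] = W"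
 by (simp add: quotient_vs_def)

lemma quotient_add: 
 assumes x: "x \<in> carrier V" and y: "y \<in> carrier V"
 shows "(W +>\<^bsub>V\<^esub> x) \<oplus>[quotient_vs V W] (W +>\<^bsub>V\<^esub> y) = W +>\<^bsub>V\<^esub> (x \<oplus>[V] y)"
proof -
 have "\<exists>w\<in>W. u \<oplus>[V] x \<oplus>[V] (v \<oplus>[V] y) = w \<oplus>[V] (x \<oplus>[V] y)" if "u \<in> W" "v \<in> W" for u v
  using that x y V wc rsub_add by (intro bexI[of _ "u \<oplus>[V] v"]) (auto simp: rm_lin4)
 moreover have "\<exists>u\<in>W. \<exists>v\<in>W. w \<oplus>[V] (x \<oplus>[V] y) = u \<oplus>[V] x \<oplus>[V] (v \<oplus>[V] y)" if "w \<in> W" for w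
  using that x y V wc rsub_zero
  by (intro bexI[of _ w] bexI[of _ "\<zero>[V]"]) (auto simp: rm_assoc)
 ultimately show ?thesis
  unfolding quotient_vs_def by (auto simp: set_add_def' coset_eq image_iff)
qed

text \<open>\<open>W <+> A\<close> is the union of the cosets of the members of \<open>A\<close>,
  and these cosets all coincide. Scalar multiplication in \<open>quotient_vs\<close> and the map
  \<open>descend\<close> are both defined as \<open>W\<close> plus an image, so this evaluates
  both.\<close>

lemma coset_absorb:
 assumes A: "A <= W +>\<^bsub>V\<^esub> x" "A ~= {}" and x: "x \<in> carrier V"
 shows "W <+>\<^bsub>V\<^esub> A = W +>\<^bsub>V\<^esub> x"
proof -
 have "(\<Union>a\<in>A. W +>\<^bsub>V\<^esub> a) = W +>\<^bsub>V\<^esub> x"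
 proof -
  have "W +>\<^bsub>V\<^esub> a = W +>\<^bsub>V\<^esub> x" if "a \<in> A" for a
   using that A(1) coset_mem_iff[OF x, of a] coset_eq_iff[of a x] x by auto
  then show ?thesis using A(2) by auto
 qed
 moreover have "W <+>\<^bsub>V\<^esub> A = (\<Union>a\<in>A. W +>\<^bsub>V\<^esub> a)" by (auto simp: set_add_def' coset_eq)
 ultimately show ?thesis by simp
qed

lemma quotient_smult: 
 assumes x: "x \<in> carrier V"
 shows "r \<odot>[quotient_vs V W] (W +>\<^bsub>V\<^esub> x) = W +>\<^bsub>V\<^esub> (r \<odot>[V] x)"
proof -
 have "(%y. r \<odot>[V] y) ` (W +>\<^bsub>V\<^esub> x) <= W +>\<^bsub>V\<^esub> (r \<odot>[V] x)"
  using V x wc rsub_smult by (auto simp: coset_eq rm_smult_r)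
 then have "W <+>\<^bsub>V\<^esub> ((%y. r \<odot>[V] y) ` (W +>\<^bsub>V\<^esub> x)) = W +>\<^bsub>V\<^esub> (r \<odot>[V] x)"
  using V x coset_self by (intro coset_absorb) auto
 then show ?thesis by (simp add: quotient_vs_def)
qed

lemma quotient_rmod: "rmod (quotient_vs V W)"
proof -
 have z: "\<zero>[quotient_vs V W] = W +>\<^bsub>V\<^esub> \<zero>[V]"
  using V coset_zero[of "\<zero>[V]"] rsub_zero by (simp add: quotient_zero)
 show ?thesis
  by (rule rmodI; (subst z)?)
   (auto simp: quotient_carrier quotient_add quotient_smult V rm_assoc rm_smult_l rm_smult_r
    rm_comm rm_lcomm)
qed

lemma quotient_proj: "lin V (quotient_vs V W) (%x. W +>\<^bsub>V\<^esub> x)"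
 by (rule real_linearI) (auto simp: quotient_carrier quotient_add quotient_smult)

end

lemma descend_coset:
 assumes V: "rmod V" "rmod V'" "rsub W V" "rsub W' V'" "lin V V' f"
  and sub: "!!w. w \<in> W ==> f w \<in> W'" and x: "x \<in> carrier V"
 shows "descend V' W' f (W +>\<^bsub>V\<^esub> x) = W' +>\<^bsub>V'\<^esub> f x"
 unfolding descend_def
proof (rule coset_absorb[OF V(2,4)])
 show "f ` (W +>\<^bsub>V\<^esub> x) <= W' +>\<^bsub>V'\<^esub> f x"
  using x sub rsub_sub[OF V(1,3)] by (auto simp: coset_eq rl_add[OF V(5)] subset_iff)
 show "f ` (W +>\<^bsub>V\<^esub> x) ~= {}" using coset_self[OF V(1,3) x] by auto
 show "f x \<in> carrier V'" using rl_closed[OF V(5) x] .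
qed

lemma descend_linear:
 assumes V: "rmod V" "rmod V'" "rsub W V" "rsub W' V'" "lin V V' f"
  and sub: "!!w. w \<in> W ==> f w \<in> W'"
 shows "lin (quotient_vs V W) (quotient_vs V' W') (descend V' W' f)"
proof -
 have c: "!!x. x \<in> carrier V ==> f x \<in> carrier V'" using rl_closed[OF V(5)] by auto
 show ?thesis
  by (rule real_linearI)
   (auto simp: quotient_carrier[OF V(1,3)] quotient_carrier[OF V(2,4)] descend_coset[OF V sub] c
    quotient_add[OF V(1,3)] quotient_add[OF V(2,4)] quotient_smult[OF V(1,3)]
    quotient_smult[OF V(2,4)] V(1) rl_add[OF V(5)] rl_smult[OF V(5)])
qed


section \<open>Tensor products\<close>

lemma pm_map_smult: "Poly_Mapping.lookup (Poly_Mapping.map ((*) r) x) g = r * Poly_Mapping.lookup x g"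
 for r :: real
 by (simp add: map.rep_eq when_def)

lemma pm_map_add: "Poly_Mapping.map ((*) r) (x + y) = Poly_Mapping.map ((*) r) x + Poly_Mapping.map ((*) r) y"
 for r :: real
 by (intro poly_mapping_eqI) (simp add: pm_map_smult lookup_add algebra_simps)

lemma free_vs_sel [simp]:
 "x \<in> carrier (free_vs G) \<longleftrightarrow> Poly_Mapping.keys x <= G"
 "x \<oplus>[free_vs G] y = x + y" "\<zero>[free_vs G] = 0"
 "r \<odot>[free_vs G] x = Poly_Mapping.map ((*) r) x"
 by (simp_all add: free_vs_def)

lemma keys_pm_smult: "Poly_Mapping.keys (Poly_Mapping.map ((*) r) x) <= Poly_Mapping.keys x"
 for r :: real
 by (auto simp: in_keys_iff pm_map_smult)

lemma free_vs_rmod: "rmod (free_vs G)"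
proof (rule rmodI)
 fix x y assume "x \<in> carrier (free_vs G)" "y \<in> carrier (free_vs G)"
 then show "x \<oplus>[free_vs G] y \<in> carrier (free_vs G)"
  using Poly_Mapping.keys_add[of x y] by auto
next
 fix r x assume "x \<in> carrier (free_vs G)"
 then show "r \<odot>[free_vs G] x \<in> carrier (free_vs G)"
  using keys_pm_smult[of r x] by auto
qed (auto intro!: poly_mapping_eqI simp: pm_map_smult lookup_add algebra_simps)

lemma free_vs_diff:
 "x \<in> carrier (free_vs G) ==> y \<in> carrier (free_vs G) ==> x - y \<in> carrier (free_vs G)"
 using keys_diff[of x y] by fastforce

lemma free_vs_single: "g \<in> G ==> Poly_Mapping.single g r \<in> carrier (free_vs G)"
 by auto

text \<open>The map under the image in \<open>tensor_lift\<close>, isolated so that its linearity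
  can be stated.\<close>

definition free_ext :: "(real, 'c) module => ('g => 'c) => ('g \<Rightarrow>\<^sub>0 real) => 'c" where
 "free_ext N h x = finsum N (%g. Poly_Mapping.lookup x g \<odot>[N] h g) (Poly_Mapping.keys x)"

lemma free_ext_superset:
 assumes "rmod N" "finite S" "Poly_Mapping.keys x <= S" "h \<in> S \<rightarrow> carrier N"
 shows "free_ext N h x = finsum N (%g. Poly_Mapping.lookup x g \<odot>[N] h g) S"
 unfolding free_ext_def
 by (rule finsum_mono_rm[symmetric]) (use assms in \<open>auto simp: in_keys_iff Pi_iff\<close>)

lemma free_ext_linear:
 assumes N: "rmod N" and h: "h \<in> G \<rightarrow> carrier N"
 shows "lin (free_vs G) N (free_ext N h)"
proof (rule real_linearI)
 fix x assume x: "x \<in> carrier (free_vs G)"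
 then have h': "h \<in> Poly_Mapping.keys x \<rightarrow> carrier N"
  and h'': "!!g. g \<in> Poly_Mapping.keys x ==> h g \<in> carrier N" using h by auto
 then show "free_ext N h x \<in> carrier N"
  unfolding free_ext_def using N by (intro finsum_closed_rm) auto
 fix r
 have "free_ext N h (Poly_Mapping.map ((*) r) x)
   = finsum N (%g. r \<odot>[N] (Poly_Mapping.lookup x g \<odot>[N] h g)) (Poly_Mapping.keys x)"
  using N h'' subsetD[OF keys_pm_smult[of r x]]
  by (subst free_ext_superset[of _ "Poly_Mapping.keys x"])
   (auto simp: pm_map_smult intro!: sum_cong_rm)
 also have "\<dots> = r \<odot>[N] free_ext N h x"
  unfolding free_ext_def using N h'' by (intro finsum_smult_rm) auto
 finally show "free_ext N h (r \<odot>[free_vs G] x) = r \<odot>[N] free_ext N h x" by simp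
next
 fix x y assume x: "x \<in> carrier (free_vs G)" and y: "y \<in> carrier (free_vs G)"
 let ?S = "Poly_Mapping.keys x Un Poly_Mapping.keys y"
 have h': "!!g. g \<in> ?S ==> h g \<in> carrier N" using x y h by auto
 have "free_ext N h (x + y) = finsum N (%g. Poly_Mapping.lookup (x + y) g \<odot>[N] h g) ?S"
  using N h' Poly_Mapping.keys_add[of x y] by (intro free_ext_superset) auto
 also have "\<dots> = finsum N (%g. Poly_Mapping.lookup x g \<odot>[N] h g \<oplus>[N] Poly_Mapping.lookup y g \<odot>[N] h g) ?S"
  using N h' by (intro sum_cong_rm) (auto simp: lookup_add rm_smult_l)
 also have "\<dots> = finsum N (%g. Poly_Mapping.lookup x g \<odot>[N] h g) ?S \<oplus>[N]
   finsum N (%g. Poly_Mapping.lookup y g \<odot>[N] h g) ?S"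
  using N h' by (intro finsum_add_rm) auto
 also have "\<dots> = free_ext N h x \<oplus>[N] free_ext N h y"
  using N h' by (simp add: free_ext_superset[of N ?S])
 finally show "free_ext N h (x \<oplus>[free_vs G] y) = free_ext N h x \<oplus>[N] free_ext N h y" by simp
qed

lemma free_ext_single:
 assumes "rmod N" "h g \<in> carrier N"
 shows "free_ext N h (Poly_Mapping.single g r) = r \<odot>[N] h g"
 using assms by (subst free_ext_superset[of _ "{g}"]) (auto simp: finsum_insert_rm)

text \<open>Each element is the finite sum, over its own keys, of multiples of basis
  vectors.\<close>

lemma free_vs_induct:
 assumes x: "x \<in> carrier (free_vs G)" and W: "rsub W (free_vs G)"
  and s: "!!g. g \<in> G ==> Poly_Mapping.single g 1 \<in> W"
 shows "x \<in> W"
proof -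
 have sub: "Poly_Mapping.keys x <= G" using x by simp
 have W': "0 \<in> W" "!!x y. x \<in> W ==> y \<in> W ==> x + y \<in> W"
  "!!r x. x \<in> W ==> Poly_Mapping.map ((*) r) x \<in> W"
  using W unfolding rsub_iff[OF free_vs_rmod] by auto
 have "(\<Sum>g\<in>S. Poly_Mapping.single g (Poly_Mapping.lookup x g)) \<in> W" if "finite S" "S <= G" for S
  using that
 proof (induction S)
  case (insert g S)
  have "Poly_Mapping.single g (Poly_Mapping.lookup x g)
    = Poly_Mapping.map ((*) (Poly_Mapping.lookup x g)) (Poly_Mapping.single g 1)"
   by (intro poly_mapping_eqI) (simp add: pm_map_smult lookup_single when_def)
  also have "\<dots> \<in> W" using insert(4) by (intro W'(3) s) auto
  finally have "Poly_Mapping.single g (Poly_Mapping.lookup x g) \<in> W" .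
  then show ?case using insert W'(2) by auto
 qed (use W' in auto)
 from this[OF finite_keys sub] show ?thesis 
  by (rule back_subst[of "%x. x \<in> W"])
   (auto intro!: poly_mapping_eqI simp: lookup_sum lookup_single when_def in_keys_iff)
qed

context
 fixes V :: "'a gvs" and W :: "'b gvs"
 assumes V: "!!j. rmod (V j)" and W: "!!j. rmod (W j)"
begin

private lemma tf_rmod: "rmod (tensor_free V W j)"
 by (simp add: tensor_free_def free_vs_rmod)

lemma bilinear_relations_carrier: "bilinear_relations V W j <= carrier (tensor_free V W j)"
 unfolding bilinear_relations_def tensor_free_def
 by (intro Un_least; clarify; intro free_vs_diff free_vs_single; simp add: tensor_basis_def V W)

lemma tn_rsub: "rsub (tensor_null V W j) (tensor_free V W j)"
 unfolding tensor_null_def by (intro span_rsub tf_rmod bilinear_relations_carrier)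

lemma tensor_rmod [simp]: "rmod (tensor V W j)"
 unfolding tensor_def by (intro quotient_rmod tf_rmod tn_rsub)

lemma tens_closed: "[|a \<in> carrier (V p); b \<in> carrier (W q); j = p + q|] ==> tens V W p q a b \<in> carrier (tensor V W j)"
 unfolding tensor_def tens_def quotient_carrier[OF tf_rmod tn_rsub]
 by (auto simp: tensor_free_def tensor_basis_def)

text \<open>The preimage of \<open>S\<close> in the free space is a subspace that contains all basis
  vectors.\<close>

lemma tensor_induct [consumes 1, case_names sub tens]:
 assumes x: "x \<in> carrier (tensor V W j)" and S: "rsub S (tensor V W j)"
  and t: "!!p a b. [|a \<in> carrier (V p); b \<in> carrier (W (j - p))|] ==> tens V W p (j - p) a b \<in> S"
 shows "x \<in> S"
proof -
 let ?\<pi> = "%y. tensor_null V W j +>\<^bsub>tensor_free V W j\<^esub> y"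
 obtain y where y: "y \<in> carrier (tensor_free V W j)" "x = ?\<pi> y"
  using x unfolding tensor_def quotient_carrier[OF tf_rmod tn_rsub] by auto
 have "rsub {y \<in> carrier (tensor_free V W j). ?\<pi> y \<in> S} (tensor_free V W j)"
  by (rule rsub_vimage[OF tf_rmod tensor_rmod _ S]) (simp add: tensor_def quotient_proj tf_rmod tn_rsub)
 then have "y \<in> {y \<in> carrier (tensor_free V W j). ?\<pi> y \<in> S}"
 proof (rule free_vs_induct[OF y(1)[unfolded tensor_free_def], folded tensor_free_def])
  fix g assume g: "g \<in> tensor_basis V W j"
  obtain p a b where "g = (p, a, b)" by (cases g)
  then show "Poly_Mapping.single g 1 \<in> {y \<in> carrier (tensor_free V W j). ?\<pi> y \<in> S}"
   using g t[of a p b] by (auto simp: tensor_free_def tensor_basis_def tens_def)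
 qed
 then show ?thesis using y by simp
qed

text \<open>The kernel of the difference is a subspace that contains the tensors
  \<open>a \<otimes> b\<close>. The basic identities between operators on tensor products below are
  checked on such tensors through this lemma.\<close>

lemma tensor_linear_eq:
 assumes N: "rmod N" and f: "lin (tensor V W j) N f" and g: "lin (tensor V W j) N g"
  and x: "x \<in> carrier (tensor V W j)"
  and t: "!!p a b. [|a \<in> carrier (V p); b \<in> carrier (W (j - p))|] ==>
   f (tens V W p (j - p) a b) = g (tens V W p (j - p) a b)"
 shows "f x = g x"
proof -
 have "rsub {x \<in> carrier (tensor V W j). f x \<oplus>[N] (-1) \<odot>[N] g x = \<zero>[N]} (tensor V W j)"
  using N f g by (intro rsub_kernel rl_fun_add rl_fun_smult) auto
 then have "x \<in> {x \<in> carrier (tensor V W j). f x \<oplus>[N] (-1) \<odot>[N] g x = \<zero>[N]}"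
  by (rule tensor_induct[OF x])
   (use N t rl_closed[OF g] in \<open>auto simp: tens_closed\<close>)
 then show ?thesis
  using rm_minus_eq_zero[OF N rl_closed[OF f x] rl_closed[OF g x]] by simp
qed

definition bilin :: "int => (real, 'c) module => (int \<times> 'a \<times> 'b => 'c) => bool" where
 "bilin j N h \<longleftrightarrow>
  (ALL p. \<forall>b\<in>carrier (W (j - p)). lin (V p) N (%a. h (p, a, b))) &
  (ALL p. \<forall>a\<in>carrier (V p). lin (W (j - p)) N (%b. h (p, a, b)))"

text \<open>The linear extension of \<open>h\<close> kills each of the four kinds of bilinear
  relations, hence their span. So it is constant on every coset, and the image of the coset is the
  singleton that \<open>the_elem\<close> opens.\<close>

lemma tensor_lift:
 assumes N: "rmod N" and h: "bilin j N h"
 shows tensor_lift_linear: "lin (tensor V W j) N (tensor_lift N h)"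
  and tensor_lift_tens: "[|a \<in> carrier (V p); b \<in> carrier (W q); p + q = j|] ==>
   tensor_lift N h (tens V W p q a b) = h (p, a, b)"
proof -
 let ?F = "tensor_free V W j" and ?K = "tensor_null V W j"
 have hl: "!!p b. b \<in> carrier (W (j - p)) ==> lin (V p) N (%a. h (p, a, b))"
  and hr: "!!p a. a \<in> carrier (V p) ==> lin (W (j - p)) N (%b. h (p, a, b))"
  using h by (auto simp: bilin_def)
 have hc: "h (p, a, b) \<in> carrier N" if "a \<in> carrier (V p)" "b \<in> carrier (W (j - p))" for p a b
  using rl_closed[OF hl[OF that(2)] that(1)] .
 have lin: "lin ?F N (free_ext N h)"
  unfolding tensor_free_def by (rule free_ext_linear[OF N]) (auto simp: tensor_basis_def hc)
 have sgl: "free_ext N h (Poly_Mapping.single (p, a, b) r) = r \<odot>[N] h (p, a, b)"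
  if "a \<in> carrier (V p)" "b \<in> carrier (W (j - p))" for p a b r
  using N hc[OF that] by (rule free_ext_single)
 have min: "free_ext N h (x - y) = free_ext N h x \<oplus>[N] (-1) \<odot>[N] free_ext N h y"
  if "x \<in> carrier ?F" "y \<in> carrier ?F" for x y
 proof -
  have "x - y = x \<oplus>[?F] (-1) \<odot>[?F] y"
   by (auto simp: tensor_free_def lookup_add lookup_minus pm_map_smult intro!: poly_mapping_eqI)
  then show ?thesis
   using that rm_smult_closed[OF tf_rmod] by (simp add: rl_add[OF lin] rl_smult[OF lin])
 qed
 have sc: "Poly_Mapping.single (p, a, b) r \<in> carrier ?F"
  if "a \<in> carrier (V p)" "b \<in> carrier (W (j - p))" for p a b r
  using that by (auto simp: tensor_free_def tensor_basis_def)
 have minc: "x - y \<in> carrier ?F" if "x \<in> carrier ?F" "y \<in> carrier ?F" for x y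
  using that keys_diff[of x y] by (auto simp: tensor_free_def)
 have null: "free_ext N h x \<in> {\<zero>[N]}" if "x \<in> ?K" for x
 proof (rule rl_span[OF tf_rmod N lin bilinear_relations_carrier _ _ that[unfolded tensor_null_def]])
  show "rsub {\<zero>[N]} N" using N by (simp add: rsub_iff)
  show "free_ext N h x \<in> {\<zero>[N]}" if "x \<in> bilinear_relations V W j" for x
   using that unfolding bilinear_relations_def
   using V W N hc
   by (auto simp: min minc sgl sc rl_add[OF hl] rl_add[OF hr] rl_smult[OF hl] rl_smult[OF hr] rm_assoc
     rm_lcomm)
 qed
 have lift: "tensor_lift N h (?K +>\<^bsub>?F\<^esub> x) = free_ext N h x" if x: "x \<in> carrier ?F" for x
 proof -
  have "free_ext N h ` (?K +>\<^bsub>?F\<^esub> x) = {free_ext N h x}"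
  proof -
   have "free_ext N h (w \<oplus>[?F] x) = free_ext N h x" if "w \<in> ?K" for w
    using null[OF that] rsub_sub[OF tf_rmod tn_rsub] that x N rl_closed[OF lin x]
    by (subst rl_add[OF lin]) auto
   then show ?thesis using rsub_zero[OF tf_rmod tn_rsub] by (force simp: coset_eq image_iff)
  qed
  moreover have "(%x. finsum N (%g. Poly_Mapping.lookup x g \<odot>[N] h g) (Poly_Mapping.keys x)) = free_ext N h"
   by (rule ext) (simp add: free_ext_def)
  ultimately show ?thesis unfolding tensor_lift_def by (metis the_elem_eq)
 qed
 show "lin (tensor V W j) N (tensor_lift N h)"
 proof (rule real_linearI)
  fix x assume "x \<in> carrier (tensor V W j)"
  then show "tensor_lift N h x \<in> carrier N"
   using rl_closed[OF lin] lift unfolding tensor_def quotient_carrier[OF tf_rmod tn_rsub] by auto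
 next
  fix x y assume "x \<in> carrier (tensor V W j)" "y \<in> carrier (tensor V W j)"
  then show "tensor_lift N h (x \<oplus>[tensor V W j] y) = tensor_lift N h x \<oplus>[N] tensor_lift N h y"
   unfolding tensor_def quotient_carrier[OF tf_rmod tn_rsub]
   by (auto simp: quotient_add[OF tf_rmod tn_rsub] lift rm_add_closed[OF tf_rmod] rl_add[OF lin])
 next
  fix x r assume "x \<in> carrier (tensor V W j)"
  then show "tensor_lift N h (r \<odot>[tensor V W j] x) = r \<odot>[N] tensor_lift N h x"
   unfolding tensor_def quotient_carrier[OF tf_rmod tn_rsub]
   by (auto simp: quotient_smult[OF tf_rmod tn_rsub] lift rm_smult_closed[OF tf_rmod] rl_smult[OF lin])
 qed
 show "tensor_lift N h (tens V W p q a b) = h (p, a, b)"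
  if "a \<in> carrier (V p)" "b \<in> carrier (W q)" "p + q = j"
 proof -
  have "q = j - p" using that by simp
  then show ?thesis
   using that(1,2) N hc[of a p b] lift[OF sc[of a p b 1]] by (simp add: tens_def sgl)
 qed
qed

text \<open>The bilinear relations of the first and the third kind are exactly the differences that
  equality of cosets requires to be null.\<close>

lemma tens_linear_left:
 assumes b: "b \<in> carrier (W q)" and j: "j = p + q"
 shows "lin (V p) (tensor V W j) (%a. tens V W p q a b)"
proof (rule real_linearI)
 have R: "x \<in> bilinear_relations V W j ==> x \<in> tensor_null V W j" for x
  unfolding tensor_null_def by (rule subsetD[OF span_superset])
 have K: "Poly_Mapping.single (p, a, b) r \<in> carrier (tensor_free V W j)" if "a \<in> carrier (V p)" for a r
  using that b j by (auto simp: tensor_free_def tensor_basis_def)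
 fix a assume a: "a \<in> carrier (V p)"
 show "tens V W p q a b \<in> carrier (tensor V W j)" using a b j by (simp add: tens_closed)
 have sm: "Poly_Mapping.map ((*) r) (Poly_Mapping.single g s) = Poly_Mapping.single g (r * s)" for r s :: real and g :: "int \<times> 'a \<times> 'b"
  by (intro poly_mapping_eqI) (simp add: pm_map_smult lookup_single when_def)
 show "tens V W p q (r \<odot>[V p] a) b = r \<odot>[tensor V W j] tens V W p q a b" for r
 proof -
  have "Poly_Mapping.single (p, r \<odot>[V p] a, b) 1 - Poly_Mapping.single (p, a, b) r \<in> bilinear_relations V W j"
   unfolding bilinear_relations_def using a b j by fastforce
  then have "Poly_Mapping.single (p, r \<odot>[V p] a, b) 1 \<oplus>[tensor_free V W j] (-1) \<odot>[tensor_free V W j] Poly_Mapping.single (p, a, b) r \<in> tensor_null V W j"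
   using R by (simp add: tensor_free_def sm single_uminus)
  moreover have e: "r \<odot>[tensor_free V W j] Poly_Mapping.single (p, a, b) 1 = Poly_Mapping.single (p, a, b) r" for r
   by (simp add: tensor_free_def sm)
  ultimately show ?thesis
   unfolding tens_def tensor_def j[symmetric]
   using K a V by (simp add: quotient_smult[OF tf_rmod tn_rsub] e coset_eq_iff[OF tf_rmod tn_rsub])
 qed
 fix a' assume a': "a' \<in> carrier (V p)"
 show "tens V W p q (a \<oplus>[V p] a') b = tens V W p q a b \<oplus>[tensor V W j] tens V W p q a' b"
 proof -
  have "Poly_Mapping.single (p, a \<oplus>[V p] a', b) 1 - Poly_Mapping.single (p, a, b) 1 - Poly_Mapping.single (p, a', b) 1 \<in> bilinear_relations V W j"
   unfolding bilinear_relations_def using a a' b j by fastforce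
  then have "Poly_Mapping.single (p, a \<oplus>[V p] a', b) 1 \<oplus>[tensor_free V W j] (-1) \<odot>[tensor_free V W j]
   (Poly_Mapping.single (p, a, b) 1 \<oplus>[tensor_free V W j] Poly_Mapping.single (p, a', b) 1) \<in> tensor_null V W j"
   using R by (simp add: tensor_free_def sm single_uminus algebra_simps pm_map_add)
  moreover have e: "r \<odot>[tensor_free V W j] Poly_Mapping.single (p, a, b) 1 = Poly_Mapping.single (p, a, b) r" for r
   by (simp add: tensor_free_def sm)
  ultimately show ?thesis
   unfolding tens_def tensor_def j[symmetric]
   using K a a' V by (simp add: quotient_add[OF tf_rmod tn_rsub] coset_eq_iff[OF tf_rmod tn_rsub] tf_rmod)
 qed
qed

lemma tens_linear_right:
 assumes a: "a \<in> carrier (V p)" and j: "j = p + q"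
 shows "lin (W q) (tensor V W j) (tens V W p q a)"
proof (rule real_linearI)
 have R: "x \<in> bilinear_relations V W j ==> x \<in> tensor_null V W j" for x
  unfolding tensor_null_def by (rule subsetD[OF span_superset])
 have K: "Poly_Mapping.single (p, a, b) r \<in> carrier (tensor_free V W j)" if "b \<in> carrier (W q)" for b r
  using that a j by (auto simp: tensor_free_def tensor_basis_def)
 fix b assume b: "b \<in> carrier (W q)"
 show "tens V W p q a b \<in> carrier (tensor V W j)" using a b j by (simp add: tens_closed)
 have sm: "Poly_Mapping.map ((*) r) (Poly_Mapping.single g s) = Poly_Mapping.single g (r * s)" for r s :: real and g :: "int \<times> 'a \<times> 'b"
  by (intro poly_mapping_eqI) (simp add: pm_map_smult lookup_single when_def)
 have q: "q = j - p" using j by simp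
 show "tens V W p q a (r \<odot>[W q] b) = r \<odot>[tensor V W j] tens V W p q a b" for r
 proof -
  have "Poly_Mapping.single (p, a, r \<odot>[W q] b) 1 - Poly_Mapping.single (p, a, b) r \<in> bilinear_relations V W j"
   unfolding bilinear_relations_def using a b q by fastforce
  then have "Poly_Mapping.single (p, a, r \<odot>[W q] b) 1 \<oplus>[tensor_free V W j] (-1) \<odot>[tensor_free V W j] Poly_Mapping.single (p, a, b) r \<in> tensor_null V W j"
   using R by (simp add: tensor_free_def sm single_uminus)
  moreover have e: "r \<odot>[tensor_free V W j] Poly_Mapping.single (p, a, b) 1 = Poly_Mapping.single (p, a, b) r" for r
   by (simp add: tensor_free_def sm)
  ultimately show ?thesis
   unfolding tens_def tensor_def j[symmetric]
   using K b W by (simp add: quotient_smult[OF tf_rmod tn_rsub] e coset_eq_iff[OF tf_rmod tn_rsub])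
 qed
 fix b' assume b': "b' \<in> carrier (W q)"
 show "tens V W p q a (b \<oplus>[W q] b') = tens V W p q a b \<oplus>[tensor V W j] tens V W p q a b'"
 proof -
  have "Poly_Mapping.single (p, a, b \<oplus>[W q] b') 1 - Poly_Mapping.single (p, a, b) 1 - Poly_Mapping.single (p, a, b') 1 \<in> bilinear_relations V W j"
   unfolding bilinear_relations_def using a b b' q by fastforce
  then have "Poly_Mapping.single (p, a, b \<oplus>[W q] b') 1 \<oplus>[tensor_free V W j] (-1) \<odot>[tensor_free V W j]
   (Poly_Mapping.single (p, a, b) 1 \<oplus>[tensor_free V W j] Poly_Mapping.single (p, a, b') 1) \<in> tensor_null V W j"
   using R by (simp add: tensor_free_def sm single_uminus algebra_simps pm_map_add)
  moreover have e: "r \<odot>[tensor_free V W j] Poly_Mapping.single (p, a, b) 1 = Poly_Mapping.single (p, a, b) r" for r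
   by (simp add: tensor_free_def sm)
  ultimately show ?thesis
   unfolding tens_def tensor_def j[symmetric]
   using K b b' W by (simp add: quotient_add[OF tf_rmod tn_rsub] coset_eq_iff[OF tf_rmod tn_rsub] tf_rmod)
 qed
qed

end


section \<open>Presheaves of graded modules\<close>

context graded_presheaf
begin

lemma sec_rmod [simp]: "openin X U ==> rmod (sec F U j)"
 using sec_vs by (auto simp: graded_vs_def)

lemma res_closed: "[|openin X U; openin X V; V <= U; s : sect F U j|] ==> res F U V j s : sect F V j"
 by (rule rl_closed[OF res_linear])

end

lemma (in graded_module_presheaf) act_closed:
 "[|openin X U; f : sect C U i; s : sect F U j; n = i + j|] ==> act F U i j f s : sect F U n"
 using rl_closed[OF act_linear_right] by simp

lemma (in graded_algebra_sheaf) gmul_closed: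
 "[|openin X U; f : sect C U i; g : sect C U j; n = i + j|] ==> gmul C U i j f g : sect C U n"
 using rl_closed[OF gmul_linear_right] by simp

lemma qp_sel [simp]:
 "sec (quotient_psh F N) U j = quotient_vs (sec F U j) (N U j)"
 "res (quotient_psh F N) U V j = descend (sec F V j) (N V j) (res F U V j)"
 "act (quotient_psh F N) U i j f = descend (sec F U (i + j)) (N U (i + j)) (act F U i j f)"
 by (simp_all add: quotient_psh_def)

text \<open>Subspaces stable under restriction and action are what a quotient presheaf of modules
  needs. The locale serves twice: for the span of the products of \<delta>-factors, and for the part
  removed by the geometrization.\<close>

locale stable_family = graded_module_presheaf X C F
 for X :: "'m topology" and C :: "('m, 'f) apsh" and F :: "('m, 'f, 'a) mpsh" +
 fixes N :: "'m set => int => 'a set"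
 assumes C: "graded_algebra_sheaf X C"
  and N_rsub: "openin X U ==> rsub (N U j) (sec F U j)"
  and N_res: "[|openin X U; openin X V; V <= U; s \<in> N U j|] ==> res F U V j s \<in> N V j"
  and N_act: "[|openin X U; f : sect C U i; s \<in> N U j|] ==> act F U i j f s \<in> N U (i + j)"
begin

interpretation C: graded_algebra_sheaf X C by (rule C)

abbreviation (input) "cs U j s == N U j +>\<^bsub>sec F U j\<^esub> s"

lemma q_carrier: "openin X U ==> carrier (quotient_vs (sec F U j) (N U j)) = cs U j ` sect F U j"
 by (simp add: quotient_carrier N_rsub)

lemma q_proj: "openin X U ==> lin (sec F U j) (sec (quotient_psh F N) U j) (cs U j)"
 by (simp add: quotient_proj N_rsub)

lemma q_res: "[|openin X U; openin X V; V <= U; s : sect F U j|] ==>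
  res (quotient_psh F N) U V j (cs U j s) = cs V j (res F U V j s)"
 unfolding qp_sel
 by (rule descend_coset) (auto intro: N_rsub N_res res_linear)

lemma q_act: "[|openin X U; f : sect C U i; s : sect F U j|] ==>
  act (quotient_psh F N) U i j f (cs U j s) = cs U (i + j) (act F U i j f s)"
 unfolding qp_sel
 by (rule descend_coset) (auto intro: N_rsub N_act act_linear_right)

lemma quotient_module_presheaf: "graded_module_presheaf X C (quotient_psh F N)"
proof
 fix U j assume U: "openin X U"
 show "graded_vs (sec (quotient_psh F N) U)"
  using U by (auto simp: graded_vs_def quotient_rmod N_rsub)
 show "lin (sec (quotient_psh F N) U j) (sec (quotient_psh F N) V j) (res (quotient_psh F N) U V j)"
  if "openin X V" "V <= U" for V j
  unfolding qp_sel
  using U that by (intro descend_linear) (auto intro: N_rsub N_res res_linear)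
 show "res (quotient_psh F N) U U j s = s" if "s : sect (quotient_psh F N) U j" for s
  using that U by (auto simp: q_carrier q_res res_id simp del: qp_sel(2))
 show "res (quotient_psh F N) V W j (res (quotient_psh F N) U V j s) = res (quotient_psh F N) U W j s"
  if "openin X V" "openin X W" "W <= V" "V <= U" "s : sect (quotient_psh F N) U j" for V W s
 proof -
  have "W <= U" using that by blast
  then show ?thesis
   using that U by (auto simp: q_carrier q_res res_closed res_comp simp del: qp_sel(2))
 qed
 show "lin (sec C U i) (sec (quotient_psh F N) U (i + j)) (%f. act (quotient_psh F N) U i j f s)"
  if s: "s : sect (quotient_psh F N) U j" for s i
 proof -
  obtain t where t: "t : sect F U j" "s = cs U j t"
   using s U by (auto simp: q_carrier)
  show ?thesis
   by (rule rl_cong[OF rl_comp[OF act_linear_left[OF U t(1)] q_proj[OF U]]])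
    (use U t in \<open>simp_all add: q_act del: qp_sel\<close>)
 qed
 show "lin (sec (quotient_psh F N) U j) (sec (quotient_psh F N) U (i + j)) (act (quotient_psh F N) U i j f)"
  if "f : sect C U i" for f i
  unfolding qp_sel
  using U that by (intro descend_linear) (auto intro: N_rsub N_act act_linear_right)
 show "act (quotient_psh F N) U (i + j) l (gmul C U i j f g) s =
   act (quotient_psh F N) U i (j + l) f (act (quotient_psh F N) U j l g s)"
  if "f : sect C U i" "g : sect C U j" "s : sect (quotient_psh F N) U l"
  for f g s i j l
  using that U
  by (auto simp: q_carrier q_act act_closed act_assoc C.gmul_closed add.assoc simp del: qp_sel(3))
 show "act (quotient_psh F N) U 0 j (gunit C U) s = s" if "s : sect (quotient_psh F N) U j" for s
  using that U q_act[OF U C.gunit_closed[OF U], of _ j]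
  by (auto simp: q_carrier act_gunit simp del: qp_sel(3))
 show "res (quotient_psh F N) U V (i + j) (act (quotient_psh F N) U i j f s) =
  act (quotient_psh F N) V i j (res C U V i f) (res (quotient_psh F N) U V j s)"
  if "openin X V" "V <= U" "f : sect C U i" "s : sect (quotient_psh F N) U j" for V f s i
  using that U
  by (auto simp: q_carrier q_act q_res act_closed res_act res_closed C.res_closed simp del: qp_sel(2,3))
qed

end


subsection \<open>Tensor products with the structure sheaf\<close>

lemma tp_sel [simp]:
 "sec (tensor_psh C B) U j = tensor (sec C U) (sec B U) j"
 "res (tensor_psh C B) U V j = tensor_lift (tensor (sec C V) (sec B V) j)
    (%(p, g, b). tens (sec C V) (sec B V) p (j - p) (res C U V p g) (res B U V (j - p) b))"
 "act (tensor_psh C B) U i j f = tensor_lift (tensor (sec C U) (sec B U) (i + j))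
    (%(p, g, b). tens (sec C U) (sec B U) (i + p) (j - p) (gmul C U i p f g) b)"
 by (simp_all add: tensor_psh_def)

locale tensor_setting = C: graded_algebra_sheaf X C + B: graded_presheaf X B
 for X :: "'m topology" and C :: "('m, 'f) apsh" and B :: "('m, 'b, 'z) psh_scheme"
begin

abbreviation "tn U p q g b == tens (sec C U) (sec B U) p q g b"
abbreviation "XX U j == sec (tensor_psh C B) U j"

lemma XX_rmod [simp]: "openin X U ==> rmod (tensor (sec C U) (sec B U) j)"
 by (rule tensor_rmod) auto

lemma tn_closed: "[|openin X U; g : sect C U p; b : sect B U q; j = p + q|] ==> tn U p q g b \<in> carrier (tensor (sec C U) (sec B U) j)"
 by (rule tens_closed) auto

lemma tn_left: "[|openin X U; b : sect B U q; j = p + q|] ==> lin (sec C U p) (tensor (sec C U) (sec B U) j) (%g. tn U p q g b)"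
 by (rule tens_linear_left) auto

lemma tn_right: "[|openin X U; g : sect C U p; j = p + q|] ==> lin (sec B U q) (tensor (sec C U) (sec B U) j) (tn U p q g)"
 by (rule tens_linear_right) auto

lemma tensor_eqI:
 assumes "openin X U" "rmod N" "lin (tensor (sec C U) (sec B U) j) N f" "lin (tensor (sec C U) (sec B U) j) N g"
  "x \<in> carrier (tensor (sec C U) (sec B U) j)"
  "!!p a b. [|a : sect C U p; b : sect B U (j - p)|] ==>
   f (tn U p (j - p) a b) = g (tn U p (j - p) a b)"
 shows "f x = g x"
 by (rule tensor_linear_eq[OF _ _ assms(2-6)]) (use assms(1) in auto)

lemma lift:
 assumes U: "openin X U" and N: "rmod N"
  and l: "!!p b. b : sect B U (j - p) ==> lin (sec C U p) N (%a. h (p, a, b))"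
  and r: "!!p a. a : sect C U p ==> lin (sec B U (j - p)) N (%b. h (p, a, b))"
 shows lift_linear: "lin (tensor (sec C U) (sec B U) j) N (tensor_lift N h)"
  and lift_tens: "[|g : sect C U p; b : sect B U q; p + q = j|] ==>
   tensor_lift N h (tn U p q g b) = h (p, g, b)"
proof -
 have VC: "!!j. rmod (sec C U j)" and VB: "!!j. rmod (sec B U j)" using U by auto
 have "bilin (sec C U) (sec B U) j N h"
  using l r by (auto simp: bilin_def[OF VC VB])
 then show "lin (tensor (sec C U) (sec B U) j) N (tensor_lift N h)"
  "[|g : sect C U p; b : sect B U q; p + q = j|] ==>
   tensor_lift N h (tn U p q g b) = h (p, g, b)"
  using tensor_lift[OF VC VB N] by auto
qed

lemma tres_linear:
 assumes "openin X U" "openin X V" "V <= U"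
 shows "lin (tensor (sec C U) (sec B U) j) (tensor (sec C V) (sec B V) j) (res (tensor_psh C B) U V j)"
  and "[|g : sect C U p; b : sect B U q; p + q = j|] ==>
   res (tensor_psh C B) U V j (tn U p q g b) = tn V p q (res C U V p g) (res B U V q b)"
proof -
 let ?h = "%(p, g, b). tens (sec C V) (sec B V) p (j - p) (res C U V p g) (res B U V (j - p) b)"
 have l: "lin (sec C U p) (tensor (sec C V) (sec B V) j) (%a. ?h (p, a, b))" if "b : sect B U (j - p)" for p b
  using assms that rl_comp[OF C.res_linear[OF assms] tn_left[of V "res B U V (j - p) b" "j - p" j p]]
  by (simp add: B.res_closed)
 have r: "lin (sec B U (j - p)) (tensor (sec C V) (sec B V) j) (%b. ?h (p, a, b))" if "a : sect C U p" for p a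
  using assms that rl_comp[OF B.res_linear[OF assms] tn_right[of V "res C U V p a" p j "j - p"]]
  by (simp add: C.res_closed)
 show "lin (tensor (sec C U) (sec B U) j) (tensor (sec C V) (sec B V) j) (res (tensor_psh C B) U V j)"
  unfolding tp_sel using assms by (intro lift_linear l r) auto
 show "res (tensor_psh C B) U V j (tn U p q g b) = tn V p q (res C U V p g) (res B U V q b)"
  if "g : sect C U p" "b : sect B U q" "p + q = j"
 proof -
  have "q = j - p" using that by simp
  then show ?thesis unfolding tp_sel using assms that by (subst lift_tens[OF _ _ l r]) auto
 qed
qed

lemma tact_linear:
 assumes U: "openin X U" and f: "f : sect C U i"
 shows "lin (tensor (sec C U) (sec B U) j) (tensor (sec C U) (sec B U) (i + j)) (act (tensor_psh C B) U i j f)"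
  and "[|g : sect C U p; b : sect B U q; p + q = j|] ==>
   act (tensor_psh C B) U i j f (tn U p q g b) = tn U (i + p) q (gmul C U i p f g) b"
proof -
 let ?h = "%(p, g, b). tens (sec C U) (sec B U) (i + p) (j - p) (gmul C U i p f g) b"
 have l: "lin (sec C U p) (tensor (sec C U) (sec B U) (i + j)) (%a. ?h (p, a, b))" if "b : sect B U (j - p)" for p b
  using that rl_comp[OF C.gmul_linear_right[OF U f] tn_left[OF U that, of "i + j" "i + p"]]
  by simp
 have r: "lin (sec B U (j - p)) (tensor (sec C U) (sec B U) (i + j)) (%b. ?h (p, a, b))" if "a : sect C U p" for p a
  using tn_right[OF U C.gmul_closed[OF U f that refl], of "i + j" "j - p"] by simp
 show "lin (tensor (sec C U) (sec B U) j) (tensor (sec C U) (sec B U) (i + j)) (act (tensor_psh C B) U i j f)"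
  unfolding tp_sel using U by (intro lift_linear l r) auto
 show "act (tensor_psh C B) U i j f (tn U p q g b) = tn U (i + p) q (gmul C U i p f g) b"
  if "g : sect C U p" "b : sect B U q" "p + q = j"
 proof -
  have "q = j - p" using that by simp
  then show ?thesis unfolding tp_sel using U that by (subst lift_tens[OF _ _ l r]) auto
 qed
qed

lemma tact_closed:
 "[|openin X U; f : sect C U i; x \<in> carrier (tensor (sec C U) (sec B U) j); n = i + j|] ==>
 act (tensor_psh C B) U i j f x \<in> carrier (tensor (sec C U) (sec B U) n)"
 using rl_closed[OF tact_linear(1)] by simp

lemma tact_linear_left:
 assumes U: "openin X U" and x: "x \<in> carrier (tensor (sec C U) (sec B U) j)"
 shows "lin (sec C U i) (tensor (sec C U) (sec B U) (i + j)) (%f. act (tensor_psh C B) U i j f x)"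
proof (rule real_linearI)
 fix f assume f: "f : sect C U i"
 show "act (tensor_psh C B) U i j f x \<in> carrier (tensor (sec C U) (sec B U) (i + j))"
  using U f x by (simp add: tact_closed del: tp_sel)
 have t: "lin (sec C U i) (tensor (sec C U) (sec B U) (i + j)) (%f. tn U (i + p) (j - p) (gmul C U i p f g) b)"
  if "g : sect C U p" "b : sect B U (j - p)" for p g b
  using rl_comp[OF C.gmul_linear_left[OF U that(1)] tn_left[OF U that(2), of "i + j" "i + p"]] by simp
 show "act (tensor_psh C B) U i j (r \<odot>[sec C U i] f) x = r \<odot>[tensor (sec C U) (sec B U) (i + j)] act (tensor_psh C B) U i j f x" for r
  by (rule tensor_eqI[OF U _ _ _ x])
   (use U f in \<open>auto intro!: rl_fun_smult tact_linear(1) simp: tact_linear(2) rl_smult[OF t] simp del: tp_sel\<close>)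
 fix g assume g: "g : sect C U i"
 show "act (tensor_psh C B) U i j (f \<oplus>[sec C U i] g) x =
   act (tensor_psh C B) U i j f x \<oplus>[tensor (sec C U) (sec B U) (i + j)] act (tensor_psh C B) U i j g x"
  by (rule tensor_eqI[OF U _ _ _ x])
   (use U f g in \<open>auto intro!: rl_fun_add tact_linear(1) simp: tact_linear(2) rl_add[OF t] simp del: tp_sel\<close>)
qed

text \<open>The axioms that equate two maps linear in the tensor are checked on
  \<open>g \<otimes> b\<close>, where they reduce to axioms for \<open>C\<close> and
  \<open>B\<close>.\<close>

lemma tensor_module_presheaf: "graded_module_presheaf X C (tensor_psh C B)"
proof
 fix U j assume U: "openin X U"
 show "graded_vs (sec (tensor_psh C B) U)" using U by (simp add: graded_vs_def)
 show "lin (sec (tensor_psh C B) U j) (sec (tensor_psh C B) V j) (res (tensor_psh C B) U V j)"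
  if "openin X V" "V <= U" for V j
  using tres_linear(1)[OF U that] by simp
 show "res (tensor_psh C B) U U j s = s" if "s : sect (tensor_psh C B) U j" for s
  by (rule tensor_eqI[OF U XX_rmod[OF U] tres_linear(1) rl_id that[unfolded tp_sel]])
   (use U in \<open>simp_all add: tres_linear(2) C.res_id B.res_id del: tp_sel\<close>)
 show "res (tensor_psh C B) V W j (res (tensor_psh C B) U V j s) = res (tensor_psh C B) U W j s"
  if V: "openin X V" "openin X W" "W <= V" "V <= U" and s: "s : sect (tensor_psh C B) U j" for V W s
 proof -
  have W: "W <= U" using V by blast
  show ?thesis
   by (rule tensor_eqI[OF U XX_rmod[OF V(2)] rl_comp[OF tres_linear(1)[OF U V(1,4)] tres_linear(1)[OF V(1-3)]]
      tres_linear(1)[OF U V(2) W] s[unfolded tp_sel]])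
    (use U V W in \<open>simp add: tres_linear(2) C.res_comp B.res_comp C.res_closed B.res_closed del: tp_sel\<close>)
 qed
 show "lin (sec C U i) (sec (tensor_psh C B) U (i + j)) (%f. act (tensor_psh C B) U i j f s)"
  if "s : sect (tensor_psh C B) U j" for s i
  using tact_linear_left[OF U, of s j i] that by simp
 show "lin (sec (tensor_psh C B) U j) (sec (tensor_psh C B) U (i + j)) (act (tensor_psh C B) U i j f)"
  if "f : sect C U i" for f i
  using tact_linear(1)[OF U that] by simp
 show "act (tensor_psh C B) U (i + j) l (gmul C U i j f g) s =
   act (tensor_psh C B) U i (j + l) f (act (tensor_psh C B) U j l g s)"
  if f: "f : sect C U i" and g: "g : sect C U j" and s: "s : sect (tensor_psh C B) U l"
  for f g s i j l
  by (rule tensor_eqI[OF U _ tact_linear(1)[OF U C.gmul_closed[OF U f g refl]]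
     rl_comp[OF tact_linear(1)[OF U g] tact_linear(1)[OF U f], folded add.assoc] s[unfolded tp_sel]])
   (use U f g in \<open>simp_all add: tact_linear(2) C.gmul_closed C.gmul_assoc add.assoc del: tp_sel\<close>)
 show "act (tensor_psh C B) U 0 j (gunit C U) s = s" if "s : sect (tensor_psh C B) U j" for s
  by (rule tensor_eqI[OF U _ tact_linear(1)[OF U C.gunit_closed[OF U], of j, simplified add_0] rl_id that[unfolded tp_sel]])
   (use U in \<open>simp_all add: tact_linear(2) C.gunit_closed C.gmul_gunit del: tp_sel\<close>)
 show "res (tensor_psh C B) U V (i + j) (act (tensor_psh C B) U i j f s) =
  act (tensor_psh C B) V i j (res C U V i f) (res (tensor_psh C B) U V j s)"
  if V: "openin X V" "V <= U" and f: "f : sect C U i" and s: "s : sect (tensor_psh C B) U j" for V f s i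
  by (rule tensor_eqI[OF U _ rl_comp[OF tact_linear(1)[OF U f] tres_linear(1)[OF U V]]
     rl_comp[OF tres_linear(1)[OF U V] tact_linear(1)[OF V(1)]] s[unfolded tp_sel]])
   (use U V f in \<open>simp_all add: tact_linear(2) tres_linear(2) C.res_gmul C.gmul_closed C.res_closed B.res_closed del: tp_sel\<close>)
qed

end


section \<open>Frames\<close>

definition lincomb ::
 "('m, 'f, 'a) mpsh => 'm set => 'i set => ('i => int) => ('i => 'a) => int => ('i => 'f) => 'a" where
 "lincomb F V L d b j c = finsum (sec F V j) (%l. act F V (j - d l) (d l) (c l) (b l)) L"

text \<open>The coordinates of \<open>s\<close>; meaningful when \<open>b\<close> freely generates,
  where the \<open>THE\<close> has exactly one witness.\<close>

definition coeff ::
 "('m, 'f) apsh => ('m, 'f, 'a) mpsh => 'm set => 'i set => ('i => int) => ('i => 'a) => int => 'a => 'i => 'f" where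
 "coeff C F V L d b j s = (THE c. c \<in> (\<Pi>\<^sub>E l\<in>L. sect C V (j - d l)) & s = lincomb F V L d b j c)"

locale graded_modules = C: graded_algebra_sheaf X C + F: graded_module_presheaf X C F
 for X :: "'m topology" and C :: "('m, 'f) apsh" and F :: "('m, 'f, 'a) mpsh"
begin

context
 fixes V :: "'m set" and L :: "'i set" and d :: "'i => int" and b :: "'i => 'a"
 assumes V: "openin X V" and L: "finite L" and b_all: "\<forall>l\<in>L. b l : sect F V (d l)"
begin

private lemma b: "l \<in> L ==> b l : sect F V (d l)"
 using b_all by blast

abbreviation "is_coeffs j c == (\<forall>l\<in>L. c l : sect C V (j - d l))"

lemma lincomb_terms: "is_coeffs j c ==> l \<in> L ==> act F V (j - d l) (d l) (c l) (b l) \<in> sect F V j"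
 using V b by (intro F.act_closed) auto

lemma lincomb_closed: "is_coeffs j c ==> lincomb F V L d b j c : sect F V j"
 unfolding lincomb_def using V lincomb_terms by (intro finsum_closed_rm) auto

lemma lincomb_cong: "is_coeffs j c ==> (!!l. l \<in> L ==> c' l = c l) ==> lincomb F V L d b j c' = lincomb F V L d b j c"
 unfolding lincomb_def using V lincomb_terms[of c j] by (intro sum_cong_rm) auto

lemma lincomb_add:
 assumes c: "is_coeffs j c" "is_coeffs j c'"
 shows "lincomb F V L d b j (%l. c l \<oplus>[sec C V (j - d l)] c' l) = lincomb F V L d b j c \<oplus>[sec F V j] lincomb F V L d b j c'"
proof -
 have "act F V (j - d l) (d l) (c l \<oplus>[sec C V (j - d l)] c' l) (b l) =
   act F V (j - d l) (d l) (c l) (b l) \<oplus>[sec F V j] act F V (j - d l) (d l) (c' l) (b l)" if "l \<in> L" for l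
  using rl_add[OF F.act_linear_left[OF V b[OF that], of "j - d l"]] c that by simp
 then show ?thesis
  unfolding lincomb_def using V lincomb_terms[OF c(1)] lincomb_terms[OF c(2)]
  by (subst finsum_add_rm[symmetric]) (auto intro!: sum_cong_rm)
qed

lemma lincomb_smult:
 assumes c: "is_coeffs j c"
 shows "lincomb F V L d b j (%l. r \<odot>[sec C V (j - d l)] c l) = r \<odot>[sec F V j] lincomb F V L d b j c"
proof -
 have "act F V (j - d l) (d l) (r \<odot>[sec C V (j - d l)] c l) (b l) =
   r \<odot>[sec F V j] act F V (j - d l) (d l) (c l) (b l)" if "l \<in> L" for l
  using rl_smult[OF F.act_linear_left[OF V b[OF that], of "j - d l"]] c that by simp
 then show ?thesis
  unfolding lincomb_def using V lincomb_terms[OF c(1)]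
  by (subst finsum_smult_rm[symmetric]) (auto intro!: sum_cong_rm)
qed

lemma lincomb_act:
 assumes f: "f : sect C V i" and c: "is_coeffs j c"
 shows "lincomb F V L d b (i + j) (%l. gmul C V i (j - d l) f (c l)) = act F V i j f (lincomb F V L d b j c)"
proof -
 have "act F V (i + j - d l) (d l) (gmul C V i (j - d l) f (c l)) (b l) =
   act F V i j f (act F V (j - d l) (d l) (c l) (b l))" if "l \<in> L" for l
  using F.act_assoc[OF V f _ b[OF that], of "c l" "j - d l"] c that by (simp add: add_diff_eq)
 then show ?thesis
  unfolding lincomb_def using V lincomb_terms[OF c(1)] f c b
  by (subst rl_finsum[OF _ _ F.act_linear_right[OF V f] L])
   (auto intro!: sum_cong_rm F.act_closed)
qed

lemma lincomb_res:
 assumes W: "openin X W" "W <= V" and c: "is_coeffs j c"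
 shows "res F V W j (lincomb F V L d b j c) =
  lincomb F W L d (%l. res F V W (d l) (b l)) j (%l. res C V W (j - d l) (c l))"
proof -
 have "res F V W j (act F V (j - d l) (d l) (c l) (b l)) =
  act F W (j - d l) (d l) (res C V W (j - d l) (c l)) (res F V W (d l) (b l))" if "l \<in> L" for l
  using F.res_act[OF V W _ b[OF that], of "c l" "j - d l"] c that by simp
 then show ?thesis
  unfolding lincomb_def using V W lincomb_terms[OF c(1)] c b
  by (subst rl_finsum[OF _ _ F.res_linear[OF V W] L])
   (auto intro!: sum_cong_rm F.act_closed simp: C.res_closed[OF V] F.res_closed[OF V])
qed

lemma lincomb_basis_cong:
 assumes "!!l. l \<in> L ==> b' l = b l" and c: "is_coeffs j c"
 shows "lincomb F V L d b' j c = lincomb F V L d b j c"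
 unfolding lincomb_def using V lincomb_terms[OF c] assms(1) by (intro sum_cong_rm) auto

lemma freely_generates_cong:
 assumes b': "!!l. l \<in> L ==> b' l = b l" and gen: "freely_generates C F V L d b"
 shows "freely_generates C F V L d b'"
proof -
 have "c \<in> (\<Pi>\<^sub>E l\<in>L. sect C V (j - d l)) & \<psi> = lincomb F V L d b' j c \<longleftrightarrow>
   c \<in> (\<Pi>\<^sub>E l\<in>L. sect C V (j - d l)) & \<psi> = lincomb F V L d b j c" for c j \<psi>
  using lincomb_basis_cong[OF b', where j = j and c = c] PiE_mem[of c L "%l. sect C V (j - d l)"] by auto
 then show ?thesis
  using gen b' unfolding freely_generates_def lincomb_def[symmetric] by simp
qed

text \<open>Uniqueness follows from independence applied to the difference of two coefficient
  families. As \<open>freely_generates\<close> asks for extensional families, the witness is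
  restricted to \<open>L\<close>.\<close>

lemma freely_generatesI:
 assumes span: "!!j s. s : sect F V j ==> EX c. is_coeffs j c & s = lincomb F V L d b j c"
  and indep: "!!j c l. [|is_coeffs j c; lincomb F V L d b j c = \<zero>[sec F V j]; l \<in> L|] ==> c l = \<zero>[sec C V (j - d l)]"
 shows "freely_generates C F V L d b"
 unfolding freely_generates_def lincomb_def[symmetric]
proof (intro conjI L ballI allI b)
 fix j \<psi> assume "\<psi> \<in> sect F V j"
 from span[OF this] obtain c where c: "is_coeffs j c" "\<psi> = lincomb F V L d b j c" by blast
 show "\<exists>!c. c \<in> (\<Pi>\<^sub>E l\<in>L. sect C V (j - d l)) & \<psi> = lincomb F V L d b j c"
 proof (rule ex1I[of _ "restrict c L"])
  show "restrict c L \<in> (\<Pi>\<^sub>E l\<in>L. sect C V (j - d l)) & \<psi> = lincomb F V L d b j (restrict c L)"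
   using c lincomb_cong[OF c(1), of "restrict c L"] by auto
 next
  fix e assume e: "e \<in> (\<Pi>\<^sub>E l\<in>L. sect C V (j - d l)) & \<psi> = lincomb F V L d b j e"
  then have e': "is_coeffs j e" by auto
  let ?m = "%l. (-1) \<odot>[sec C V (j - d l)] c l"
  have m: "is_coeffs j ?m" using c V by auto
  have "lincomb F V L d b j (%l. e l \<oplus>[sec C V (j - d l)] ?m l) = \<zero>[sec F V j]"
   unfolding lincomb_add[OF e' m] lincomb_smult[OF c(1)]
   using e c(2) lincomb_closed[OF c(1)] V by auto
  then have z: "e l \<oplus>[sec C V (j - d l)] ?m l = \<zero>[sec C V (j - d l)]" if "l \<in> L" for l
   using indep[of "%l. e l \<oplus>[sec C V (j - d l)] ?m l" j l] e' m V that by auto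
  have "e l = c l" if "l \<in> L" for l
   using z[OF that] rm_minus_eq_zero[OF C.sec_rmod[OF V]] e' c(1) that by blast
  then show "e = restrict c L" using e by (auto simp: PiE_iff extensional_def)
 qed
qed

context
 assumes gen: "freely_generates C F V L d b"
begin

lemma ex1_coeffs:
 "s : sect F V j ==> \<exists>!c. c \<in> (\<Pi>\<^sub>E l\<in>L. sect C V (j - d l)) & s = lincomb F V L d b j c"
 using gen unfolding freely_generates_def lincomb_def by blast

lemma coeff:
 assumes "s : sect F V j"
 shows coeff_closed: "l \<in> L ==> coeff C F V L d b j s l : sect C V (j - d l)"
  and lincomb_coeff: "lincomb F V L d b j (coeff C F V L d b j s) = s"
  and coeff_ext: "coeff C F V L d b j s \<in> extensional L"
 using theI'[OF ex1_coeffs[OF assms]] unfolding coeff_def[symmetric] by (auto simp: PiE_iff)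

lemma coeff_lincomb:
 assumes c: "is_coeffs j c" and s: "s = lincomb F V L d b j c" and l: "l \<in> L"
 shows "coeff C F V L d b j s l = c l"
proof -
 have "coeff C F V L d b j s = restrict c L"
  unfolding coeff_def
  by (rule the1_equality[OF ex1_coeffs])
   (use lincomb_closed[OF c] lincomb_cong[OF c, of "restrict c L"] c s in auto)
 then show ?thesis using l by simp
qed

lemma coeff_linear:
 assumes l: "l \<in> L"
 shows "lin (sec F V j) (sec C V (j - d l)) (%s. coeff C F V L d b j s l)"
proof (rule real_linearI)
 fix s t r assume s: "s : sect F V j"
 show "coeff C F V L d b j s l : sect C V (j - d l)" using coeff_closed[OF s l] .
 show "coeff C F V L d b j (r \<odot>[sec F V j] s) l = r \<odot>[sec C V (j - d l)] coeff C F V L d b j s l"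
  by (rule coeff_lincomb[OF _ _ l]) (use V s coeff_closed[OF s] in \<open>auto simp: lincomb_smult lincomb_coeff\<close>)
 assume t: "t : sect F V j"
 show "coeff C F V L d b j (s \<oplus>[sec F V j] t) l = coeff C F V L d b j s l \<oplus>[sec C V (j - d l)] coeff C F V L d b j t l"
  by (rule coeff_lincomb[OF _ _ l])
   (use V s t coeff_closed[OF s] coeff_closed[OF t] in \<open>auto simp: lincomb_add lincomb_coeff\<close>)
qed

lemma coeff_act:
 assumes f: "f : sect C V i" and s: "s : sect F V j" and l: "l \<in> L"
 shows "coeff C F V L d b (i + j) (act F V i j f s) l = gmul C V i (j - d l) f (coeff C F V L d b j s l)"
 by (rule coeff_lincomb[OF _ _ l])
  (use V f s coeff_closed[OF s] in \<open>auto simp: lincomb_act lincomb_coeff add_diff_eq intro!: C.gmul_closed\<close>)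

end

end

lemma fg_onD:
 assumes "freely_generates_on X C F U L d b"
 shows "openin X U" "!!V. openin X V ==> V <= U ==> freely_generates C F V L d (%l. res F U V (d l) (b l))"
  "!!l. l \<in> L ==> b l : sect F U (d l)" "finite L"
 using assms unfolding freely_generates_on_def freely_generates_def by auto

text \<open>The restricted coefficients are coefficients of the restricted section, and those are
  unique.\<close>

lemma coeff_res:
 assumes gen: "freely_generates_on X C F U L d b" and V: "openin X V" "V <= U" and W: "openin X W" "W <= V"
  and s: "s : sect F V j" and l: "l \<in> L"
 shows "coeff C F W L d (%l. res F U W (d l) (b l)) j (res F V W j s) l =
  res C V W (j - d l) (coeff C F V L d (%l. res F U V (d l) (b l)) j s l)"
proof -
 note g = fg_onD[OF gen]
 have WU: "W <= U" using V W by blast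
 have bV: "\<forall>l\<in>L. res F U V (d l) (b l) \<in> sect F V (d l)"
  and bW: "\<forall>l\<in>L. res F U W (d l) (b l) \<in> sect F W (d l)"
  using g V W WU by (auto intro!: F.res_closed)
 note cV = coeff_closed[OF V(1) g(4) bV g(2)[OF V] s] lincomb_coeff[OF V(1) g(4) bV g(2)[OF V] s]
 show ?thesis
 proof (rule coeff_lincomb[OF W(1) g(4) bW g(2)[OF W(1) WU] _ _ l])
  show "\<forall>l\<in>L. res C V W (j - d l) (coeff C F V L d (%l. res F U V (d l) (b l)) j s l) \<in> sect C W (j - d l)"
   using cV(1) V W by (auto intro!: C.res_closed)
  have "res F V W j s = res F V W j (lincomb F V L d (%l. res F U V (d l) (b l)) j (coeff C F V L d (%l. res F U V (d l) (b l)) j s))"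
   by (simp add: cV(2))
  also have "\<dots> = lincomb F W L d (%l. res F V W (d l) (res F U V (d l) (b l))) j
    (%l. res C V W (j - d l) (coeff C F V L d (%l. res F U V (d l) (b l)) j s l))"
   using cV(1) by (intro lincomb_res[OF V(1) g(4) bV W]) auto
  also have "\<dots> = lincomb F W L d (%l. res F U W (d l) (b l)) j
    (%l. res C V W (j - d l) (coeff C F V L d (%l. res F U V (d l) (b l)) j s l))"
   unfolding lincomb_def
   by (rule sum_cong_rm) (use W V g bW cV(1) in \<open>auto simp: F.res_comp[OF g(1) V(1) W(1)] intro!: F.act_closed C.res_closed\<close>)
  finally show "res F V W j s = \<dots>" .
 qed
qed

lemma freely_generates_on_restrict:
 assumes gen: "freely_generates_on X C F U L d b" and W: "openin X W" "W <= U"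
 shows "freely_generates_on X C F W L d (%l. res F U W (d l) (b l))"
proof -
 note g = fg_onD[OF gen]
 show ?thesis
  unfolding freely_generates_on_def
 proof (intro conjI ballI allI impI W(1))
  show "res F U W (d l) (b l) \<in> sect F W (d l)" if "l \<in> L" for l
   using that g W by (intro F.res_closed) auto
  fix V assume "openin X V & V <= W"
  then have V: "openin X V" "V <= W" "V <= U" using W by auto
  show "freely_generates C F V L d (%l. res F W V (d l) (res F U W (d l) (b l)))"
  proof (rule freely_generates_cong[OF V(1) g(4) _ _ g(2)[OF V(1,3)]])
   show "\<forall>l\<in>L. res F U V (d l) (b l) \<in> sect F V (d l)"
    using g V by (auto intro!: F.res_closed[OF g(1) V(1)])
   show "res F W V (d l) (res F U W (d l) (b l)) = res F U V (d l) (b l)" if "l \<in> L" for l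
    using F.res_comp[OF g(1) W(1) V(1,2) W(2) g(3)[OF that]] .
  qed
 qed
qed

text \<open>Coordinates identify the sections over each \<open>V\<close> with finitely many
  functions, compatibly with restriction by \<open>coeff_res\<close>; locality and gluing are
  inherited from \<open>C\<close> coordinate by coordinate. This is the step from free generation to
  the sheaf property.\<close>

lemma frame_sheaf:
 assumes gen: "freely_generates_on X C F U L d b"
 shows "graded_module_sheaf (subtopology X U) C F"
proof -
 note g = fg_onD[OF gen]
 have op: "openin (subtopology X U) V \<longleftrightarrow> openin X V & V <= U" for V
  using g(1) by (simp add: openin_open_subtopology)
 let ?b = "%V l. res F U V (d l) (b l)"
 let ?k = "%V. coeff C F V L d (?b V)"
 have bV: "\<forall>l\<in>L. ?b V l : sect F V (d l)" if "openin X V" "V <= U" for V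
  using that g by (auto intro!: F.res_closed)
 have cl: "?k V j s l : sect C V (j - d l)"
  if "openin X V" "V <= U" "s : sect F V j" "l \<in> L" for V j s l
  using coeff_closed[OF that(1) g(4) bV g(2)] that by auto
 have lc: "lincomb F V L d (?b V) j (?k V j s) = s"
  if "openin X V" "V <= U" "s : sect F V j" for V j s
  using lincomb_coeff[OF that(1) g(4) bV g(2)] that by auto
 have eqI: "s = t" if V: "openin X V" "V <= U" and s: "s : sect F V j" and t: "t : sect F V j"
  and e: "!!l. l \<in> L ==> ?k V j s l = ?k V j t l" for V s t j
 proof -
  have "?k V j s = ?k V j t"
   using e coeff_ext[OF V(1) g(4) bV[OF V] g(2)[OF V] s] coeff_ext[OF V(1) g(4) bV[OF V] g(2)[OF V] t]
   by (auto intro: extensionalityI)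
  then have "lincomb F V L d (?b V) j (?k V j s) = lincomb F V L d (?b V) j (?k V j t)" by (rule arg_cong)
  then show ?thesis unfolding lc[OF V s] lc[OF V t] .
 qed
 \<comment> \<open>Open sets of the subspace are open in \<open>X\<close>, so each axiom is an
   instance of the corresponding one over \<open>X\<close>.\<close>
 have sub: "graded_module_presheaf (subtopology X U) C F"
  by (unfold_locales, unfold op)
   (elim conjE, (rule F.sec_vs, assumption | rule F.res_linear; assumption | rule F.res_id; assumption
    | rule F.res_comp; assumption | rule F.act_linear_left; assumption
    | rule F.act_linear_right; assumption | rule F.act_assoc; assumption
    | rule F.act_gunit; assumption | rule F.res_act; assumption))+
 interpret S: graded_module_presheaf "subtopology X U" C F by (rule sub)
 show ?thesis
 proof unfold_locales
  fix \<U> s t j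
  assume \<U>: "\<forall>V\<in>\<U>. openin (subtopology X U) V" and s: "s : sect F (\<Union>\<U>) j" and t: "t : sect F (\<Union>\<U>) j"
   and e: "\<forall>V\<in>\<U>. res F (\<Union>\<U>) V j s = res F (\<Union>\<U>) V j t"
  have V: "openin X (\<Union>\<U>)" "\<Union>\<U> <= U" using \<U> op by auto
  show "s = t"
  proof (rule eqI[OF V s t])
   fix l assume l: "l \<in> L"
   show "?k (\<Union>\<U>) j s l = ?k (\<Union>\<U>) j t l"
   proof (rule C.locality)
    show "\<forall>V\<in>\<U>. openin X V" using \<U> op by auto
    show "\<forall>V\<in>\<U>. res C (\<Union>\<U>) V (j - d l) (?k (\<Union>\<U>) j s l) = res C (\<Union>\<U>) V (j - d l) (?k (\<Union>\<U>) j t l)"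
    proof
     fix W assume W: "W \<in> \<U>"
     then have W': "openin X W" "W <= \<Union>\<U>" using \<U> op by auto
     show "res C (\<Union>\<U>) W (j - d l) (?k (\<Union>\<U>) j s l) = res C (\<Union>\<U>) W (j - d l) (?k (\<Union>\<U>) j t l)"
      using coeff_res[OF gen V W' s l] coeff_res[OF gen V W' t l] e W by simp
    qed
   qed (use cl[OF V s l] cl[OF V t l] in auto)
  qed
 next
  fix \<U> \<sigma> j
  assume \<U>: "\<forall>V\<in>\<U>. openin (subtopology X U) V" and \<sigma>: "\<forall>V\<in>\<U>. \<sigma> V : sect F V j"
   and e: "\<forall>V\<in>\<U>. \<forall>W\<in>\<U>. res F V (V Int W) j (\<sigma> V) = res F W (V Int W) j (\<sigma> W)"
  have \<U>': "!!V. V \<in> \<U> ==> openin X V" "!!V. V \<in> \<U> ==> V <= U" using \<U> op by auto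
  have V: "openin X (\<Union>\<U>)" "\<Union>\<U> <= U" using \<U>' by auto
  have "\<exists>c\<in>sect C (\<Union>\<U>) (j - d l). \<forall>V\<in>\<U>. res C (\<Union>\<U>) V (j - d l) c = ?k V j (\<sigma> V) l" if l: "l \<in> L" for l
  proof (rule C.gluing)
   show "\<forall>V\<in>\<U>. openin X V" using \<U>' by auto
   show "\<forall>V\<in>\<U>. ?k V j (\<sigma> V) l : sect C V (j - d l)"
    using \<U>' \<sigma> cl[OF \<U>' _ l] by auto
   show "\<forall>V\<in>\<U>. \<forall>W\<in>\<U>. res C V (V Int W) (j - d l) (?k V j (\<sigma> V) l) = res C W (V Int W) (j - d l) (?k W j (\<sigma> W) l)"
   proof (intro ballI)
    fix V W assume VW: "V \<in> \<U>" "W \<in> \<U>"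
    have o: "openin X (V Int W)" using \<U>' VW by auto
    show "res C V (V Int W) (j - d l) (?k V j (\<sigma> V) l) = res C W (V Int W) (j - d l) (?k W j (\<sigma> W) l)"
    proof -
     have \<sigma>VW: "\<sigma> V : sect F V j" "\<sigma> W : sect F W j" using \<sigma> VW by auto
     have "res F V (V Int W) j (\<sigma> V) = res F W (V Int W) j (\<sigma> W)" using e VW by blast
     then show ?thesis
      by (simp only: coeff_res[OF gen \<U>'[OF VW(1)] o Int_lower1 \<sigma>VW(1) l, symmetric]
       coeff_res[OF gen \<U>'[OF VW(2)] o Int_lower2 \<sigma>VW(2) l, symmetric])
    qed
   qed
  qed
  then have "\<forall>l\<in>L. EX c. c : sect C (\<Union>\<U>) (j - d l) & (\<forall>V\<in>\<U>. res C (\<Union>\<U>) V (j - d l) c = ?k V j (\<sigma> V) l)"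
   by blast
  from bchoice[OF this] obtain c where c: "!!l. l \<in> L ==> c l : sect C (\<Union>\<U>) (j - d l)"
   "!!l V. l \<in> L ==> V \<in> \<U> ==> res C (\<Union>\<U>) V (j - d l) (c l) = ?k V j (\<sigma> V) l"
   by blast
  let ?s = "lincomb F (\<Union>\<U>) L d (?b (\<Union>\<U>)) j c"
  have s: "?s : sect F (\<Union>\<U>) j"
   using c by (intro lincomb_closed[OF V(1) g(4) bV[OF V]]) auto
  show "\<exists>s\<in>sect F (\<Union>\<U>) j. \<forall>V\<in>\<U>. res F (\<Union>\<U>) V j s = \<sigma> V"
  proof (intro bexI[of _ ?s] s ballI)
   fix W assume W: "W \<in> \<U>"
   then have W': "W <= \<Union>\<U>" by blast
   show "res F (\<Union>\<U>) W j ?s = \<sigma> W"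
   proof (rule eqI[OF \<U>'[OF W]])
    show "res F (\<Union>\<U>) W j ?s : sect F W j" using V \<U>'[OF W] W' s by (intro F.res_closed) auto
    show "\<sigma> W : sect F W j" using \<sigma> W by auto
    fix l assume l: "l \<in> L"
    have k: "?k (\<Union>\<U>) j ?s l = c l"
     by (rule coeff_lincomb[OF V(1) g(4) bV[OF V] g(2)[OF V] _ refl l]) (use c(1) in blast)
    have "?k W j (res F (\<Union>\<U>) W j ?s) l = res C (\<Union>\<U>) W (j - d l) (?k (\<Union>\<U>) j ?s l)"
     by (rule coeff_res[OF gen V \<U>'(1)[OF W] W' s l])
    also have "\<dots> = ?k W j (\<sigma> W) l" unfolding k by (rule c(2)[OF l W])
    finally show "?k W j (res F (\<Union>\<U>) W j ?s) l = ?k W j (\<sigma> W) l" .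
   qed
  qed
 qed
qed

text \<open>Local frames are indexed by an initial segment of the natural numbers, the generators of
  the jets by pairs, and the calculations with them by words; this passes between such index
  sets.\<close>

lemma freely_generates_on_reindex:
 assumes gen: "freely_generates_on X C F U L d b" and h: "bij_betw h M L"
 shows "freely_generates_on X C F U M (%m. d (h m)) (%m. b (h m))"
proof -
 note g = fg_onD[OF gen]
 have M: "finite M" "inj_on h M" "h ` M = L" using h g(4) bij_betw_finite[OF h] by (auto simp: bij_betw_def)
 have hM: "!!m. m \<in> M ==> h m \<in> L" using M by auto
 show ?thesis
  unfolding freely_generates_on_def
 proof (intro conjI ballI allI impI g(1))
  show "b (h m) \<in> sect F U (d (h m))" if "m \<in> M" for m using g(3) hM that by auto
  fix V assume "openin X V & V <= U"
  then have V: "openin X V" "V <= U" by auto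
  let ?b = "%l. res F U V (d l) (b l)"
  have bV: "\<forall>l\<in>L. ?b l : sect F V (d l)" using g V by (auto intro!: F.res_closed)
  have bM: "\<forall>m\<in>M. ?b (h m) \<in> sect F V (d (h m))" using bV hM by auto
  have lin: "lincomb F V M (%m. d (h m)) (%m. ?b (h m)) j (%m. c (h m)) = lincomb F V L d ?b j c"
   if "\<forall>l\<in>L. c l : sect C V (j - d l)" for j c
   unfolding lincomb_def M(3)[symmetric]
   by (subst finsum_reindex_rm) (use V M bV that in \<open>auto intro!: F.act_closed\<close>)
  let ?i = "the_inv_into M h"
  have i: "!!m. m \<in> M ==> ?i (h m) = m" using M by (simp add: the_inv_into_f_f)
  show "freely_generates C F V M (%m. d (h m)) (%m. ?b (h m))"
  proof (rule freely_generatesI[OF V(1) M(1) bM])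
   show "EX c. (\<forall>m\<in>M. c m : sect C V (j - d (h m))) & s = lincomb F V M (%m. d (h m)) (%m. ?b (h m)) j c"
    if s: "s : sect F V j" for j s
    using coeff_closed[OF V(1) g(4) bV g(2)[OF V] s] lincomb_coeff[OF V(1) g(4) bV g(2)[OF V] s] hM
    by (intro exI[of _ "%m. coeff C F V L d ?b j s (h m)"]) (simp add: lin)
   show "c m = \<zero>[sec C V (j - d (h m))]"
    if c: "\<forall>m\<in>M. c m : sect C V (j - d (h m))"
     "lincomb F V M (%m. d (h m)) (%m. ?b (h m)) j c = \<zero>[sec F V j]" and m: "m \<in> M" for j c m
   proof -
    let ?c = "%l. c (?i l)"
    have c': "\<forall>l\<in>L. ?c l : sect C V (j - d l)" using c(1) M(3) i by force
    have e: "lincomb F V M (%m. d (h m)) (%m. ?b (h m)) j (%m. ?c (h m)) = lincomb F V M (%m. d (h m)) (%m. ?b (h m)) j c"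
     unfolding lincomb_def
     by (rule sum_cong_rm) (use V i bV hM c in \<open>auto intro!: F.act_closed\<close>)
    have "\<zero>[sec F V j] = lincomb F V L d ?b j ?c" using lin[OF c'] c(2) e by simp
    then have "?c (h m) = coeff C F V L d ?b j \<zero>[sec F V j] (h m)"
     using coeff_lincomb[OF V(1) g(4) bV g(2)[OF V] c' _ hM[OF m]] by simp
    also have "\<dots> = \<zero>[sec C V (j - d (h m))]"
     using rl_zero[OF _ _ coeff_linear[OF V(1) g(4) bV g(2)[OF V] hM[OF m], of j]] V by simp
    finally show ?thesis using i m by simp
   qed
  qed
 qed
qed

end

text \<open>A combination of the first frame goes to the combination of the second with the same
  coefficients.\<close>

lemma frames_iso:
 assumes F: "graded_modules X C F" and G: "graded_modules X C G"
  and genF: "freely_generates_on X C F U L d b" and genG: "freely_generates_on X C G U L d b'"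
 shows "EX \<tau>. module_iso_on X C F G U \<tau>"
proof -
 interpret F: graded_modules X C F by fact
 interpret G: graded_modules X C G by fact
 note gF = F.fg_onD[OF genF] and gG = G.fg_onD[OF genG]
 let ?b = "%V l. res F U V (d l) (b l)" and ?b' = "%V l. res G U V (d l) (b' l)"
 let ?k = "%V. coeff C F V L d (?b V)" and ?k' = "%V. coeff C G V L d (?b' V)"
 let ?\<tau> = "%V j s. lincomb G V L d (?b' V) j (?k V j s)"
 have bV: "\<forall>l\<in>L. ?b V l : sect F V (d l)" if "openin X V" "V <= U" for V
  using that gF by (auto intro!: F.F.res_closed)
 have bV': "\<forall>l\<in>L. ?b' V l : sect G V (d l)" if "openin X V" "V <= U" for V
  using that gG by (auto intro!: G.F.res_closed)
 have "module_iso_on X C F G U ?\<tau>"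
  unfolding module_iso_on_def
 proof (intro allI impI)
  fix V assume "openin X V & V <= U"
  then have V: "openin X V" "V <= U" by auto
  note cF = F.coeff_closed[OF V(1) gF(4) bV[OF V] gF(2)[OF V]]
   and lF = F.lincomb_coeff[OF V(1) gF(4) bV[OF V] gF(2)[OF V]]
   and kF = F.coeff_lincomb[OF V(1) gF(4) bV[OF V] gF(2)[OF V]]
   and linF = F.coeff_linear[OF V(1) gF(4) bV[OF V] gF(2)[OF V]]
   and cG = G.coeff_closed[OF V(1) gG(4) bV'[OF V] gG(2)[OF V]]
   and lG = G.lincomb_coeff[OF V(1) gG(4) bV'[OF V] gG(2)[OF V]]
   and kG = G.coeff_lincomb[OF V(1) gG(4) bV'[OF V] gG(2)[OF V]]
   and clF = F.lincomb_closed[OF V(1) gF(4) bV[OF V]] and clG = G.lincomb_closed[OF V(1) gG(4) bV'[OF V]]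
   and cgF = F.lincomb_cong[OF V(1) gF(4) bV[OF V]] and cgG = G.lincomb_cong[OF V(1) gG(4) bV'[OF V]]
  show "(ALL j. lin (sec F V j) (sec G V j) (?\<tau> V j) & bij_betw (?\<tau> V j) (sect F V j) (sect G V j)) &
  (ALL i j. \<forall>f\<in>sect C V i. \<forall>s\<in>sect F V j. ?\<tau> V (i + j) (act F V i j f s) = act G V i j f (?\<tau> V j s)) &
  (ALL W j. openin X W & W <= V --> (\<forall>s\<in>sect F V j. ?\<tau> W j (res F V W j s) = res G V W j (?\<tau> V j s)))"
  proof (intro conjI allI ballI impI)
   fix j
   show "lin (sec F V j) (sec G V j) (?\<tau> V j)"
   proof (rule real_linearI)
    fix s r assume s: "s : sect F V j"
    show "?\<tau> V j s : sect G V j" using cF[OF s] by (intro clG) auto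
    show "?\<tau> V j (r \<odot>[sec F V j] s) = r \<odot>[sec G V j] ?\<tau> V j s"
     using cF[OF s] V
     by (subst G.lincomb_smult[OF V(1) gG(4) bV'[OF V], symmetric])
      (auto intro!: cgG simp: rl_smult[OF linF s])
    fix t assume t: "t : sect F V j"
    show "?\<tau> V j (s \<oplus>[sec F V j] t) = ?\<tau> V j s \<oplus>[sec G V j] ?\<tau> V j t"
     using cF[OF s] cF[OF t] V
     by (subst G.lincomb_add[OF V(1) gG(4) bV'[OF V], symmetric])
      (auto intro!: cgG simp: rl_add[OF linF s t])
   qed
   show "bij_betw (?\<tau> V j) (sect F V j) (sect G V j)"
   proof (rule bij_betw_byWitness[where f' = "%s. lincomb F V L d (?b V) j (?k' V j s)"])
    show "\<forall>s\<in>sect F V j. lincomb F V L d (?b V) j (?k' V j (?\<tau> V j s)) = s"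
    proof
     fix s assume s: "s : sect F V j"
     have "lincomb F V L d (?b V) j (?k' V j (?\<tau> V j s)) = lincomb F V L d (?b V) j (?k V j s)"
      using cF[OF s] by (intro cgF kG) auto
     then show "lincomb F V L d (?b V) j (?k' V j (?\<tau> V j s)) = s" using lF[OF s] by simp
    qed
    show "\<forall>s\<in>sect G V j. ?\<tau> V j (lincomb F V L d (?b V) j (?k' V j s)) = s"
    proof
     fix s assume s: "s : sect G V j"
     have "?\<tau> V j (lincomb F V L d (?b V) j (?k' V j s)) = lincomb G V L d (?b' V) j (?k' V j s)"
      using cG[OF s] by (intro cgG kF) auto
     then show "?\<tau> V j (lincomb F V L d (?b V) j (?k' V j s)) = s" using lG[OF s] by simp
    qed
   qed (use cF cG in \<open>auto intro!: clF clG\<close>)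
  next
   fix i j f s assume f: "f : sect C V i" and s: "s : sect F V j"
   show "?\<tau> V (i + j) (act F V i j f s) = act G V i j f (?\<tau> V j s)"
    using cF[OF s] f V
    by (subst G.lincomb_act[OF V(1) gG(4) bV'[OF V] f, symmetric])
     (auto intro!: cgG F.C.gmul_closed simp: F.coeff_act[OF V(1) gF(4) bV[OF V] gF(2)[OF V] f s] add_diff_eq)
  next
   fix W j s assume "openin X W & W <= V" and s: "s : sect F V j"
   then have W: "openin X W" "W <= V" and WU: "W <= U" using V by auto
   have "res G V W j (?\<tau> V j s) = lincomb G W L d (%l. res G V W (d l) (?b' V l)) j (%l. res C V W (j - d l) (?k V j s l))"
    using cF[OF s] by (intro G.lincomb_res[OF V(1) gG(4) bV'[OF V] W]) auto
   also have "\<dots> = lincomb G W L d (?b' W) j (%l. res C V W (j - d l) (?k V j s l))"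
    by (rule G.lincomb_basis_cong[OF W(1) gG(4) bV'[OF W(1) WU]])
     (use W V WU gG cF[OF s] in \<open>auto intro!: F.C.res_closed simp: G.F.res_comp[OF gG(1) V(1) W(1)]\<close>)
   also have "\<dots> = ?\<tau> W j (res F V W j s)"
    by (rule G.lincomb_cong[OF W(1) gG(4) bV'[OF W(1) WU], symmetric])
     (use W V WU gG cF[OF s] in \<open>auto intro!: F.C.res_closed simp: F.coeff_res[OF genF V W s]\<close>)
   finally show "?\<tau> W j (res F V W j s) = res G V W j (?\<tau> V j s)" ..
  qed
 qed
 then show ?thesis by (rule exI[where P = "module_iso_on X C F G U"])
qed

text \<open>Carries the standard frame to a vector bundle, and the frame of the geometrized jets to
  their sheafification.\<close>

lemma frame_transfer:
 assumes F: "graded_modules X C F" and G: "graded_modules X C G"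
  and iso: "module_iso_on X C F G U \<tau>" and gen: "freely_generates_on X C F U L d b"
 shows "freely_generates_on X C G U L d (%l. \<tau> U (d l) (b l))"
proof -
 interpret F: graded_modules X C F by fact
 interpret G: graded_modules X C G by fact
 note g = F.fg_onD[OF gen]
 note i = iso[unfolded module_iso_on_def, THEN spec, THEN mp, OF conjI]
 have lin: "lin (sec F V j) (sec G V j) (\<tau> V j)" if "openin X V" "V <= U" for V j
  using conjunct1[OF i[OF that]] by simp
 have bij: "bij_betw (\<tau> V j) (sect F V j) (sect G V j)" if "openin X V" "V <= U" for V j
  using conjunct1[OF i[OF that]] by simp
 have act: "\<tau> V (i + j) (act F V i j f s) = act G V i j f (\<tau> V j s)"
  if "openin X V" "V <= U" "f : sect C V i" "s : sect F V j" for V i j f s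
  using conjunct1[OF conjunct2[OF i[OF that(1,2)]]] that(3,4) by simp
 have rs: "\<tau> W j (res F V W j s) = res G V W j (\<tau> V j s)"
  if "openin X V" "V <= U" "openin X W" "W <= V" "s : sect F V j" for V W j s
  using conjunct2[OF conjunct2[OF i[OF that(1,2)]]] that(3-5) by simp
 show ?thesis
  unfolding freely_generates_on_def
 proof (intro conjI ballI allI impI g(1))
  show "\<tau> U (d l) (b l) \<in> sect G U (d l)" if "l \<in> L" for l
   using rl_closed[OF lin[OF g(1) subset_refl] g(3)[OF that]] .
  fix V assume "openin X V & V <= U"
  then have V: "openin X V" "V <= U" by auto
  let ?b = "%l. res F U V (d l) (b l)" and ?b' = "%l. \<tau> V (d l) (res F U V (d l) (b l))"
  have bV: "\<forall>l\<in>L. ?b l : sect F V (d l)" using g V by (auto intro!: F.F.res_closed)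
  have bV': "\<forall>l\<in>L. ?b' l : sect G V (d l)" using rl_closed[OF lin[OF V]] bV by blast
  have e: "res G U V (d l) (\<tau> U (d l) (b l)) = ?b' l" if "l \<in> L" for l
   using rs[OF g(1) subset_refl V g(3)[OF that]] by simp
  have lc: "\<tau> V j (lincomb F V L d ?b j c) = lincomb G V L d ?b' j c" if c: "\<forall>l\<in>L. c l : sect C V (j - d l)" for j c
  proof -
   have "\<tau> V j (act F V (j - d l) (d l) (c l) (?b l)) = act G V (j - d l) (d l) (c l) (?b' l)" if "l \<in> L" for l
    using act[OF V _ bspec[OF bV that], of "c l" "j - d l"] c that by simp
   then show ?thesis
    unfolding lincomb_def
    using V c bV bV' by (subst rl_finsum[OF _ _ lin[OF V] g(4)])
     (auto intro!: sum_cong_rm F.F.act_closed G.F.act_closed)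
  qed
  have "freely_generates C G V L d ?b'"
  proof (rule G.freely_generatesI[OF V(1) g(4) bV'])
   fix j s assume "s : sect G V j"
   then obtain t where t: "t : sect F V j" "s = \<tau> V j t"
    using bij_betw_imp_surj_on[OF bij[OF V, of j]] by blast
   note cF = F.coeff_closed[OF V(1) g(4) bV g(2)[OF V] t(1)] F.lincomb_coeff[OF V(1) g(4) bV g(2)[OF V] t(1)]
   show "EX c. (\<forall>l\<in>L. c l : sect C V (j - d l)) & s = lincomb G V L d ?b' j c"
    using cF t lc[of "coeff C F V L d ?b j t" j] by (intro exI[of _ "coeff C F V L d ?b j t"]) simp
  next
   fix j c l assume c: "\<forall>l\<in>L. c l : sect C V (j - d l)" and z: "lincomb G V L d ?b' j c = \<zero>[sec G V j]" and l: "l \<in> L"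
   have "\<tau> V j (lincomb F V L d ?b j c) = \<tau> V j \<zero>[sec F V j]"
    using lc[OF c] z rl_zero[OF _ _ lin[OF V]] V by simp
   then have "\<zero>[sec F V j] = lincomb F V L d ?b j c"
    using bij_betw_imp_inj_on[OF bij[OF V, of j]] F.lincomb_closed[OF V(1) g(4) bV c] V
    by (auto dest: inj_onD)
   then have "c l = coeff C F V L d ?b j \<zero>[sec F V j] l"
    using F.coeff_lincomb[OF V(1) g(4) bV g(2)[OF V] c _ l] by simp
   then show "c l = \<zero>[sec C V (j - d l)]"
    using rl_zero[OF _ _ F.coeff_linear[OF V(1) g(4) bV g(2)[OF V] l, of j]] V by simp
  qed
  then show "freely_generates C G V L d (%l. res G U V (d l) (\<tau> U (d l) (b l)))"
   by (rule G.freely_generates_cong[OF V(1) g(4) bV' e, rotated])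
 qed
qed


subsection \<open>The standard frame\<close>

lemma coord_gvs_sel [simp]:
 "v \<in> carrier (coord_gvs es j) \<longleftrightarrow> (ALL l. \<not> (l < length es & es ! l = j) --> v l = 0)"
 "u \<oplus>[coord_gvs es j] v = (%l. u l + v l)" "\<zero>[coord_gvs es j] = (%_. 0)"
 "r \<odot>[coord_gvs es j] v = (%l. r * v l)"
 by (simp_all add: coord_gvs_def)

lemma constant_presheaf: "graded_presheaf X (constant_psh (coord_gvs es))"
proof
 have "rmod (coord_gvs es j)" for j
  by (rule rmodI) (auto simp: algebra_simps)
 then show "graded_vs (sec (constant_psh (coord_gvs es)) U)" for U
  by (simp add: constant_psh_def graded_vs_def)
qed (auto simp: constant_psh_def rl_id)

definition unit_coord :: "nat => nat => real" where
 "unit_coord l = (%m. if m = l then 1 else 0)"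

text \<open>The frame consists of \<open>1 \<otimes> e\<close> for the unit vectors
  \<open>e\<close>. It spans because \<open>g \<otimes> v\<close> expands along the coordinates of
  \<open>v\<close>, and it is independent because contraction with the dual basis recovers the
  coefficients.\<close>

lemma standard_frame:
 assumes C: "graded_algebra_sheaf X C" and U: "openin X U"
 shows "EX b. freely_generates_on X C (tensor_psh C (constant_psh (coord_gvs es))) U {..<length es} ((!) es) b"
proof -
 let ?K = "constant_psh (coord_gvs es) :: ('a, nat => real) psh"
 interpret T: tensor_setting X C ?K
  using C constant_presheaf by (simp add: tensor_setting_def)
 interpret M: graded_modules X C "tensor_psh C ?K"
  using C T.tensor_module_presheaf by (simp add: graded_modules_def)
 have K: "sec ?K V = coord_gvs es" "res ?K V W j = (%v. v)" for V W j by (simp_all add: constant_psh_def)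
 have e: "unit_coord l \<in> carrier (coord_gvs es (es ! l))" if "l < length es" for l
  using that by (auto simp: unit_coord_def)
 let ?t = "%V p q g v. tens (sec C V) (coord_gvs es) p q g v"
 let ?b = "%V l. ?t V 0 (es ! l) (gunit C V) (unit_coord l)"
 have b: "?b V l : sect (tensor_psh C ?K) V (es ! l)" if "openin X V" "l < length es" for V l
  using T.tn_closed[OF that(1) T.C.gunit_closed[OF that(1)], of "unit_coord l" "es ! l" "es ! l"] e[OF that(2)]
  by (simp add: K del: coord_gvs_sel)
 have gen: "freely_generates C (tensor_psh C ?K) V {..<length es} ((!) es) (?b V)" if V: "openin X V" for V
 proof (rule M.freely_generatesI[OF V finite_lessThan])
  show bb: "\<forall>l\<in>{..<length es}. ?b V l : sect (tensor_psh C ?K) V (es ! l)" using b V by simp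
  have gmul1: "gmul C V i 0 f (gunit C V) = f" if "f : sect C V i" for f i
   using T.C.gmul_commute[OF V that T.C.gunit_closed[OF V]] T.C.gmul_gunit[OF V that] V that
   by (simp add: koszul_def)
  have actb: "act (tensor_psh C ?K) V i (es ! l) f (?b V l) = ?t V i (es ! l) f (unit_coord l)"
   if "f : sect C V i" "l < length es" for f i l
   using T.tact_linear(2)[OF V that(1) T.C.gunit_closed[OF V], of "unit_coord l" "es ! l" "es ! l"] e[OF that(2)] that gmul1
   by (simp add: K del: coord_gvs_sel tp_sel)
  fix j
  let ?X = "tensor (sec C V) (coord_gvs es) j"
  have X: "rmod ?X" using T.XX_rmod[OF V, of j] by (simp add: K)
  let ?P = "%s. EX c. (\<forall>l\<in>{..<length es}. c l : sect C V (j - es ! l)) & s = lincomb (tensor_psh C ?K) V {..<length es} ((!) es) (?b V) j c"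
  {
   fix s assume s: "s : sect (tensor_psh C ?K) V j"
   have P: "rsub {s \<in> carrier ?X. ?P s} ?X"
    unfolding rsub_iff[OF X]
   proof (intro conjI ballI allI)
    have z: "lincomb (tensor_psh C ?K) V {..<length es} ((!) es) (?b V) j (%l. \<zero>[sec C V (j - es ! l)]) = \<zero>[?X]"
     using M.lincomb_smult[OF V finite_lessThan bb, of "%l. \<zero>[sec C V (j - es ! l)]" j 0]
      M.lincomb_closed[OF V finite_lessThan bb, of "%l. \<zero>[sec C V (j - es ! l)]" j] V X
     by (simp add: K)
    show "\<zero>[?X] \<in> {s \<in> carrier ?X. ?P s}"
     using X V z by (auto intro!: exI[of _ "%l. \<zero>[sec C V (j - es ! l)]"])
    fix x r assume x: "x \<in> {s \<in> carrier ?X. ?P s}"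
    then obtain c where c: "\<forall>l\<in>{..<length es}. c l : sect C V (j - es ! l)"
     "x = lincomb (tensor_psh C ?K) V {..<length es} ((!) es) (?b V) j c" by auto
    show "r \<odot>[?X] x \<in> {s \<in> carrier ?X. ?P s}"
     using x c V X M.lincomb_smult[OF V finite_lessThan bb, of c j r]
     by (auto simp: K intro!: exI[of _ "%l. r \<odot>[sec C V (j - es ! l)] c l"])
    fix y assume y: "y \<in> {s \<in> carrier ?X. ?P s}"
    then obtain c' where c': "\<forall>l\<in>{..<length es}. c' l : sect C V (j - es ! l)"
     "y = lincomb (tensor_psh C ?K) V {..<length es} ((!) es) (?b V) j c'" by auto
    show "x \<oplus>[?X] y \<in> {s \<in> carrier ?X. ?P s}"
     using x y c c' V X M.lincomb_add[OF V finite_lessThan bb, of c j c']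
     by (auto simp: K intro!: exI[of _ "%l. c l \<oplus>[sec C V (j - es ! l)] c' l"])
   qed auto
   have "s \<in> {s \<in> carrier ?X. ?P s}"
   proof (rule tensor_induct[OF _ _ s[unfolded tp_sel K] P])
    show "rmod (sec C V j)" for j using V by simp
    show "rmod (coord_gvs es j)" for j using T.B.sec_rmod[OF V] by (simp add: K)
    fix p g v assume g: "g : sect C V p" and v: "v \<in> carrier (coord_gvs es (j - p))"
    \<comment> \<open>Only unit vectors of the degree of \<open>v\<close> occur in \<open>v\<close>;
      at the others the degree of \<open>g\<close> would not fit.\<close>
    let ?c = "%l. if es ! l = j - p then v l \<odot>[sec C V p] g else \<zero>[sec C V (j - es ! l)]"
    have c: "\<forall>l\<in>{..<length es}. ?c l : sect C V (j - es ! l)" using g V by auto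
    let ?L = "{l. l < length es & es ! l = j - p}"
    have uL: "!!l. l \<in> ?L ==> unit_coord l \<in> carrier (coord_gvs es (j - p))" using e by auto
    have lr: "lin (coord_gvs es (j - p)) ?X (?t V p (j - p) g)"
     using T.tn_right[OF V g, of j "j - p"] by (simp add: K)
    have ll: "lin (sec C V p) ?X (%g. ?t V p (j - p) g u)" if "u \<in> carrier (coord_gvs es (j - p))" for u
     using T.tn_left[OF V, of u "j - p" j p] that by (simp add: K)
    have KM: "rmod (coord_gvs es (j - p))" using T.B.sec_rmod[OF V, of "j - p"] by (simp add: K)
    have vs: "v = finsum (coord_gvs es (j - p)) (%l. v l \<odot>[coord_gvs es (j - p)] unit_coord l) ?L"
    proof -
     have "finsum (coord_gvs es (j - p)) (%l. v l \<odot>[coord_gvs es (j - p)] unit_coord l) S = (%m. if m \<in> S then v m else 0)"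
      if "finite S" "S <= ?L" for S
      using that
     proof (induction S)
      case (insert l S)
      then show ?case
       by (subst finsum_insert_rm[OF KM]) (use insert uL in \<open>auto simp: unit_coord_def fun_eq_iff\<close>)
     qed (use KM in simp)
     from this[of ?L] show ?thesis using v by auto
    qed
    have "?t V p (j - p) g v = ?t V p (j - p) g (finsum (coord_gvs es (j - p)) (%l. v l \<odot>[coord_gvs es (j - p)] unit_coord l) ?L)"
     using vs by (rule arg_cong)
    also have "\<dots> = finsum ?X (%l. ?t V p (j - p) g (v l \<odot>[coord_gvs es (j - p)] unit_coord l)) ?L"
     using uL by (intro rl_finsum[OF KM X lr]) (auto simp del: coord_gvs_sel intro!: rm_smult_closed[OF KM])
    also have "\<dots> = finsum ?X (%l. v l \<odot>[?X] ?t V p (j - p) g (unit_coord l)) ?L"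
     by (rule sum_cong_rm[OF X refl])
      (use uL in \<open>auto simp: rl_smult[OF lr] simp del: coord_gvs_sel intro!: rm_smult_closed[OF X] rl_closed[OF lr]\<close>)
    also have "\<dots> = finsum ?X (%l. act (tensor_psh C ?K) V (j - es ! l) (es ! l) (?c l) (?b V l)) ?L"
    proof (rule sum_cong_rm[OF X refl])
     show "v l \<odot>[?X] ?t V p (j - p) g (unit_coord l) = act (tensor_psh C ?K) V (j - es ! l) (es ! l) (?c l) (?b V l)" if "l \<in> ?L" for l
     proof -
      have "act (tensor_psh C ?K) V p (es ! l) (v l \<odot>[sec C V p] g) (?b V l) = ?t V p (es ! l) (v l \<odot>[sec C V p] g) (unit_coord l)"
       using that g V by (intro actb) auto
      also have "\<dots> = v l \<odot>[?X] ?t V p (j - p) g (unit_coord l)"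
       using that rl_smult[OF ll[OF uL[OF that]] g] by simp
      finally show ?thesis using that by simp
     qed
     show "(%l. act (tensor_psh C ?K) V (j - es ! l) (es ! l) (?c l) (?b V l)) \<in> ?L \<rightarrow> carrier ?X"
      using M.lincomb_terms[OF V finite_lessThan bb c] by (auto simp: K simp del: tp_sel(3))
    qed
    also have "\<dots> = finsum ?X (%l. act (tensor_psh C ?K) V (j - es ! l) (es ! l) (?c l) (?b V l)) {..<length es}"
    proof (rule finsum_mono_rm[OF X, symmetric])
     show "(%l. act (tensor_psh C ?K) V (j - es ! l) (es ! l) (?c l) (?b V l)) \<in> ?L \<rightarrow> carrier ?X"
      using M.lincomb_terms[OF V finite_lessThan bb c] by (auto simp: K simp del: tp_sel(3))
     fix l assume "l \<in> {..<length es} - ?L"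
     then have l: "l < length es" "es ! l ~= j - p" by auto
     show "act (tensor_psh C ?K) V (j - es ! l) (es ! l) (?c l) (?b V l) = \<zero>[?X]"
      using l rl_zero[OF _ _ M.F.act_linear_left[OF V b[OF V l(1)], of "j - es ! l"]] V X by (simp add: K del: tp_sel(3))
    qed auto
    finally have "?t V p (j - p) g v = lincomb (tensor_psh C ?K) V {..<length es} ((!) es) (?b V) j ?c"
     by (simp add: lincomb_def K del: tp_sel(3))
    moreover have "?t V p (j - p) g v \<in> carrier ?X" using rl_closed[OF lr v] .
    ultimately show "?t V p (j - p) g v \<in> {s \<in> carrier ?X. ?P s}" using c by (intro CollectI conjI exI[of _ ?c])
   qed
   then show "?P s" by blast
  }
  fix c l
  assume c: "\<forall>l\<in>{..<length es}. c l : sect C V (j - es ! l)"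
   and z: "lincomb (tensor_psh C ?K) V {..<length es} ((!) es) (?b V) j c = \<zero>[sec (tensor_psh C ?K) V j]" and l: "l \<in> {..<length es}"
  let ?N = "sec C V (j - es ! l)"
  have N: "rmod ?N" using V by simp
  \<comment> \<open>Contraction with the \<open>l\<close>-th dual basis vector. For other
    \<open>p\<close> the coordinate \<open>v l\<close> is zero anyway; the case distinction keeps
    the value in degree \<open>j - es ! l\<close>.\<close>
  define h where "h = (%(p, g, v). if p = j - es ! l then v l \<odot>[?N] g else \<zero>[?N])"
  have hl: "lin (sec C V p) ?N (%a. h (p, a, v))" for p v
   by (cases "p = j - es ! l") (simp_all add: h_def rl_fun_smult[OF N rl_id] rl_const_zero[OF N])
  have hr: "lin (sec ?K V (j - p)) ?N (%v. h (p, a, v))" if "a : sect C V p" for p a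
   unfolding h_def K using N that by (intro real_linearI) (auto simp: rm_smult_l)
  note lft = T.lift_linear[OF V N hl hr] T.lift_tens[OF V N hl hr]
  have "tensor_lift ?N h (lincomb (tensor_psh C ?K) V {..<length es} ((!) es) (?b V) j c)
   = finsum ?N (%m. tensor_lift ?N h (act (tensor_psh C ?K) V (j - es ! m) (es ! m) (c m) (?b V m))) {..<length es}"
   unfolding lincomb_def
   by (rule rl_finsum[OF _ N]) (use V X lft(1) M.lincomb_terms[OF V finite_lessThan bb c] in \<open>auto simp: K simp del: tp_sel(3)\<close>)
  also have "\<dots> = finsum ?N (%m. if m = l then c l else \<zero>[?N]) {..<length es}"
  proof (rule sum_cong_rm[OF N refl])
   fix m assume m: "m \<in> {..<length es}"
   have "tensor_lift ?N h (act (tensor_psh C ?K) V (j - es ! m) (es ! m) (c m) (?b V m)) = h (j - es ! m, c m, unit_coord m)"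
    using lft(2)[of "c m" "j - es ! m" "unit_coord m" "es ! m"] e[of m] c m actb[of "c m" "j - es ! m" m] by (simp add: K del: coord_gvs_sel tp_sel)
   also have "\<dots> = (if m = l then c l else \<zero>[?N])" using bspec[OF c l] bspec[OF c m] N by (auto simp: h_def unit_coord_def)
   finally show "tensor_lift ?N h (act (tensor_psh C ?K) V (j - es ! m) (es ! m) (c m) (?b V m)) = (if m = l then c l else \<zero>[?N])" .
  qed (use c l N in auto)
  also have "\<dots> = c l" using finsum_single_rm[OF N, of "{..<length es}" l "%m. if m = l then c l else \<zero>[?N]"] c l N by simp
  finally show "c l = \<zero>[?N]" using z rl_zero[OF _ N lft(1)] X V by (simp add: K)
 qed
 have "freely_generates_on X C (tensor_psh C ?K) U {..<length es} ((!) es) (?b U)"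
  unfolding freely_generates_on_def
 proof (intro conjI ballI allI impI U)
  show "?b U l : sect (tensor_psh C ?K) U (es ! l)" if "l \<in> {..<length es}" for l using b U that by simp
  fix V assume V: "openin X V & V <= U"
  have rb: "res (tensor_psh C ?K) U V (es ! l) (?b U l) = ?b V l" if "l \<in> {..<length es}" for l
   using T.tres_linear(2)[OF U, of V "gunit C U" 0 "unit_coord l" "es ! l" "es ! l"] V T.C.gunit_closed[OF U] e that
    T.C.res_gunit[OF U] by (simp add: K del: coord_gvs_sel tp_sel)
  have bV: "\<forall>l\<in>{..<length es}. ?b V l : sect (tensor_psh C ?K) V (es ! l)" using b V by simp
  show "freely_generates C (tensor_psh C ?K) V {..<length es} ((!) es) (%l. res (tensor_psh C ?K) U V (es ! l) (?b U l))"
   by (rule M.freely_generates_cong[OF _ _ bV rb gen]) (use V in auto)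
 qed
 then show ?thesis by blast
qed


section \<open>Sheafification\<close>

context graded_modules
begin

section \<open>Germs and the operations on them\<close>

lemma germ_mono:
 assumes V: "openin X V" "x \<in> V" "s : sect F V j" and W: "openin X W" "x \<in> W" "t : sect F W j"
  and N: "openin X N" "x \<in> N" "N <= V Int W" "res F V N j s = res F W N j t"
 shows "germ X F j x V s <= germ X F j x W t"
proof
 fix p assume "p \<in> germ X F j x V s"
 then obtain Z u M where p: "p = (Z, u)" and Z: "openin X Z" "x \<in> Z" "u : sect F Z j"
  and M: "openin X M" "x \<in> M" "M <= V Int Z" "res F V M j s = res F Z M j u"
  unfolding germ_def by blast
 have o: "openin X (N Int M)" using N M by auto
 have "res F W (N Int M) j t = res F N (N Int M) j (res F W N j t)"
  using F.res_comp[OF W(1) N(1) o _ _ W(3)] N by simp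
 also have "\<dots> = res F V (N Int M) j s"
  using F.res_comp[OF V(1) N(1) o _ _ V(3)] N by simp
 also have "\<dots> = res F M (N Int M) j (res F V M j s)"
  using F.res_comp[OF V(1) M(1) o _ _ V(3)] M by simp
 also have "\<dots> = res F Z (N Int M) j u"
  using F.res_comp[OF Z(1) M(1) o _ _ Z(3)] M by simp
 finally have "res F W (N Int M) j t = res F Z (N Int M) j u" .
 then show "p \<in> germ X F j x W t"
  unfolding germ_def p using Z o N M by blast
qed

lemma germ_eq_iff:
 assumes V: "openin X V" "x \<in> V" "s : sect F V j" and W: "openin X W" "x \<in> W" "t : sect F W j"
 shows "germ X F j x V s = germ X F j x W t \<longleftrightarrow>
  (EX N. openin X N & x \<in> N & N <= V Int W & res F V N j s = res F W N j t)"
proof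
 assume "germ X F j x V s = germ X F j x W t"
 moreover have "(W, t) \<in> germ X F j x W t" unfolding germ_def using W by blast
 ultimately have "(W, t) \<in> germ X F j x V s" by simp
 then show "EX N. openin X N & x \<in> N & N <= V Int W & res F V N j s = res F W N j t"
  unfolding germ_def by blast
next
 assume "EX N. openin X N & x \<in> N & N <= V Int W & res F V N j s = res F W N j t"
 then obtain N where N: "openin X N" "x \<in> N" "N <= V Int W" "res F V N j s = res F W N j t" by blast
 show "germ X F j x V s = germ X F j x W t"
  using germ_mono[OF V W N] germ_mono[OF W V N(1,2) _ N(4)[symmetric]] N(3) by blast
qed

lemma germ_res:
 assumes V: "openin X V" "s : sect F V j" and N: "openin X N" "x \<in> N" "N <= V"
 shows "germ X F j x N (res F V N j s) = germ X F j x V s"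
proof -
 have x: "x \<in> V" using N by blast
 have "res F N N j (res F V N j s) = res F V N j s"
  by (rule F.res_id[OF N(1) F.res_closed[OF V(1) N(1,3) V(2)]])
 then show ?thesis
  unfolding germ_eq_iff[OF N(1,2) F.res_closed[OF V(1) N(1,3) V(2)] V(1) x V(2)]
  using N by blast
qed

lemma germ_eqE:
 assumes "germ X F j x V s = germ X F j x W t"
  "openin X V" "x \<in> V" "s : sect F V j" "openin X W" "x \<in> W" "t : sect F W j"
 obtains N where "openin X N" "x \<in> N" "N <= V" "N <= W" "res F V N j s = res F W N j t"
 using assms germ_eq_iff[OF assms(2-7)] by blast

lemma res_eq_smaller:
 assumes V: "openin X V" "s : sect F V j" and W: "openin X W" "t : sect F W j"
  and N: "openin X N" "N <= V" "N <= W" "res F V N j s = res F W N j t" and M: "openin X M" "M <= N"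
 shows "res F V M j s = res F W M j t"
 using F.res_comp[OF V(1) N(1) M(1,2) N(2) V(2)] F.res_comp[OF W(1) N(1) M(1,2) N(3) W(2)] N(4) by simp

text \<open>Two pairs of representatives agree on a common smaller neighbourhood, so their sums have
  the same germ and the \<open>THE\<close> in \<open>germ_add\<close> is legitimate. Scaling and the
  action are treated alike.\<close>

lemma germ_add_eq:
 assumes V: "openin X V" "x \<in> V" and s: "s : sect F V j" and t: "t : sect F V j"
 shows "germ_add X F j x (germ X F j x V s) (germ X F j x V t) = germ X F j x V (s \<oplus>[sec F V j] t)"
 unfolding germ_add_def
proof (rule the_equality)
 show "EX V' s' t'. openin X V' & x \<in> V' & s' \<in> sect F V' j & t' \<in> sect F V' j &
  germ X F j x V s = germ X F j x V' s' & germ X F j x V t = germ X F j x V' t' &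
  germ X F j x V (s \<oplus>[sec F V j] t) = germ X F j x V' (s' \<oplus>[sec F V' j] t')"
  using V s t by blast
 fix \<gamma> assume "EX V' s' t'. openin X V' & x \<in> V' & s' \<in> sect F V' j & t' \<in> sect F V' j &
  germ X F j x V s = germ X F j x V' s' & germ X F j x V t = germ X F j x V' t' &
  \<gamma> = germ X F j x V' (s' \<oplus>[sec F V' j] t')"
 then obtain V' s' t' where V': "openin X V'" "x \<in> V'" and s': "s' \<in> sect F V' j" and t': "t' \<in> sect F V' j"
  and e: "germ X F j x V s = germ X F j x V' s'" "germ X F j x V t = germ X F j x V' t'"
  and \<gamma>: "\<gamma> = germ X F j x V' (s' \<oplus>[sec F V' j] t')" by blast
 obtain N where N: "openin X N" "x \<in> N" "N <= V" "N <= V'" "res F V N j s = res F V' N j s'"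
  by (rule germ_eqE[OF e(1) V s V' s'])
 obtain M where M: "openin X M" "x \<in> M" "M <= V" "M <= V'" "res F V M j t = res F V' M j t'"
  by (rule germ_eqE[OF e(2) V t V' t'])
 let ?O = "N Int M"
 have O: "openin X ?O" "x \<in> ?O" "?O <= V" "?O <= V'" using N M by auto
 have "res F V ?O j (s \<oplus>[sec F V j] t) = res F V' ?O j (s' \<oplus>[sec F V' j] t')"
  unfolding rl_add[OF F.res_linear[OF V(1) O(1,3)] s t] rl_add[OF F.res_linear[OF V'(1) O(1,4)] s' t']
   res_eq_smaller[OF V(1) s V'(1) s' N(1,3,4,5) O(1) Int_lower1] res_eq_smaller[OF V(1) t V'(1) t' M(1,3,4,5) O(1) Int_lower2] ..
 then show "\<gamma> = germ X F j x V (s \<oplus>[sec F V j] t)"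
  unfolding \<gamma> germ_eq_iff[OF V' rm_add_closed[OF F.sec_rmod[OF V'(1)] s' t'] V rm_add_closed[OF F.sec_rmod[OF V(1)] s t]]
  using O by (intro exI[of _ ?O]) simp
qed

lemma germ_scale_eq:
 assumes V: "openin X V" "x \<in> V" and s: "s : sect F V j"
 shows "germ_scale X F j x r (germ X F j x V s) = germ X F j x V (r \<odot>[sec F V j] s)"
 unfolding germ_scale_def
proof (rule the_equality)
 show "EX V' s'. openin X V' & x \<in> V' & s' \<in> sect F V' j & germ X F j x V s = germ X F j x V' s' &
  germ X F j x V (r \<odot>[sec F V j] s) = germ X F j x V' (r \<odot>[sec F V' j] s')"
  using V s by blast
 fix \<gamma> assume "EX V' s'. openin X V' & x \<in> V' & s' \<in> sect F V' j & germ X F j x V s = germ X F j x V' s' &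
  \<gamma> = germ X F j x V' (r \<odot>[sec F V' j] s')"
 then obtain V' s' where V': "openin X V'" "x \<in> V'" and s': "s' \<in> sect F V' j"
  and e: "germ X F j x V s = germ X F j x V' s'"
  and \<gamma>: "\<gamma> = germ X F j x V' (r \<odot>[sec F V' j] s')" by blast
 obtain N where N: "openin X N" "x \<in> N" "N <= V" "N <= V'" "res F V N j s = res F V' N j s'"
  by (rule germ_eqE[OF e V s V' s'])
 have "res F V N j (r \<odot>[sec F V j] s) = res F V' N j (r \<odot>[sec F V' j] s')"
  unfolding rl_smult[OF F.res_linear[OF V(1) N(1,3)] s] rl_smult[OF F.res_linear[OF V'(1) N(1,4)] s'] N(5) ..
 then show "\<gamma> = germ X F j x V (r \<odot>[sec F V j] s)"
  unfolding \<gamma> germ_eq_iff[OF V' rm_smult_closed[OF F.sec_rmod[OF V'(1)] s'] V rm_smult_closed[OF F.sec_rmod[OF V(1)] s]]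
  using N by (intro exI[of _ N]) simp
qed

lemma germ_act_eq:
 assumes U: "openin X U" and f: "f : sect C U i" and V: "openin X V" "x \<in> V" "V <= U" and s: "s : sect F V j"
 shows "germ_act X C F i j x U f (germ X F j x V s) = germ X F (i + j) x V (act F V i j (res C U V i f) s)"
 unfolding germ_act_def
proof (rule the_equality)
 show "EX V' s'. openin X V' & x \<in> V' & V' <= U & s' \<in> sect F V' j & germ X F j x V s = germ X F j x V' s' &
  germ X F (i + j) x V (act F V i j (res C U V i f) s) = germ X F (i + j) x V' (act F V' i j (res C U V' i f) s')"
  using V s by blast
 fix \<gamma> assume "EX V' s'. openin X V' & x \<in> V' & V' <= U & s' \<in> sect F V' j & germ X F j x V s = germ X F j x V' s' &
  \<gamma> = germ X F (i + j) x V' (act F V' i j (res C U V' i f) s')"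
 then obtain V' s' where V': "openin X V'" "x \<in> V'" "V' <= U" and s': "s' \<in> sect F V' j"
  and e: "germ X F j x V s = germ X F j x V' s'"
  and \<gamma>: "\<gamma> = germ X F (i + j) x V' (act F V' i j (res C U V' i f) s')" by blast
 obtain N where N: "openin X N" "x \<in> N" "N <= V" "N <= V'" "res F V N j s = res F V' N j s'"
  by (rule germ_eqE[OF e V(1,2) s V'(1,2) s'])
 note fV = C.res_closed[OF U V(1,3) f] and fV' = C.res_closed[OF U V'(1,3) f]
 have "res F V N (i + j) (act F V i j (res C U V i f) s) = res F V' N (i + j) (act F V' i j (res C U V' i f) s')"
  unfolding F.res_act[OF V(1) N(1,3) fV s] F.res_act[OF V'(1) N(1,4) fV' s'] N(5)
   C.res_comp[OF U V(1) N(1,3) V(3) f] C.res_comp[OF U V'(1) N(1,4) V'(3) f] ..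
 then show "\<gamma> = germ X F (i + j) x V (act F V i j (res C U V i f) s)"
  unfolding \<gamma> germ_eq_iff[OF V'(1,2) F.act_closed[OF V'(1) fV' s' refl] V(1,2) F.act_closed[OF V(1) fV s refl]]
  using N by (intro exI[of _ N]) simp
qed

abbreviation "Sh == sheafification X C F"

section \<open>The sheafification computed through local representatives\<close>

lemma sh_simps:
 "sec Sh U j = \<lparr>carrier = {\<sigma> \<in> extensional U. \<forall>x\<in>U. EX V s. openin X V & x \<in> V & V <= U &
     s : sect F V j & (\<forall>y\<in>V. \<sigma> y = germ X F j y V s)},
    mult = undefined, one = undefined,
    zero = (\<lambda>x\<in>U. germ X F j x U \<zero>[sec F U j]),
    add = (%\<sigma> \<tau>. \<lambda>x\<in>U. germ_add X F j x (\<sigma> x) (\<tau> x)),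
    smult = (%r \<sigma>. \<lambda>x\<in>U. germ_scale X F j x r (\<sigma> x))\<rparr>"
 "res Sh U V j \<sigma> = restrict \<sigma> V"
 "act Sh U i j f \<sigma> = (\<lambda>x\<in>U. germ_act X C F i j x U f (\<sigma> x))"
 by (simp_all add: sheafification_def)

lemma sh_zero: "\<zero>[sec Sh U j] = (\<lambda>x\<in>U. germ X F j x U \<zero>[sec F U j])"
 and sh_add: "\<sigma> \<oplus>[sec Sh U j] \<tau> = (\<lambda>x\<in>U. germ_add X F j x (\<sigma> x) (\<tau> x))"
 and sh_smult: "r \<odot>[sec Sh U j] \<sigma> = (\<lambda>x\<in>U. germ_scale X F j x r (\<sigma> x))"
 by (simp_all add: sh_simps)

text \<open>No ambient open set occurs, so the same \<open>s\<close> also represents the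
  restrictions of the family to sets that contain \<open>V\<close>. The algebraic laws reduce to
  those of \<open>F\<close> over \<open>V\<close>.\<close>

definition rep :: "int => 'm set => 'a => ('m => ('m set \<times> 'a) set) => bool" where
 "rep j V s \<sigma> \<longleftrightarrow> openin X V & s : sect F V j & (\<forall>y\<in>V. \<sigma> y = germ X F j y V s)"

lemma rep_res: "rep j V s \<sigma> ==> openin X W ==> W <= V ==> rep j W (res F V W j s) \<sigma>"
 unfolding rep_def by (auto simp: germ_res F.res_closed)

lemma repD: "rep j V s \<sigma> ==> openin X V" "rep j V s \<sigma> ==> s : sect F V j"
 "rep j V s \<sigma> ==> y \<in> V ==> \<sigma> y = germ X F j y V s"
 by (auto simp: rep_def)

lemma sh_mem: "\<sigma> \<in> sect Sh U j \<longleftrightarrow> \<sigma> \<in> extensional U & (\<forall>x\<in>U. EX V s. x \<in> V & V <= U & rep j V s \<sigma>)"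
proof -
 have "(openin X V & x \<in> V & V <= U & s : sect F V j & (\<forall>y\<in>V. \<sigma> y = germ X F j y V s)) \<longleftrightarrow>
  (x \<in> V & V <= U & rep j V s \<sigma>)" for x V s by (auto simp: rep_def)
 moreover have "sect Sh U j = {\<sigma> \<in> extensional U. \<forall>x\<in>U. EX V s. openin X V & x \<in> V & V <= U &
     s : sect F V j & (\<forall>y\<in>V. \<sigma> y = germ X F j y V s)}"
  unfolding sh_simps by simp
 ultimately show ?thesis by (simp only: mem_Collect_eq)
qed

lemma sh_local:
 assumes "\<sigma> \<in> sect Sh U j" "x \<in> U"
 obtains V s where "x \<in> V" "V <= U" "rep j V s \<sigma>"
 using assms unfolding sh_mem by blast

lemma sh_local2:
 assumes "\<sigma> \<in> sect Sh U j" "\<tau> \<in> sect Sh U i" "x \<in> U"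
 obtains V s t where "x \<in> V" "V <= U" "rep j V s \<sigma>" "rep i V t \<tau>"
proof -
 obtain V s where V: "x \<in> V" "V <= U" "rep j V s \<sigma>" by (rule sh_local[OF assms(1,3)])
 obtain W t where W: "x \<in> W" "W <= U" "rep i W t \<tau>" by (rule sh_local[OF assms(2,3)])
 have o: "openin X (V Int W)" using V W by (auto simp: rep_def)
 show ?thesis
  by (rule that[of "V Int W"]) (use V W o in \<open>auto intro: rep_res\<close>)
qed

lemma sh_local3:
 assumes "\<sigma> \<in> sect Sh U j" "\<tau> \<in> sect Sh U j" "\<rho> \<in> sect Sh U j" "x \<in> U"
 obtains V s t r where "x \<in> V" "V <= U" "rep j V s \<sigma>" "rep j V t \<tau>" "rep j V r \<rho>"
proof -
 obtain V s t where V: "x \<in> V" "V <= U" "rep j V s \<sigma>" "rep j V t \<tau>" by (rule sh_local2[OF assms(1,2,4)])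
 obtain W r where W: "x \<in> W" "W <= U" "rep j W r \<rho>" by (rule sh_local[OF assms(3,4)])
 have o: "openin X (V Int W)" using V W by (auto simp: rep_def)
 show ?thesis
  by (rule that[of "V Int W"]) (use V W o in \<open>auto intro: rep_res\<close>)
qed

lemma rep_add: "V <= U ==> rep j V s \<sigma> ==> rep j V t \<tau> ==> rep j V (s \<oplus>[sec F V j] t) (\<sigma> \<oplus>[sec Sh U j] \<tau>)"
 unfolding rep_def sh_add by (auto simp: germ_add_eq subset_iff)

lemma rep_smult: "V <= U ==> rep j V s \<sigma> ==> rep j V (r \<odot>[sec F V j] s) (r \<odot>[sec Sh U j] \<sigma>)"
 unfolding rep_def sh_smult by (auto simp: germ_scale_eq subset_iff)

lemma rep_zero: "openin X U ==> openin X V ==> V <= U ==> rep j V \<zero>[sec F V j] \<zero>[sec Sh U j]"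
 unfolding rep_def
proof (intro conjI ballI)
 fix y assume U: "openin X U" and V: "openin X V" "V <= U" and y: "y \<in> V"
 have "\<zero>[sec Sh U j] y = germ X F j y U \<zero>[sec F U j]" using V(2) y by (auto simp: sh_zero)
 also have "\<dots> = germ X F j y V \<zero>[sec F V j]"
  using germ_res[OF U rm_zero_closed[OF F.sec_rmod[OF U]] V(1) y V(2), of j, symmetric]
  unfolding rl_zero[OF F.sec_rmod[OF U] F.sec_rmod[OF V(1)] F.res_linear[OF U V]] .
 finally show "\<zero>[sec Sh U j] y = germ X F j y V \<zero>[sec F V j]" .
qed auto

lemma rep_act: "openin X U ==> f : sect C U i ==> V <= U ==> rep j V s \<sigma> ==>
 rep (i + j) V (act F V i j (res C U V i f) s) (act Sh U i j f \<sigma>)"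
 unfolding rep_def sh_simps(3) by (auto simp: germ_act_eq F.act_closed C.res_closed subset_iff)

lemma rep_restrict: "W <= V ==> rep j W s (restrict \<sigma> V) \<longleftrightarrow> rep j W s \<sigma>"
 unfolding rep_def by (auto simp: subset_iff)

lemma rep_eq: "rep j V s \<sigma> ==> rep j V s \<tau> ==> x \<in> V ==> \<sigma> x = \<tau> x"
 by (simp add: rep_def)

lemma sh_ext: "\<sigma> \<oplus>[sec Sh U j] \<tau> \<in> extensional U" "r \<odot>[sec Sh U j] \<sigma> \<in> extensional U"
 "\<zero>[sec Sh U j] \<in> extensional U" "act Sh U i j f \<sigma> \<in> extensional U" "restrict \<sigma> U \<in> extensional U"
 "\<sigma> \<in> sect Sh U j ==> \<sigma> \<in> extensional U"
 by (auto simp: sh_add sh_smult sh_zero sh_simps(3) sh_mem)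

lemma sh_add_closed: "\<sigma> \<in> sect Sh U j ==> \<tau> \<in> sect Sh U j ==> \<sigma> \<oplus>[sec Sh U j] \<tau> \<in> sect Sh U j"
proof -
 assume m: "\<sigma> \<in> sect Sh U j" "\<tau> \<in> sect Sh U j"
 have "EX V s. x \<in> V & V <= U & rep j V s (\<sigma> \<oplus>[sec Sh U j] \<tau>)" if x: "x \<in> U" for x
 proof -
  obtain V s t where V: "x \<in> V" "V <= U" "rep j V s \<sigma>" "rep j V t \<tau>" by (rule sh_local2[OF m x])
  show ?thesis using V(1,2) rep_add[OF V(2-4)] by blast
 qed
 then show ?thesis unfolding sh_mem using sh_ext(1) by blast
qed

lemma sh_smult_closed: "\<sigma> \<in> sect Sh U j ==> r \<odot>[sec Sh U j] \<sigma> \<in> sect Sh U j"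
proof -
 assume m: "\<sigma> \<in> sect Sh U j"
 have "EX V s. x \<in> V & V <= U & rep j V s (r \<odot>[sec Sh U j] \<sigma>)" if x: "x \<in> U" for x
 proof -
  obtain V s where V: "x \<in> V" "V <= U" "rep j V s \<sigma>" by (rule sh_local[OF m x])
  show ?thesis using V(1,2) rep_smult[OF V(2,3)] by blast
 qed
 then show ?thesis unfolding sh_mem using sh_ext(2) by blast
qed

lemma sh_zero_closed: "openin X U ==> \<zero>[sec Sh U j] \<in> sect Sh U j"
 unfolding sh_mem using sh_ext(3) rep_zero[OF _ _ subset_refl] by blast

lemma sh_act_closed: "openin X U ==> f : sect C U i ==> \<sigma> \<in> sect Sh U j ==> act Sh U i j f \<sigma> \<in> sect Sh U (i + j)"
proof -
 assume U: "openin X U" and f: "f : sect C U i" and m: "\<sigma> \<in> sect Sh U j"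
 have "EX V s. x \<in> V & V <= U & rep (i + j) V s (act Sh U i j f \<sigma>)" if x: "x \<in> U" for x
 proof -
  obtain V s where V: "x \<in> V" "V <= U" "rep j V s \<sigma>" by (rule sh_local[OF m x])
  show ?thesis using V(1,2) rep_act[OF U f V(2,3)] by blast
 qed
 then show ?thesis unfolding sh_mem using sh_ext(4) by blast
qed

lemma sh_res_closed:
 assumes "\<sigma> \<in> sect Sh U j" "openin X V" "V <= U"
 shows "restrict \<sigma> V : sect Sh V j"
 unfolding sh_mem
proof (intro conjI ballI)
 fix x assume x: "x \<in> V"
 then have "x \<in> U" using assms(3) by blast
 then obtain W s where W: "x \<in> W" "W <= U" "rep j W s \<sigma>" by (rule sh_local[OF assms(1)])
 have o: "openin X (V Int W)" using assms(2) W by (auto simp: rep_def)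
 have "rep j (V Int W) (res F W (V Int W) j s) (restrict \<sigma> V)"
  using rep_res[OF W(3) o] by (simp add: rep_restrict)
 then show "EX W s. x \<in> W & W <= V & rep j W s (restrict \<sigma> V)" using x W(1) by blast
qed simp

text \<open>Equality of germs is pointwise, so common representatives on a cover suffice. The
  section \<open>\<sigma>\<close> only supplies the cover, which is why its degree \<open>i\<close>
  is unrelated to \<open>j\<close>.\<close>

lemma sh_eqI:
 assumes m: "\<sigma> \<in> sect Sh U i" and e: "\<rho> \<in> extensional U" "\<tau> \<in> extensional U"
  and "!!V s. V <= U ==> rep i V s \<sigma> ==> EX t. rep j V t \<rho> & rep j V t \<tau>"
 shows "\<rho> = \<tau>"
proof (rule extensionalityI[OF e])
 fix x assume x: "x \<in> U"
 obtain V s where V: "x \<in> V" "V <= U" "rep i V s \<sigma>" by (rule sh_local[OF m x])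
 obtain t where t: "rep j V t \<rho>" "rep j V t \<tau>" using assms(4)[OF V(2,3)] by blast
 show "\<rho> x = \<tau> x" by (rule rep_eq[OF t V(1)])
qed

lemma sh_rmod:
 assumes U: "openin X U"
 shows "rmod (sec Sh U j)"
proof (rule rmodI)
 note clo = sh_add_closed sh_smult_closed sh_zero_closed[OF U] sh_ext
 show "\<sigma> \<oplus>[sec Sh U j] \<tau> \<in> sect Sh U j" if "\<sigma> \<in> sect Sh U j" "\<tau> \<in> sect Sh U j" for \<sigma> \<tau>
  by (rule sh_add_closed[OF that])
 show "\<zero>[sec Sh U j] \<in> sect Sh U j" by (rule sh_zero_closed[OF U])
 show "r \<odot>[sec Sh U j] \<sigma> \<in> sect Sh U j" if "\<sigma> \<in> sect Sh U j" for r \<sigma>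
  by (rule sh_smult_closed[OF that])
 show "\<sigma> \<oplus>[sec Sh U j] \<tau> \<oplus>[sec Sh U j] \<rho> = \<sigma> \<oplus>[sec Sh U j] (\<tau> \<oplus>[sec Sh U j] \<rho>)"
  if m: "\<sigma> \<in> sect Sh U j" "\<tau> \<in> sect Sh U j" "\<rho> \<in> sect Sh U j" for \<sigma> \<tau> \<rho>
 proof (rule extensionalityI[OF sh_ext(1) sh_ext(1)])
  fix x assume x: "x \<in> U"
  obtain V s t r where V: "x \<in> V" "V <= U" "rep j V s \<sigma>" "rep j V t \<tau>" "rep j V r \<rho>" by (rule sh_local3[OF m x])
  show "(\<sigma> \<oplus>[sec Sh U j] \<tau> \<oplus>[sec Sh U j] \<rho>) x = (\<sigma> \<oplus>[sec Sh U j] (\<tau> \<oplus>[sec Sh U j] \<rho>)) x"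
   by (rule rep_eq[OF _ rep_add[OF V(2,3) rep_add[OF V(2,4,5)]] V(1)],
     subst rm_assoc[OF F.sec_rmod[OF repD(1)[OF V(3)]] V(3-5)[THEN repD(2)], symmetric],
     rule rep_add[OF V(2) rep_add[OF V(2-4)] V(5)])
 qed
 show "\<sigma> \<oplus>[sec Sh U j] \<tau> = \<tau> \<oplus>[sec Sh U j] \<sigma>"
  if m: "\<sigma> \<in> sect Sh U j" "\<tau> \<in> sect Sh U j" for \<sigma> \<tau>
 proof (rule extensionalityI[OF sh_ext(1) sh_ext(1)])
  fix x assume x: "x \<in> U"
  obtain V s t where V: "x \<in> V" "V <= U" "rep j V s \<sigma>" "rep j V t \<tau>" by (rule sh_local2[OF m x])
  show "(\<sigma> \<oplus>[sec Sh U j] \<tau>) x = (\<tau> \<oplus>[sec Sh U j] \<sigma>) x"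
   by (rule rep_eq[OF _ rep_add[OF V(2,4,3)] V(1)],
     subst rm_comm[OF F.sec_rmod[OF repD(1)[OF V(3)]] V(4)[THEN repD(2)] V(3)[THEN repD(2)]],
     rule rep_add[OF V(2-4)])
 qed
 {
  fix \<sigma> assume m: "\<sigma> \<in> sect Sh U j"
  note eq = sh_eqI[OF m]
  note se = sh_ext(6)[OF m]
  show "\<zero>[sec Sh U j] \<oplus>[sec Sh U j] \<sigma> = \<sigma>"
  proof (rule eq[OF sh_ext(1) se], intro exI conjI)
   fix V s assume V: "V <= U" "rep j V s \<sigma>"
   show "rep j V s (\<zero>[sec Sh U j] \<oplus>[sec Sh U j] \<sigma>)"
    using rep_add[OF V(1) rep_zero[OF U repD(1)[OF V(2)] V(1)] V(2)] repD(1,2)[OF V(2)] by simp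
  qed
  show "0 \<odot>[sec Sh U j] \<sigma> = \<zero>[sec Sh U j]"
  proof (rule eq[OF sh_ext(2,3)], intro exI conjI)
   fix V s assume V: "V <= U" "rep j V s \<sigma>"
   show "rep j V \<zero>[sec F V j] (0 \<odot>[sec Sh U j] \<sigma>)"
    using rep_smult[OF V, of 0] repD(1,2)[OF V(2)] by simp
   show "rep j V \<zero>[sec F V j] \<zero>[sec Sh U j]" by (rule rep_zero[OF U repD(1)[OF V(2)] V(1)])
  qed
  show "(p + q) \<odot>[sec Sh U j] \<sigma> = p \<odot>[sec Sh U j] \<sigma> \<oplus>[sec Sh U j] q \<odot>[sec Sh U j] \<sigma>" for p q
  proof (rule eq[OF sh_ext(2,1)], intro exI conjI)
   fix V s assume V: "V <= U" "rep j V s \<sigma>"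
   show "rep j V ((p + q) \<odot>[sec F V j] s) ((p + q) \<odot>[sec Sh U j] \<sigma>)" by (rule rep_smult[OF V])
   show "rep j V ((p + q) \<odot>[sec F V j] s) (p \<odot>[sec Sh U j] \<sigma> \<oplus>[sec Sh U j] q \<odot>[sec Sh U j] \<sigma>)"
    unfolding rm_smult_l[OF F.sec_rmod[OF repD(1)[OF V(2)]] repD(2)[OF V(2)]]
    by (rule rep_add[OF V(1) rep_smult[OF V] rep_smult[OF V]])
  qed
  show "(p * q) \<odot>[sec Sh U j] \<sigma> = p \<odot>[sec Sh U j] (q \<odot>[sec Sh U j] \<sigma>)" for p q
  proof (rule eq[OF sh_ext(2,2)], intro exI conjI)
   fix V s assume V: "V <= U" "rep j V s \<sigma>"
   show "rep j V ((p * q) \<odot>[sec F V j] s) ((p * q) \<odot>[sec Sh U j] \<sigma>)" by (rule rep_smult[OF V])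
   show "rep j V ((p * q) \<odot>[sec F V j] s) (p \<odot>[sec Sh U j] (q \<odot>[sec Sh U j] \<sigma>))"
    unfolding rm_smult_smult[OF F.sec_rmod[OF repD(1)[OF V(2)]] repD(2)[OF V(2)], symmetric]
    by (rule rep_smult[OF V(1) rep_smult[OF V]])
  qed
  show "1 \<odot>[sec Sh U j] \<sigma> = \<sigma>"
  proof (rule eq[OF sh_ext(2) se], intro exI conjI)
   fix V s assume V: "V <= U" "rep j V s \<sigma>"
   show "rep j V s (1 \<odot>[sec Sh U j] \<sigma>)"
    using rep_smult[OF V, of 1] repD(1,2)[OF V(2)] by simp
  qed
 }
 show "p \<odot>[sec Sh U j] (\<sigma> \<oplus>[sec Sh U j] \<tau>) = p \<odot>[sec Sh U j] \<sigma> \<oplus>[sec Sh U j] p \<odot>[sec Sh U j] \<tau>"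
  if m: "\<sigma> \<in> sect Sh U j" "\<tau> \<in> sect Sh U j" for p \<sigma> \<tau>
 proof (rule extensionalityI[OF sh_ext(2) sh_ext(1)])
  fix x assume x: "x \<in> U"
  obtain V s t where V: "x \<in> V" "V <= U" "rep j V s \<sigma>" "rep j V t \<tau>" by (rule sh_local2[OF m x])
  show "(p \<odot>[sec Sh U j] (\<sigma> \<oplus>[sec Sh U j] \<tau>)) x = (p \<odot>[sec Sh U j] \<sigma> \<oplus>[sec Sh U j] p \<odot>[sec Sh U j] \<tau>) x"
   by (rule rep_eq[OF _ rep_add[OF V(2) rep_smult[OF V(2,3)] rep_smult[OF V(2,4)]] V(1)],
     subst rm_smult_r[OF F.sec_rmod[OF repD(1)[OF V(3)]] V(3,4)[THEN repD(2)], symmetric],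
     rule rep_smult[OF V(2) rep_add[OF V(2-4)]])
 qed
qed

lemma sh_res_linear:
 assumes V: "openin X U" "openin X V" "V <= U"
 shows "lin (sec Sh U j) (sec Sh V j) (res Sh U V j)"
 unfolding sh_simps(2)
proof (rule real_linearI)
 fix \<sigma> assume \<sigma>: "\<sigma> \<in> sect Sh U j"
 show "restrict \<sigma> V : sect Sh V j" by (rule sh_res_closed[OF \<sigma> V(2,3)])
 show "restrict (r \<odot>[sec Sh U j] \<sigma>) V = r \<odot>[sec Sh V j] restrict \<sigma> V" for r
  using V by (auto simp: sh_smult fun_eq_iff)
 fix \<tau>
 show "restrict (\<sigma> \<oplus>[sec Sh U j] \<tau>) V = restrict \<sigma> V \<oplus>[sec Sh V j] restrict \<tau> V"
  using V by (auto simp: sh_add fun_eq_iff)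
qed

theorem sheafification_module_sheaf: "graded_module_sheaf X C Sh"
proof
 fix U j assume U: "openin X U"
 show "graded_vs (sec Sh U)" using sh_rmod[OF U] by (simp add: graded_vs_def)
 show "lin (sec Sh U j) (sec Sh V j) (res Sh U V j)" if "openin X V" "V <= U" for V j
  by (rule sh_res_linear[OF U that])
 show "res Sh U U j \<sigma> = \<sigma>" if "\<sigma> \<in> sect Sh U j" for \<sigma>
  using sh_ext(6)[OF that] by (simp add: sh_simps(2) extensional_restrict)
 show "res Sh V W j (res Sh U V j \<sigma>) = res Sh U W j \<sigma>" if "openin X V" "openin X W" "W <= V" "V <= U" for V W \<sigma>
  using that by (auto simp: sh_simps(2) fun_eq_iff)
 show "lin (sec C U i) (sec Sh U (i + j)) (%f. act Sh U i j f \<sigma>)"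
  if m: "\<sigma> \<in> sect Sh U j" for i \<sigma>
 proof (rule real_linearI)
  fix f assume f: "f : sect C U i"
  show "act Sh U i j f \<sigma> \<in> sect Sh U (i + j)" by (rule sh_act_closed[OF U f m])
  show "act Sh U i j (r \<odot>[sec C U i] f) \<sigma> = r \<odot>[sec Sh U (i + j)] act Sh U i j f \<sigma>" for r
  proof (rule sh_eqI[OF m sh_ext(4,2)], intro exI conjI)
   fix V s assume V: "V <= U" "rep j V s \<sigma>"
   note o = repD(1)[OF V(2)]
   show "rep (i + j) V (r \<odot>[sec F V (i + j)] act F V i j (res C U V i f) s) (r \<odot>[sec Sh U (i + j)] act Sh U i j f \<sigma>)"
    by (rule rep_smult[OF V(1) rep_act[OF U f V]])
   show "rep (i + j) V (r \<odot>[sec F V (i + j)] act F V i j (res C U V i f) s) (act Sh U i j (r \<odot>[sec C U i] f) \<sigma>)"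
    using rep_act[OF U rm_smult_closed[OF C.sec_rmod[OF U] f] V]
    unfolding rl_smult[OF C.res_linear[OF U o V(1)] f] rl_smult[OF F.act_linear_left[OF o repD(2)[OF V(2)]] C.res_closed[OF U o V(1) f]] .
  qed
  fix g assume g: "g : sect C U i"
  show "act Sh U i j (f \<oplus>[sec C U i] g) \<sigma> = act Sh U i j f \<sigma> \<oplus>[sec Sh U (i + j)] act Sh U i j g \<sigma>"
  proof (rule sh_eqI[OF m sh_ext(4,1)], intro exI conjI)
   fix V s assume V: "V <= U" "rep j V s \<sigma>"
   note o = repD(1)[OF V(2)]
   show "rep (i + j) V (act F V i j (res C U V i f) s \<oplus>[sec F V (i + j)] act F V i j (res C U V i g) s) (act Sh U i j f \<sigma> \<oplus>[sec Sh U (i + j)] act Sh U i j g \<sigma>)"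
    by (rule rep_add[OF V(1) rep_act[OF U f V] rep_act[OF U g V]])
   show "rep (i + j) V (act F V i j (res C U V i f) s \<oplus>[sec F V (i + j)] act F V i j (res C U V i g) s) (act Sh U i j (f \<oplus>[sec C U i] g) \<sigma>)"
    using rep_act[OF U rm_add_closed[OF C.sec_rmod[OF U] f g] V]
    unfolding rl_add[OF C.res_linear[OF U o V(1)] f g]
     rl_add[OF F.act_linear_left[OF o repD(2)[OF V(2)]] C.res_closed[OF U o V(1) f] C.res_closed[OF U o V(1) g]] .
  qed
 qed
 show "lin (sec Sh U j) (sec Sh U (i + j)) (act Sh U i j f)" if f: "f : sect C U i" for i f
 proof (rule real_linearI)
  fix \<sigma> assume m: "\<sigma> \<in> sect Sh U j"
  show "act Sh U i j f \<sigma> \<in> sect Sh U (i + j)" by (rule sh_act_closed[OF U f m])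
  show "act Sh U i j f (r \<odot>[sec Sh U j] \<sigma>) = r \<odot>[sec Sh U (i + j)] act Sh U i j f \<sigma>" for r
  proof (rule sh_eqI[OF m sh_ext(4,2)], intro exI conjI)
   fix V s assume V: "V <= U" "rep j V s \<sigma>"
   note o = repD(1)[OF V(2)]
   show "rep (i + j) V (r \<odot>[sec F V (i + j)] act F V i j (res C U V i f) s) (r \<odot>[sec Sh U (i + j)] act Sh U i j f \<sigma>)"
    by (rule rep_smult[OF V(1) rep_act[OF U f V]])
   show "rep (i + j) V (r \<odot>[sec F V (i + j)] act F V i j (res C U V i f) s) (act Sh U i j f (r \<odot>[sec Sh U j] \<sigma>))"
    using rep_act[OF U f V(1) rep_smult[OF V]]
    unfolding rl_smult[OF F.act_linear_right[OF o C.res_closed[OF U o V(1) f]] repD(2)[OF V(2)]] .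
  qed
  fix \<tau> assume m': "\<tau> \<in> sect Sh U j"
  show "act Sh U i j f (\<sigma> \<oplus>[sec Sh U j] \<tau>) = act Sh U i j f \<sigma> \<oplus>[sec Sh U (i + j)] act Sh U i j f \<tau>"
  proof (rule extensionalityI[OF sh_ext(4,1)])
   fix x assume x: "x \<in> U"
   obtain V s t where V: "x \<in> V" "V <= U" "rep j V s \<sigma>" "rep j V t \<tau>" by (rule sh_local2[OF m m' x])
   note o = repD(1)[OF V(3)]
   show "act Sh U i j f (\<sigma> \<oplus>[sec Sh U j] \<tau>) x = (act Sh U i j f \<sigma> \<oplus>[sec Sh U (i + j)] act Sh U i j f \<tau>) x"
    using rep_eq[OF rep_act[OF U f V(2) rep_add[OF V(2-4)],
      unfolded rl_add[OF F.act_linear_right[OF o C.res_closed[OF U o V(2) f]] repD(2)[OF V(3)] repD(2)[OF V(4)]]]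
     rep_add[OF V(2) rep_act[OF U f V(2,3)] rep_act[OF U f V(2,4)]] V(1)] .
  qed
 qed
 show "act Sh U (i + j) l (gmul C U i j f g) \<sigma> = act Sh U i (j + l) f (act Sh U j l g \<sigma>)"
  if f: "f : sect C U i" and g: "g : sect C U j" and m: "\<sigma> \<in> sect Sh U l" for i j l f g \<sigma>
 proof (rule sh_eqI[OF m sh_ext(4,4)], intro exI conjI)
  fix V s assume V: "V <= U" "rep l V s \<sigma>"
  note o = repD(1)[OF V(2)]
  show "rep (i + j + l) V (act F V (i + j) l (res C U V (i + j) (gmul C U i j f g)) s) (act Sh U (i + j) l (gmul C U i j f g) \<sigma>)"
   by (rule rep_act[OF U C.gmul_closed[OF U f g refl] V])
  show "rep (i + j + l) V (act F V (i + j) l (res C U V (i + j) (gmul C U i j f g)) s) (act Sh U i (j + l) f (act Sh U j l g \<sigma>))"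
   unfolding C.res_gmul[OF U o V(1) f g] F.act_assoc[OF o C.res_closed[OF U o V(1) f] C.res_closed[OF U o V(1) g] repD(2)[OF V(2)]] add.assoc
   by (rule rep_act[OF U f V(1) rep_act[OF U g V]])
 qed
 show "act Sh U 0 j (gunit C U) \<sigma> = \<sigma>" if m: "\<sigma> \<in> sect Sh U j" for \<sigma>
 proof (rule sh_eqI[OF m sh_ext(4) sh_ext(6)[OF m]], intro exI conjI)
  fix V s assume V: "V <= U" "rep j V s \<sigma>"
  note o = repD(1)[OF V(2)]
  show "rep j V s (act Sh U 0 j (gunit C U) \<sigma>)"
   using rep_act[OF U C.gunit_closed[OF U] V] unfolding C.res_gunit[OF U o V(1)] F.act_gunit[OF o repD(2)[OF V(2)]] add_0 .
 qed
 show "res Sh U V (i + j) (act Sh U i j f \<sigma>) = act Sh V i j (res C U V i f) (res Sh U V j \<sigma>)"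
  if V: "openin X V" "V <= U" and f: "f : sect C U i" and m: "\<sigma> \<in> sect Sh U j" for V i f \<sigma>
  unfolding sh_simps(2)
 proof (rule sh_eqI[OF sh_res_closed[OF m V] sh_ext(5,4)], intro exI conjI)
  fix W s assume W: "W <= V" "rep j W s (restrict \<sigma> V)"
  then have W': "rep j W s \<sigma>" "W <= U" using V by (auto simp: rep_restrict)
  note o = repD(1)[OF W(2)]
  show "rep (i + j) W (act F W i j (res C U W i f) s) (restrict (act Sh U i j f \<sigma>) V)"
   using rep_act[OF U f W'(2,1)] W(1) by (simp add: rep_restrict)
  show "rep (i + j) W (act F W i j (res C U W i f) s) (act Sh V i j (res C U V i f) (restrict \<sigma> V))"
   using rep_act[OF V(1) C.res_closed[OF U V f] W] unfolding C.res_comp[OF U V(1) o W(1) V(2) f] .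
 qed
next
 fix \<U> s t j
 assume \<U>: "\<forall>U\<in>\<U>. openin X U" and s: "s : sect Sh (\<Union>\<U>) j" and t: "t : sect Sh (\<Union>\<U>) j"
  and e: "\<forall>U\<in>\<U>. res Sh (\<Union>\<U>) U j s = res Sh (\<Union>\<U>) U j t"
 show "s = t"
 proof (rule extensionalityI[OF sh_ext(6)[OF s] sh_ext(6)[OF t]])
  fix x assume "x \<in> \<Union>\<U>"
  then obtain U where U: "U \<in> \<U>" "x \<in> U" by blast
  then have "restrict s U x = restrict t U x" using e unfolding sh_simps(2) by simp
  then show "s x = t x" using U by simp
 qed
next
 fix \<U> \<sigma> j
 assume \<U>: "\<forall>U\<in>\<U>. openin X U" and \<sigma>: "\<forall>U\<in>\<U>. \<sigma> U : sect Sh U j"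
  and e: "\<forall>U\<in>\<U>. \<forall>V\<in>\<U>. res Sh U (U Int V) j (\<sigma> U) = res Sh V (U Int V) j (\<sigma> V)"
 \<comment> \<open>At each point any member of the cover that contains it may be used: by
   \<open>e\<close> the choice does not matter.\<close>
 define s where "s = (\<lambda>x\<in>\<Union>\<U>. \<sigma> (SOME U. U \<in> \<U> & x \<in> U) x)"
 have sU: "s x = \<sigma> U x" if "U \<in> \<U>" "x \<in> U" for x U
 proof -
  let ?V = "SOME U. U \<in> \<U> & x \<in> U"
  have V: "?V \<in> \<U> & x \<in> ?V" by (rule someI[of _ U]) (use that in blast)
  then have "restrict (\<sigma> ?V) (?V Int U) x = restrict (\<sigma> U) (?V Int U) x" using e that unfolding sh_simps(2) by auto
  then show ?thesis using that V by (auto simp: s_def)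
 qed
 have "s : sect Sh (\<Union>\<U>) j"
  unfolding sh_mem
 proof (intro conjI ballI)
  show "s \<in> extensional (\<Union>\<U>)" by (simp add: s_def)
  fix x assume "x \<in> \<Union>\<U>"
  then obtain U where U: "U \<in> \<U>" "x \<in> U" by blast
  obtain V t where V: "x \<in> V" "V <= U" "rep j V t (\<sigma> U)" by (rule sh_local[OF bspec[OF \<sigma> U(1)] U(2)])
  have "rep j V t s" using V sU[OF U(1)] unfolding rep_def by auto
  then show "EX V t. x \<in> V & V <= \<Union>\<U> & rep j V t s" using V U by blast
 qed
 moreover have "res Sh (\<Union>\<U>) U j s = \<sigma> U" if "U \<in> \<U>" for U
  unfolding sh_simps(2)
  by (rule extensionalityI[OF sh_ext(5) sh_ext(6)]) (use \<sigma> that sU in auto)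
 ultimately show "\<exists>s\<in>sect Sh (\<Union>\<U>) j. \<forall>U\<in>\<U>. res Sh (\<Union>\<U>) U j s = \<sigma> U" by blast
qed

text \<open>A section goes to the family of its germs. Locality over \<open>U\<close> makes this
  injective; for surjectivity the local representatives are glued, and they agree on overlaps by
  injectivity there.\<close>

lemma sheafification_iso:
 assumes U: "openin X U" and sh: "graded_module_sheaf (subtopology X U) C F"
 shows "EX \<tau>. module_iso_on X C F Sh U \<tau>"
proof -
 interpret S: graded_module_sheaf "subtopology X U" C F by (rule sh)
 have op: "openin (subtopology X U) V \<longleftrightarrow> openin X V & V <= U" for V
  using U by (simp add: openin_open_subtopology)
 let ?\<tau> = "%V j s. \<lambda>y\<in>V. germ X F j y V s"
 have rp: "rep j V s (?\<tau> V j s)" if "openin X V" "s : sect F V j" for V j s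
  using that by (simp add: rep_def)
 have clo: "?\<tau> V j s : sect Sh V j" if "openin X V" "s : sect F V j" for V j s
  unfolding sh_mem using rp[OF that] by auto
 have eqI: "\<sigma> = \<tau>" if "\<sigma> \<in> extensional V" "\<tau> \<in> extensional V" "rep j V s \<sigma>" "rep j V s \<tau>" for V j s \<sigma> \<tau>
  by (rule extensionalityI[OF that(1,2)]) (rule rep_eq[OF that(3,4)])
 have inj: "s = t" if V: "openin X V" "V <= U" and s: "s : sect F V j" and t: "t : sect F V j"
  and e: "!!y. y \<in> V ==> germ X F j y V s = germ X F j y V t" for V j s t
 proof -
  let ?\<U> = "{N. openin X N & N <= V & res F V N j s = res F V N j t}"
  have "V <= \<Union>?\<U>"
  proof
   fix y assume y: "y \<in> V"
   obtain N where "openin X N" "y \<in> N" "N <= V" "N <= V" "res F V N j s = res F V N j t"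
    by (rule germ_eqE[OF e[OF y] V(1) y s V(1) y t])
   then show "y \<in> \<Union>?\<U>" by blast
  qed
  then have VU: "\<Union>?\<U> = V" by blast
  show "s = t"
   by (rule S.locality[of ?\<U>, unfolded VU, OF _ s t]) (use V op in auto)
 qed
 have "module_iso_on X C F Sh U ?\<tau>"
  unfolding module_iso_on_def
 proof (intro allI impI)
  fix V assume "openin X V & V <= U"
  then have V: "openin X V" "V <= U" by auto
  show "(ALL j. lin (sec F V j) (sec Sh V j) (?\<tau> V j) & bij_betw (?\<tau> V j) (sect F V j) (sect Sh V j)) &
  (ALL i j. \<forall>f\<in>sect C V i. \<forall>s\<in>sect F V j. ?\<tau> V (i + j) (act F V i j f s) = act Sh V i j f (?\<tau> V j s)) &
  (ALL W j. openin X W & W <= V --> (\<forall>s\<in>sect F V j. ?\<tau> W j (res F V W j s) = res Sh V W j (?\<tau> V j s)))"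
  proof (intro conjI allI ballI impI)
   fix j
   show "lin (sec F V j) (sec Sh V j) (?\<tau> V j)"
   proof (rule real_linearI)
    fix s assume s: "s : sect F V j"
    show "?\<tau> V j s : sect Sh V j" by (rule clo[OF V(1) s])
    show "?\<tau> V j (r \<odot>[sec F V j] s) = r \<odot>[sec Sh V j] ?\<tau> V j s" for r
     by (rule eqI[OF restrict_extensional sh_ext(2) rp[OF V(1) rm_smult_closed[OF F.sec_rmod[OF V(1)] s]]])
      (rule rep_smult[OF subset_refl rp[OF V(1) s]])
    fix t assume t: "t : sect F V j"
    show "?\<tau> V j (s \<oplus>[sec F V j] t) = ?\<tau> V j s \<oplus>[sec Sh V j] ?\<tau> V j t"
     by (rule eqI[OF restrict_extensional sh_ext(1) rp[OF V(1) rm_add_closed[OF F.sec_rmod[OF V(1)] s t]]])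
      (rule rep_add[OF subset_refl rp[OF V(1) s] rp[OF V(1) t]])
   qed
   show "bij_betw (?\<tau> V j) (sect F V j) (sect Sh V j)"
    unfolding bij_betw_def
   proof (intro conjI inj_onI equalityI subsetI)
    fix s t assume s: "s : sect F V j" and t: "t : sect F V j" and e: "?\<tau> V j s = ?\<tau> V j t"
    show "s = t"
    proof (rule inj[OF V s t])
     show "germ X F j y V s = germ X F j y V t" if "y \<in> V" for y
      using fun_cong[OF e, of y] that by simp
    qed
   next
    fix \<sigma> assume "\<sigma> \<in> ?\<tau> V j ` sect F V j"
    then show "\<sigma> \<in> sect Sh V j" using clo[OF V(1)] by auto
   next
    fix \<sigma> assume m: "\<sigma> \<in> sect Sh V j"
    let ?\<U> = "{N. N <= V & (EX s. rep j N s \<sigma>)}"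
    define t where "t N = (SOME s. rep j N s \<sigma>)" for N
    have t: "rep j N (t N) \<sigma>" if "N \<in> ?\<U>" for N
     unfolding t_def by (rule someI_ex) (use that in blast)
    have "V <= \<Union>?\<U>"
    proof
     fix x assume x: "x \<in> V"
     obtain N s where "x \<in> N" "N <= V" "rep j N s \<sigma>" by (rule sh_local[OF m x])
     then show "x \<in> \<Union>?\<U>" by blast
    qed
    then have VU: "\<Union>?\<U> = V" by blast
    have "\<exists>s\<in>sect F (\<Union>?\<U>) j. \<forall>N\<in>?\<U>. res F (\<Union>?\<U>) N j s = t N"
    proof (rule S.gluing)
     show "\<forall>N\<in>?\<U>. openin (subtopology X U) N" using V repD(1) unfolding op by blast
     show "\<forall>N\<in>?\<U>. t N : sect F N j" using t repD(2) by blast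
     show "\<forall>N\<in>?\<U>. \<forall>M\<in>?\<U>. res F N (N Int M) j (t N) = res F M (N Int M) j (t M)"
     proof (intro ballI)
      fix N M assume N: "N \<in> ?\<U>" and M: "M \<in> ?\<U>"
      have o: "openin X (N Int M)" "N Int M <= U" using N M V repD(1)[OF t[OF N]] repD(1)[OF t[OF M]] by auto
      note r = rep_res[OF t[OF N] o(1) Int_lower1] rep_res[OF t[OF M] o(1) Int_lower2]
      show "res F N (N Int M) j (t N) = res F M (N Int M) j (t M)"
       by (rule inj[OF o repD(2)[OF r(1)] repD(2)[OF r(2)]]) (simp only: repD(3)[OF r(1), symmetric] repD(3)[OF r(2), symmetric])
     qed
    qed
    then obtain s where s: "s : sect F V j" "!!N. N \<in> ?\<U> ==> res F V N j s = t N"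
     unfolding VU by blast
    have "\<sigma> = ?\<tau> V j s"
    proof (rule extensionalityI[OF sh_ext(6)[OF m] restrict_extensional])
     fix x assume x: "x \<in> V"
     then obtain N where N: "N \<in> ?\<U>" "x \<in> N" using VU by blast
     have NV: "N <= V" using N by blast
     have "\<sigma> x = germ X F j x N (res F V N j s)" unfolding s(2)[OF N(1)] by (rule repD(3)[OF t[OF N(1)] N(2)])
     also have "\<dots> = germ X F j x V s" by (rule germ_res[OF V(1) s(1) repD(1)[OF t[OF N(1)]] N(2) NV])
     finally show "\<sigma> x = ?\<tau> V j s x" using x by simp
    qed
    then show "\<sigma> \<in> ?\<tau> V j ` sect F V j" using s(1) by blast
   qed
  next
   fix i j f s assume f: "f : sect C V i" and s: "s : sect F V j"
   show "?\<tau> V (i + j) (act F V i j f s) = act Sh V i j f (?\<tau> V j s)"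
    by (rule eqI[OF restrict_extensional sh_ext(4) rp[OF V(1) F.act_closed[OF V(1) f s refl]]])
     (rule rep_act[OF V(1) f subset_refl rp[OF V(1) s], unfolded C.res_id[OF V(1) f]])
  next
   fix W j s assume "openin X W & W <= V" and s: "s : sect F V j"
   then have W: "openin X W" "W <= V" by auto
   show "?\<tau> W j (res F V W j s) = res Sh V W j (?\<tau> V j s)"
    unfolding sh_simps(2)
    by (rule eqI[OF restrict_extensional restrict_extensional rp[OF W(1) F.res_closed[OF V(1) W s]]
       iffD2[OF rep_restrict[OF subset_refl] rep_res[OF rp[OF V(1) s] W]]])
  qed
 qed
 then show ?thesis by (rule exI[where P = "module_iso_on X C F Sh U"])
qed

end


section \<open>Smooth functions on the body\<close>

definition zpos :: "int list => nat set" where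
 "zpos ds = {A. A < length ds & ds ! A = 0}"

definition bpts :: "int list => (nat => real) set" where
 "bpts ds = {x. ALL A. A \<notin> zpos ds --> x A = 0}"

lemma finite_zpos [simp]: "finite (zpos ds)"
 by (simp add: zpos_def)

text \<open>As a subspace of a function space with the product topology, the body becomes accessible
  to \<open>continuous_on\<close> and \<open>openin_open\<close>.\<close>

lemma body_space_eq: "body_space ds = top_of_set (bpts ds)"
 by (simp add: body_space_def bpts_def zpos_def euclidean_product_topology)

abbreviation bopen :: "int list => (nat => real) set => bool" where
 "bopen ds W == openin (body_space ds) W"

lemma bopen_subset: "bopen ds W ==> W <= bpts ds"
 using openin_subset[of "body_space ds" W] by (simp add: body_space_eq)

lemma body_continuous:
 "bopen ds W ==> continuous_map (subtopology (body_space ds) W) euclideanreal f \<longleftrightarrow> continuous_on W f"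
 using bopen_subset[of ds W] by (simp add: body_space_eq subtopology_subtopology inf_absorb2)

lemma Ck_0: "bopen ds W ==> Ck_on ds 0 W f \<longleftrightarrow> continuous_on W f"
 by (simp add: body_continuous)

lemma Ck_Suc_iff: "bopen ds W ==> Ck_on ds (Suc k) W f \<longleftrightarrow> continuous_on W f &
 (\<forall>A\<in>zpos ds. EX g. Ck_on ds k W g & (\<forall>x\<in>W. pder A x f (g x)))"
 by (auto simp: body_continuous zpos_def)

declare Ck_on.simps [simp del]

lemma continuous_line: "continuous_on UNIV (%t::real. x(A := t) :: nat => real)"
proof (rule continuous_on_coordinatewise_then_product)
 show "continuous_on UNIV (%t. (x(A := t)) i)" for i by (cases "i = A") auto
qed

text \<open>Although \<open>W\<close> is open only relative to \<open>bpts ds\<close>, changing a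
  body coordinate does not leave \<open>bpts ds\<close>. So the partial derivatives at points of
  \<open>W\<close> see only values on \<open>W\<close>.\<close>

lemma eventually_line:
 assumes W: "bopen ds W" and x: "x \<in> W" and A: "A \<in> zpos ds"
 shows "eventually (%t. x(A := t) \<in> W) (nhds (x A))"
proof -
 obtain T where T: "open T" "W = bpts ds Int T"
  using W unfolding body_space_eq openin_open by blast
 have "open ((%t. x(A := t)) -` T)"
  using open_vimage[OF T(1) continuous_line] .
 moreover have "x A \<in> (%t. x(A := t)) -` T" using x T by simp
 ultimately have "eventually (%t. t \<in> (%t. x(A := t)) -` T) (nhds (x A))"
  by (rule eventually_nhds_in_open)
 moreover have "x(A := t) \<in> bpts ds" for t using x T A by (auto simp: bpts_def)
 ultimately show ?thesis by (simp add: T(2))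
qed

lemma pderiv_cong:
 assumes W: "bopen ds W" "x \<in> W" "A \<in> zpos ds" and e: "!!y. y \<in> W ==> f y = f' y"
  and d: "pder A x f D"
 shows "pder A x f' D"
proof -
 have "eventually (%t. f (x(A := t)) = f' (x(A := t))) (nhds (x A))"
  using eventually_line[OF W] by eventually_elim (rule e)
 from DERIV_cong_ev[OF refl this refl] d show ?thesis by blast
qed

lemma Ck_continuous: "bopen ds W ==> Ck_on ds k W f ==> continuous_on W f"
 by (cases k) (auto simp: Ck_0 Ck_Suc_iff)

lemma Ck_Suc_ex:
 assumes "bopen ds W" "Ck_on ds (Suc k) W f" "A \<in> zpos ds"
 shows "EX g. Ck_on ds k W g & (\<forall>x\<in>W. pder A x f (g x))"
 using assms(2) unfolding Ck_Suc_iff[OF assms(1)] by (auto dest: bspec[OF _ assms(3)])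

lemma Ck_SucI:
 assumes "bopen ds W" "continuous_on W f"
  "!!A. A \<in> zpos ds ==> Ck_on ds k W (g A)"
  "!!A x. A \<in> zpos ds ==> x \<in> W ==> pder A x f (g A x)"
 shows "Ck_on ds (Suc k) W f"
 unfolding Ck_Suc_iff[OF assms(1)]
proof (intro conjI ballI assms(2))
 fix A assume "A \<in> zpos ds"
 then show "EX g. Ck_on ds k W g & (\<forall>x\<in>W. pder A x f (g x))"
  using assms(3,4) by (intro exI[of _ "g A"] conjI ballI)
qed

lemma Ck_cong:
 assumes W: "bopen ds W" and e: "!!y. y \<in> W ==> f y = f' y" and f: "Ck_on ds k W f"
 shows "Ck_on ds k W f'"
proof -
 have c: "continuous_on W f'" using Ck_continuous[OF W f] e continuous_on_cong[OF refl, of W f f'] by simp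
 show ?thesis
 proof (cases k)
  case 0
  then show ?thesis using c W by (simp add: Ck_0)
 next
  case (Suc k)
  show ?thesis
   unfolding Suc Ck_Suc_iff[OF W]
  proof (intro conjI ballI c)
   fix A assume A: "A \<in> zpos ds"
   obtain g where g: "Ck_on ds k W g" "!!x. x \<in> W ==> pder A x f (g x)"
    using Ck_Suc_ex[OF W f[unfolded Suc] A] by blast
   show "EX g. Ck_on ds k W g & (\<forall>x\<in>W. pder A x f' (g x))"
    by (intro exI[of _ g] conjI ballI g(1) pderiv_cong[OF W _ A e g(2)])
  qed
 qed
qed

lemma Ck_mono: "bopen ds W ==> bopen ds W' ==> W' <= W ==> Ck_on ds k W f ==> Ck_on ds k W' f"
proof (induction k arbitrary: f)
 case 0
 then show ?case using continuous_on_subset by (auto simp: Ck_0)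
next
 case (Suc k)
 have c: "continuous_on W' f" using Ck_continuous[OF Suc.prems(1,4)] continuous_on_subset Suc.prems(3) by blast
 show ?case
  unfolding Ck_Suc_iff[OF Suc.prems(2)]
 proof (intro conjI c ballI)
  fix A assume A: "A \<in> zpos ds"
  obtain g where g: "Ck_on ds k W g" "!!x. x \<in> W ==> pder A x f (g x)"
   using Ck_Suc_ex[OF Suc.prems(1,4) A] by blast
  show "EX g. Ck_on ds k W' g & (\<forall>x\<in>W'. pder A x f (g x))"
   by (intro exI[of _ g] conjI ballI Suc.IH[OF Suc.prems(1-3) g(1)] g(2) subsetD[OF Suc.prems(3)])
 qed
qed

lemma Ck_SucD: "bopen ds W ==> Ck_on ds (Suc k) W f ==> Ck_on ds k W f"
proof (induction k arbitrary: f)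
 case 0
 then show ?case by (auto simp: Ck_0 Ck_Suc_iff)
next
 case (Suc k)
 show ?case
  unfolding Ck_Suc_iff[OF Suc.prems(1)]
 proof (intro conjI ballI Ck_continuous[OF Suc.prems])
  fix A assume A: "A \<in> zpos ds"
  obtain g where g: "Ck_on ds (Suc k) W g" "!!x. x \<in> W ==> pder A x f (g x)"
   using Ck_Suc_ex[OF Suc.prems A] by blast
  show "EX g. Ck_on ds k W g & (\<forall>x\<in>W. pder A x f (g x))"
   by (intro exI[of _ g] conjI ballI Suc.IH[OF Suc.prems(1) g(1)] g(2))
 qed
qed

lemma continuous_on_local:
 fixes f :: "'a::topological_space => 'b::topological_space"
 assumes "!!x. x \<in> W ==> EX T. open T & x \<in> T & continuous_on (W Int T) f"
 shows "continuous_on W f"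
 unfolding continuous_on_topological
proof (intro ballI allI impI)
 fix x B assume x: "x \<in> W" and B: "open B" "f x \<in> B"
 obtain T where T: "open T" "x \<in> T" "continuous_on (W Int T) f" using assms[OF x] by blast
 then obtain A where "open A" "x \<in> A" "\<forall>y\<in>W Int T. y \<in> A --> f y \<in> B"
  using x B unfolding continuous_on_topological by blast
 then show "EX A. open A & x \<in> A & (\<forall>y\<in>W. y \<in> A --> f y \<in> B)"
  using T by (intro exI[of _ "A Int T"]) auto
qed

lemma Ck_local_continuous:
 assumes W: "bopen ds W" and l: "!!x. x \<in> W ==> EX W'. bopen ds W' & x \<in> W' & W' <= W & Ck_on ds k W' f"
 shows "continuous_on W f"
proof (rule continuous_on_local)
 fix x assume "x \<in> W"
 then obtain W' where W': "bopen ds W'" "x \<in> W'" "W' <= W" "Ck_on ds k W' f" using l by blast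
 obtain T where T: "open T" "W' = bpts ds Int T" using W'(1) unfolding body_space_eq openin_open by blast
 have "W Int T = W'" using T W' bopen_subset[OF W] by blast
 then show "EX T. open T & x \<in> T & continuous_on (W Int T) f"
  using T W'(2) Ck_continuous[OF W'(1,4)] by (intro exI[of _ T]) auto
qed

text \<open>The local partial derivatives agree by uniqueness of derivatives, hence
  \<open>deriv\<close> is a common witness.\<close>

lemma Ck_local:
 assumes W: "bopen ds W" and l: "!!x. x \<in> W ==> EX W'. bopen ds W' & x \<in> W' & W' <= W & Ck_on ds k W' f"
 shows "Ck_on ds k W f"
 using l
proof (induction k arbitrary: f)
 case 0
 show ?case unfolding Ck_0[OF W] by (rule Ck_local_continuous[OF W 0])
next
 case (Suc k)
 show ?case
 proof (rule Ck_SucI[OF W Ck_local_continuous[OF W Suc.prems]])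
  fix A assume A: "A \<in> zpos ds"
  let ?g = "%x. deriv (%t. f (x(A := t))) (x A)"
  have l: "EX W'. (bopen ds W' & x \<in> W' & W' <= W & Ck_on ds k W' ?g) &
   pder A x f (?g x)" if x: "x \<in> W" for x
  proof -
   obtain W' where W': "bopen ds W'" "x \<in> W'" "W' <= W" "Ck_on ds (Suc k) W' f" using Suc.prems[OF x] by blast
   obtain g where g: "Ck_on ds k W' g" "!!x. x \<in> W' ==> pder A x f (g x)"
    using Ck_Suc_ex[OF W'(1,4) A] by blast
   have e: "g y = ?g y" if "y \<in> W'" for y using DERIV_imp_deriv[OF g(2)[OF that]] by simp
   have "pder A x f (?g x)"
    using g(2)[OF W'(2)] unfolding e[OF W'(2)] .
   with W'(1-3) Ck_cong[OF W'(1) e g(1)] show ?thesis by (intro exI[of _ W'] conjI)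
  qed
  show "Ck_on ds k W ?g"
  proof (rule Suc.IH)
   fix x assume "x \<in> W"
   from l[OF this] show "EX W'. bopen ds W' & x \<in> W' & W' <= W & Ck_on ds k W' ?g" by (elim ex_forward conjunct1)
  qed
  show "pder A x f (?g x)" if "x \<in> W" for x
   using l[OF that] by (elim exE conjE)
 qed
qed

lemma Ck_const: "bopen ds W ==> Ck_on ds k W (%_. c)"
proof (induction k arbitrary: c)
 case (Suc k)
 show ?case by (rule Ck_SucI[where g = "%_ _. 0"]) (use Suc in auto)
qed (simp add: Ck_0)

lemma coord_cont: "continuous_on S (%x::nat => real. x A)"
 by (rule continuous_on_subset[OF continuous_on_product_coordinates]) simp

lemma Ck_coord: "bopen ds W ==> Ck_on ds k W (%x. x B)"
proof (induction k)
 case 0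
 then show ?case by (simp add: Ck_0 coord_cont)
next
 case (Suc k)
 have "((%t. (x(A := t)) B) has_real_derivative (if A = B then 1 else 0)) (at (x A))" for A x
  by (cases "A = B") auto
 then show ?case
  using Suc by (intro Ck_SucI[where g = "%A _. if A = B then 1 else 0"])
   (auto simp: coord_cont intro: Ck_const)
qed

lemma Ck_add: "bopen ds W ==> Ck_on ds k W f ==> Ck_on ds k W g ==> Ck_on ds k W (%x. f x + g x)"
proof (induction k arbitrary: f g)
 case 0
 then show ?case by (simp add: Ck_0 continuous_on_add)
next
 case (Suc k)
 show ?case
  unfolding Ck_Suc_iff[OF Suc.prems(1)]
 proof (intro conjI ballI)
  show "continuous_on W (%x. f x + g x)"
   using Ck_continuous[OF Suc.prems(1,2)] Ck_continuous[OF Suc.prems(1,3)] by (rule continuous_on_add)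
  fix A assume A: "A \<in> zpos ds"
  obtain f' where f: "Ck_on ds k W f'" "!!x. x \<in> W ==> pder A x f (f' x)"
   using Ck_Suc_ex[OF Suc.prems(1,2) A] by blast
  obtain g' where g: "Ck_on ds k W g'" "!!x. x \<in> W ==> pder A x g (g' x)"
   using Ck_Suc_ex[OF Suc.prems(1,3) A] by blast
  show "EX h. Ck_on ds k W h & (\<forall>x\<in>W. ((%t. f (x(A := t)) + g (x(A := t))) has_real_derivative h x) (at (x A)))"
   using Suc.IH[OF Suc.prems(1) f(1) g(1)] f(2) g(2)
   by (intro exI[of _ "%x. f' x + g' x"] conjI ballI DERIV_add) auto
 qed
qed

lemma Ck_mult: "bopen ds W ==> Ck_on ds k W f ==> Ck_on ds k W g ==> Ck_on ds k W (%x. f x * g x)"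
proof (induction k arbitrary: f g)
 case 0
 then show ?case by (simp add: Ck_0 continuous_on_mult)
next
 case (Suc k)
 show ?case
  unfolding Ck_Suc_iff[OF Suc.prems(1)]
 proof (intro conjI ballI)
  show "continuous_on W (%x. f x * g x)"
   using Ck_continuous[OF Suc.prems(1,2)] Ck_continuous[OF Suc.prems(1,3)] by (rule continuous_on_mult)
  fix A assume A: "A \<in> zpos ds"
  obtain f' where f: "Ck_on ds k W f'" "!!x. x \<in> W ==> pder A x f (f' x)"
   using Ck_Suc_ex[OF Suc.prems(1,2) A] by blast
  obtain g' where g: "Ck_on ds k W g'" "!!x. x \<in> W ==> pder A x g (g' x)"
   using Ck_Suc_ex[OF Suc.prems(1,3) A] by blast
  have "Ck_on ds k W (%x. f' x * g x + g' x * f x)"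
   by (intro Ck_add[OF Suc.prems(1)] Suc.IH[OF Suc.prems(1)] f(1) g(1)
     Ck_SucD[OF Suc.prems(1,2)] Ck_SucD[OF Suc.prems(1,3)])
  moreover have "((%t. f (x(A := t)) * g (x(A := t))) has_real_derivative f' x * g x + g' x * f x) (at (x A))" if "x \<in> W" for x
   using DERIV_mult[OF f(2)[OF that] g(2)[OF that]] by simp
  ultimately show "EX h. Ck_on ds k W h & (\<forall>x\<in>W. ((%t. f (x(A := t)) * g (x(A := t))) has_real_derivative h x) (at (x A)))"
   by (intro exI conjI ballI)
 qed
qed

lemma Ck_sum: "bopen ds W ==> (!!i. i \<in> I ==> Ck_on ds k W (f i)) ==> Ck_on ds k W (%x. \<Sum>i\<in>I. f i x)"
 by (induction I rule: infinite_finite_induct) (auto intro: Ck_const Ck_add)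

lemma Ck_inverse:
 "bopen ds W ==> Ck_on ds k W f ==> (!!x. x \<in> W ==> f x ~= 0) ==> Ck_on ds k W (%x. inverse (f x))"
proof (induction k)
 case 0
 then show ?case by (simp add: Ck_0 continuous_on_inverse)
next
 case (Suc k)
 show ?case
  unfolding Ck_Suc_iff[OF Suc.prems(1)]
 proof (intro conjI ballI)
  show "continuous_on W (%x. inverse (f x))"
   using Ck_continuous[OF Suc.prems(1,2)] Suc.prems(3) by (intro continuous_on_inverse) auto
  fix A assume A: "A \<in> zpos ds"
  obtain f' where f: "Ck_on ds k W f'" "!!x. x \<in> W ==> pder A x f (f' x)"
   using Ck_Suc_ex[OF Suc.prems(1,2) A] by blast
  have i: "Ck_on ds k W (%x. inverse (f x))"
   by (rule Suc.IH[OF Suc.prems(1) Ck_SucD[OF Suc.prems(1,2)] Suc.prems(3)])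
  have "Ck_on ds k W (%x. - 1 * (f' x * (inverse (f x) * inverse (f x))))"
   using Suc.prems(1) f(1) i by (intro Ck_mult Ck_const)
  moreover have "((%t. inverse (f (x(A := t)))) has_real_derivative - 1 * (f' x * (inverse (f x) * inverse (f x)))) (at (x A))" if "x \<in> W" for x
   using DERIV_inverse_fun[OF f(2)[OF that]] Suc.prems(3)[OF that] by (simp add: algebra_simps)
  ultimately show "EX h. Ck_on ds k W h & (\<forall>x\<in>W. ((%t. inverse (f (x(A := t)))) has_real_derivative h x) (at (x A)))"
   by (intro exI conjI ballI)
 qed
qed

subsection \<open>A flat function\<close>

text \<open>The power in front of the exponential makes the family closed under differentiation up
  to linear combinations, so that one induction for all \<open>m\<close> at once proves
  smoothness.\<close>

definition flat :: "nat => real => real" where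
 "flat m t = (if t <= 0 then 0 else inverse t ^ m * exp (- inverse t))"

lemma flat_nonpos [simp]: "t <= 0 ==> flat m t = 0"
 by (simp add: flat_def)

lemma flat_tendsto: "(flat m \<longlongrightarrow> 0) (at 0)"
proof (rule filterlim_split_at)
 have "((%t::real. 0) \<longlongrightarrow> 0) (at_left 0)" by simp
 then show "(flat m \<longlongrightarrow> 0) (at_left 0)"
  by (rule Lim_transform_eventually) (auto simp: flat_def eventually_at_filter)
 \<comment> \<open>With \<open>s = 1/t\<close> this is \<open>s ^ m / exp s\<close>, which tends to
   0 at infinity.\<close>
 have "((%t. inverse t ^ m / exp (inverse t)) \<longlongrightarrow> 0) (at_right (0::real))"
  by (rule filterlim_compose[OF tendsto_power_div_exp_0 filterlim_inverse_at_top_right])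
 then show "(flat m \<longlongrightarrow> 0) (at_right 0)"
  by (rule Lim_transform_eventually)
   (auto simp: flat_def eventually_at_filter exp_minus field_simps)
qed

lemma flat_deriv: "(flat m has_real_derivative (- real m * flat (Suc m) t + flat (Suc (Suc m)) t)) (at t)"
proof -
 consider "t < 0" | "t > 0" | "t = 0" by linarith
 then show ?thesis
 proof cases
  case 1
  then have ev: "eventually (%s. flat m s = 0) (nhds t)"
   using eventually_nhds_in_open[of "{..<0}" t] by (auto elim: eventually_mono)
  have "(flat m has_real_derivative 0) (at t)"
   by (rule iffD2[OF DERIV_cong_ev[OF refl ev refl] DERIV_const])
  then show ?thesis using 1 by simp
 next
  case 2
  then have "eventually (%s. flat m s = inverse s ^ m * exp (- inverse s)) (nhds t)"
   using eventually_nhds_in_open[of "{0<..}" t] by (auto simp: flat_def elim: eventually_mono)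
  moreover have "((%s. inverse s ^ m * exp (- inverse s)) has_real_derivative
    (- real m * flat (Suc m) t + flat (Suc (Suc m)) t)) (at t)"
  proof -
   have i: "(inverse has_real_derivative - (inverse t * inverse t)) (at t)"
    using DERIV_inverse[of t UNIV] 2 by (simp add: power2_eq_square)
   have e: "((%s. exp (- inverse s)) has_real_derivative exp (- inverse t) * (inverse t * inverse t)) (at t)"
    using DERIV_chain2[OF DERIV_exp DERIV_minus[OF i]] by simp
   have "((%s. inverse s ^ m) has_real_derivative real m * (- (inverse t * inverse t) * inverse t ^ (m - Suc 0))) (at t)"
    by (rule DERIV_power[OF i])
   from DERIV_mult[OF this e] have "((%s. inverse s ^ m * exp (- inverse s)) has_real_derivative
    real m * (- (inverse t * inverse t) * inverse t ^ (m - Suc 0)) * exp (- inverse t) +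
    exp (- inverse t) * (inverse t * inverse t) * inverse t ^ m) (at t)" .
   moreover have "real m * (- (inverse t * inverse t) * inverse t ^ (m - Suc 0)) * exp (- inverse t) +
    exp (- inverse t) * (inverse t * inverse t) * inverse t ^ m = - real m * flat (Suc m) t + flat (Suc (Suc m)) t"
    using 2 by (cases m) (simp_all add: flat_def algebra_simps)
   ultimately show ?thesis by (simp only:)
  qed
  ultimately show ?thesis by (rule iffD2[OF DERIV_cong_ev[OF refl _ refl]])
 next
  case 3
  \<comment> \<open>At 0 the difference quotient of \<open>flat m\<close> is
    \<open>flat (Suc m)\<close>.\<close>
  have "((%s. (flat m s - flat m 0) / (s - 0)) \<longlongrightarrow> 0) (at 0)"
   by (rule Lim_transform_eventually[OF flat_tendsto[of "Suc m"]])
    (auto simp: flat_def eventually_at_filter divide_inverse mult_ac)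
  then show ?thesis unfolding 3 has_field_derivative_iff by simp
 qed
qed

lemma Ck_flat: "bopen ds W ==> Ck_on ds k W w ==> Ck_on ds k W (%x. flat m (w x))"
proof (induction k arbitrary: m)
 have fc: "continuous_on UNIV (flat m)" for m
  using flat_deriv DERIV_isCont continuous_at_imp_continuous_on by blast
 {
  case 0
  then show ?case by (auto simp: Ck_0 intro: continuous_on_compose2[OF fc])
 next
  case (Suc k)
  show ?case
   unfolding Ck_Suc_iff[OF Suc.prems(1)]
  proof (intro conjI ballI)
   show "continuous_on W (%x. flat m (w x))"
    using Ck_continuous[OF Suc.prems] by (auto intro: continuous_on_compose2[OF fc])
   fix A assume A: "A \<in> zpos ds"
   obtain w' where w: "Ck_on ds k W w'" "!!x. x \<in> W ==> pder A x w (w' x)"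
    using Ck_Suc_ex[OF Suc.prems A] by blast
   note IH = Suc.IH[OF Suc.prems(1) Ck_SucD[OF Suc.prems]]
   have "Ck_on ds k W (%x. (- real m * flat (Suc m) (w x) + flat (Suc (Suc m)) (w x)) * w' x)"
    using Suc.prems(1) w(1) IH by (intro Ck_mult Ck_add Ck_const) auto
   moreover have "((%t. flat m (w (x(A := t)))) has_real_derivative
    (- real m * flat (Suc m) (w x) + flat (Suc (Suc m)) (w x)) * w' x) (at (x A))" if "x \<in> W" for x
    using DERIV_chain2[OF flat_deriv w(2)[OF that], of m] by simp
   ultimately show "EX h. Ck_on ds k W h & (\<forall>x\<in>W. ((%t. flat m (w (x(A := t)))) has_real_derivative h x) (at (x A)))"
    by (intro exI conjI ballI)
  qed
 }
qed

subsection \<open>The smooth calculus\<close>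

lemma smooth_intros:
 assumes W: "bopen ds W"
 shows smooth_const: "smooth_on ds W (%_. c)" and smooth_coord: "smooth_on ds W (%x. x B)"
  and smooth_add: "smooth_on ds W f ==> smooth_on ds W g ==> smooth_on ds W (%x. f x + g x)"
  and smooth_mult: "smooth_on ds W f ==> smooth_on ds W g ==> smooth_on ds W (%x. f x * g x)"
  and smooth_sum: "(!!i. i \<in> I ==> smooth_on ds W (h i)) ==> smooth_on ds W (%x. \<Sum>i\<in>I. h i x)"
  and smooth_inverse: "smooth_on ds W f ==> (!!x. x \<in> W ==> f x ~= 0) ==> smooth_on ds W (%x. inverse (f x))"
  and smooth_flat: "smooth_on ds W f ==> smooth_on ds W (%x. flat m (f x))"
 using W by (auto simp: smooth_on_def intro: Ck_const Ck_coord Ck_add Ck_mult Ck_sum Ck_inverse Ck_flat)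

lemma smooth_diff: "bopen ds W ==> smooth_on ds W f ==> smooth_on ds W g ==> smooth_on ds W (%x. f x - g x)"
 using smooth_add[of ds W f "%x. -1 * g x"] smooth_mult[OF _ smooth_const, of ds W g "-1"] by simp

lemma smooth_cong: "bopen ds W ==> smooth_on ds W f ==> (!!y. y \<in> W ==> f y = f' y) ==> smooth_on ds W f'"
 unfolding smooth_on_def by (intro allI, rule Ck_cong[of ds W f]) simp_all

lemma smooth_mono: "smooth_on ds W f ==> bopen ds W ==> bopen ds W' ==> W' <= W ==> smooth_on ds W' f"
 unfolding smooth_on_def by (intro allI, rule Ck_mono[of ds W W']) simp_all

lemma smooth_local:
 assumes "bopen ds W" "!!x. x \<in> W ==> EX W'. bopen ds W' & x \<in> W' & W' <= W & smooth_on ds W' f"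
 shows "smooth_on ds W f"
 unfolding smooth_on_def
proof
 fix k show "Ck_on ds k W f"
 proof (rule Ck_local[OF assms(1)])
  fix x assume "x \<in> W"
  from assms(2)[OF this] obtain W' where W': "bopen ds W'" "x \<in> W'" "W' <= W" "smooth_on ds W' f"
   by (elim exE conjE)
  have "Ck_on ds k W' f" using W'(4) unfolding smooth_on_def by (rule spec)
  with W'(1-3) show "EX W'. bopen ds W' & x \<in> W' & W' <= W & Ck_on ds k W' f"
   by (intro exI conjI)
 qed
qed

definition pd :: "nat => ((nat => real) => real) => (nat => real) => real" where
 "pd A f x = deriv (%t. f (x(A := t))) (x A)"

lemma smooth_pd:
 assumes W: "bopen ds W" and f: "smooth_on ds W f" and A: "A \<in> zpos ds"
 shows pd_smooth: "smooth_on ds W (pd A f)"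
  and pd_deriv: "x \<in> W ==> pder A x f (pd A f x)"
proof -
 have *: "Ck_on ds k W (pd A f) & (\<forall>x\<in>W. pder A x f (pd A f x))" for k
 proof -
  obtain g where g: "Ck_on ds k W g" "!!x. x \<in> W ==> pder A x f (g x)"
   using Ck_Suc_ex[OF W f[unfolded smooth_on_def, rule_format] A, of k] by blast
  have e: "g y = pd A f y" if "y \<in> W" for y using DERIV_imp_deriv[OF g(2)[OF that]] by (simp add: pd_def)
  have "pder A x f (pd A f x)" if "x \<in> W" for x
   using g(2)[OF that] unfolding e[OF that] .
  then show ?thesis using Ck_cong[OF W e g(1)] by blast
 qed
 then show "smooth_on ds W (pd A f)" "x \<in> W ==> pder A x f (pd A f x)"
  by (auto simp: smooth_on_def)
qed

lemma pd_eqI: "pder A x f D ==> pd A f x = D"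
 unfolding pd_def by (rule DERIV_imp_deriv)

subsection \<open>Hadamard's lemma\<close>

text \<open>Boxes are stable under moving one body coordinate towards that of \<open>a\<close>, as
  the integrals below require.\<close>

definition bbox :: "int list => (nat => real) => real => (nat => real) set" where
 "bbox ds a \<epsilon> = {x \<in> bpts ds. \<forall>A\<in>zpos ds. \<bar>x A - a A\<bar> < \<epsilon>}"

lemma bopen_Collect: "open T ==> bopen ds {x \<in> bpts ds. x \<in> T}"
 unfolding body_space_eq openin_open by auto

lemma box_open: "bopen ds (bbox ds a \<epsilon>)"
proof -
 have "open (\<Inter>A\<in>zpos ds. {x::nat => real. \<bar>x A - a A\<bar> < \<epsilon>})"
  by (intro open_INT ballI open_Collect_less continuous_intros coord_cont) auto
 from bopen_Collect[OF this, of ds] show ?thesis by (simp add: bbox_def)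
qed

lemma box_subset:
 assumes W: "bopen ds W" and a: "a \<in> W"
 obtains \<epsilon> where "\<epsilon> > 0" "bbox ds a \<epsilon> <= W" "a \<in> bbox ds a \<epsilon>"
proof -
 obtain T where T: "open T" "W = bpts ds Int T" using W unfolding body_space_eq openin_open by blast
 have "openin (product_topology (%_. euclideanreal) UNIV) T" using T(1) by (simp add: euclidean_product_topology)
 moreover have "a \<in> T" using a T by blast
 ultimately have "EX Y. finite {i \<in> UNIV. Y i ~= topspace euclideanreal} & (\<forall>i\<in>UNIV. openin euclideanreal (Y i)) &
   a \<in> Pi\<^sub>E UNIV Y & Pi\<^sub>E UNIV Y <= T"
  unfolding openin_product_topology_alt by (rule bspec)
 then obtain Y where Y: "!!i. open (Y i :: real set)" "a \<in> Pi\<^sub>E UNIV Y" "Pi\<^sub>E UNIV Y <= T"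
  by auto
 have "ALL i. EX e. e > 0 & ball (a i) e <= Y i"
 proof
  fix i
  have "a i \<in> Y i" using Y(2) by (simp add: PiE_iff)
  then show "EX e. e > 0 & ball (a i) e <= Y i" using Y(1)[of i] unfolding open_contains_ball by blast
 qed
 then obtain e where e: "!!i. e i > 0" "!!i. ball (a i) (e i) <= Y i" by metis
 \<comment> \<open>Outside \<open>zpos ds\<close> all points of the body agree, so only finitely
   many radii count; the 1 covers the case of no body coordinates.\<close>
 define \<epsilon> where "\<epsilon> = Min (insert 1 (e ` zpos ds))"
 have \<epsilon>: "\<epsilon> > 0" "!!A. A \<in> zpos ds ==> \<epsilon> <= e A" using e(1) by (auto simp: \<epsilon>_def)
 have ab: "a \<in> bpts ds" using a T by blast
 have "x \<in> W" if x: "x \<in> bbox ds a \<epsilon>" for x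
 proof -
  have "x i \<in> Y i" for i
  proof (cases "i \<in> zpos ds")
   case True
   then have "x i \<in> ball (a i) (e i)" using x \<epsilon>(2)[OF True] by (force simp: bbox_def dist_real_def)
   then show ?thesis using e(2) by blast
  next
   case False
   then have "x i = a i" using x ab by (auto simp: bbox_def bpts_def)
   then show ?thesis using Y(2) by (simp add: PiE_iff)
  qed
  then have "x \<in> Pi\<^sub>E UNIV Y" by (simp add: PiE_iff)
  then show ?thesis using Y(3) x T(2) by (auto simp: bbox_def)
 qed
 then show ?thesis using that[OF \<epsilon>(1)] ab \<epsilon>(1) by (auto simp: bbox_def)
qed

context
 fixes ds :: "int list" and a :: "nat => real" and \<epsilon> :: real and A :: nat
 assumes A: "A \<in> zpos ds" and a: "a \<in> bpts ds" and \<epsilon>: "\<epsilon> > 0"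
begin

abbreviation "Bx == bbox ds a \<epsilon>"

definition contract :: "real => (nat => real) => nat => real" where
 "contract t x = x(A := a A + t * (x A - a A))"

text \<open>For \<open>m = 0\<close> this is the integral in the classical proof of Hadamard's
  lemma. The weight \<open>t ^ m\<close> is there because differentiating in direction
  \<open>A\<close> brings out a factor \<open>t\<close>.\<close>

definition mean :: "nat => ((nat => real) => real) => (nat => real) => real" where
 "mean m f x = integral (cbox 0 1) (%t. t ^ m * f (contract t x))"

lemma contract_box: "x \<in> Bx ==> t \<in> cbox 0 1 ==> contract t x \<in> Bx"
proof -
 assume x: "x \<in> Bx" and t: "t \<in> cbox 0 1"
 have "\<bar>t * (x A - a A)\<bar> <= \<bar>x A - a A\<bar>" using t by (auto simp: abs_mult intro: mult_left_le_one_le)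
 then have "\<bar>t * (x A - a A)\<bar> < \<epsilon>" using x A by (force simp: bbox_def)
 then show ?thesis using x A by (auto simp: bbox_def contract_def bpts_def)
qed

lemma continuous_contract: "continuous_on S (%p. contract (snd p) (fst p))"
 unfolding contract_def
proof (rule continuous_on_coordinatewise_then_product)
 have c: "continuous_on S (%p::(nat => real) \<times> real. fst p i)" for i
  by (rule continuous_on_compose2[OF coord_cont[of UNIV] continuous_on_fst[OF continuous_on_id]]) auto
 show "continuous_on S (%p. ((fst p)(A := a A + snd p * (fst p A - a A))) i)" for i
  using c by (cases "i = A") (auto intro!: continuous_intros)
qed

lemma continuous_integrand:
 assumes f: "continuous_on Bx f"
 shows "continuous_on (Bx \<times> cbox 0 1) (%(x, t). t ^ m * f (contract t x))"
proof -
 have "continuous_on (Bx \<times> cbox 0 1) (%p. f (contract (snd p) (fst p)))"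
  by (rule continuous_on_compose2[OF f continuous_contract]) (use contract_box in auto)
 then show ?thesis unfolding case_prod_unfold by (auto intro!: continuous_intros)
qed

lemma mean_continuous:
 assumes f: "continuous_on Bx f"
 shows "continuous_on Bx (mean m f)"
 unfolding mean_def[abs_def] by (rule integral_continuous_on_param[OF continuous_integrand[OF f]])

lemma upd_box: "x \<in> Bx ==> A' \<in> zpos ds ==> s \<in> {a A' - \<epsilon><..<a A' + \<epsilon>} ==> x(A' := s) \<in> Bx"
 by (auto simp: bbox_def bpts_def)

text \<open>By differentiation under the integral sign, a partial derivative of
  \<open>mean m f\<close> is \<open>mean m' g\<close> for the corresponding partial derivative
  \<open>g\<close> of \<open>f\<close>, with one more power of \<open>t\<close> exactly in direction
  \<open>A\<close>; hence the induction for all \<open>m\<close> at once.\<close>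

lemma Ck_mean: "Ck_on ds k Bx f ==> Ck_on ds k Bx (mean m f)"
proof (induction k arbitrary: f m)
 case 0
 then show ?case using mean_continuous by (simp add: Ck_0 box_open)
next
 case (Suc k)
 note cf = Ck_continuous[OF box_open Suc.prems]
 show ?case
  unfolding Ck_Suc_iff[OF box_open]
 proof (intro conjI ballI mean_continuous cf)
  fix A' assume A': "A' \<in> zpos ds"
  obtain g where g: "Ck_on ds k Bx g" "!!x. x \<in> Bx ==> ((%t. f (x(A' := t))) has_real_derivative g x) (at (x A'))"
   using Ck_Suc_ex[OF box_open Suc.prems A'] by blast
  define m' where "m' = (if A' = A then Suc m else m)"
  have "((%s. mean m f (x(A' := s))) has_real_derivative mean m' g x) (at (x A'))" if x: "x \<in> Bx" for x
  proof -
   let ?U = "{a A' - \<epsilon><..<a A' + \<epsilon>}"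
   have xU: "x A' \<in> ?U" using x A' by (force simp: bbox_def)
   have der: "((%s. t ^ m * f (contract t (x(A' := s)))) has_real_derivative t ^ m' * g (contract t (x(A' := s)))) (at s within ?U)"
    if s: "s \<in> ?U" and t: "t \<in> cbox 0 1" for s t
   proof -
    define y where "y = contract t (x(A' := s))"
    have y: "y \<in> Bx" unfolding y_def by (rule contract_box[OF upd_box[OF x A' s] t])
    have "((%s. f (contract t (x(A' := s)))) has_real_derivative (if A' = A then t else 1) * g y) (at s)"
    proof (cases "A' = A")
     case True
     have e: "contract t (x(A' := s')) = y(A' := a A + t * (s' - a A))" for s' by (simp add: contract_def True y_def)
     have yA: "y A' = a A + t * (s - a A)" by (simp add: contract_def True y_def)
     have "((%s'. a A + t * (s' - a A)) has_real_derivative t) (at s)" by (auto intro!: derivative_eq_intros)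
     from DERIV_chain2[OF g(2)[OF y, unfolded yA] this] show ?thesis
      unfolding e by (simp add: True mult.commute)
    next
     case False
     have e: "contract t (x(A' := s')) = y(A' := s')" for s' using False by (simp add: contract_def y_def fun_eq_iff)
     have yA: "y A' = s" using False by (simp add: contract_def y_def)
     from g(2)[OF y, unfolded yA] show ?thesis unfolding e using False by simp
    qed
    from DERIV_cmult[OF this, of "t ^ m"] have "((%s. t ^ m * f (contract t (x(A' := s)))) has_real_derivative t ^ m' * g y) (at s)"
     by (simp add: m'_def mult_ac split: if_splits)
    then show ?thesis unfolding y_def by (rule has_field_derivative_at_within)
   qed
   have ic: "continuous_on (?U \<times> cbox 0 1) (%(s, t). t ^ n * h (contract t (x(A' := s))))" if h: "continuous_on Bx h" for n h
   proof -
    have c1: "continuous_on (?U \<times> cbox 0 1) (%p. (x(A' := fst p), snd p))"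
     by (intro continuous_on_Pair continuous_on_compose2[OF continuous_line continuous_on_fst[OF continuous_on_id]]
       continuous_on_snd continuous_on_id) auto
    have c2: "(%p. (x(A' := fst p), snd p)) ` (?U \<times> cbox 0 1) <= Bx \<times> cbox 0 1"
     using upd_box[OF x A'] by auto
    show ?thesis
     using continuous_on_compose2[OF continuous_integrand[OF h, of n] c1 c2] by (simp add: case_prod_unfold)
   qed
   have "((%s. integral (cbox 0 1) (%t. t ^ m * f (contract t (x(A' := s))))) has_field_derivative
     integral (cbox 0 1) (%t. t ^ m' * g (contract t (x(A' := x A'))))) (at (x A') within ?U)"
   proof (rule leibniz_rule_field_derivative[OF der _ ic[OF Ck_continuous[OF box_open g(1)]] xU])
    fix s assume s: "s \<in> ?U"
    have c1: "continuous_on (cbox 0 1) (%t::real. (s, t))" by (intro continuous_intros)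
    have c2: "(%t::real. (s, t)) ` cbox 0 1 <= ?U \<times> cbox 0 1" using s by auto
    show "(%t. t ^ m * f (contract t (x(A' := s)))) integrable_on cbox 0 1"
     using continuous_on_compose2[OF ic[OF cf, of m] c1 c2] unfolding prod.case by (rule integrable_continuous)
   qed (assumption | simp)+
   then show ?thesis using at_within_open[OF xU] by (simp add: mean_def)
  qed
  then show "EX g. Ck_on ds k Bx g & (\<forall>x\<in>Bx. ((%t. mean m f (x(A' := t))) has_real_derivative g x) (at (x A')))"
   by (intro exI[of _ "mean m' g"] conjI ballI Suc.IH[OF g(1)])
 qed
qed

text \<open>The fundamental theorem of calculus along the segment that moves only the coordinate
  \<open>A\<close>; the quotient is \<open>mean 0\<close> of the partial derivative.\<close>

lemma hadamard_step:
 assumes f: "smooth_on ds Bx f"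
 shows "EX q. smooth_on ds Bx q & (\<forall>x\<in>Bx. f x - f (x(A := a A)) = (x A - a A) * q x)"
proof (intro exI conjI ballI)
 let ?g = "pd A f"
 note g = smooth_pd[OF box_open f A]
 show "smooth_on ds Bx (mean 0 ?g)" using Ck_mean g(1) by (auto simp: smooth_on_def)
 fix x assume x: "x \<in> Bx"
 have der: "((%t. f (contract t x)) has_vector_derivative (x A - a A) * ?g (contract t x)) (at t within {0..1})" if t: "t \<in> {0..1}" for t
 proof -
  define y where "y = contract t x"
  have y: "y \<in> Bx" unfolding y_def using contract_box x t by auto
  have e: "contract s x = y(A := a A + s * (x A - a A))" for s by (simp add: contract_def y_def)
  have yA: "y A = a A + t * (x A - a A)" by (simp add: contract_def y_def)
  have "((%s. a A + s * (x A - a A)) has_real_derivative (x A - a A)) (at t)" by (auto intro!: derivative_eq_intros)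
  from DERIV_chain2[OF g(2)[OF y, unfolded yA] this]
  have "((%s. f (contract s x)) has_real_derivative ?g y * (x A - a A)) (at t)" unfolding e .
  then show ?thesis unfolding y_def
   by (simp add: mult.commute has_real_derivative_iff_has_vector_derivative has_vector_derivative_at_within)
 qed
 have "((%t. (x A - a A) * ?g (contract t x)) has_integral f (contract 1 x) - f (contract 0 x)) {0..1}"
  by (rule fundamental_theorem_of_calculus[OF _ der]) auto
 then have "f (contract 1 x) - f (contract 0 x) = integral {0..1} (%t. (x A - a A) * ?g (contract t x))"
  by (rule integral_unique[symmetric])
 also have "\<dots> = (x A - a A) * mean 0 ?g x" by (simp add: mean_def)
 finally show "f x - f (x(A := a A)) = (x A - a A) * mean 0 ?g x" by (simp add: contract_def)
qed

end

text \<open>The coordinates are frozen at \<open>a\<close> one after another, and the differences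
  telescope.\<close>

lemma hadamard_box:
 assumes a: "a \<in> bpts ds" and \<epsilon>: "\<epsilon> > 0" and f: "smooth_on ds (bbox ds a \<epsilon>) f"
 shows "EX g. (ALL A. smooth_on ds (bbox ds a \<epsilon>) (g A)) &
  (\<forall>x\<in>bbox ds a \<epsilon>. f x - f a = (\<Sum>A\<in>zpos ds. (x A - a A) * g A x))"
proof -
 let ?B = "bbox ds a \<epsilon>"
 have "EX g. (ALL A. smooth_on ds ?B (g A)) &
  (\<forall>x\<in>?B. f x - f (%i. if i \<in> T then a i else x i) = (\<Sum>A\<in>T. (x A - a A) * g A x))"
  if "T <= zpos ds" "smooth_on ds ?B f" for T f
 proof -
  have "finite T" using that finite_subset finite_zpos by blast
  then show ?thesis using that
  proof (induction T arbitrary: f)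
   case empty
   then show ?case by (intro exI[of _ "%_ _. 0"]) (simp add: smooth_const box_open)
  next
   case (insert A T)
   have A: "A \<in> zpos ds" using insert by blast
   obtain q where q: "smooth_on ds ?B q" "!!x. x \<in> ?B ==> f x - f (x(A := a A)) = (x A - a A) * q x"
    using hadamard_step[OF A a \<epsilon> insert.prems(2)] by blast
   have "smooth_on ds ?B (%x. f x - (x A - a A) * q x)"
    by (intro smooth_diff smooth_mult smooth_coord smooth_const box_open insert.prems q(1))
   then have "smooth_on ds ?B (%x. f (x(A := a A)))"
    by (rule smooth_cong[OF box_open]) (use q(2) in force)
   then obtain g where g: "!!A. smooth_on ds ?B (g A)"
    "!!x. x \<in> ?B ==> f (x(A := a A)) - f ((%i. if i \<in> T then a i else x i)(A := a A)) = (\<Sum>A\<in>T. (x A - a A) * g A x)"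
    using insert.IH[of "%x. f (x(A := a A))"] insert.prems(1) by blast
   have u: "(%i. if i \<in> T then a i else x i)(A := a A) = (%i. if i \<in> insert A T then a i else x i)" for x :: "nat => real"
    by (auto simp: fun_eq_iff)
   show ?case
   proof (intro exI[of _ "g(A := q)"] conjI allI ballI)
    show "smooth_on ds ?B ((g(A := q)) A')" for A' using g(1) q(1) by simp
    fix x assume x: "x \<in> ?B"
    have "(\<Sum>A'\<in>insert A T. (x A' - a A') * (g(A := q)) A' x) = (x A - a A) * q x + (\<Sum>A'\<in>T. (x A' - a A') * g A' x)"
     using insert.hyps by (auto intro!: sum.cong)
    then show "f x - f (%i. if i \<in> insert A T then a i else x i) = (\<Sum>A'\<in>insert A T. (x A' - a A') * (g(A := q)) A' x)"
     using g(2)[OF x] q(2)[OF x] unfolding u by simp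
   qed
  qed
 qed
 from this[OF subset_refl f] obtain g where g: "!!A. smooth_on ds ?B (g A)"
  "!!x. x \<in> ?B ==> f x - f (%i. if i \<in> zpos ds then a i else x i) = (\<Sum>A\<in>zpos ds. (x A - a A) * g A x)" by blast
 have "(%i. if i \<in> zpos ds then a i else x i) = a" if "x \<in> ?B" for x
  using that a by (auto simp: bbox_def bpts_def fun_eq_iff)
 then show ?thesis using g by (intro exI[of _ g]) auto
qed

text \<open>
 As \<open>W\<close> need not be star-shaped, the decomposition on a box around \<open>a\<close>, damped by the flat
 function \<open>\<rho>\<close>, is combined with \<open>u f = \<Sum> (x\<^sub>A - a\<^sub>A) ((x\<^sub>A - a\<^sub>A) f)\<close>, where \<open>u\<close> is the squared distance
 to \<open>a\<close>: the function \<open>\<rho> + u\<close> has no zeros.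
\<close>

lemma hadamard:
 assumes W: "bopen ds W" and a: "a \<in> W" and f: "smooth_on ds W f" and fa: "f a = 0"
 shows "EX h. (ALL A. smooth_on ds W (h A)) & (\<forall>x\<in>W. f x = (\<Sum>A\<in>zpos ds. (x A - a A) * h A x))"
proof -
 obtain \<epsilon> where \<epsilon>: "\<epsilon> > 0" "bbox ds a \<epsilon> <= W" "a \<in> bbox ds a \<epsilon>" by (rule box_subset[OF W a])
 let ?B = "bbox ds a \<epsilon>"
 have ab: "a \<in> bpts ds" using bopen_subset[OF W] a by blast
 obtain g where g: "!!A. smooth_on ds ?B (g A)" "!!x. x \<in> ?B ==> f x = (\<Sum>A\<in>zpos ds. (x A - a A) * g A x)"
  using hadamard_box[OF ab \<epsilon>(1) smooth_mono[OF f W box_open \<epsilon>(2)]] fa by auto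
 \<comment> \<open>Any \<open>r\<close> with \<open>0 < r < \<epsilon> * \<epsilon>\<close> would
   do: \<open>\<rho>\<close> is positive at \<open>a\<close> and vanishes where
   \<open>u \<ge> r\<close>, in particular on \<open>W\<close> outside the box.\<close>
 define r where "r = (\<epsilon> / 2)\<^sup>2"
 define u where "u x = (\<Sum>A\<in>zpos ds. (x A - a A) * (x A - a A))" for x :: "nat => real"
 define \<rho> where "\<rho> x = flat 0 (r - u x)" for x
 have us: "smooth_on ds V u" if "bopen ds V" for V
  unfolding u_def[abs_def] using that by (intro smooth_sum smooth_mult smooth_diff smooth_coord smooth_const)
 have \<rho>s: "smooth_on ds V \<rho>" if "bopen ds V" for V
  unfolding \<rho>_def[abs_def] using that us by (intro smooth_flat smooth_diff smooth_const)
 have r0: "r > 0" using \<epsilon> by (simp add: r_def)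
 have u_ge: "\<epsilon> * \<epsilon> <= u x" if x: "x \<in> W" "x \<notin> ?B" for x
 proof -
  obtain A where A: "A \<in> zpos ds" "\<epsilon> <= \<bar>x A - a A\<bar>"
   using x bopen_subset[OF W] by (auto simp: bbox_def not_less)
  have "\<epsilon> * \<epsilon> <= \<bar>x A - a A\<bar> * \<bar>x A - a A\<bar>" using A \<epsilon> by (intro mult_mono) auto
  also have "\<dots> = (x A - a A) * (x A - a A)" by simp
  also have "\<dots> <= u x" unfolding u_def using A by (intro member_le_sum) auto
  finally show ?thesis .
 qed
 have r_less: "r < \<epsilon> * \<epsilon>" using \<epsilon> by (simp add: r_def power2_eq_square)
 define G where "G A x = (if x \<in> ?B then \<rho> x * g A x else 0)" for A x
 have \<rho>0: "\<rho> x = 0" if "u x \<ge> r" for x using that by (simp add: \<rho>_def flat_def)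
 have Gs: "smooth_on ds W (G A)" for A
 proof (rule smooth_local[OF W])
  fix x assume x: "x \<in> W"
  show "EX W'. bopen ds W' & x \<in> W' & W' <= W & smooth_on ds W' (G A)"
  proof (cases "x \<in> ?B")
   case True
   have "smooth_on ds ?B (%x. \<rho> x * g A x)" by (intro smooth_mult box_open \<rho>s g(1))
   then have "smooth_on ds ?B (G A)" by (rule smooth_cong[OF box_open]) (simp add: G_def)
   then show ?thesis using True box_open \<epsilon>(2) by blast
  next
   case False
   \<comment> \<open>Around a point outside the box the damped function is identically zero on the
     open set where \<open>u\<close> exceeds \<open>r\<close>.\<close>
   let ?W = "W Int {x \<in> bpts ds. x \<in> {x. r < u x}}"
   have "open {x. r < u x}"
    unfolding u_def by (intro open_Collect_less continuous_intros coord_cont)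
   then have o: "bopen ds ?W" by (intro openin_Int W bopen_Collect)
   have "smooth_on ds ?W (G A)"
    by (rule smooth_cong[OF o smooth_const[OF o, of 0]]) (auto simp: G_def \<rho>0)
   moreover have "x \<in> ?W" using u_ge[OF x False] r_less x bopen_subset[OF W] by auto
   ultimately show ?thesis using o by blast
  qed
 qed
 have D: "\<rho> x + u x ~= 0" if x: "x \<in> W" for x
 proof (cases "u x = 0")
  case True
  then show ?thesis using r0 by (simp add: \<rho>_def flat_def)
 next
  case False
  have "u x \<ge> 0" unfolding u_def by (intro sum_nonneg) simp
  moreover have "\<rho> x \<ge> 0" by (simp add: \<rho>_def flat_def)
  ultimately show ?thesis using False by linarith
 qed
 define h where "h A x = (G A x + (x A - a A) * f x) * inverse (\<rho> x + u x)" for A x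
 have "smooth_on ds W (h A)" for A
  unfolding h_def[abs_def]
  by (intro smooth_mult smooth_add smooth_inverse smooth_diff smooth_coord smooth_const W Gs f \<rho>s us D)
 moreover have "f x = (\<Sum>A\<in>zpos ds. (x A - a A) * h A x)" if x: "x \<in> W" for x
 proof -
  have "(\<Sum>A\<in>zpos ds. (x A - a A) * G A x) = \<rho> x * f x"
  proof (cases "x \<in> ?B")
   case True
   then have "\<rho> x * f x = (\<Sum>A\<in>zpos ds. \<rho> x * ((x A - a A) * g A x))" by (simp add: g(2) sum_distrib_left)
   then show ?thesis using True by (simp add: G_def algebra_simps)
  next
   case False
   then have "\<rho> x = 0" using u_ge[OF x False] r_less \<rho>0 by simp
   then show ?thesis using False by (simp add: G_def)
  qed
  moreover have "(\<Sum>A\<in>zpos ds. (x A - a A) * ((x A - a A) * f x)) = u x * f x"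
   unfolding u_def sum_distrib_right by (simp add: mult.assoc)
  moreover have "(\<Sum>A\<in>zpos ds. (x A - a A) * h A x) =
   ((\<Sum>A\<in>zpos ds. (x A - a A) * G A x) + (\<Sum>A\<in>zpos ds. (x A - a A) * ((x A - a A) * f x))) * inverse (\<rho> x + u x)"
   unfolding h_def sum.distrib[symmetric] sum_distrib_right by (rule sum.cong) (simp_all add: algebra_simps)
  ultimately have "(\<Sum>A\<in>zpos ds. (x A - a A) * h A x) = (\<rho> x * f x + u x * f x) * inverse (\<rho> x + u x)"
   by (simp only:)
  also have "\<dots> = f x" using D[OF x] unfolding distrib_right[symmetric] by simp
  finally show ?thesis ..
 qed
 ultimately show ?thesis by blast
qed


section \<open>The model sheaf\<close>

lemma koszul_0 [simp]: "koszul 0 = 1"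
 and koszul_add: "koszul (a + b) = koszul a * koszul b"
 and koszul_square [simp]: "koszul a * koszul a = 1"
 and koszul_minus [simp]: "koszul (- a) = koszul a"
 and koszul_diff: "koszul (a - b) = koszul a * koszul b"
 by (auto simp: koszul_def)

section \<open>Multi-indices and the signs of monomials\<close>

definition unit_mi :: "nat => nat => nat" where
 "unit_mi A = (%_. 0)(A := 1)"

lemma unit_mi_simps [simp]: "unit_mi A A = 1" "B ~= A ==> unit_mi A B = 0"
 by (simp_all add: unit_mi_def)

abbreviation mplus :: "(nat => nat) => (nat => nat) => nat => nat" (infixl \<open>+.\<close> 65) where
 "I +. J == %A. I A + J A"

abbreviation mminus :: "(nat => nat) => (nat => nat) => nat => nat" (infixl \<open>-.\<close> 65) where
 "I -. J == %A. I A - J A"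

definition below :: "(nat => nat) => (nat => nat) set" where
 "below K = {I. ALL A. I A <= K A}"

context
 fixes ds :: "int list"
begin

abbreviation "sg == monomial_sign ds"
abbreviation "mi == multiindices ds"

lemma sg_plus_left: "sg (I +. I') J = sg I J * sg I' J"
 unfolding monomial_sign_def koszul_add[symmetric] sum.distrib[symmetric]
 by (simp add: algebra_simps)

lemma sg_plus_right: "sg I (J +. J') = sg I J * sg I J'"
 unfolding monomial_sign_def koszul_add[symmetric] sum.distrib[symmetric]
 by (simp add: algebra_simps)

lemma sg_zero [simp]: "sg (%_. 0) J = 1" "sg J (%_. 0) = 1"
 by (simp_all add: monomial_sign_def)

lemma sg_square [simp]: "sg I J * sg I J = 1"
 by (simp add: monomial_sign_def)

text \<open>The first sign counts the letters of \<open>I\<close> after position \<open>A\<close>,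
  the second those before it. Together these are all letters except the ones at \<open>A\<close>,
  whence the subtracted term.\<close>

lemma sg_swap:
 assumes A: "A < length ds"
 shows "sg I (unit_mi A) * sg (unit_mi A) I = koszul (ds ! A * (mi_degree ds I - int (I A) * ds ! A))"
proof -
 let ?d = "(!) ds" and ?n = "length ds"
 have 1: "(\<Sum>A'<?n. \<Sum>B<A'. (int (I A') * ?d A') * (int (unit_mi A B) * ?d B)) = (\<Sum>A'<?n. if A < A' then int (I A') * ?d A' * ?d A else 0)"
 proof (rule sum.cong[OF refl])
  fix A'
  have "(\<Sum>B<A'. (int (I A') * ?d A') * (int (unit_mi A B) * ?d B)) = (\<Sum>B<A'. if B = A then int (I A') * ?d A' * ?d A else 0)"
   by (rule sum.cong) (auto simp: unit_mi_def)
  then show "(\<Sum>B<A'. (int (I A') * ?d A') * (int (unit_mi A B) * ?d B)) = (if A < A' then int (I A') * ?d A' * ?d A else 0)"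
   by (simp add: sum.delta)
 qed
 have 2: "(\<Sum>A'<?n. \<Sum>B<A'. (int (unit_mi A A') * ?d A') * (int (I B) * ?d B)) = (\<Sum>B<?n. if B < A then int (I B) * ?d B * ?d A else 0)"
 proof -
  have "(\<Sum>A'<?n. \<Sum>B<A'. (int (unit_mi A A') * ?d A') * (int (I B) * ?d B)) = (\<Sum>A'<?n. if A' = A then (\<Sum>B<A. ?d A * (int (I B) * ?d B)) else 0)"
   by (rule sum.cong) (auto simp: unit_mi_def)
  also have "\<dots> = (\<Sum>B<A. ?d A * (int (I B) * ?d B))" using A by (simp add: sum.delta)
  also have "\<dots> = (\<Sum>B\<in>{..<?n} Int {B. B < A}. int (I B) * ?d B * ?d A)"
   using A by (intro sum.cong) auto
  also have "\<dots> = (\<Sum>B<?n. if B < A then int (I B) * ?d B * ?d A else 0)"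
   by (simp add: sum.inter_restrict)
  finally show ?thesis .
 qed
 have "(\<Sum>A'<?n. if A < A' then int (I A') * ?d A' * ?d A else 0) + (\<Sum>B<?n. if B < A then int (I B) * ?d B * ?d A else 0)
  = (\<Sum>B<?n. int (I B) * ?d B * ?d A) - (\<Sum>B<?n. if B = A then int (I B) * ?d B * ?d A else 0)"
  unfolding sum.distrib[symmetric] sum_subtractf[symmetric] by (rule sum.cong) auto
 also have "\<dots> = ?d A * (mi_degree ds I - int (I A) * ?d A)"
  using A by (simp add: sum.delta mi_degree_def sum_distrib_left sum_distrib_right algebra_simps)
 finally show ?thesis unfolding monomial_sign_def koszul_add[symmetric] 1 2 by simp
qed

lemma mi_below: "K \<in> mi ==> I \<in> below K ==> I \<in> mi"
 unfolding multiindices_def below_def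
proof clarsimp
 assume K: "\<forall>A\<ge>length ds. K A = 0" "\<forall>A<length ds. odd (ds ! A) --> K A = 0 \<or> K A = Suc 0" and I: "ALL A. I A <= K A"
 show "(\<forall>A\<ge>length ds. I A = 0) & (\<forall>A<length ds. odd (ds ! A) --> I A = 0 \<or> I A = Suc 0)"
 proof (intro conjI allI impI)
  show "I A = 0" if "length ds <= A" for A using K(1) I that by (metis le_zero_eq)
  show "I A = 0 \<or> I A = Suc 0" if "A < length ds" "odd (ds ! A)" for A
  proof -
   have "K A <= 1" using K(2) that by fastforce
   then have "I A <= 1" using I le_trans by blast
   then show ?thesis by linarith
  qed
 qed
qed

lemma finite_below: "K \<in> mi ==> finite (below K)"
proof -
 assume K: "K \<in> mi"
 have "below K <= {f. ALL x. (x \<in> {..<length ds} --> f x \<in> {..(\<Sum>A<length ds. K A)}) & (x \<notin> {..<length ds} --> f x = 0)}"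
 proof
  fix I assume I: "I \<in> below K"
  have "I x <= (\<Sum>A<length ds. K A)" if "x < length ds" for x
  proof -
   have "I x <= K x" using I by (simp add: below_def)
   also have "\<dots> <= (\<Sum>A<length ds. K A)" using that by (intro member_le_sum) auto
   finally show ?thesis .
  qed
  moreover have "I x = 0" if "\<not> x < length ds" for x
   using mi_below[OF K I] that by (simp add: multiindices_def)
  ultimately show "I \<in> {f. ALL x. (x \<in> {..<length ds} --> f x \<in> {..(\<Sum>A<length ds. K A)}) & (x \<notin> {..<length ds} --> f x = 0)}" by simp
 qed
 then show ?thesis by (rule finite_subset) (rule finite_set_of_finite_funs; simp)
qed

lemma below_diff: "I \<in> below K ==> K -. I \<in> below K" "I \<in> below K ==> I +. (K -. I) = K"
 by (auto simp: below_def)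

lemma degree_plus: "mi_degree ds (I +. J) = mi_degree ds I + mi_degree ds J"
 by (simp add: mi_degree_def sum.distrib algebra_simps)

lemma weight_plus: "mi_weight ds (I +. J) = mi_weight ds I + mi_weight ds J"
 by (simp add: mi_weight_def sum.distrib)

lemma degree_unit: "A < length ds ==> mi_degree ds (unit_mi A) = ds ! A"
proof -
 assume A: "A < length ds"
 have "mi_degree ds (unit_mi A) = (\<Sum>B<length ds. if B = A then ds ! A else 0)"
  unfolding mi_degree_def by (rule sum.cong) (auto simp: unit_mi_def)
 then show ?thesis using A by (simp add: sum.delta)
qed

abbreviation "mdl == model_sheaf ds"
abbreviation "msec W j == sect mdl W j"

lemma msec_iff: "f \<in> msec W j \<longleftrightarrow> (ALL I. I \<notin> series_indices ds j --> f I = (%_. 0)) &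
 (\<forall>I\<in>series_indices ds j. smooth_on ds W (f I) & (ALL x. x \<notin> W --> f I x = 0))"
 by (simp add: model_sheaf_def)

lemma model_simps:
 "f \<oplus>[sec mdl W j] g = (%I x. f I x + g I x)" "r \<odot>[sec mdl W j] f = (%I x. r * f I x)"
 "\<zero>[sec mdl W j] = (%I x. 0)"
 "res mdl W W' j f = (%I x. if x \<in> W' then f I x else 0)"
 "gunit mdl W = (%I x. if I = (%_. 0) & x \<in> W then 1 else 0)"
 by (simp_all add: model_sheaf_def)

lemma gmul_model: "gmul mdl W i j f g K x =
 (if K \<in> mi then (\<Sum>I\<in>below K. sg I (K -. I) * f I x * g (K -. I) x) else 0)"
 by (simp add: model_sheaf_def below_def)

lemma msecD:
 assumes "f \<in> msec W j"
 shows "I \<notin> series_indices ds j ==> f I x = 0" "x \<notin> W ==> f I x = 0"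
proof -
 show "I \<notin> series_indices ds j ==> f I x = 0" using assms unfolding msec_iff by simp
 then show "x \<notin> W ==> f I x = 0" using assms unfolding msec_iff by blast
qed

lemma msec_smooth: "bopen ds W ==> f \<in> msec W j ==> smooth_on ds W (f I)"
 unfolding msec_iff using smooth_const[of ds W 0] by (cases "I \<in> series_indices ds j") auto

lemma msecI:
 assumes "!!I x. I \<notin> series_indices ds j ==> f I x = 0" "!!I. I \<in> series_indices ds j ==> smooth_on ds W (f I)"
  "!!I x. x \<notin> W ==> f I x = 0"
 shows "f \<in> msec W j"
 unfolding msec_iff using assms by auto

lemma series_mi: "I \<in> series_indices ds j ==> I \<in> mi" "I \<in> series_indices ds j ==> mi_degree ds I = j"
 by (simp_all add: series_indices_def)

lemma series_below:
 assumes K: "K \<in> series_indices ds j" and I: "I \<in> below K"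
 shows "I \<in> series_indices ds (mi_degree ds I)"
proof -
 have "I A = 0" if "A < length ds" "ds ! A = 0" for A
 proof -
  have "K A = 0" using K that by (simp add: series_indices_def)
  moreover have "I A <= K A" using I by (simp add: below_def)
  ultimately show ?thesis by simp
 qed
 then show ?thesis using mi_below[OF series_mi(1)[OF K] I] by (simp add: series_indices_def)
qed

lemma series_plus:
 assumes "I \<in> series_indices ds i" "J \<in> series_indices ds j" "I +. J \<in> mi"
 shows "I +. J \<in> series_indices ds (i + j)"
 using assms unfolding series_indices_def by (simp add: degree_plus)

lemma zero_mi: "(%_. 0) \<in> mi" "(%_. 0) \<in> series_indices ds 0"
 by (simp_all add: multiindices_def series_indices_def mi_degree_def)

lemma msec_add: "bopen ds W ==> f \<in> msec W j ==> g \<in> msec W j ==> (%I x. f I x + g I x) \<in> msec W j"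
 by (rule msecI) (simp_all add: msecD smooth_add msec_smooth)

lemma msec_smult: "bopen ds W ==> f \<in> msec W j ==> (%I x. r * f I x) \<in> msec W j"
 by (rule msecI) (simp_all add: msecD smooth_mult smooth_const msec_smooth)

lemma msec_zero: "bopen ds W ==> (%I x. 0) \<in> msec W j"
 by (rule msecI) (simp_all add: smooth_const)

lemma msec_gunit: "bopen ds W ==> gunit mdl W \<in> msec W 0"
 unfolding model_simps
proof (rule msecI)
 fix I assume W: "bopen ds W"
 show "smooth_on ds W (%x. if I = (%_. 0) & x \<in> W then 1 else 0)"
  by (rule smooth_cong[OF W smooth_const[OF W, of "if I = (%_. 0) then 1 else 0"]]) auto
qed (use zero_mi in auto)

lemma msec_body: "bopen ds W ==> smooth_on ds W h ==> (%I x. if I = (%_. 0) & x \<in> W then h x else 0) \<in> msec W 0"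
proof (rule msecI)
 fix I assume W: "bopen ds W" and h: "smooth_on ds W h"
 show "smooth_on ds W (%x. if I = (%_. 0) & x \<in> W then h x else 0)"
  by (cases "I = (%_. 0)") (auto intro: smooth_cong[OF W h] smooth_const[OF W])
qed (use zero_mi in auto)

lemma msec_gmul:
 assumes W: "bopen ds W" and f: "f \<in> msec W i" and g: "g \<in> msec W j"
 shows "gmul mdl W i j f g \<in> msec W (i + j)"
proof (rule msecI)
 fix K x assume K: "K \<notin> series_indices ds (i + j)"
 have "f I x * g (K -. I) x = 0" if KI: "K \<in> mi" "I \<in> below K" for I
 proof (rule ccontr)
  assume "f I x * g (K -. I) x ~= 0"
  then have "I \<in> series_indices ds i" "K -. I \<in> series_indices ds j"
   using msecD(1)[OF f, of I x] msecD(1)[OF g, of "K -. I" x] by auto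
  from series_plus[OF this] show False using K KI by (simp add: below_diff(2))
 qed
 then show "gmul mdl W i j f g K x = 0"
  unfolding gmul_model by (auto simp: mult.assoc intro!: sum.neutral)
next
 fix K assume "K \<in> series_indices ds (i + j)"
 then have K: "K \<in> mi" by (rule series_mi)
 have "smooth_on ds W (%x. \<Sum>I\<in>below K. sg I (K -. I) * f I x * g (K -. I) x)"
  by (rule smooth_sum[OF W smooth_mult[OF W smooth_mult[OF W smooth_const[OF W] msec_smooth[OF W f]] msec_smooth[OF W g]]])
 then show "smooth_on ds W (gmul mdl W i j f g K)"
  using K by (simp add: gmul_model[abs_def])
next
 fix K x assume "x \<notin> W"
 then show "gmul mdl W i j f g K x = 0" by (simp add: gmul_model msecD(2)[OF f])
qed

lemma below_zero: "below (%_. 0) = {%_. 0}"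
 by (auto simp: below_def)

lemma gmul_model_zero: "gmul mdl W i j f g (%_. 0) x = f (%_. 0) x * g (%_. 0) x"
 by (simp add: gmul_model zero_mi below_zero)

lemma sum_single_index:
 assumes K: "K \<in> mi" and t: "!!I. I \<in> below K ==> I ~= J ==> t I = (0::real)"
 shows "(\<Sum>I\<in>below K. t I) = (if J \<in> below K then t J else 0)"
proof -
 have "(\<Sum>I\<in>below K. t I) = (\<Sum>I\<in>below K. if I = J then t J else 0)"
  by (rule sum.cong) (use t in auto)
 then show ?thesis using finite_below[OF K] by (simp add: sum.delta)
qed

lemma gmul_model_body:
 assumes "!!I. I ~= (%_. 0) ==> c I x = 0" "K \<in> mi"
 shows "gmul mdl W i j c f K x = c (%_. 0) x * f K x"
proof -
 have z: "(%_. 0) \<in> below K" by (simp add: below_def)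
 have "(\<Sum>I\<in>below K. sg I (K -. I) * c I x * f (K -. I) x) = (if (%_. 0) \<in> below K then sg (%_. 0) (K -. (%_. 0)) * c (%_. 0) x * f (K -. (%_. 0)) x else 0)"
  by (rule sum_single_index[OF assms(2)]) (use assms(1) in simp)
 then show ?thesis using assms(2) z by (simp add: gmul_model)
qed

lemma gmul_model_unit_mi:
 assumes "!!I. I ~= unit_mi A ==> c I x = 0" "K \<in> mi"
 shows "gmul mdl W i j c f K x = (if K A = 0 then 0 else sg (unit_mi A) (K -. unit_mi A) * c (unit_mi A) x * f (K -. unit_mi A) x)"
proof -
 have z: "unit_mi A \<in> below K \<longleftrightarrow> K A ~= 0" by (auto simp: below_def unit_mi_def)
 have "(\<Sum>I\<in>below K. sg I (K -. I) * c I x * f (K -. I) x) = (if unit_mi A \<in> below K then sg (unit_mi A) (K -. unit_mi A) * c (unit_mi A) x * f (K -. unit_mi A) x else 0)"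
  by (rule sum_single_index[OF assms(2)]) (use assms(1) in simp)
 then show ?thesis using assms(2) z by (simp add: gmul_model)
qed

lemma unit_mi_series: "A < length ds ==> ds ! A ~= 0 ==> unit_mi A \<in> series_indices ds (ds ! A)"
 unfolding series_indices_def multiindices_def using degree_unit[of A] by (auto simp: unit_mi_def)

lemma coordinate_simps:
 "x \<in> W ==> ds ! A = 0 ==> model_coordinate ds W A I x = (if I = (%_. 0) then x A else 0)"
 "x \<in> W ==> ds ! A ~= 0 ==> model_coordinate ds W A I x = (if I = unit_mi A then 1 else 0)"
 "x \<notin> W ==> model_coordinate ds W A I x = 0"
 by (simp_all add: model_coordinate_def unit_mi_def)

lemma msec_coordinate:
 assumes W: "bopen ds W" and A: "A < length ds"
 shows "model_coordinate ds W A \<in> msec W (ds ! A)"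
proof (cases "ds ! A = 0")
 case True
 have "model_coordinate ds W A = (%I x. if I = (%_. 0) & x \<in> W then x A else 0)"
  using True by (auto simp: model_coordinate_def fun_eq_iff)
 then show ?thesis using msec_body[OF W smooth_coord[OF W, of A]] True by simp
next
 case False
 show ?thesis
 proof (rule msecI)
  show "model_coordinate ds W A I x = 0" if "I \<notin> series_indices ds (ds ! A)" for I x
  proof -
   have "I ~= unit_mi A" using that unit_mi_series[OF A False] by blast
   then show ?thesis using False by (cases "x \<in> W") (simp_all add: coordinate_simps)
  qed
  show "smooth_on ds W (model_coordinate ds W A I)" for I
   by (rule smooth_cong[OF W smooth_const[OF W, of "if I = unit_mi A then 1 else 0"]])
    (simp add: coordinate_simps(2) False)
  show "model_coordinate ds W A I x = 0" if "x \<notin> W" for I x using that by (simp add: coordinate_simps)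
 qed
qed

text \<open>Coordinates of nonzero degree have value 0 at every point.\<close>

definition centre :: "(nat => real) => nat => real" where
 "centre a A = (if ds ! A = 0 then a A else 0)"

text \<open>The coefficient of the monomial 1 is split by Hadamard's lemma on the body; every other
  monomial is divided by its first variable.\<close>

lemma hadamard_model:
 assumes W: "bopen ds W" and a: "a \<in> W" and f: "f \<in> msec W j" and fa: "f (%_. 0) a = 0"
 shows "EX F. (\<forall>A<length ds. F A \<in> msec W (j - ds ! A)) &
  f = (%K x. \<Sum>A<length ds. gmul mdl W (ds ! A) (j - ds ! A)
   (%I x. model_coordinate ds W A I x + (- centre a A) * (if ds ! A = 0 then gunit mdl W I x else 0)) (F A) K x)"
proof -
 obtain h where h: "!!A. smooth_on ds W (h A)" "!!x. x \<in> W ==> f (%_. 0) x = (\<Sum>A\<in>zpos ds. (x A - a A) * h A x)"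
  using hadamard[OF W a msec_smooth[OF W f] fa] by blast
 \<comment> \<open>For a coordinate of nonzero degree, \<open>F A\<close> collects the monomials
   whose first variable is \<open>A\<close>. That variable stands in front, so splitting it off
   produces no sign. Body coordinates contribute only to the coefficient of 1, which can be nonzero
   only in degree 0.\<close>
 define F where "F A = (if ds ! A = 0 then (%I x. if j = 0 & I = (%_. 0) & x \<in> W then h A x else 0)
  else (%I x. if \<forall>B<A. I B = 0 then f (I +. unit_mi A) x else 0))" for A
 let ?c = "%A I x. model_coordinate ds W A I x + (- centre a A) * (if ds ! A = 0 then gunit mdl W I x else 0)"
 have F: "F A \<in> msec W (j - ds ! A)" if A: "A < length ds" for A
 proof (cases "ds ! A = 0")
  case True
  show ?thesis
  proof (cases "j = 0")
   case True
   then have "F A = (%I x. if I = (%_. 0) & x \<in> W then h A x else 0)"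
    using \<open>ds ! A = 0\<close> by (simp add: F_def)
   then show ?thesis using msec_body[OF W h(1)] True \<open>ds ! A = 0\<close> by simp
  next
   case False
   then have "F A = (%I x. 0)" using True by (simp add: F_def)
   then show ?thesis using msec_zero[OF W] by simp
  qed
 next
  case False
  show ?thesis
  proof (rule msecI)
   show "F A I x = 0" if I: "I \<notin> series_indices ds (j - ds ! A)" for I x
   proof -
    have "I +. unit_mi A \<notin> series_indices ds j"
    proof
     assume K: "I +. unit_mi A \<in> series_indices ds j"
     have "I \<in> series_indices ds (mi_degree ds I)"
      by (rule series_below[OF K]) (simp add: below_def)
     moreover have "mi_degree ds I = j - ds ! A"
      using series_mi(2)[OF K] by (simp add: degree_plus degree_unit A)
     ultimately show False using I by simp
    qed
    then show ?thesis using False msecD(1)[OF f] by (simp add: F_def)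
   qed
   show "smooth_on ds W (F A I)" for I
   proof -
    have "F A I = (if \<forall>B<A. I B = 0 then f (I +. unit_mi A) else (%_. 0))"
     using False by (auto simp: F_def fun_eq_iff)
    then show ?thesis using msec_smooth[OF W f, of "I +. unit_mi A"] smooth_const[OF W, of 0] by presburger
   qed
   show "F A I x = 0" if "x \<notin> W" for I x using False msecD(2)[OF f that] by (simp add: F_def)
  qed
 qed
 have term0: "gmul mdl W (ds ! A) (j - ds ! A) (?c A) (F A) K x = (if j = 0 & K = (%_. 0) then (x A - a A) * h A x else 0)"
  if "ds ! A = 0" "K \<in> mi" "x \<in> W" for A K x
  using that by (subst gmul_model_body) (auto simp: coordinate_simps model_simps centre_def F_def)
 have term1: "gmul mdl W (ds ! A) (j - ds ! A) (?c A) (F A) K x = (if K A ~= 0 & (\<forall>B<A. K B = 0) then f K x else 0)"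
  if "ds ! A ~= 0" "K \<in> mi" "x \<in> W" for A K x
 proof -
  have eq: "(K -. unit_mi A) +. unit_mi A = K" if "K A ~= 0"
  proof
   show "K B - unit_mi A B + unit_mi A B = K B" for B using that by (cases "B = A") auto
  qed
  have s: "sg (unit_mi A) (K -. unit_mi A) = 1" if "\<forall>B<A. (K -. unit_mi A) B = 0"
  proof -
   have "(\<Sum>A'<length ds. \<Sum>B<A'. (int (unit_mi A A') * ds ! A') * (int (K B - unit_mi A B) * ds ! B)) = 0"
   proof (intro sum.neutral ballI)
    fix A' B :: nat assume "B \<in> {..<A'}"
    then show "(int (unit_mi A A') * ds ! A') * (int (K B - unit_mi A B) * ds ! B) = 0"
     using that by (cases "A' = A") auto
   qed
   then show ?thesis by (simp add: monomial_sign_def)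
  qed
  have b: "(\<forall>B<A. (K -. unit_mi A) B = 0) \<longleftrightarrow> (\<forall>B<A. K B = 0)" by auto
  have c: "?c A I x = (if I = unit_mi A then 1 else 0)" for I using that by (simp add: coordinate_simps centre_def)
  have "gmul mdl W (ds ! A) (j - ds ! A) (?c A) (F A) K x
   = (if K A = 0 then 0 else sg (unit_mi A) (K -. unit_mi A) * ?c A (unit_mi A) x * F A (K -. unit_mi A) x)"
   by (rule gmul_model_unit_mi) (use that c in auto)
  also have "\<dots> = (if K A = 0 then 0 else sg (unit_mi A) (K -. unit_mi A) * F A (K -. unit_mi A) x)"
   unfolding c by simp
  also have "\<dots> = (if K A ~= 0 & (\<forall>B<A. K B = 0) then f K x else 0)"
  proof (cases "K A = 0")
   case False
   have "F A (K -. unit_mi A) x = (if \<forall>B<A. (K -. unit_mi A) B = 0 then f ((K -. unit_mi A) +. unit_mi A) x else 0)"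
    unfolding F_def using that(1) by (simp only: if_False)
   then have "F A (K -. unit_mi A) x = (if \<forall>B<A. K B = 0 then f K x else 0)"
    unfolding b eq[OF False] .
   then show ?thesis using False s b by auto
  qed simp
  finally show ?thesis .
 qed
 have "f K x = (\<Sum>A<length ds. gmul mdl W (ds ! A) (j - ds ! A) (?c A) (F A) K x)" for K x
 proof (cases "x \<in> W & K \<in> mi")
  case False
  then have "f K x = 0" using msecD[OF f] series_mi(1) by blast
  moreover have "gmul mdl W (ds ! A) (j - ds ! A) (?c A) (F A) K x = 0" if "A < length ds" for A
   using False msecD(2)[OF F[OF that]] by (cases "K \<in> mi") (simp_all add: gmul_model)
  ultimately show ?thesis by simp
 next
  case True
  then have x: "x \<in> W" and K: "K \<in> mi" by auto
  let ?t = "%A. gmul mdl W (ds ! A) (j - ds ! A) (?c A) (F A) K x"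
  have split: "(\<Sum>A<length ds. ?t A) = (\<Sum>A\<in>zpos ds. ?t A) + (\<Sum>A\<in>{..<length ds} - zpos ds. ?t A)"
   by (subst sum.subset_diff[of "zpos ds"]) (auto simp: zpos_def)
  have s0: "(\<Sum>A\<in>zpos ds. ?t A) = (\<Sum>A\<in>zpos ds. if j = 0 & K = (%_. 0) then (x A - a A) * h A x else 0)"
   by (rule sum.cong) (use term0 K x in \<open>auto simp: zpos_def\<close>)
  have s1: "(\<Sum>A\<in>{..<length ds} - zpos ds. ?t A) = (\<Sum>A\<in>{..<length ds} - zpos ds. if K A ~= 0 & (\<forall>B<A. K B = 0) then f K x else 0)"
   by (rule sum.cong) (use term1 K x in \<open>auto simp: zpos_def\<close>)
  show ?thesis
  proof (cases "K = (%_. 0)")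
   case True
   have "f K x = 0" if "j ~= 0"
    by (rule msecD(1)[OF f]) (use True that in \<open>auto simp: series_indices_def mi_degree_def\<close>)
   moreover have "(\<Sum>A\<in>zpos ds. if j = 0 & K = (%_. 0) then (x A - a A) * h A x else 0) = (if j = 0 then f K x else 0)"
    using h(2)[OF x] True by simp
   ultimately show ?thesis unfolding split s0 s1 using True by simp
  next
   case False
   show ?thesis
   proof (cases "K \<in> series_indices ds j")
    case S: False
    then have z: "f K x = 0" by (rule msecD(1)[OF f])
    have "(\<Sum>A\<in>{..<length ds} - zpos ds. if K A ~= 0 & (\<forall>B<A. K B = 0) then f K x else 0) = 0"
     by (rule sum.neutral) (simp add: z)
    then show ?thesis unfolding split s0 s1 using False z by simp
   next
    case S: True
    \<comment> \<open>For \<open>K\<close> other than 0 exactly one summand survives, that of the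
      first variable of the monomial.\<close>
    define A0 where "A0 = (LEAST A. K A ~= 0)"
    have "EX A. K A ~= 0" using False by auto
    then have A0: "K A0 ~= 0" unfolding A0_def by (rule LeastI_ex)
    have least: "K B = 0" if "B < A0" for B using not_less_Least that unfolding A0_def by blast
    have A0n: "A0 < length ds" using A0 K by (force simp: multiindices_def not_less[symmetric])
    have A0z: "A0 \<notin> zpos ds" using A0 S A0n by (auto simp: zpos_def series_indices_def)
    have "(K A ~= 0 & (\<forall>B<A. K B = 0)) \<longleftrightarrow> A = A0" for A
    proof
     assume *: "K A ~= 0 & (\<forall>B<A. K B = 0)"
     show "A = A0" using * A0 least by (cases A A0 rule: linorder_cases) auto
    qed (use A0 least in auto)
    then have "(\<Sum>A\<in>{..<length ds} - zpos ds. if K A ~= 0 & (\<forall>B<A. K B = 0) then f K x else 0) = f K x"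
     using A0n A0z by (simp add: sum.delta)
    then show ?thesis unfolding split s0 s1 using False by simp
   qed
  qed
 qed
 then have "f = (%K x. \<Sum>A<length ds. gmul mdl W (ds ! A) (j - ds ! A) (?c A) (F A) K x)" by (intro ext)
 then show ?thesis using F by blast
qed

subsection \<open>Derivations of the model\<close>

text \<open>The partial derivatives act from the right; this makes the signs in the jet computations local.\<close>

definition mder :: "(nat => real) set => nat => ((nat => nat) => (nat => real) => real) => (nat => nat) => (nat => real) => real" where
 "mder W A f I x = (if ds ! A = 0 then (if x \<in> W then pd A (f I) x else 0)
  else real (I A + 1) * sg I (unit_mi A) * f (I +. unit_mi A) x)"

lemma pd_smooth_msec: "bopen ds W ==> f \<in> msec W j ==> A \<in> zpos ds ==> x \<in> W ==>
 ((%t. f I (x(A := t))) has_real_derivative pd A (f I) x) (at (x A))"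
 by (rule pd_deriv[OF _ msec_smooth])

lemma pd_zero: "pd A (%_. 0) x = 0"
 by (rule pd_eqI) simp

lemma mder_closed:
 assumes W: "bopen ds W" and f: "f \<in> msec W j" and A: "A < length ds"
 shows "mder W A f \<in> msec W (j - ds ! A)"
proof (cases "ds ! A = 0")
 case True
 then have Az: "A \<in> zpos ds" using A by (simp add: zpos_def)
 show ?thesis
 proof (rule msecI)
  show "mder W A f I x = 0" if "I \<notin> series_indices ds (j - ds ! A)" for I x
  proof -
   have "f I = (%_. 0)" using msecD(1)[OF f] that True by (simp add: fun_eq_iff)
   then show ?thesis using True by (simp add: mder_def pd_zero)
  qed
  show "smooth_on ds W (mder W A f I)" for I
   by (rule smooth_cong[OF W pd_smooth[OF W msec_smooth[OF W f, of I] Az]]) (simp add: mder_def True)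
  show "mder W A f I x = 0" if "x \<notin> W" for I x using that True by (simp add: mder_def)
 qed
next
 case False
 show ?thesis
 proof (rule msecI)
  show "mder W A f I x = 0" if I: "I \<notin> series_indices ds (j - ds ! A)" for I x
  proof -
   have "I +. unit_mi A \<notin> series_indices ds j"
   proof
    assume K: "I +. unit_mi A \<in> series_indices ds j"
    have "I \<in> series_indices ds (mi_degree ds I)"
     by (rule series_below[OF K]) (simp add: below_def)
    moreover have "mi_degree ds I = j - ds ! A"
     using series_mi(2)[OF K] by (simp add: degree_plus degree_unit A)
    ultimately show False using I by simp
   qed
   then show ?thesis using False msecD(1)[OF f] by (simp add: mder_def)
  qed
  show "smooth_on ds W (mder W A f I)" for I
  proof -
   have "mder W A f I = (%x. real (I A + 1) * sg I (unit_mi A) * f (I +. unit_mi A) x)"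
    using False by (simp add: mder_def fun_eq_iff)
   then show ?thesis using smooth_mult[OF W smooth_const[OF W] msec_smooth[OF W f]] by simp
  qed
  show "mder W A f I x = 0" if "x \<notin> W" for I x using False msecD(2)[OF f that] by (simp add: mder_def)
 qed
qed

lemma mder_add:
 assumes W: "bopen ds W" and f: "f \<in> msec W j" and g: "g \<in> msec W j" and A: "A < length ds"
 shows "mder W A (%I x. f I x + g I x) = (%I x. mder W A f I x + mder W A g I x)"
proof (intro ext)
 fix I x
 show "mder W A (%I x. f I x + g I x) I x = mder W A f I x + mder W A g I x"
 proof (cases "ds ! A = 0 & x \<in> W")
  case True
  then have Az: "A \<in> zpos ds" "x \<in> W" using A by (auto simp: zpos_def)
  have "pd A (%x. f I x + g I x) x = pd A (f I) x + pd A (g I) x"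
   by (rule pd_eqI[OF DERIV_add[OF pd_smooth_msec[OF W f Az] pd_smooth_msec[OF W g Az]]])
  then show ?thesis using True by (simp add: mder_def)
 qed (auto simp: mder_def algebra_simps)
qed

lemma mder_smult:
 assumes W: "bopen ds W" and f: "f \<in> msec W j" and A: "A < length ds"
 shows "mder W A (%I x. r * f I x) = (%I x. r * mder W A f I x)"
proof (intro ext)
 fix I x
 show "mder W A (%I x. r * f I x) I x = r * mder W A f I x"
 proof (cases "ds ! A = 0 & x \<in> W")
  case True
  then have Az: "A \<in> zpos ds" "x \<in> W" using A by (auto simp: zpos_def)
  have "pd A (%x. r * f I x) x = r * pd A (f I) x"
   by (rule pd_eqI[OF DERIV_cmult[OF pd_smooth_msec[OF W f Az]]])
  then show ?thesis using True by (simp add: mder_def)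
 qed (auto simp: mder_def)
qed

text \<open>Tells which summands are nonzero when factorisations of \<open>K\<close> are extended in
  the Leibniz rule: those whose second factor contains \<open>A\<close>.\<close>

lemma below_unit_iff: "P \<in> below (K +. unit_mi A) ==> P \<in> below K \<longleftrightarrow> (K +. unit_mi A -. P) A ~= 0"
proof
 assume P: "P \<in> below (K +. unit_mi A)"
 then have le: "P B <= K B + unit_mi A B" for B by (simp add: below_def)
 show "(K +. unit_mi A -. P) A ~= 0" if "P \<in> below K"
 proof -
  have "P A <= K A" using that by (simp add: below_def)
  then show ?thesis by simp
 qed
 assume *: "(K +. unit_mi A -. P) A ~= 0"
 have "P B <= K B" for B using le[of B] * by (cases "B = A") auto
 then show "P \<in> below K" by (simp add: below_def)
qed

text \<open>The Leibniz rule for the pair of monomials with exponents \<open>P\<close> and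
  \<open>Q\<close>. Up to a common sign both terms are multiplicities, which add up to
  \<open>K A + 1\<close> for even degree. For odd degree they cancel when \<open>A\<close> occurs in
  both factors, where the product of the monomials is zero.\<close>

lemma mder_sign:
 assumes A: "A < length ds" and P: "P \<in> mi" and Q: "Q \<in> mi" and K: "P +. Q = K +. unit_mi A"
  and Km: "K \<in> mi"
 shows "real (Q A) * sg P (Q -. unit_mi A) * sg (Q -. unit_mi A) (unit_mi A) +
   koszul (ds ! A * mi_degree ds Q) * (real (P A) * sg (P -. unit_mi A) Q * sg (P -. unit_mi A) (unit_mi A))
  = (if K +. unit_mi A \<in> mi then real (K A + 1) * sg K (unit_mi A) * sg P Q else 0)"
proof -
 let ?e = "unit_mi A" and ?d = "ds ! A"
 have KA: "P A + Q A = K A + 1" using fun_cong[OF K, of A] by simp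
 have minus: "(R -. ?e) +. ?e = R" if "R A ~= 0" for R :: "nat => nat"
 proof
  show "R B - ?e B + ?e B = R B" for B using that by (cases "B = A") auto
 qed
 have sq: "a * a = (1::real) ==> a * (a * b) = b" for a b by (simp add: mult.assoc[symmetric])
 have 1: "sg P (Q -. ?e) * sg (Q -. ?e) ?e = sg K ?e * sg P Q" if "Q A ~= 0"
 proof -
  let ?Q = "Q -. ?e"
  have Kq: "K = P +. ?Q"
  proof
   fix B show "K B = P B + (Q B - ?e B)" using fun_cong[OF K, of B] that by (cases "B = A") auto
  qed
  have "sg P Q = sg P ?Q * sg P ?e" using sg_plus_right[of P ?Q ?e] minus[of Q] that by simp
  moreover have "sg K ?e = sg P ?e * sg ?Q ?e" unfolding Kq by (rule sg_plus_left)
  ultimately show ?thesis using sg_square[of P ?e] by (simp add: mult_ac sq)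
 qed
 have 2: "koszul (?d * mi_degree ds Q) * (sg (P -. ?e) Q * sg (P -. ?e) ?e) = koszul (?d * (int (Q A) * ?d)) * (sg K ?e * sg P Q)" if "P A ~= 0"
 proof -
  let ?P = "P -. ?e"
  have Kp: "K = ?P +. Q"
  proof
   fix B show "K B = (P B - ?e B) + Q B" using fun_cong[OF K, of B] that by (cases "B = A") auto
  qed
  have a: "sg P Q = sg ?P Q * sg ?e Q" using sg_plus_left[of ?P ?e Q] minus[of P] that by simp
  have b: "sg K ?e = sg ?P ?e * sg Q ?e" unfolding Kp by (rule sg_plus_left)
  have "sg Q ?e * sg ?e Q = koszul (?d * mi_degree ds Q) * koszul (?d * (int (Q A) * ?d))"
   unfolding sg_swap[OF A] right_diff_distrib by (rule koszul_diff)
  then have "koszul (?d * (int (Q A) * ?d)) * (sg Q ?e * sg ?e Q) = koszul (?d * mi_degree ds Q)"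
   by (simp add: mult_ac sq)
  then show ?thesis unfolding a b by (simp add: mult_ac)
 qed
 have first: "real (Q A) * sg P (Q -. ?e) * sg (Q -. ?e) ?e = real (Q A) * (sg K ?e * sg P Q)"
  using 1 by (cases "Q A = 0") (simp_all add: mult.assoc)
 have second: "koszul (?d * mi_degree ds Q) * (real (P A) * sg (P -. ?e) Q * sg (P -. ?e) ?e)
   = real (P A) * koszul (?d * (int (Q A) * ?d)) * (sg K ?e * sg P Q)"
  using 2 by (cases "P A = 0") (simp_all add: mult_ac)
 have up: "K +. ?e \<in> mi" if "odd ?d ==> K A = 0"
  unfolding multiindices_def
 proof (intro CollectI conjI allI impI)
  fix B assume B: "length ds <= B"
  then have "B ~= A" using A by auto
  then show "K B + ?e B = 0" using Km B by (simp add: multiindices_def)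
 next
  fix B assume B: "B < length ds" "odd (ds ! B)"
  show "K B + ?e B \<in> {0, 1}"
   using Km B that by (cases "B = A") (auto simp: multiindices_def)
 qed
 show ?thesis
 proof (cases "even ?d")
  case True
  have "K +. ?e \<in> mi" using up True by blast
  moreover have "koszul (?d * (int (Q A) * ?d)) = 1" using True by (simp add: koszul_def)
  moreover have "real (Q A) + real (P A) = real (K A + 1)" using KA by linarith
  ultimately show ?thesis unfolding first second by (simp add: distrib_right[symmetric] mult.assoc)
 next
  case False
  have pq: "P A \<in> {0, 1}" "Q A \<in> {0, 1}" using P Q A False by (auto simp: multiindices_def)
  show ?thesis
  proof (cases "K A = 0")
   case True
   have "K +. ?e \<in> mi" using up True by blast
   moreover have "(P A = 0 & Q A = 1) \<or> (P A = 1 & Q A = 0)" using pq KA True by auto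
   ultimately show ?thesis unfolding first second using True by auto
  next
   case nz: False
   \<comment> \<open>Here \<open>A\<close> occurs in both factors, and the terms cancel because
     \<open>koszul (ds ! A * ds ! A)\<close> is -1.\<close>
   then have pq1: "P A = 1" "Q A = 1" using pq KA by auto
   have "K A + ?e A \<notin> {0, 1}" using nz by simp
   then have "K +. ?e \<notin> mi" using A False unfolding multiindices_def by blast
   then show ?thesis unfolding first second using pq1 False by (simp add: koszul_def)
  qed
 qed
qed

text \<open>The sign arises because a derivation acting from the right passes \<open>g\<close>
  before it reaches \<open>f\<close>.\<close>

lemma mder_leibniz:
 assumes W: "bopen ds W" and f: "f \<in> msec W i" and g: "g \<in> msec W j" and A: "A < length ds"
 shows "mder W A (gmul mdl W i j f g) = (%K x. gmul mdl W i (j - ds ! A) f (mder W A g) K x +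
   koszul (ds ! A * j) * gmul mdl W (i - ds ! A) j (mder W A f) g K x)"
proof (intro ext)
 fix K x
 show "mder W A (gmul mdl W i j f g) K x = gmul mdl W i (j - ds ! A) f (mder W A g) K x +
   koszul (ds ! A * j) * gmul mdl W (i - ds ! A) j (mder W A f) g K x"
 proof (cases "K \<in> mi & x \<in> W")
  case False
  have z: "h K x = 0" if "h \<in> msec W n" for h n
   using msecD[OF that] False series_mi(1) by blast
  show ?thesis
   using z[OF mder_closed[OF W msec_gmul[OF W f g] A]] z[OF msec_gmul[OF W f mder_closed[OF W g A]]]
    z[OF msec_gmul[OF W mder_closed[OF W f A] g]] by simp
 next
  case True
  then have K: "K \<in> mi" and x: "x \<in> W" by auto
  show ?thesis
  proof (cases "ds ! A = 0")
   case d: True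
   have Az: "A \<in> zpos ds" using A d by (simp add: zpos_def)
   have "((%t. \<Sum>I\<in>below K. sg I (K -. I) * f I (x(A := t)) * g (K -. I) (x(A := t))) has_real_derivative
    (\<Sum>I\<in>below K. sg I (K -. I) * (f I x * pd A (g (K -. I)) x + pd A (f I) x * g (K -. I) x))) (at (x A))"
   proof (rule DERIV_sum)
    fix I
    show "((%t. sg I (K -. I) * f I (x(A := t)) * g (K -. I) (x(A := t))) has_real_derivative
     sg I (K -. I) * (f I x * pd A (g (K -. I)) x + pd A (f I) x * g (K -. I) x)) (at (x A))"
     using DERIV_mult[OF DERIV_cmult[OF pd_smooth_msec[OF W f Az x]] pd_smooth_msec[OF W g Az x], of "sg I (K -. I)" I "K -. I"]
     by (simp add: algebra_simps)
   qed
   then have "((%t. gmul mdl W i j f g K (x(A := t))) has_real_derivative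
    (\<Sum>I\<in>below K. sg I (K -. I) * (f I x * pd A (g (K -. I)) x + pd A (f I) x * g (K -. I) x))) (at (x A))"
    using K by (simp add: gmul_model)
   from pd_eqI[OF this] have "mder W A (gmul mdl W i j f g) K x =
    (\<Sum>I\<in>below K. sg I (K -. I) * (f I x * pd A (g (K -. I)) x + pd A (f I) x * g (K -. I) x))"
    using d x by (simp add: mder_def)
   also have "\<dots> = (\<Sum>I\<in>below K. sg I (K -. I) * f I x * mder W A g (K -. I) x) +
    (\<Sum>I\<in>below K. sg I (K -. I) * mder W A f I x * g (K -. I) x)"
    unfolding sum.distrib[symmetric] by (rule sum.cong) (simp_all add: mder_def d x algebra_simps)
   also have "\<dots> = gmul mdl W i (j - ds ! A) f (mder W A g) K x + koszul (ds ! A * j) * gmul mdl W (i - ds ! A) j (mder W A f) g K x"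
    using K d by (simp add: gmul_model)
   finally show ?thesis .
  next
   case d: False
   let ?e = "unit_mi A"
   let ?Q = "%P. K +. ?e -. P"
   \<comment> \<open>\<open>K +. ?e\<close> need not be a multi-index, so
     \<open>finite_below\<close> does not apply.\<close>
   have fin: "finite (below (K +. ?e))"
   proof -
    have "below (K +. ?e) <= {f. ALL x. (x \<in> {..<length ds} --> f x \<in> {..(\<Sum>A<length ds. K A) + 1}) & (x \<notin> {..<length ds} --> f x = 0)}"
    proof
     fix I assume I: "I \<in> below (K +. ?e)"
     then have le: "I B <= K B + ?e B" for B by (simp add: below_def)
     have "I B <= (\<Sum>A<length ds. K A) + 1" if "B < length ds" for B
     proof -
      have "K B <= (\<Sum>A<length ds. K A)" using that by (intro member_le_sum) auto
      moreover have "?e B <= 1" by (simp add: unit_mi_def)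
      ultimately show ?thesis using le[of B] by linarith
     qed
     moreover have "I B = 0" if "\<not> B < length ds" for B
     proof -
      have "K B = 0" using K that by (simp add: multiindices_def)
      moreover have "B ~= A" using A that by auto
      ultimately show ?thesis using le[of B] by simp
     qed
     ultimately show "I \<in> {f. ALL x. (x \<in> {..<length ds} --> f x \<in> {..(\<Sum>A<length ds. K A) + 1}) & (x \<notin> {..<length ds} --> f x = 0)}" by simp
    qed
    then show ?thesis by (rule finite_subset) (rule finite_set_of_finite_funs; simp)
   qed
   \<comment> \<open>Both sums on the right run over factorisations of \<open>K\<close>. They are
     rewritten over the factorisations of \<open>K +. ?e\<close> to one factor of which the
     derivation is applied; the summands that are added carry the multiplicity 0.\<close>
   have sub: "below K <= below (K +. ?e)" by (auto simp: below_def intro: trans_le_add1)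
   have QI: "(K -. I) +. ?e = ?Q I" if "I \<in> below K" for I
   proof
    have "I B <= K B" for B using that by (simp add: below_def)
    then show "K B - I B + ?e B = K B + ?e B - I B" for B by simp
   qed
   have "gmul mdl W i (j - ds ! A) f (mder W A g) K x
    = (\<Sum>I\<in>below K. f I x * g (?Q I) x * (real (?Q I A) * sg I (?Q I -. ?e) * sg (?Q I -. ?e) ?e))"
   proof -
    have eq: "sg I (K -. I) * f I x * mder W A g (K -. I) x = f I x * g (?Q I) x * (real (?Q I A) * sg I (?Q I -. ?e) * sg (?Q I -. ?e) ?e)"
     if "I \<in> below K" for I
    proof -
     have a: "?Q I -. ?e = K -. I" unfolding QI[OF that, symmetric] by simp
     have b: "?Q I A = (K -. I) A + 1" unfolding fun_cong[OF QI[OF that], symmetric] by simp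
     show ?thesis unfolding a b mder_def using d by (simp only: QI[OF that] if_False mult_ac)
    qed
    have "gmul mdl W i (j - ds ! A) f (mder W A g) K x = (\<Sum>I\<in>below K. sg I (K -. I) * f I x * mder W A g (K -. I) x)"
     using K by (simp add: gmul_model)
    also have "\<dots> = (\<Sum>I\<in>below K. f I x * g (?Q I) x * (real (?Q I A) * sg I (?Q I -. ?e) * sg (?Q I -. ?e) ?e))"
     by (rule sum.cong[OF refl eq])
    finally show ?thesis .
   qed
   also have "\<dots> = (\<Sum>P\<in>below (K +. ?e). f P x * g (?Q P) x * (real (?Q P A) * sg P (?Q P -. ?e) * sg (?Q P -. ?e) ?e))"
    by (rule sum.mono_neutral_left[OF fin sub]) (use below_unit_iff in auto)
   finally have 1: "gmul mdl W i (j - ds ! A) f (mder W A g) K x = \<dots>" .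
   have inj: "inj_on (%I. I +. ?e) (below K)" by (rule inj_onI) (simp add: fun_eq_iff)
   have im: "(%I. I +. ?e) ` below K = {P \<in> below (K +. ?e). P A ~= 0}"
   proof (intro equalityI subsetI)
    fix P assume "P \<in> {P \<in> below (K +. ?e). P A ~= 0}"
    then have P: "!!B. P B <= K B + ?e B" "P A ~= 0" by (auto simp: below_def)
    have "P = (P -. ?e) +. ?e"
    proof
     show "P B = P B - ?e B + ?e B" for B using P(2) by (cases "B = A") auto
    qed
    moreover have "P -. ?e \<in> below K" using P(1) by (simp add: below_def le_diff_conv)
    ultimately show "P \<in> (%I. I +. ?e) ` below K" by (rule image_eqI)
   qed (auto simp: below_def)
   have "gmul mdl W (i - ds ! A) j (mder W A f) g K x
    = (\<Sum>I\<in>below K. f (I +. ?e) x * g (?Q (I +. ?e)) x * (real ((I +. ?e) A) * sg ((I +. ?e) -. ?e) (?Q (I +. ?e)) * sg ((I +. ?e) -. ?e) ?e))"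
    using K d by (simp add: gmul_model mder_def mult_ac)
   also have "\<dots> = (\<Sum>P\<in>(%I. I +. ?e) ` below K. f P x * g (?Q P) x * (real (P A) * sg (P -. ?e) (?Q P) * sg (P -. ?e) ?e))"
    by (rule sum.reindex[OF inj, unfolded o_def, symmetric])
   also have "\<dots> = (\<Sum>P\<in>below (K +. ?e). f P x * g (?Q P) x * (real (P A) * sg (P -. ?e) (?Q P) * sg (P -. ?e) ?e))"
    unfolding im by (rule sum.mono_neutral_left[OF fin]) auto
   finally have 2: "gmul mdl W (i - ds ! A) j (mder W A f) g K x = \<dots>" .
   let ?F = "%P. f P x * g (?Q P) x"
   have "gmul mdl W i (j - ds ! A) f (mder W A g) K x + koszul (ds ! A * j) * gmul mdl W (i - ds ! A) j (mder W A f) g K x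
    = (\<Sum>P\<in>below (K +. ?e). ?F P * (if K +. ?e \<in> mi then real (K A + 1) * sg K ?e * sg P (?Q P) else 0))"
    unfolding 1 2 sum_distrib_left sum.distrib[symmetric]
   proof (rule sum.cong[OF refl])
    fix P assume P: "P \<in> below (K +. ?e)"
    let ?a = "real (?Q P A) * sg P (?Q P -. ?e) * sg (?Q P -. ?e) ?e"
    let ?b = "real (P A) * sg (P -. ?e) (?Q P) * sg (P -. ?e) ?e"
    show "?F P * ?a + koszul (ds ! A * j) * (?F P * ?b) = ?F P * (if K +. ?e \<in> mi then real (K A + 1) * sg K ?e * sg P (?Q P) else 0)"
    proof (cases "P \<in> series_indices ds i & ?Q P \<in> series_indices ds j")
     case True
     then have "P \<in> mi" "?Q P \<in> mi" "mi_degree ds (?Q P) = j" using series_mi by blast+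
     from mder_sign[OF A this(1,2) below_diff(2)[OF P] K, unfolded this(3), symmetric] show ?thesis
      by (simp only: distrib_left mult.left_commute)
    next
     case False
     then have z: "?F P = 0" using msecD(1)[OF f] msecD(1)[OF g] by auto
     show ?thesis by (simp only: z mult_zero_left mult_zero_right add_0_left)
    qed
   qed
   also have "\<dots> = mder W A (gmul mdl W i j f g) K x"
    using d by (simp add: mder_def gmul_model sum_distrib_left mult_ac)
   finally show ?thesis ..
  qed
 qed
qed

lemma mder_coordinate:
 assumes A: "A < length ds" and B: "B < length ds" and W: "bopen ds W"
 shows "mder W A (model_coordinate ds W B) = (if A = B then gunit mdl W else (%I x. 0))"
proof (intro ext)
 fix I x
 show "mder W A (model_coordinate ds W B) I x = (if A = B then gunit mdl W else (%I x. 0)) I x"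
 proof (cases "x \<in> W")
  case False
  then show ?thesis by (simp add: mder_def coordinate_simps model_simps)
 next
  case x: True
  show ?thesis
  proof (cases "ds ! A = 0")
   case d: True
   have Az: "A \<in> zpos ds" using A d by (simp add: zpos_def)
   let ?D = "if A = B & I = (%_. 0) then 1 else 0"
   have der: "((%t. (if ds ! B = 0 then (if I = (%_. 0) then (x(A := t)) B else 0) else (if I = unit_mi B then 1 else 0))) has_real_derivative ?D) (at (x A))"
    using d by (cases "A = B"; cases "ds ! B = 0"; cases "I = (%_. 0)"; cases "I = unit_mi B") auto
   have ev: "eventually (%t. (if ds ! B = 0 then (if I = (%_. 0) then (x(A := t)) B else 0) else (if I = unit_mi B then 1 else 0))
     = model_coordinate ds W B I (x(A := t))) (nhds (x A))"
    using eventually_line[OF W x Az] by eventually_elim (simp add: coordinate_simps)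
   have "((%t. model_coordinate ds W B I (x(A := t))) has_real_derivative ?D) (at (x A))"
    by (rule iffD1[OF DERIV_cong_ev[OF refl ev refl] der])
   from pd_eqI[OF this] show ?thesis using d x by (simp add: mder_def model_simps)
  next
   case d: False
   have ne: "I +. unit_mi A ~= (%_. 0)" using fun_cong[of "I +. unit_mi A" "%_. 0" A] by auto
   have eq: "I +. unit_mi A = unit_mi B \<longleftrightarrow> A = B & I = (%_. 0)"
   proof
    assume e: "I +. unit_mi A = unit_mi B"
    have "A = B" using fun_cong[OF e, of A] by (cases "A = B") auto
    moreover have "I C = 0" for C using fun_cong[OF e, of C] \<open>A = B\<close> by simp
    ultimately show "A = B & I = (%_. 0)" by auto
   qed auto
   show ?thesis
    using d x ne eq by (cases "ds ! B = 0") (auto simp: mder_def coordinate_simps model_simps)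
  qed
 qed
qed

subsection \<open>Order of vanishing\<close>

text \<open>Only the coefficients themselves are tested at \<open>a\<close>, not their derivatives
  in body directions. This weaker filtration still has trivial intersection once \<open>a\<close>
  runs through all points.\<close>

definition vanishing_order :: "nat => (nat => real) => ((nat => nat) => (nat => real) => real) => bool" where
 "vanishing_order q a f \<longleftrightarrow> (ALL I. mi_weight ds I < q --> f I a = 0)"

text \<open>In the coefficient of \<open>K\<close>, the summand with \<open>I = 0\<close> is killed
  by the value of \<open>f\<close>; in every other summand the second factor has weight below
  \<open>q\<close>.\<close>

lemma vanishing_order_gmul:
 assumes f: "f (%_. 0) a = 0" and g: "vanishing_order q a g"
 shows "vanishing_order (Suc q) a (gmul mdl W i j f g)"
 unfolding vanishing_order_def
proof (intro allI impI)
 fix K assume K: "mi_weight ds K < Suc q"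
 have "f I a * g (K -. I) a = 0" if KI: "K \<in> mi" "I \<in> below K" for I
 proof (cases "I = (%_. 0)")
  case True
  then show ?thesis using f by simp
 next
  case False
  then obtain A where A: "I A ~= 0" by auto
  have "A < length ds" using mi_below[OF KI] A by (force simp: multiindices_def not_less[symmetric])
  then have "I A <= mi_weight ds I" unfolding mi_weight_def by (intro member_le_sum) auto
  moreover have "mi_weight ds I + mi_weight ds (K -. I) = mi_weight ds K"
   using weight_plus[of I "K -. I"] below_diff(2)[OF KI(2)] by simp
  ultimately have "mi_weight ds (K -. I) < q" using A K by linarith
  then show ?thesis using g by (simp add: vanishing_order_def)
 qed
 then show "gmul mdl W i j f g K a = 0"
  unfolding gmul_model by (auto simp: mult.assoc intro!: sum.neutral)
qed

end


section \<open>Charts\<close>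

text \<open>All that the study of jets takes from a chart, over one fixed open set.
  \<open>Z a q\<close> has to contain the products of \<open>q\<close> elements of the ideal of
  \<open>a\<close>, without being defined as a power of it. \<open>J_hadamard\<close> leaves the
  shifts \<open>v\<close> unspecified, so values of coordinates never occur.\<close>

locale coordinate_algebra = C: graded_algebra_sheaf X C
 for X :: "'m topology" and C :: "('m, 'f) apsh" +
 fixes V :: "'m set" and ds :: "int list" and z :: "nat => 'f" and D :: "nat => int => 'f => 'f"
  and J :: "'m => int => 'f set" and Z :: "'m => nat => int => 'f set"
 assumes V_open: "openin X V"
  and z_closed: "A < length ds ==> z A : sect C V (ds ! A)"
  and D_linear: "A < length ds ==> lin (sec C V j) (sec C V (j - ds ! A)) (D A j)"
  and D_leibniz: "[|A < length ds; f : sect C V i; p : sect C V j|] ==>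
   D A (i + j) (gmul C V i j f p) = gmul C V i (j - ds ! A) f (D A j p) \<oplus>[sec C V (i + j - ds ! A)]
    koszul (ds ! A * j) \<odot>[sec C V (i + j - ds ! A)] gmul C V (i - ds ! A) j (D A i f) p"
  and D_coordinate: "[|A < length ds; B < length ds|] ==>
   D A (ds ! B) (z B) = (if A = B then gunit C V else \<zero>[sec C V (ds ! B - ds ! A)])"
  and J_subset: "a \<in> V ==> J a i <= sect C V i"
  and J_degree: "[|a \<in> V; i ~= 0; f : sect C V i|] ==> f \<in> J a i"
  and J_shift: "[|a \<in> V; f : sect C V 0|] ==> EX v. f \<oplus>[sec C V 0] v \<odot>[sec C V 0] gunit C V \<in> J a 0"
  and J_hadamard: "[|a \<in> V; f \<in> J a j|] ==> EX v F.
   (\<forall>A<length ds. F A : sect C V (j - ds ! A) &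
    (if ds ! A = 0 then z A \<oplus>[sec C V (ds ! A)] v A \<odot>[sec C V (ds ! A)] gunit C V else z A) \<in> J a (ds ! A)) &
   f = finsum (sec C V j) (%A. gmul C V (ds ! A) (j - ds ! A)
    (if ds ! A = 0 then z A \<oplus>[sec C V (ds ! A)] v A \<odot>[sec C V (ds ! A)] gunit C V else z A) (F A)) {..<length ds}"
  and Z_rsub: "a \<in> V ==> rsub (Z a q j) (sec C V j)"
  and Z_0: "a \<in> V ==> Z a 0 j = sect C V j"
  and Z_Suc: "[|a \<in> V; f \<in> J a i; g \<in> Z a q j|] ==> gmul C V i j f g \<in> Z a (Suc q) (i + j)"
  and Z_separated: "[|f : sect C V j; !!a q. a \<in> V ==> f \<in> Z a q j|] ==> f = \<zero>[sec C V j]"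

lemma chart_restrict:
 assumes ch: "graded_chart X C ds U \<phi> \<theta>" and V: "openin X V" "V <= U"
 shows "graded_chart X C ds V \<phi> \<theta>"
proof -
 have U: "openin X U" and hm: "homeomorphic_map (subtopology X U) (subtopology (body_space ds) (\<phi> ` U)) \<phi>"
  and o: "openin (body_space ds) (\<phi> ` U)"
  using ch unfolding graded_chart_def by auto
 have "openin (subtopology X U) V" using V U by (simp add: openin_open_subtopology)
 then have "openin (subtopology (body_space ds) (\<phi> ` U)) (\<phi> ` V)"
  using homeomorphic_imp_open_map[OF hm] unfolding open_map_def by blast
 then have oV: "openin (body_space ds) (\<phi> ` V)" using o by (simp add: openin_open_subtopology)
 have tX: "topspace (subtopology X U) Int V = V" using V openin_subset[OF V(1)] by auto
 have tY: "topspace (subtopology (body_space ds) (\<phi> ` U)) Int \<phi> ` V = \<phi> ` V"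
  using V openin_subset[OF oV] by auto
 have "homeomorphic_map (subtopology (subtopology X U) V) (subtopology (subtopology (body_space ds) (\<phi> ` U)) (\<phi> ` V)) \<phi>"
  by (rule homeomorphic_map_subtopologies[OF hm]) (simp only: tX tY)
 moreover have "U Int V = V" "\<phi> ` U Int \<phi> ` V = \<phi> ` V" using V by auto
 ultimately have hV: "homeomorphic_map (subtopology X V) (subtopology (body_space ds) (\<phi> ` V)) \<phi>"
  by (simp add: subtopology_subtopology)
 note big = ch[unfolded graded_chart_def, THEN conjunct2, THEN conjunct2, THEN conjunct2, THEN spec, THEN mp]
 show ?thesis
  unfolding graded_chart_def
 proof (intro conjI[OF V(1) conjI[OF oV conjI[OF hV]]] allI impI)
  fix N assume N: "openin X N & N <= V"
  then have "openin X N & N <= U" using V by auto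
  from big[OF this] show "(ALL j. lin (sec (model_sheaf ds) (\<phi> ` N) j) (sec C N j) (\<theta> N j) &
     bij_betw (\<theta> N j) (sect (model_sheaf ds) (\<phi> ` N) j) (sect C N j)) &
    (ALL i j. \<forall>f\<in>sect (model_sheaf ds) (\<phi> ` N) i.
     \<forall>g\<in>sect (model_sheaf ds) (\<phi> ` N) j.
     \<theta> N (i + j) (gmul (model_sheaf ds) (\<phi> ` N) i j f g) = gmul C N i j (\<theta> N i f) (\<theta> N j g)) &
    \<theta> N 0 (gunit (model_sheaf ds) (\<phi> ` N)) = gunit C N &
    (ALL W j. openin X W & W <= N --> (\<forall>f\<in>sect (model_sheaf ds) (\<phi> ` N) j.
     \<theta> W j (res (model_sheaf ds) (\<phi> ` N) (\<phi> ` W) j f) = res C N W j (\<theta> N j f)))" .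
 qed
qed

section \<open>Coefficients and values of functions in a chart\<close>

locale chart = C: graded_algebra_sheaf X C
 for X :: "'m topology" and C :: "('m, 'f) apsh" +
 fixes ds :: "int list" and V :: "'m set" and \<phi> :: "'m => nat => real"
  and \<theta> :: "'m set => int => ((nat => nat) => (nat => real) => real) => 'f"
 assumes chart: "graded_chart X C ds V \<phi> \<theta>"
begin

abbreviation "W == \<phi> ` V"
abbreviation "M j == sect (model_sheaf ds) W j"

lemma V_open: "openin X V" and W_open: "bopen ds W"
 and homeo: "homeomorphic_map (subtopology X V) (subtopology (body_space ds) W) \<phi>"
 using chart unfolding graded_chart_def by auto

lemmas at_V = chart[unfolded graded_chart_def, THEN conjunct2, THEN conjunct2, THEN conjunct2, THEN spec,
  THEN mp, OF conjI[OF V_open subset_refl]]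

lemma \<theta>_linear: "lin (sec (model_sheaf ds) W j) (sec C V j) (\<theta> V j)"
 and \<theta>_bij: "bij_betw (\<theta> V j) (M j) (sect C V j)"
 using conjunct1[OF at_V] by auto

lemma \<theta>_gmul: "f \<in> M i ==> g \<in> M j ==>
  \<theta> V (i + j) (gmul (model_sheaf ds) W i j f g) = gmul C V i j (\<theta> V i f) (\<theta> V j g)"
 using conjunct1[OF conjunct2[OF at_V]] by simp

lemma \<theta>_gunit: "\<theta> V 0 (gunit (model_sheaf ds) W) = gunit C V"
 using conjunct1[OF conjunct2[OF conjunct2[OF at_V]]] .

lemma \<theta>_res: "openin X N ==> N <= V ==> f \<in> M j ==>
  \<theta> N j (res (model_sheaf ds) W (\<phi> ` N) j f) = res C V N j (\<theta> V j f)"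
 using conjunct2[OF conjunct2[OF conjunct2[OF at_V]]] by simp

text \<open>The power series of a function in the chart.\<close>

definition T :: "int => 'f => (nat => nat) => (nat => real) => real" where
 "T j f = inv_into (M j) (\<theta> V j) f"

lemma \<theta>_closed: "h \<in> M j ==> \<theta> V j h : sect C V j"
 using \<theta>_bij by (rule bij_betwE[THEN bspec])

lemma T_closed: "f : sect C V j ==> T j f \<in> M j"
 and \<theta>_T: "f : sect C V j ==> \<theta> V j (T j f) = f"
 and T_\<theta>: "h \<in> M j ==> T j (\<theta> V j h) = h"
proof -
 show "T j f \<in> M j" if "f : sect C V j"
  unfolding T_def by (rule inv_into_into) (use that bij_betw_imp_surj_on[OF \<theta>_bij[of j]] in simp)
 show "\<theta> V j (T j f) = f" if "f : sect C V j"
  unfolding T_def by (rule f_inv_into_f[of f "\<theta> V j" "M j"]) (use that bij_betw_imp_surj_on[OF \<theta>_bij[of j]] in simp)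
 show "T j (\<theta> V j h) = h" if "h \<in> M j"
  unfolding T_def by (rule inv_into_f_f[OF bij_betw_imp_inj_on[OF \<theta>_bij] that])
qed

lemma \<theta>_add: "f \<in> M j ==> g \<in> M j ==> \<theta> V j (%I x. f I x + g I x) = \<theta> V j f \<oplus>[sec C V j] \<theta> V j g"
 using rl_add[OF \<theta>_linear] by (simp add: model_simps)

lemma \<theta>_smult: "f \<in> M j ==> \<theta> V j (%I x. r * f I x) = r \<odot>[sec C V j] \<theta> V j f"
 using rl_smult[OF \<theta>_linear] by (simp add: model_simps)

lemma \<theta>_zero: "\<theta> V j (%I x. 0) = \<zero>[sec C V j]"
 using \<theta>_smult[OF msec_zero[OF W_open], of j 0] \<theta>_closed[OF msec_zero[OF W_open], of j] V_open by simp

lemma T_add: "f : sect C V j ==> g : sect C V j ==> T j (f \<oplus>[sec C V j] g) = (%I x. T j f I x + T j g I x)"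
 using T_\<theta>[OF msec_add[OF W_open T_closed T_closed, of f j g]] by (simp add: \<theta>_add T_closed \<theta>_T)

lemma T_smult: "f : sect C V j ==> T j (r \<odot>[sec C V j] f) = (%I x. r * T j f I x)"
 using T_\<theta>[OF msec_smult[OF W_open T_closed, of f j r]] by (simp add: \<theta>_smult T_closed \<theta>_T)

lemma T_gmul: "f : sect C V i ==> g : sect C V j ==>
  T (i + j) (gmul C V i j f g) = gmul (model_sheaf ds) W i j (T i f) (T j g)"
 using T_\<theta>[OF msec_gmul[OF W_open T_closed T_closed, of f i g j]] by (simp add: \<theta>_gmul T_closed \<theta>_T)

lemma T_gunit: "T 0 (gunit C V) = gunit (model_sheaf ds) W"
 using T_\<theta>[OF msec_gunit[OF W_open]] by (simp add: \<theta>_gunit)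

definition ev :: "'m => int => 'f => real" where
 "ev a j f = T j f (%_. 0) (\<phi> a)"

lemma ev_add: "f : sect C V j ==> g : sect C V j ==> ev a j (f \<oplus>[sec C V j] g) = ev a j f + ev a j g"
 and ev_smult: "f : sect C V j ==> ev a j (r \<odot>[sec C V j] f) = r * ev a j f"
 and ev_gmul: "f : sect C V i ==> g : sect C V j ==> ev a (i + j) (gmul C V i j f g) = ev a i f * ev a j g"
 and ev_gunit: "a \<in> V ==> ev a 0 (gunit C V) = 1"
 by (simp_all add: ev_def T_add T_smult T_gmul T_gunit gmul_model_zero model_simps)

lemma ev_degree: "j ~= 0 ==> f : sect C V j ==> ev a j f = 0"
 unfolding ev_def by (rule msecD(1)[OF T_closed]) (auto simp: series_indices_def mi_degree_def)

lemma ev_zero: "ev a j \<zero>[sec C V j] = 0"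
 using ev_smult[of "\<zero>[sec C V j]" j a 0] V_open by simp

lemma ev_finsum:
 assumes "finite S" "g \<in> S \<rightarrow> sect C V j" "!!i. i \<in> S ==> ev a j (g i) = 0"
 shows "ev a j (finsum (sec C V j) g S) = 0"
 using assms
proof (induction S)
 case empty
 then show ?case using V_open by (simp add: ev_zero)
next
 case (insert i S)
 have c: "g i : sect C V j" "g \<in> S \<rightarrow> sect C V j" using insert.prems by auto
 show ?case
  unfolding finsum_insert_rm[OF C.sec_rmod[OF V_open] insert.hyps(1,2) c(2,1)]
   ev_add[OF c(1) finsum_closed_rm[OF C.sec_rmod[OF V_open] c(2)]]
  using insert.IH[OF c(2)] insert.prems(2) by simp
qed

lemma \<theta>_sum:
 assumes "finite S" "!!i. i \<in> S ==> h i \<in> M j"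
 shows "(%I x. \<Sum>i\<in>S. h i I x) \<in> M j & \<theta> V j (%I x. \<Sum>i\<in>S. h i I x) = finsum (sec C V j) (%i. \<theta> V j (h i)) S"
 using assms
proof (induction S)
 case empty
 then show ?case using V_open by (simp add: \<theta>_zero msec_zero W_open)
next
 case (insert i S)
 have IH: "(%I x. \<Sum>i\<in>S. h i I x) \<in> M j" "\<theta> V j (%I x. \<Sum>i\<in>S. h i I x) = finsum (sec C V j) (%i. \<theta> V j (h i)) S"
  using insert.IH insert.prems by auto
 have hi: "h i \<in> M j" using insert.prems by simp
 have e: "(%I x. \<Sum>i\<in>insert i S. h i I x) = (%I x. h i I x + (\<Sum>i\<in>S. h i I x))" using insert.hyps by simp
 have "finsum (sec C V j) (%i. \<theta> V j (h i)) (insert i S) = \<theta> V j (h i) \<oplus>[sec C V j] finsum (sec C V j) (%i. \<theta> V j (h i)) S"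
  using insert.prems by (intro finsum_insert_rm[OF C.sec_rmod[OF V_open] insert.hyps]) (auto intro: \<theta>_closed)
 then show ?case unfolding e using msec_add[OF W_open hi IH(1)] \<theta>_add[OF hi IH(1)] IH(2) by simp
qed

definition z :: "nat => 'f" where
 "z A = \<theta> V (ds ! A) (model_coordinate ds W A)"

lemma z_closed: "A < length ds ==> z A : sect C V (ds ! A)"
 unfolding z_def by (intro \<theta>_closed msec_coordinate W_open)

text \<open>The coordinate functions, shifted so as to vanish at \<open>a\<close>. By
  \<open>hadamard_chart\<close> they generate the functions that vanish there.\<close>

definition zs :: "'m => nat => 'f" where
 "zs a A = (if ds ! A = 0 then z A \<oplus>[sec C V (ds ! A)] (- \<phi> a A) \<odot>[sec C V (ds ! A)] gunit C V else z A)"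

lemma model_shift:
 assumes A: "A < length ds"
 shows "(%I x. model_coordinate ds W A I x + (- centre ds (\<phi> a) A) * (if ds ! A = 0 then gunit (model_sheaf ds) W I x else 0)) \<in> M (ds ! A)"
  and "\<theta> V (ds ! A) (%I x. model_coordinate ds W A I x + (- centre ds (\<phi> a) A) * (if ds ! A = 0 then gunit (model_sheaf ds) W I x else 0)) = zs a A"
proof -
 let ?u = "%I x. if ds ! A = 0 then gunit (model_sheaf ds) W I x else 0"
 have u: "?u \<in> M (ds ! A)" using msec_gunit[OF W_open] msec_zero[OF W_open] by (cases "ds ! A = 0") auto
 have mc: "model_coordinate ds W A \<in> M (ds ! A)" by (rule msec_coordinate[OF W_open A])
 note su = msec_smult[OF W_open u, of "- centre ds (\<phi> a) A"]
 show "(%I x. model_coordinate ds W A I x + (- centre ds (\<phi> a) A) * ?u I x) \<in> M (ds ! A)"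
  by (rule msec_add[OF W_open mc su])
 have "\<theta> V (ds ! A) (%I x. model_coordinate ds W A I x + (- centre ds (\<phi> a) A) * ?u I x) =
  z A \<oplus>[sec C V (ds ! A)] (- centre ds (\<phi> a) A) \<odot>[sec C V (ds ! A)] \<theta> V (ds ! A) ?u"
  unfolding \<theta>_add[OF mc su] \<theta>_smult[OF u] z_def ..
 also have "\<dots> = zs a A"
  using V_open z_closed[OF A] by (cases "ds ! A = 0") (simp_all add: zs_def centre_def \<theta>_gunit \<theta>_zero)
 finally show "\<theta> V (ds ! A) (%I x. model_coordinate ds W A I x + (- centre ds (\<phi> a) A) * ?u I x) = zs a A" .
qed

lemma zs_closed: "A < length ds ==> zs a A : sect C V (ds ! A)"
proof -
 assume A: "A < length ds"
 show ?thesis using \<theta>_closed[OF model_shift(1)[OF A, of a]] unfolding model_shift(2)[OF A] .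
qed

lemma T_zs: "A < length ds ==> T (ds ! A) (zs a A) =
  (%I x. model_coordinate ds W A I x + (- centre ds (\<phi> a) A) * (if ds ! A = 0 then gunit (model_sheaf ds) W I x else 0))"
proof -
 assume A: "A < length ds"
 show ?thesis using T_\<theta>[OF model_shift(1)[OF A, of a]] unfolding model_shift(2)[OF A] .
qed

lemma hadamard_chart:
 assumes a: "a \<in> V" and f: "f : sect C V j" and fa: "ev a j f = 0"
 shows "EX F. (\<forall>A<length ds. F A : sect C V (j - ds ! A)) &
  f = finsum (sec C V j) (%A. gmul C V (ds ! A) (j - ds ! A) (zs a A) (F A)) {..<length ds}"
proof -
 let ?c = "%A I x. model_coordinate ds W A I x + (- centre ds (\<phi> a) A) * (if ds ! A = 0 then gunit (model_sheaf ds) W I x else 0)"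
 have "\<phi> a \<in> W" using a by blast
 from hadamard_model[OF W_open this T_closed[OF f] fa[unfolded ev_def]] obtain F
  where F: "\<forall>A<length ds. F A \<in> M (j - ds ! A)"
   "T j f = (%K x. \<Sum>A<length ds. gmul (model_sheaf ds) W (ds ! A) (j - ds ! A) (?c A) (F A) K x)" by blast
 have m: "gmul (model_sheaf ds) W (ds ! A) (j - ds ! A) (?c A) (F A) \<in> M j" if "A < length ds" for A
  using msec_gmul[OF W_open model_shift(1)[OF that], of "F A" "j - ds ! A" a] F(1) that by simp
 have "f = \<theta> V j (%K x. \<Sum>A<length ds. gmul (model_sheaf ds) W (ds ! A) (j - ds ! A) (?c A) (F A) K x)"
  using \<theta>_T[OF f] unfolding F(2) by simp
 also have "\<dots> = finsum (sec C V j) (%A. \<theta> V j (gmul (model_sheaf ds) W (ds ! A) (j - ds ! A) (?c A) (F A))) {..<length ds}"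
  using \<theta>_sum[of "{..<length ds}" "%A. gmul (model_sheaf ds) W (ds ! A) (j - ds ! A) (?c A) (F A)" j] m by simp
 also have "\<dots> = finsum (sec C V j) (%A. gmul C V (ds ! A) (j - ds ! A) (zs a A) (\<theta> V (j - ds ! A) (F A))) {..<length ds}"
 proof (rule sum_cong_rm[OF C.sec_rmod[OF V_open] refl])
  fix A assume "A \<in> {..<length ds}"
  then have A: "A < length ds" by simp
  show "\<theta> V j (gmul (model_sheaf ds) W (ds ! A) (j - ds ! A) (?c A) (F A)) = gmul C V (ds ! A) (j - ds ! A) (zs a A) (\<theta> V (j - ds ! A) (F A))"
   using \<theta>_gmul[OF model_shift(1)[OF A, of a] F(1)[rule_format, OF A]] unfolding model_shift(2)[OF A] by simp
 next
  show "(%A. gmul C V (ds ! A) (j - ds ! A) (zs a A) (\<theta> V (j - ds ! A) (F A))) \<in> {..<length ds} \<rightarrow> sect C V j"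
  proof (rule funcsetI)
   fix A assume "A \<in> {..<length ds}"
   then have A: "A < length ds" by simp
   show "gmul C V (ds ! A) (j - ds ! A) (zs a A) (\<theta> V (j - ds ! A) (F A)) \<in> sect C V j"
    by (rule C.gmul_closed[OF V_open zs_closed[OF A] \<theta>_closed[OF F(1)[rule_format, OF A]]]) simp
  qed
 qed
 finally show ?thesis using F(1) by (intro exI[of _ "%A. \<theta> V (j - ds ! A) (F A)"]) (simp add: \<theta>_closed)
qed

lemma restrict_chart: "openin X N ==> N <= V ==> chart X C ds N \<phi> \<theta>"
 using chart_restrict[OF chart] C.graded_algebra_sheaf_axioms by (simp add: chart_def chart_axioms_def)

lemma T_res:
 assumes N: "openin X N" "N <= V" and f: "f : sect C V j"
 shows "chart.T ds N \<phi> \<theta> j (res C V N j f) = res (model_sheaf ds) W (\<phi> ` N) j (T j f)"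
proof -
 interpret N: chart X C ds N \<phi> \<theta> by (rule restrict_chart[OF N])
 have m: "res (model_sheaf ds) W (\<phi> ` N) j (T j f) \<in> N.M j"
  unfolding model_simps
 proof (rule msecI)
  show "smooth_on ds (\<phi> ` N) (%x. if x \<in> \<phi> ` N then T j f I x else 0)" for I
   by (rule smooth_cong[OF N.W_open smooth_mono[OF msec_smooth[OF W_open T_closed[OF f]] W_open N.W_open image_mono[OF N(2)], of I]]) simp
 qed (use msecD(1)[OF T_closed[OF f]] in auto)
 have "\<theta> N j (res (model_sheaf ds) W (\<phi> ` N) j (T j f)) = res C V N j f"
  using \<theta>_res[OF N T_closed[OF f]] \<theta>_T[OF f] by simp
 then show ?thesis using N.T_\<theta>[OF m] by simp
qed

lemma ev_res:
 assumes N: "openin X N" "N <= V" and f: "f : sect C V j" and a: "a \<in> N"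
 shows "chart.ev ds N \<phi> \<theta> a j (res C V N j f) = ev a j f"
proof -
 interpret N: chart X C ds N \<phi> \<theta> by (rule restrict_chart[OF N])
 show ?thesis unfolding N.ev_def ev_def T_res[OF N f] using a by (simp add: model_simps)
qed

text \<open>At \<open>a\<close> this function has the value \<open>-c\<close>, so its reciprocal is
  smooth nearby. Invertibility is a property of the algebra alone, which lets another chart draw a
  conclusion from it.\<close>

lemma invertible_near:
 assumes a: "a \<in> V" and A: "A < length ds" "ds ! A = 0" and c: "c ~= 0"
 shows "EX N g. openin X N & N <= V & a \<in> N & g : sect C N 0 &
  gmul C N 0 0 (res C V N 0 (zs a A \<oplus>[sec C V 0] (- c) \<odot>[sec C V 0] gunit C V)) g = gunit C N"
proof -
 let ?w = "%x. x A - \<phi> a A - c"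
 let ?h = "zs a A \<oplus>[sec C V 0] (- c) \<odot>[sec C V 0] gunit C V"
 let ?m = "%I x. if I = (%_. 0) & x \<in> W then ?w x else 0"
 note zc = zs_closed[OF A(1), of a, unfolded A(2)] and uc = C.gunit_closed[OF V_open]
 have hc: "?h : sect C V 0" using zc uc V_open by simp
 have Th: "T 0 ?h = ?m"
 proof -
  have "T 0 (zs a A) = (%I x. model_coordinate ds W A I x + (- centre ds (\<phi> a) A) * gunit (model_sheaf ds) W I x)"
   using T_zs[OF A(1), of a] by (simp add: A(2))
  then show ?thesis
   using V_open zc uc
   by (auto simp: T_add T_smult T_gunit model_simps model_coordinate_def centre_def A(2) fun_eq_iff)
 qed
 define N where "N = {m \<in> V. ?w (\<phi> m) ~= 0}"
 have No: "openin X N"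
 proof -
  have "continuous_map (subtopology X V) (subtopology (body_space ds) W) \<phi>" using homeo by (rule homeomorphic_imp_continuous_map)
  then have "continuous_map (subtopology X V) (body_space ds) \<phi>" by (rule continuous_map_into_fulltopology)
  moreover have "bopen ds {x \<in> bpts ds. x \<in> {x. ?w x ~= 0}}"
   by (rule bopen_Collect) (intro open_Collect_neq continuous_intros coord_cont)
  ultimately have "openin (subtopology X V) {m \<in> topspace (subtopology X V). \<phi> m \<in> {x \<in> bpts ds. x \<in> {x. ?w x ~= 0}}}"
   by (rule openin_continuous_map_preimage)
  moreover have "{m \<in> topspace (subtopology X V). \<phi> m \<in> {x \<in> bpts ds. x \<in> {x. ?w x ~= 0}}} = N"
   using openin_subset[OF V_open] bopen_subset[OF W_open] by (auto simp: N_def)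
  ultimately show ?thesis using V_open by (simp add: openin_open_subtopology)
 qed
 have NV: "N <= V" and aN: "a \<in> N" using a c by (auto simp: N_def)
 interpret N: chart X C ds N \<phi> \<theta> by (rule restrict_chart[OF No NV])
 let ?g = "%I x. if I = (%_. 0) & x \<in> \<phi> ` N then inverse (?w x) else 0"
 have nz: "?w x ~= 0" if "x \<in> \<phi> ` N" for x using that by (auto simp: N_def)
 have gm: "?g \<in> N.M 0"
  by (intro msec_body N.W_open smooth_inverse smooth_diff smooth_coord smooth_const nz)
 have rc: "res C V N 0 ?h : sect C N 0" by (rule C.res_closed[OF V_open No NV hc])
 have "N.T 0 (gmul C N 0 0 (res C V N 0 ?h) (\<theta> N 0 ?g)) = gmul (model_sheaf ds) (\<phi> ` N) 0 0 (res (model_sheaf ds) W (\<phi> ` N) 0 ?m) ?g"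
  using N.T_gmul[OF rc N.\<theta>_closed[OF gm]] T_res[OF No NV hc] by (simp add: N.T_\<theta>[OF gm] Th)
 also have "\<dots> = gunit (model_sheaf ds) (\<phi> ` N)"
 proof (intro ext)
  fix K x
  show "gmul (model_sheaf ds) (\<phi> ` N) 0 0 (res (model_sheaf ds) W (\<phi> ` N) 0 ?m) ?g K x = gunit (model_sheaf ds) (\<phi> ` N) K x"
  proof (cases "K \<in> multiindices ds")
   case True
   then show ?thesis
    using nz[of x] image_mono[OF NV, of \<phi>]
    by (subst gmul_model_body) (auto simp: model_simps subset_iff)
  next
   case False
   then have "K ~= (%_. 0)" using zero_mi by auto
   then show ?thesis using False by (simp add: gmul_model model_simps)
  qed
 qed
 finally have "gmul C N 0 0 (res C V N 0 ?h) (\<theta> N 0 ?g) = gunit C N"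
  using N.\<theta>_T[OF C.gmul_closed[OF No rc N.\<theta>_closed[OF gm], of 0]] by (simp add: N.\<theta>_gunit)
 then show ?thesis using No NV aN N.\<theta>_closed[OF gm] by blast
qed

end

text \<open>Let \<open>c\<close> be the value that the first chart gives to a shifted coordinate of
  the second. If \<open>c\<close> were not 0, the coordinate minus \<open>c\<close> would be
  invertible near \<open>a\<close> and yet have value 0 in the first chart. So the first evaluation
  kills these coordinates, hence by Hadamard's lemma all that the second one kills, and both send 1
  to 1.\<close>

lemma ev_unique:
 assumes "chart X C ds V \<phi> \<theta>" "chart X C ds V \<phi>' \<theta>'" and a: "a \<in> V" and f: "f : sect C V j"
 shows "chart.ev ds V \<phi> \<theta> a j f = chart.ev ds V \<phi>' \<theta>' a j f"
proof (cases "j = 0")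
 case False
 then show ?thesis using chart.ev_degree[OF assms(1) False f] chart.ev_degree[OF assms(2) False f] by simp
next
 case True
 interpret A: chart X C ds V \<phi> \<theta> by fact
 interpret B: chart X C ds V \<phi>' \<theta>' by fact
 note uc = A.C.gunit_closed[OF A.V_open] and rm = A.C.sec_rmod[OF A.V_open]
 have f0: "f : sect C V 0" using f True by simp
 have zs0: "A.ev a (ds ! A) (B.zs a A) = 0" if A: "A < length ds" for A
 proof (cases "ds ! A = 0")
  case False
  then show ?thesis by (rule A.ev_degree[OF _ B.zs_closed[OF A]])
 next
  case d: True
  show ?thesis
  proof (rule ccontr)
   assume nz: "A.ev a (ds ! A) (B.zs a A) ~= 0"
   let ?c = "A.ev a (ds ! A) (B.zs a A)"
   let ?h = "B.zs a A \<oplus>[sec C V 0] (- ?c) \<odot>[sec C V 0] gunit C V"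
   note zc = B.zs_closed[OF A, of a, unfolded d]
   have hc: "?h : sect C V 0" using zc uc rm by simp
   have "A.ev a 0 ?h = ?c + (- ?c) * 1"
    using A.ev_add[OF zc rm_smult_closed[OF rm uc]] A.ev_smult[OF uc] A.ev_gunit[OF a] d by simp
   then have h0: "A.ev a 0 ?h = 0" by simp
   obtain N g where N: "openin X N" "N <= V" "a \<in> N" and g: "g : sect C N 0"
    and inv: "gmul C N 0 0 (res C V N 0 ?h) g = gunit C N"
    using B.invertible_near[OF a A d nz] by blast
   interpret N: chart X C ds N \<phi> \<theta> by (rule A.restrict_chart[OF N(1,2)])
   have "N.ev a (0 + 0) (gmul C N 0 0 (res C V N 0 ?h) g) = 0"
    unfolding N.ev_gmul[OF A.C.res_closed[OF A.V_open N(1,2) hc] g] A.ev_res[OF N(1,2) hc N(3)] h0 by simp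
   then show False unfolding inv using N.ev_gunit[OF N(3)] by simp
  qed
 qed
 let ?v = "B.ev a 0 f"
 let ?f = "f \<oplus>[sec C V 0] (- ?v) \<odot>[sec C V 0] gunit C V"
 have fc: "?f : sect C V 0" using f0 uc rm by simp
 have "B.ev a 0 ?f = 0"
  using B.ev_add[OF f0 rm_smult_closed[OF rm uc]] B.ev_smult[OF uc] B.ev_gunit[OF a] by simp
 from B.hadamard_chart[OF a fc this] obtain F where F: "\<forall>A<length ds. F A : sect C V (0 - ds ! A)"
  "?f = finsum (sec C V 0) (%A. gmul C V (ds ! A) (0 - ds ! A) (B.zs a A) (F A)) {..<length ds}" by blast
 have "A.ev a 0 ?f = 0"
 proof (subst F(2), rule A.ev_finsum)
  fix A assume "A \<in> {..<length ds}"
  then have A: "A < length ds" by simp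
  show "A.ev a 0 (gmul C V (ds ! A) (0 - ds ! A) (B.zs a A) (F A)) = 0"
   using A.ev_gmul[OF B.zs_closed[OF A] F(1)[rule_format, OF A], of a a] zs0[OF A] by simp
 next
  show "(%A. gmul C V (ds ! A) (0 - ds ! A) (B.zs a A) (F A)) \<in> {..<length ds} \<rightarrow> sect C V 0"
  proof (rule funcsetI)
   fix A assume "A \<in> {..<length ds}"
   then have A: "A < length ds" by simp
   show "gmul C V (ds ! A) (0 - ds ! A) (B.zs a A) (F A) \<in> sect C V 0"
    by (rule A.C.gmul_closed[OF A.V_open B.zs_closed[OF A] F(1)[rule_format, OF A]]) simp
  qed
 qed simp
 moreover have "A.ev a 0 ?f = A.ev a 0 f - ?v"
  using A.ev_add[OF f0 rm_smult_closed[OF rm uc]] A.ev_smult[OF uc] A.ev_gunit[OF a] by simp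
 ultimately show ?thesis using True by simp
qed

text \<open>Any two charts around \<open>a\<close> are compared on their common domain by
  \<open>ev_unique\<close>, so the \<open>THE\<close> in \<open>fun_value\<close> has a unique
  witness.\<close>

lemma fun_value_eq:
 assumes C: "graded_algebra_sheaf X C" and ch: "graded_chart X C ds U \<phi> \<theta>"
  and V: "openin X V" "a \<in> V" "a \<in> U" and f: "f : sect C V j"
 shows "fun_value X C ds V j f a = chart.ev ds (V Int U) \<phi> \<theta> a j (res C V (V Int U) j f)"
proof -
 interpret C: graded_algebra_sheaf X C by fact
 have chI: "chart X C ds N \<phi> \<theta>" if "graded_chart X C ds W \<phi> \<theta>" "openin X N" "N <= W" for N W \<phi> \<theta>
  using chart_restrict[OF that] C by (simp add: chart_def chart_axioms_def)
 have Wo: "openin X W" if "graded_chart X C ds W \<phi> \<theta>" for W \<phi> \<theta> using that by (simp add: graded_chart_def)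
 have key: "h (%_. 0) (\<phi>' a) = chart.ev ds (V Int U) \<phi> \<theta> a j (res C V (V Int U) j f)"
  if h: "graded_chart X C ds W \<phi>' \<theta>'" "a \<in> W" "h : sect (model_sheaf ds) (\<phi>' ` (V Int W)) j"
   "\<theta>' (V Int W) j h = res C V (V Int W) j f" for W \<phi>' \<theta>' h
 proof -
  have oW: "openin X (V Int W)" and oU: "openin X (V Int U)" and oN: "openin X (V Int U Int W)"
   using V Wo[OF h(1)] Wo[OF ch] by auto
  interpret A: chart X C ds "V Int W" \<phi>' \<theta>' by (rule chI[OF h(1) oW]) simp
  interpret B: chart X C ds "V Int U" \<phi> \<theta> by (rule chI[OF ch oU]) simp
  let ?N = "V Int U Int W"
  have NA: "?N <= V Int W" and NB: "?N <= V Int U" and aN: "a \<in> ?N" and NV: "V Int W <= V" "V Int U <= V" using V h by auto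
  note fA = C.res_closed[OF V(1) oW NV(1) f] and fB = C.res_closed[OF V(1) oU NV(2) f]
  have "A.T j (res C V (V Int W) j f) = h" using A.T_\<theta>[OF h(3)] unfolding h(4) .
  then have "h (%_. 0) (\<phi>' a) = A.ev a j (res C V (V Int W) j f)" by (simp add: A.ev_def)
  also have "\<dots> = chart.ev ds ?N \<phi>' \<theta>' a j (res C V ?N j f)"
   unfolding A.ev_res[OF oN NA fA aN, symmetric] C.res_comp[OF V(1) oW oN NA NV(1) f] ..
  also have "\<dots> = chart.ev ds ?N \<phi> \<theta> a j (res C V ?N j f)"
   by (rule ev_unique[OF A.restrict_chart[OF oN NA] B.restrict_chart[OF oN NB] aN C.res_closed[OF V(1) oN _ f]]) auto
  also have "\<dots> = B.ev a j (res C V (V Int U) j f)"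
   unfolding B.ev_res[OF oN NB fB aN, symmetric] C.res_comp[OF V(1) oU oN NB NV(2) f] ..
  finally show ?thesis .
 qed
 show ?thesis
  unfolding fun_value_def
 proof (rule the_equality)
  have oU: "openin X (V Int U)" using V Wo[OF ch] by auto
  interpret B: chart X C ds "V Int U" \<phi> \<theta> by (rule chI[OF ch oU]) simp
  have fB: "res C V (V Int U) j f : sect C (V Int U) j" by (rule C.res_closed[OF V(1) oU _ f]) simp
  show "\<exists>W \<phi>' \<theta>' h. graded_chart X C ds W \<phi>' \<theta>' & a \<in> W & h : sect (model_sheaf ds) (\<phi>' ` (V Int W)) j &
   \<theta>' (V Int W) j h = res C V (V Int W) j f & B.ev a j (res C V (V Int U) j f) = h (%_. 0) (\<phi>' a)"
   using ch V(3) B.T_closed[OF fB] B.\<theta>_T[OF fB] unfolding B.ev_def by blast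
 next
  fix v assume "\<exists>W \<phi>' \<theta>' h. graded_chart X C ds W \<phi>' \<theta>' & a \<in> W & h : sect (model_sheaf ds) (\<phi>' ` (V Int W)) j &
   \<theta>' (V Int W) j h = res C V (V Int W) j f & v = h (%_. 0) (\<phi>' a)"
  then show "v = chart.ev ds (V Int U) \<phi> \<theta> a j (res C V (V Int U) j f)" using key by (elim exE conjE) simp
 qed
qed

lemma fun_value_res:
 assumes C: "graded_manifold X C ds"
  and V: "openin X U" "openin X V" "V <= U" "a \<in> V" and f: "f : sect C U j"
 shows "fun_value X C ds V j (res C U V j f) a = fun_value X C ds U j f a"
proof -
 have C': "graded_algebra_sheaf X C" and "a \<in> topspace X" using C openin_subset[OF V(2)] V(4) by (auto simp: graded_manifold_def)
 interpret C: graded_algebra_sheaf X C by (rule C')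
 obtain W \<phi> \<theta> where ch: "graded_chart X C ds W \<phi> \<theta>" "a \<in> W"
  using C \<open>a \<in> topspace X\<close> unfolding graded_manifold_def by blast
 have Wo: "openin X W" using ch by (simp add: graded_chart_def)
 have o: "openin X (U Int W)" "openin X (V Int W)" using V Wo by auto
 interpret A: chart X C ds "U Int W" \<phi> \<theta>
  using chart_restrict[OF ch(1) o(1)] C' by (simp add: chart_def chart_axioms_def)
 have s: "V Int W <= U Int W" "U Int W <= U" "V Int W <= V" using V by auto
 have aU: "a \<in> U" and aN: "a \<in> V Int W" using V ch by auto
 show ?thesis
  unfolding fun_value_eq[OF C' ch(1) V(2,4) ch(2) C.res_closed[OF V(1,2,3) f]] fun_value_eq[OF C' ch(1) V(1) aU ch(2) f]
   C.res_comp[OF V(1,2) o(2) s(3) V(3) f]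
  unfolding A.ev_res[OF o(2) s(1) C.res_closed[OF V(1) o(1) s(2) f] aN, symmetric] C.res_comp[OF V(1) o(1,2) s(1,2) f] ..
qed

section \<open>A chart as a coordinate algebra\<close>

context chart
begin

definition D :: "nat => int => 'f => 'f" where
 "D A j f = \<theta> V (j - ds ! A) (mder ds W A (T j f))"

definition Z :: "'m => nat => int => 'f set" where
 "Z a q j = {f \<in> sect C V j. vanishing_order ds q (\<phi> a) (T j f)}"

lemma fun_value_chart: "a \<in> V ==> f : sect C V j ==> fun_value X C ds V j f a = ev a j f"
 using fun_value_eq[OF C.graded_algebra_sheaf_axioms chart V_open _ _, of a f j] C.res_id[OF V_open] by simp

lemma vanishing_ideal_chart: "a \<in> V ==> vanishing_ideal X C ds V a j = {f \<in> sect C V j. ev a j f = 0}"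
 unfolding vanishing_ideal_def using fun_value_chart by auto

lemma zs_vanishing: "a \<in> V ==> A < length ds ==> ev a (ds ! A) (zs a A) = 0"
proof (cases "ds ! A = 0")
 case False
 assume "A < length ds"
 then show ?thesis using ev_degree[OF False zs_closed] by simp
next
 case True
 assume a: "a \<in> V" and A: "A < length ds"
 have "T (ds ! A) (zs a A) (%_. 0) (\<phi> a) = 0"
  unfolding T_zs[OF A] using a by (simp add: True model_coordinate_def centre_def model_simps)
 then show ?thesis by (simp add: ev_def)
qed

theorem coordinate_algebra:
 "coordinate_algebra X C V ds z D (vanishing_ideal X C ds V) Z"
proof (intro coordinate_algebra.intro[OF C.graded_algebra_sheaf_axioms] coordinate_algebra_axioms.intro)
 show "openin X V" by (rule V_open)
 show "z A : sect C V (ds ! A)" if "A < length ds" for A by (rule z_closed[OF that])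
 show "lin (sec C V j) (sec C V (j - ds ! A)) (D A j)" if A: "A < length ds" for A j
  unfolding D_def
 proof (rule real_linearI)
  fix f assume f: "f : sect C V j"
  note m = mder_closed[OF W_open T_closed[OF f] A]
  show "\<theta> V (j - ds ! A) (mder ds W A (T j f)) \<in> sect C V (j - ds ! A)" by (rule \<theta>_closed[OF m])
  show "\<theta> V (j - ds ! A) (mder ds W A (T j (r \<odot>[sec C V j] f))) = r \<odot>[sec C V (j - ds ! A)] \<theta> V (j - ds ! A) (mder ds W A (T j f))" for r
   unfolding T_smult[OF f] mder_smult[OF W_open T_closed[OF f] A] \<theta>_smult[OF m] ..
  fix g assume g: "g : sect C V j"
  show "\<theta> V (j - ds ! A) (mder ds W A (T j (f \<oplus>[sec C V j] g))) = \<theta> V (j - ds ! A) (mder ds W A (T j f)) \<oplus>[sec C V (j - ds ! A)] \<theta> V (j - ds ! A) (mder ds W A (T j g))"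
   unfolding T_add[OF f g] mder_add[OF W_open T_closed[OF f] T_closed[OF g] A] \<theta>_add[OF m mder_closed[OF W_open T_closed[OF g] A]] ..
 qed
 show "D A (i + j) (gmul C V i j f p) = gmul C V i (j - ds ! A) f (D A j p) \<oplus>[sec C V (i + j - ds ! A)]
    koszul (ds ! A * j) \<odot>[sec C V (i + j - ds ! A)] gmul C V (i - ds ! A) j (D A i f) p"
  if A: "A < length ds" and f: "f : sect C V i" and p: "p : sect C V j" for A i j f p
 proof -
  note Tf = T_closed[OF f] and Tp = T_closed[OF p]
  note mf = mder_closed[OF W_open Tf A] and mp = mder_closed[OF W_open Tp A]
  have e: "i + (j - ds ! A) = i + j - ds ! A" "(i - ds ! A) + j = i + j - ds ! A" by simp_all
  note m1 = msec_gmul[OF W_open Tf mp, unfolded e] and m2 = msec_gmul[OF W_open mf Tp, unfolded e]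
  show ?thesis
   unfolding D_def T_gmul[OF f p] mder_leibniz[OF W_open Tf Tp A]
    \<theta>_add[OF m1 msec_smult[OF W_open m2]] \<theta>_smult[OF m2]
    \<theta>_gmul[OF Tf mp, unfolded e] \<theta>_gmul[OF mf Tp, unfolded e] \<theta>_T[OF f] \<theta>_T[OF p] ..
 qed
 show "D A (ds ! B) (z B) = (if A = B then gunit C V else \<zero>[sec C V (ds ! B - ds ! A)])"
  if "A < length ds" "B < length ds" for A B
  unfolding D_def z_def T_\<theta>[OF msec_coordinate[OF W_open that(2)]] mder_coordinate[OF that W_open]
  by (cases "A = B") (simp_all add: \<theta>_gunit \<theta>_zero)
 show "vanishing_ideal X C ds V a i <= sect C V i" for a i by (auto simp: vanishing_ideal_def)
 show "f \<in> vanishing_ideal X C ds V a i" if "a \<in> V" "i ~= 0" "f : sect C V i" for a i f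
  using that by (simp add: vanishing_ideal_chart ev_degree)
 show "EX v. f \<oplus>[sec C V 0] v \<odot>[sec C V 0] gunit C V \<in> vanishing_ideal X C ds V a 0" if a: "a \<in> V" and f: "f : sect C V 0" for a f
 proof
  have u: "gunit C V : sect C V 0" by (rule C.gunit_closed[OF V_open])
  show "f \<oplus>[sec C V 0] (- ev a 0 f) \<odot>[sec C V 0] gunit C V \<in> vanishing_ideal X C ds V a 0"
   unfolding vanishing_ideal_chart[OF a]
   using V_open f u by (simp add: ev_add ev_smult ev_gunit a)
 qed
 show "EX v F. (\<forall>A<length ds. F A : sect C V (j - ds ! A) &
    (if ds ! A = 0 then z A \<oplus>[sec C V (ds ! A)] v A \<odot>[sec C V (ds ! A)] gunit C V else z A) \<in> vanishing_ideal X C ds V a (ds ! A)) &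
   f = finsum (sec C V j) (%A. gmul C V (ds ! A) (j - ds ! A)
    (if ds ! A = 0 then z A \<oplus>[sec C V (ds ! A)] v A \<odot>[sec C V (ds ! A)] gunit C V else z A) (F A)) {..<length ds}"
  if a: "a \<in> V" and f: "f \<in> vanishing_ideal X C ds V a j" for a f j
 proof -
  have f': "f : sect C V j" "ev a j f = 0" using f unfolding vanishing_ideal_chart[OF a] by auto
  obtain F where F: "\<forall>A<length ds. F A : sect C V (j - ds ! A)"
   "f = finsum (sec C V j) (%A. gmul C V (ds ! A) (j - ds ! A) (zs a A) (F A)) {..<length ds}"
   using hadamard_chart[OF a f'] by (elim exE conjE)
  have "zs a A \<in> vanishing_ideal X C ds V a (ds ! A)" if "A < length ds" for A
   unfolding vanishing_ideal_chart[OF a] using zs_vanishing[OF a that] zs_closed[OF that] by simp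
  then show ?thesis
   using F unfolding zs_def by (intro exI[of _ "%A. - \<phi> a A"] exI[of _ F] conjI allI impI) simp_all
 qed
 show "rsub (Z a q j) (sec C V j)" for a q j
  unfolding rsub_iff[OF C.sec_rmod[OF V_open]]
 proof (intro conjI ballI allI)
  have u: "\<zero>[sec C V j] \<in> sect C V j" using V_open by simp
  have "T j (0 \<odot>[sec C V j] \<zero>[sec C V j]) = (%I x. 0)" unfolding T_smult[OF u] by simp
  then have "T j \<zero>[sec C V j] = (%I x. 0)" using u V_open by simp
  then show "\<zero>[sec C V j] \<in> Z a q j" using u by (simp add: Z_def vanishing_order_def)
 qed (use V_open in \<open>auto simp: Z_def vanishing_order_def T_add T_smult\<close>)
 show "Z a 0 j = sect C V j" for a j by (auto simp: Z_def vanishing_order_def)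
 show "gmul C V i j f g \<in> Z a (Suc q) (i + j)" if a: "a \<in> V" and f: "f \<in> vanishing_ideal X C ds V a i" and g: "g \<in> Z a q j" for a i j f g q
 proof -
  have f': "f : sect C V i" "T i f (%_. 0) (\<phi> a) = 0" using f unfolding vanishing_ideal_chart[OF a] ev_def by auto
  have g': "g : sect C V j" "vanishing_order ds q (\<phi> a) (T j g)" using g by (auto simp: Z_def)
  show ?thesis unfolding Z_def
   using C.gmul_closed[OF V_open f'(1) g'(1) refl] vanishing_order_gmul[where f = "T i f", OF f'(2) g'(2)] by (simp add: T_gmul[OF f'(1) g'(1)])
 qed
 show "f = \<zero>[sec C V j]" if f: "f : sect C V j" and v: "!!a q. a \<in> V ==> f \<in> Z a q j" for f j
 proof -
  have "T j f I x = 0" for I x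
  proof (cases "x \<in> W")
   case True
   then obtain a where a: "a \<in> V" "x = \<phi> a" by blast
   then show ?thesis using v[OF a(1), of "Suc (mi_weight ds I)"] by (simp add: Z_def vanishing_order_def)
  next
   case False
   then show ?thesis by (rule msecD(2)[OF T_closed[OF f]])
  qed
  then have "T j f = (%I x. 0)" by (intro ext)
  then show ?thesis using \<theta>_T[OF f] \<theta>_zero by simp
 qed
qed

end


section \<open>The algebra of jets\<close>

declare tp_sel [simp del]

lemma koszul_cancel [simp]: "koszul a * (koszul a * x) = x"
 using koszul_square[of a] by (simp add: mult.assoc[symmetric] del: koszul_square)

lemma rsub_image:
 assumes V: "rmod V" and W: "rmod W" and f: "lin V W f" and S: "rsub S V"
 shows "rsub (f ` S) W"
proof -
 have SV: "S <= carrier V" by (rule rsub_sub[OF V S])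
 have z: "f \<zero>[V] = \<zero>[W]" by (rule rl_zero[OF V W f])
 show ?thesis
  unfolding rsub_iff[OF W]
 proof (intro conjI ballI allI)
  show "f ` S <= carrier W" using SV rl_closed[OF f] by blast
  show "\<zero>[W] \<in> f ` S" using rsub_zero[OF V S] z by (metis imageI)
  fix x assume "x \<in> f ` S"
  then obtain u where u: "u \<in> S" "x = f u" by blast
  then show "r \<odot>[W] x \<in> f ` S" for r
   using rl_smult[OF f, of u r] rsub_smult[OF V S u(1), of r] SV by (metis imageI subsetD)
  fix y assume "y \<in> f ` S"
  then obtain v where v: "v \<in> S" "y = f v" by blast
  then show "x \<oplus>[W] y \<in> f ` S"
   using rl_add[OF f, of u v] rsub_add[OF V S u(1) v(1)] SV u by (metis imageI subsetD)
 qed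
qed

text \<open>Intermediate degrees enter as variables with equations, here and in the lemmas on jets,
  because equal sums of degrees are seldom written in the same way.\<close>

lemma (in graded_modules) act_act:
 assumes U: "openin X U" and f: "f : sect C U i" and g: "g : sect C U m" and x: "x : sect F U j"
  and n: "n = m + j" "p = i + j" "N = i + n"
 shows "act F U i n f (act F U m j g x) = koszul (i * m) \<odot>[sec F U N] act F U m p g (act F U i j f x)"
proof -
 have "act F U i n f (act F U m j g x) = act F U (i + m) j (gmul C U i m f g) x"
  using F.act_assoc[OF U f g x] n by simp
 also have "\<dots> = act F U (i + m) j (koszul (i * m) \<odot>[sec C U (i + m)] gmul C U m i g f) x"
  by (simp add: C.gmul_commute[OF U f g])
 also have "\<dots> = koszul (i * m) \<odot>[sec F U N] act F U (m + i) j (gmul C U m i g f) x"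
  using rl_smult[OF F.act_linear_left[OF U x, of "i + m"] C.gmul_closed[OF U g f, of "i + m"], of "koszul (i * m)"] n
  by (simp add: ac_simps)
 also have "\<dots> = koszul (i * m) \<odot>[sec F U N] act F U m p g (act F U i j f x)"
  using F.act_assoc[OF U g f x] n by simp
 finally show ?thesis .
qed

section \<open>The two actions on \<open>C \<otimes> E\<close> and their difference\<close>

locale jets = C: graded_algebra_sheaf X C + E: graded_module_presheaf X C E
 for X :: "'m topology" and C :: "('m, 'f) apsh" and E :: "('m, 'f, 'e) mpsh"
begin

sublocale tensor_setting X C E by unfold_locales

sublocale TP: graded_module_presheaf X C "tensor_psh C E" by (rule tensor_module_presheaf)

sublocale TPm: graded_modules X C "tensor_psh C E" ..

abbreviation "S U j == sec (tensor_psh C E) U j"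
abbreviation "Lf U i j f == act (tensor_psh C E) U i j f"
abbreviation "Rf U i j f == right_act C E U i j f"
abbreviation "df U i j f == jdelta C E U i j f"

lemmas tS_closed = tn_closed[folded tp_sel(1)]
lemmas tS_left = tn_left[folded tp_sel(1)]
lemmas tS_right = tn_right[folded tp_sel(1)]
lemmas S_eqI = tensor_eqI[folded tp_sel(1)]
lemmas S_lift_linear = lift_linear[folded tp_sel(1)]
lemmas S_lift_tens = lift_tens[folded tp_sel(1)]
lemmas L_tens = tact_linear(2)
lemmas res_tens = tres_linear(2)

lemma S_induct:
 assumes U: "openin X U" and x: "x \<in> carrier (S U j)" and T: "rsub T (S U j)"
  and t: "!!p a b. [|a : sect C U p; b : sect E U (j - p)|] ==> tn U p (j - p) a b \<in> T"
 shows "x \<in> T"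
 by (rule tensor_induct[OF _ _ x[unfolded tp_sel(1)] T[unfolded tp_sel(1)] t])
  (use U in simp_all)

lemma L_linear: "[|openin X U; f : sect C U i; n = i + j|] ==> lin (S U j) (S U n) (Lf U i j f)"
 using TP.act_linear_right by simp

lemma L_closed: "[|openin X U; f : sect C U i; x \<in> carrier (S U j); n = i + j|] ==> Lf U i j f x \<in> carrier (S U n)"
 by (rule TP.act_closed)

lemma
 assumes U: "openin X U" and f: "f : sect C U i"
 shows R_linear: "n = i + j ==> lin (S U j) (S U n) (Rf U i j f)"
  and R_tens: "[|g : sect C U p; \<psi> \<in> sect E U q; p + q = j|] ==>
   Rf U i j f (tn U p q g \<psi>) = koszul (i * p) \<odot>[S U (i + j)] tn U p (i + q) g (act E U i q f \<psi>)"
proof -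
 let ?h = "%(p, g, \<psi>). koszul (i * p) \<odot>[S U (i + j)] tn U p (i + (j - p)) g (act E U i (j - p) f \<psi>)"
 have l: "lin (sec C U p) (S U (i + j)) (%a. ?h (p, a, b))" if "b : sect E U (j - p)" for p b
  using rl_fun_smult[OF TP.sec_rmod[OF U] tS_left[OF U E.act_closed[OF U f that refl], where p = p and j = "i + j"], of "koszul (i * p)"] by simp
 have r: "lin (sec E U (j - p)) (S U (i + j)) (%b. ?h (p, a, b))" if "a : sect C U p" for p a
  using rl_fun_smult[OF TP.sec_rmod[OF U] rl_comp[OF E.act_linear_right[OF U f] tS_right[OF U that, where j = "i + j" and q = "i + (j - p)"]], of "koszul (i * p)"]
  by simp
 show "lin (S U j) (S U n) (Rf U i j f)" if n: "n = i + j"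
  unfolding right_act_def n by (rule S_lift_linear[OF U TP.sec_rmod[OF U] l r])
 show "Rf U i j f (tn U p q g \<psi>) = koszul (i * p) \<odot>[S U (i + j)] tn U p (i + q) g (act E U i q f \<psi>)"
  if "g : sect C U p" "\<psi> \<in> sect E U q" "p + q = j"
 proof -
  have q: "q = j - p" using that by simp
  show ?thesis
   unfolding right_act_def using S_lift_tens[OF U TP.sec_rmod[OF U] l r that] unfolding q by simp
 qed
qed

lemma R_closed: "[|openin X U; f : sect C U i; x \<in> carrier (S U j); n = i + j|] ==> Rf U i j f x \<in> carrier (S U n)"
 by (rule rl_closed[OF R_linear])

lemma R_linear_left:
 assumes U: "openin X U" and x: "x \<in> carrier (S U j)" and n: "n = i + j"
 shows "lin (sec C U i) (S U n) (%f. Rf U i j f x)"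
proof (rule real_linearI)
 note m = TP.sec_rmod[OF U]
 have t: "lin (sec C U i) (S U (i + j)) (%f. koszul (i * p) \<odot>[S U (i + j)] tn U p (i + (j - p)) g (act E U i (j - p) f b))"
  if "g : sect C U p" "b : sect E U (j - p)" for p g b
  by (rule rl_fun_smult[OF m rl_comp[OF E.act_linear_left[OF U that(2)] tS_right[OF U that(1)]]]) simp
 fix f assume f: "f : sect C U i"
 show "Rf U i j f x \<in> carrier (S U n)" by (rule R_closed[OF U f x n])
 show "Rf U i j (r \<odot>[sec C U i] f) x = r \<odot>[S U n] Rf U i j f x" for r
  unfolding n
  by (rule S_eqI[OF U m R_linear[OF U _ refl] rl_fun_smult[OF m R_linear[OF U f refl]] x])
   (use U f rl_smult[OF t f] in \<open>simp_all add: R_tens\<close>)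
 fix g assume g: "g : sect C U i"
 show "Rf U i j (f \<oplus>[sec C U i] g) x = Rf U i j f x \<oplus>[S U n] Rf U i j g x"
  unfolding n
  by (rule S_eqI[OF U m R_linear[OF U _ refl] rl_fun_add[OF m R_linear[OF U f refl] R_linear[OF U g refl]] x])
   (use U f g rl_add[OF t f g] in \<open>simp_all add: R_tens\<close>)
qed

text \<open>The two actions touch different tensor factors; only the sign of passing
  \<open>f\<close> and \<open>g\<close> remains.\<close>

lemma L_R:
 assumes U: "openin X U" and f: "f : sect C U i" and g: "g : sect C U m" and x: "x \<in> carrier (S U j)"
  and n: "n = m + j" "p = i + j" "N = i + n"
 shows "Lf U i n f (Rf U m j g x) = koszul (i * m) \<odot>[S U N] Rf U m p g (Lf U i j f x)"
 by (rule S_eqI[OF U TP.sec_rmod[OF U] rl_comp[OF R_linear[OF U g n(1)] L_linear[OF U f n(3)]]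
    rl_fun_smult[OF TP.sec_rmod[OF U] rl_comp[OF L_linear[OF U f n(2)] R_linear[OF U g]]] x])
  (use U f g n in \<open>simp_all add: R_tens L_tens rl_smult[OF L_linear[OF U f refl]] tS_closed E.act_closed C.gmul_closed
   distrib_left koszul_add ac_simps\<close>)

lemmas L_L = TPm.act_act

lemma R_gmul:
 assumes U: "openin X U" and f: "f : sect C U i" and g: "g : sect C U m" and x: "x \<in> carrier (S U j)"
  and n: "k = i + m" "n = m + j"
 shows "Rf U k j (gmul C U i m f g) x = Rf U i n f (Rf U m j g x)"
 unfolding n
 by (rule S_eqI[OF U TP.sec_rmod[OF U] R_linear[OF U C.gmul_closed[OF U f g refl] refl]
    rl_comp[OF R_linear[OF U g refl] R_linear[OF U f]] x])
  (use U f g in \<open>simp_all add: R_tens rl_smult[OF R_linear[OF U f refl]] tS_closed E.act_closed C.gmul_closed E.act_assoc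
   distrib_left distrib_right koszul_add ac_simps\<close>)

lemma R_R:
 assumes U: "openin X U" and f: "f : sect C U i" and g: "g : sect C U m" and x: "x \<in> carrier (S U j)"
  and n: "n = m + j" "p = i + j" "N = i + n"
 shows "Rf U i n f (Rf U m j g x) = koszul (i * m) \<odot>[S U N] Rf U m p g (Rf U i j f x)"
proof -
 have "Rf U i n f (Rf U m j g x) = Rf U (i + m) j (gmul C U i m f g) x"
  by (rule R_gmul[OF U f g x refl n(1), symmetric])
 also have "\<dots> = Rf U (i + m) j (koszul (i * m) \<odot>[sec C U (i + m)] gmul C U m i g f) x"
  by (simp add: C.gmul_commute[OF U f g])
 also have "\<dots> = koszul (i * m) \<odot>[S U N] Rf U (i + m) j (gmul C U m i g f) x"
  by (rule rl_smult[OF R_linear_left[OF U x] C.gmul_closed[OF U g f]]) (use n in simp_all)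
 also have "\<dots> = koszul (i * m) \<odot>[S U N] Rf U m p g (Rf U i j f x)"
  using R_gmul[OF U g f x _ n(2), of "i + m"] by simp
 finally show ?thesis .
qed

lemma R_gunit: "openin X U ==> x \<in> carrier (S U j) ==> Rf U 0 j (gunit C U) x = x"
 by (rule S_eqI[OF _ TP.sec_rmod R_linear rl_id])
  (simp_all add: R_tens C.gunit_closed E.act_gunit tS_closed)

lemma d_eq:
 "[|openin X U; f : sect C U i; x \<in> carrier (S U j); n = i + j|] ==>
  df U i j f x = Lf U i j f x \<oplus>[S U n] (-1) \<odot>[S U n] Rf U i j f x"
 unfolding jdelta_def using rm_minus[OF TP.sec_rmod L_closed R_closed] by simp

lemma d_linear: "[|openin X U; f : sect C U i; n = i + j|] ==> lin (S U j) (S U n) (df U i j f)"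
 by (rule rl_cong[OF rl_fun_add[OF _ L_linear rl_fun_smult[OF _ R_linear]]]) (auto simp: d_eq)

lemma d_closed: "[|openin X U; f : sect C U i; x \<in> carrier (S U j); n = i + j|] ==> df U i j f x \<in> carrier (S U n)"
 by (rule rl_closed[OF d_linear])

text \<open>Trades \<open>\<blacktriangleright>\<close> for \<open>\<triangleright>\<close> at the
  cost of a \<delta>-factor, the basic move of the spanning argument.\<close>

lemma R_eq:
 assumes "openin X U" "f : sect C U i" "x \<in> carrier (S U j)" "n = i + j"
 shows "Rf U i j f x = Lf U i j f x \<oplus>[S U n] (-1) \<odot>[S U n] df U i j f x"
proof -
 note m = TP.sec_rmod[OF assms(1)] and l = L_closed[OF assms] and r = R_closed[OF assms]
 show ?thesis
  unfolding d_eq[OF assms] using l r by (simp add: rm_smult_r[OF m] m rm_assoc[OF m, symmetric])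
qed

text \<open>\<delta> is the difference of two operators that graded commute with
  \<open>\<triangleright>\<close>. The same reasoning gives \<open>R_d\<close>, and both together
  give \<open>d_d\<close>.\<close>

lemma L_d:
 assumes U: "openin X U" and f: "f : sect C U i" and g: "g : sect C U m" and x: "x \<in> carrier (S U j)"
  and n: "n = m + j" "p = i + j" "N = i + n"
 shows "Lf U i n f (df U m j g x) = koszul (i * m) \<odot>[S U N] df U m p g (Lf U i j f x)"
proof -
 note mo = TP.sec_rmod[OF U] and L = L_linear[OF U f n(3)]
 note Lx = L_closed[OF U f x n(2)] and Lg = L_closed[OF U g x n(1)] and Rg = R_closed[OF U g x n(1)]
 have p: "N = m + p" using n by simp
 show ?thesis
  unfolding d_eq[OF U g x n(1)] d_eq[OF U g Lx p] rl_add[OF L Lg rm_smult_closed[OF mo Rg]] rl_smult[OF L Rg]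
   L_L[OF U f g x n] L_R[OF U f g x n]
  using L_closed[OF U g Lx p] R_closed[OF U g Lx p] mo by (simp add: rm_smult_r mult.commute)
qed

lemma R_d:
 assumes U: "openin X U" and f: "f : sect C U i" and g: "g : sect C U m" and x: "x \<in> carrier (S U j)"
  and n: "n = m + j" "p = i + j" "N = i + n"
 shows "Rf U i n f (df U m j g x) = koszul (i * m) \<odot>[S U N] df U m p g (Rf U i j f x)"
proof -
 note mo = TP.sec_rmod[OF U] and R = R_linear[OF U f n(3)]
 note Rx = R_closed[OF U f x n(2)] and Lg = L_closed[OF U g x n(1)] and Rg = R_closed[OF U g x n(1)]
 have p: "N = m + p" using n by simp
 have "Lf U m p g (Rf U i j f x) = koszul (m * i) \<odot>[S U N] Rf U i n f (Lf U m j g x)"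
  by (rule L_R[OF U g f x n(2,1) p])
 then have e: "Rf U i n f (Lf U m j g x) = koszul (i * m) \<odot>[S U N] Lf U m p g (Rf U i j f x)"
  using mo R_closed[OF U f Lg n(3)] by (simp add: mult.commute[of m i])
 show ?thesis
  unfolding d_eq[OF U g x n(1)] d_eq[OF U g Rx p] rl_add[OF R Lg rm_smult_closed[OF mo Rg]] rl_smult[OF R Rg]
   R_R[OF U f g x n] e
  using L_closed[OF U g Rx p] R_closed[OF U g Rx p] mo by (simp add: rm_smult_r mult.commute)
qed

lemma d_d:
 assumes U: "openin X U" and f: "f : sect C U i" and g: "g : sect C U m" and x: "x \<in> carrier (S U j)"
  and n: "n = m + j" "p = i + j" "N = i + n"
 shows "df U i n f (df U m j g x) = koszul (i * m) \<odot>[S U N] df U m p g (df U i j f x)"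
proof -
 note mo = TP.sec_rmod[OF U] and dx = d_closed[OF U g x n(1)]
 note Lx = L_closed[OF U f x n(2)] and Rx = R_closed[OF U f x n(2)]
 have p: "N = m + p" using n by simp
 note D = d_linear[OF U g p]
 show ?thesis
  unfolding d_eq[OF U f dx n(3)] d_eq[OF U f x n(2)] L_d[OF U f g x n] R_d[OF U f g x n]
   rl_add[OF D Lx rm_smult_closed[OF mo Rx]] rl_smult[OF D Rx]
  using d_closed[OF U g Lx p] d_closed[OF U g Rx p] mo by (simp add: rm_smult_r mult.commute)
qed

lemma
 assumes U: "openin X U" and V: "openin X V" "V <= U" and f: "f : sect C U i" and x: "x \<in> carrier (S U j)"
  and n: "n = i + j"
 shows res_R: "res (tensor_psh C E) U V n (Rf U i j f x) = Rf V i j (res C U V i f) (res (tensor_psh C E) U V j x)"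
  and res_d: "res (tensor_psh C E) U V n (df U i j f x) = df V i j (res C U V i f) (res (tensor_psh C E) U V j x)"
proof -
 note rf = C.res_closed[OF U V f] and r = TP.res_linear[OF U V] and mo = TP.sec_rmod[OF V(1)]
 show *: "res (tensor_psh C E) U V n (Rf U i j f x) = Rf V i j (res C U V i f) (res (tensor_psh C E) U V j x)"
  by (rule S_eqI[OF U mo rl_comp[OF R_linear[OF U f n] r] rl_comp[OF r R_linear[OF V(1) rf n]] x])
   (use U V f rf n in \<open>simp_all add: R_tens res_tens rl_smult[OF r] tS_closed E.act_closed C.res_closed E.res_closed E.res_act\<close>)
 have "res (tensor_psh C E) U V n (Lf U i j f x) = Lf V i j (res C U V i f) (res (tensor_psh C E) U V j x)"
  unfolding n by (rule TP.res_act[OF U V f x])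
 then show "res (tensor_psh C E) U V n (df U i j f x) = df V i j (res C U V i f) (res (tensor_psh C E) U V j x)"
  unfolding d_eq[OF U f x n] d_eq[OF V(1) rf TP.res_closed[OF U V x] n]
   rl_add[OF r L_closed[OF U f x n] rm_smult_closed[OF TP.sec_rmod[OF U] R_closed[OF U f x n]]]
   rl_smult[OF r R_closed[OF U f x n]] * by simp
qed

text \<open>The index counts \<delta>-factors: the subspace that defines the k-th jets is
  \<open>jnull U (Suc k)\<close>, and \<open>jnull U 0\<close> is everything.\<close>

definition jnull :: "'m set => nat => int => ('f, 'e) jet_tensor set" where
 "jnull U m j = real_span (S U j) (delta_products C E U m j)"

lemma jet_null_eq: "jet_null C E k U j = jnull U (Suc k) j"
 by (simp add: jet_null_def jnull_def)

context
 fixes U :: "'m set" assumes U: "openin X U"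
begin

lemma dp_closed: "x \<in> delta_products C E U m j ==> x \<in> carrier (S U j)"
proof (induction m arbitrary: j x)
 case 0
 then show ?case using U by (auto intro: tS_closed)
next
 case (Suc m)
 then show ?case using U by (auto intro!: d_closed)
qed

lemma dp_jnull: "x \<in> delta_products C E U m j ==> x \<in> jnull U m j"
 unfolding jnull_def by (rule subsetD[OF span_superset])

lemma dp_SucE:
 assumes "x \<in> delta_products C E U (Suc m) j"
 obtains i f y where "f : sect C U i" "y \<in> delta_products C E U m (j - i)" "x = df U i (j - i) f y"
 using assms unfolding delta_products.simps(2) mem_Collect_eq by (elim exE conjE)

lemma jnull_rsub: "rsub (jnull U m j) (S U j)"
 unfolding jnull_def by (rule span_rsub[OF TP.sec_rmod[OF U]]) (use dp_closed in blast)

lemma jnull_map: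
 assumes f: "lin (S U j) W f" and W: "rmod W" "rsub T W" and x: "x \<in> jnull U m j"
  and g: "!!y. y \<in> delta_products C E U m j ==> f y \<in> T"
 shows "f x \<in> T"
 by (rule rl_span[OF TP.sec_rmod[OF U] W(1) f _ W(2) g x[unfolded jnull_def]]) (use dp_closed in blast)

lemma jnull_0: "jnull U 0 j = carrier (S U j)"
proof
 show "jnull U 0 j <= carrier (S U j)" by (rule rsub_sub[OF TP.sec_rmod[OF U] jnull_rsub])
 show "carrier (S U j) <= jnull U 0 j"
 proof
  fix x assume x: "x \<in> carrier (S U j)"
  show "x \<in> jnull U 0 j"
   by (rule S_induct[OF U x jnull_rsub]) (unfold jnull_def, rule subsetD[OF span_superset], auto)
 qed
qed

lemma d_jnull:
 assumes f: "f : sect C U i" and x: "x \<in> jnull U m j" and n: "n = i + j"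
 shows "df U i j f x \<in> jnull U (Suc m) n"
proof (rule jnull_map[OF d_linear[OF U f n] TP.sec_rmod[OF U] jnull_rsub x])
 fix y assume y: "y \<in> delta_products C E U m j"
 have "EX l g w. df U i j f y = df U l (n - l) g w & g : sect C U l & w \<in> delta_products C E U m (n - l)"
  by (rule exI[of _ i], rule exI[of _ f], rule exI[of _ y]) (use f y n in simp)
 then have "df U i j f y \<in> delta_products C E U (Suc m) n" by simp
 then show "df U i j f y \<in> jnull U (Suc m) n"
  unfolding jnull_def by (rule subsetD[OF span_superset])
qed

lemma jnull_Suc: "jnull U (Suc m) j <= jnull U m j"
proof (induction m arbitrary: j)
 case 0
 then show ?case unfolding jnull_0 by (rule rsub_sub[OF TP.sec_rmod[OF U] jnull_rsub])
next
 case (Suc m)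
 have "delta_products C E U (Suc (Suc m)) j <= jnull U (Suc m) j"
 proof
  fix x assume "x \<in> delta_products C E U (Suc (Suc m)) j"
  then obtain i f y where f: "f : sect C U i" "y \<in> delta_products C E U (Suc m) (j - i)" "x = df U i (j - i) f y"
   by (rule dp_SucE)
  have "y \<in> jnull U m (j - i)" by (rule subsetD[OF Suc.IH dp_jnull[OF f(2)]])
  then show "x \<in> jnull U (Suc m) j" unfolding f(3) by (rule d_jnull[OF f(1)]) simp
 qed
 then show ?case unfolding jnull_def[of U "Suc (Suc m)"] by (rule span_minimal[OF jnull_rsub])
qed

lemma jnull_mono: "m <= m' ==> jnull U m' j <= jnull U m j"
 by (rule lift_Suc_antimono_le[where f = "%m. jnull U m j", OF jnull_Suc])

lemma L_jnull:
 assumes f: "f : sect C U i" and x: "x \<in> jnull U m j" and n: "n = i + j"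
 shows "Lf U i j f x \<in> jnull U m n"
 using x n
proof (induction m arbitrary: j n x)
 case 0
 then show ?case using L_closed[OF U f] unfolding jnull_0 by blast
next
 case (Suc m)
 note mo = TP.sec_rmod[OF U]
 show ?case
 proof (rule jnull_map[OF L_linear[OF U f Suc.prems(2)] mo jnull_rsub Suc.prems(1)])
  fix y assume "y \<in> delta_products C E U (Suc m) j"
  then obtain l g w where g: "g : sect C U l" "w \<in> delta_products C E U m (j - l)" "y = df U l (j - l) g w"
   by (rule dp_SucE)
  note wn = dp_jnull[OF g(2)]
  have "Lf U i j f y = koszul (i * l) \<odot>[S U n] df U l (i + (j - l)) g (Lf U i (j - l) f w)"
   unfolding g(3) by (rule L_d[OF U f g(1) dp_closed[OF g(2)]]) (use Suc.prems in simp_all)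
  moreover have "df U l (i + (j - l)) g (Lf U i (j - l) f w) \<in> jnull U (Suc m) n"
   by (rule d_jnull[OF g(1) Suc.IH[OF wn refl]]) (use Suc.prems in simp)
  ultimately show "Lf U i j f y \<in> jnull U (Suc m) n" using rsub_smult[OF mo jnull_rsub] by simp
 qed
qed

lemma R_jnull:
 assumes f: "f : sect C U i" and x: "x \<in> jnull U m j" and n: "n = i + j"
 shows "Rf U i j f x \<in> jnull U m n"
proof -
 note mo = TP.sec_rmod[OF U]
 have c: "x \<in> carrier (S U j)" using rsub_sub[OF mo jnull_rsub] x by blast
 have "df U i j f x \<in> jnull U m n" using d_jnull[OF f x n] jnull_Suc by blast
 then show ?thesis
  unfolding R_eq[OF U f c n] by (intro rsub_add[OF mo jnull_rsub] L_jnull[OF f x n] rsub_smult[OF mo jnull_rsub])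
qed

text \<open>The context fixes only \<open>U\<close>; the premise \<open>rs\<close> stands for
  \<open>jnull_rsub\<close> over the second open set.\<close>

lemma jnull_res:
 assumes V: "openin X V" "V <= U" and x: "x \<in> real_span (S U j) (delta_products C E U m j)"
  and rs: "!!j. rsub (real_span (S V j) (delta_products C E V m j)) (S V j)"
 shows "res (tensor_psh C E) U V j x \<in> real_span (S V j) (delta_products C E V m j)"
proof -
 have "y \<in> delta_products C E U m j ==> res (tensor_psh C E) U V j y \<in> delta_products C E V m j" for y
 proof (induction m arbitrary: j y)
  case 0
  then obtain p g \<psi> where y: "y = tn U p (j - p) g \<psi>" "g : sect C U p" "\<psi> \<in> sect E U (j - p)"
   by auto
  have "res (tensor_psh C E) U V j y = tn V p (j - p) (res C U V p g) (res E U V (j - p) \<psi>)"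
   unfolding y(1) using res_tens[OF U V y(2,3)] by simp
  then show ?case using C.res_closed[OF U V y(2)] E.res_closed[OF U V y(3)] by auto
 next
  case (Suc m)
  obtain i f w where y: "f : sect C U i" "w \<in> delta_products C E U m (j - i)" "y = df U i (j - i) f w"
   by (rule dp_SucE[OF Suc.prems])
  have "res (tensor_psh C E) U V j y = df V i (j - i) (res C U V i f) (res (tensor_psh C E) U V (j - i) w)"
   unfolding y(3) by (rule res_d[OF U V y(1) dp_closed[OF y(2)]]) simp
  then show ?case
   unfolding delta_products.simps(2) mem_Collect_eq
   by (intro exI conjI) (assumption, rule C.res_closed[OF U V y(1)], rule Suc.IH[OF y(2)])
 qed
 then show ?thesis
  by (intro rl_span[OF TP.sec_rmod[OF U] TP.sec_rmod[OF V(1)] TP.res_linear[OF U V] _ rs _ x] subsetD[OF span_superset] subsetI dp_closed)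
qed

end

sublocale null: stable_family X C "tensor_psh C E" "jet_null C E k" for k
proof (intro stable_family.intro stable_family_axioms.intro TP.graded_module_presheaf_axioms C.graded_algebra_sheaf_axioms)
 show "rsub (jet_null C E k U j) (S U j)" if "openin X U" for U j
  unfolding jet_null_eq by (rule jnull_rsub[OF that])
 show "res (tensor_psh C E) U V j s \<in> jet_null C E k V j"
  if "openin X U" "openin X V" "V <= U" "s \<in> jet_null C E k U j" for U V j s
  unfolding jet_null_eq jnull_def
  by (rule jnull_res[OF that(1-3) that(4)[unfolded jet_null_eq jnull_def] jnull_rsub[OF that(2), unfolded jnull_def]])
 show "Lf U i j f s \<in> jet_null C E k U (i + j)"
  if "openin X U" "f : sect C U i" "s \<in> jet_null C E k U j" for U i j f s
  unfolding jet_null_eq by (rule L_jnull[OF that(1,2) that(3)[unfolded jet_null_eq] refl])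
qed

sublocale pj: graded_module_presheaf X C "pJet C E k" for k
 unfolding pJet_def by (rule null.quotient_module_presheaf)

end


subsection \<open>Powers of ideals and the geometrization\<close>

text \<open>Powers of an ideal acting on a module, stated for an arbitrary degreewise linear
  operation, because the tensor product and its quotient \<open>pJet\<close> are compared.\<close>

locale ideal_action =
 fixes J :: "int => 'f set" and K :: "int => 'f set" and P :: "'a gvs" and ac :: "int => int => 'f => 'a => 'a"
 assumes P_rmod: "rmod (P j)" and J_K: "J i <= K i"
  and ac_linear: "f \<in> K i ==> lin (P j) (P (i + j)) (ac i j f)"
begin

abbreviation "ipow q N == (ideal_times J P ac ^^ q) N"
abbreviation "full j == carrier (P j)"

lemma ideal_times_gen:
 "f \<in> J i ==> x \<in> N l ==> n = i + l ==> ac i l f x \<in> ideal_times J P ac N n"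
 unfolding ideal_times_def
 by (rule subsetD[OF span_superset], rule CollectI, rule exI[of _ i], rule exI[of _ f], rule exI[of _ x]) simp

lemma ideal_times_le:
 assumes T: "rsub T (P j)" and g: "!!i l f x. [|f \<in> J i; x \<in> N l; j = i + l|] ==> ac i l f x \<in> T"
 shows "ideal_times J P ac N j <= T"
 unfolding ideal_times_def
proof (rule span_minimal[OF T], rule subsetI, unfold mem_Collect_eq, elim exE conjE)
 fix x i f y assume "f \<in> J i" "y \<in> N (j - i)" "x = ac i (j - i) f y"
 then show "x \<in> T" using g[of f i y "j - i"] by simp
qed

lemma ideal_times_rsub:
 assumes N: "!!j. N j <= carrier (P j)"
 shows "rsub (ideal_times J P ac N j) (P j)"
 unfolding ideal_times_def
proof (rule span_rsub[OF P_rmod], rule subsetI, unfold mem_Collect_eq, elim exE conjE)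
 fix x i f y assume "f \<in> J i" "y \<in> N (j - i)" "x = ac i (j - i) f y"
 then show "x \<in> carrier (P j)" using rl_closed[OF ac_linear[of f i "j - i"], of y] J_K N by (auto simp: subset_iff)
qed

lemma ipow_rsub:
 assumes N: "!!j. rsub (N j) (P j)"
 shows "rsub (ipow q N j) (P j)"
proof (induction q arbitrary: j)
 case 0
 show ?case using N by simp
next
 case (Suc q)
 show ?case unfolding funpow.simps comp_def by (rule ideal_times_rsub, rule rsub_sub[OF P_rmod Suc.IH])
qed

lemma ipow_Suc: "f \<in> J i ==> x \<in> ipow q N l ==> n = i + l ==> ac i l f x \<in> ipow (Suc q) N n"
 unfolding funpow.simps comp_def by (rule ideal_times_gen)

text \<open>The powers lie in every filtration that starts above \<open>N\<close> and is raised by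
  \<open>J\<close>. This is the induction principle for their elements.\<close>

lemma ipow_le:
 assumes T: "!!q j. rsub (T q j) (P j)" and 0: "!!j. N j <= T 0 j"
  and s: "!!q i j f x. [|f \<in> J i; x \<in> T q j|] ==> ac i j f x \<in> T (Suc q) (i + j)"
 shows "x \<in> ipow q N j ==> x \<in> T q j"
proof (induction q arbitrary: j x)
 case 0
 then show ?case using assms(2) by auto
next
 case (Suc q)
 have "ideal_times J P ac (ipow q N) j <= T (Suc q) j"
 proof (rule ideal_times_le[OF T])
  fix i l f x assume f: "f \<in> J i" "x \<in> ipow q N l" "j = i + l"
  show "ac i l f x \<in> T (Suc q) j" unfolding f(3) by (rule s[OF f(1) Suc.IH[OF f(2)]])
 qed
 then show ?case using Suc.prems by auto
qed

lemma ipow_sub: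
 assumes N: "!!j. rsub (N j) (P j)" and s: "!!i j f x. [|f \<in> J i; x \<in> N j|] ==> ac i j f x \<in> N (i + j)"
 shows "x \<in> ipow q N j ==> x \<in> N j"
 by (rule ipow_le[where T = "%q. N", OF N _ s]) auto

lemma ac_full: "f \<in> J i ==> x \<in> full j ==> ac i j f x \<in> full (i + j)"
 by (rule rl_closed[OF ac_linear]) (use J_K in blast)

lemma ipow_mono:
 assumes N: "!!j. rsub (N j) (P j)"
 shows "x \<in> ipow q N j ==> x \<in> ipow q full j"
 by (rule ipow_le[OF ipow_rsub[OF rsub_carrier[OF P_rmod]], of N], simp add: rsub_sub[OF P_rmod N]) (rule ipow_Suc, assumption, assumption, rule refl)

lemma ipow_full_Suc: "x \<in> ipow (Suc q) full j ==> x \<in> ipow q full j"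
proof (induction q arbitrary: j x)
 case 0
 then show ?case using rsub_sub[OF P_rmod ipow_rsub[OF rsub_carrier[OF P_rmod]], of "Suc 0" j] by auto
next
 case (Suc q)
 have "ideal_times J P ac (ipow (Suc q) full) j <= ipow (Suc q) full j"
 proof (rule ideal_times_le[OF ipow_rsub[OF rsub_carrier[OF P_rmod]]])
  fix i l f x assume f: "f \<in> J i" "x \<in> ipow (Suc q) full l" "j = i + l"
  show "ac i l f x \<in> ipow (Suc q) full j" by (rule ipow_Suc[OF f(1) Suc.IH[OF f(2)] f(3)])
 qed
 then show ?case using Suc.prems unfolding funpow.simps(2)[of "Suc q"] comp_def by blast
qed

lemma ipow_full_antimono: "q <= p ==> x \<in> ipow p full j ==> x \<in> ipow q full j"
 by (induction p) (auto simp: le_Suc_eq simp del: funpow.simps dest: ipow_full_Suc)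

end

text \<open>A map compatible with the actions up to the scalars \<open>s\<close> carries powers to
  powers. The degree shift \<open>t\<close> and the scalars admit maps such as \<delta> and the
  action of a function, which commute with the ideal only up to sign.\<close>

lemma ipow_map:
 assumes A: "ideal_action J K P ac" and B: "ideal_action J' K' P' ac'"
  and h: "!!j. lin (P j) (P' (t j)) (h j)" and t: "!!i j. t (i + j) = i + t j"
  and \<rho>: "!!i f. f \<in> J i ==> \<rho> i f \<in> J' i"
  and hN: "!!j x. x \<in> N j ==> h j x \<in> N' (t j)"
  and N: "!!j. rsub (N j) (P j)" and N': "!!j. rsub (N' j) (P' j)"
  and c: "!!i j f x. [|f \<in> J i; x \<in> carrier (P j)|] ==> h (i + j) (ac i j f x) = s i \<odot>[P' (i + t j)] ac' i (t j) (\<rho> i f) (h j x)"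
  and x: "x \<in> (ideal_times J P ac ^^ q) N j"
 shows "h j x \<in> (ideal_times J' P' ac' ^^ q) N' (t j)"
proof -
 interpret A: ideal_action J K P ac by (rule A)
 interpret B: ideal_action J' K' P' ac' by (rule B)
 have "x \<in> {x \<in> carrier (P j). h j x \<in> B.ipow q N' (t j)}"
 proof (rule A.ipow_le[where T = "%q j. {x \<in> carrier (P j). h j x \<in> B.ipow q N' (t j)}", OF _ _ _ x])
  show "rsub {x \<in> carrier (P j). h j x \<in> B.ipow q N' (t j)} (P j)" for q j
   by (rule rsub_vimage[OF A.P_rmod B.P_rmod h B.ipow_rsub[OF N']])
  show "N j <= {x \<in> carrier (P j). h j x \<in> B.ipow 0 N' (t j)}" for j
   using hN rsub_sub[OF A.P_rmod N] by auto
  fix q i j f x assume f: "f \<in> J i" and "x \<in> {x \<in> carrier (P j). h j x \<in> B.ipow q N' (t j)}"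
  then have x: "x \<in> carrier (P j)" "h j x \<in> B.ipow q N' (t j)" by auto
  have "h (i + j) (ac i j f x) \<in> B.ipow (Suc q) N' (t (i + j))"
   unfolding c[OF f x(1)] t
   by (rule rsub_smult[OF B.P_rmod B.ipow_rsub[OF N'] B.ipow_Suc[OF \<rho>[OF f] x(2) refl]])
  then show "ac i j f x \<in> {x \<in> carrier (P (i + j)). h (i + j) x \<in> B.ipow (Suc q) N' (t (i + j))}"
   using A.ac_full[OF f x(1)] by blast
 qed
 then show ?thesis by blast
qed

context graded_modules
begin

lemma ideal_action:
 "openin X U ==> ideal_action (vanishing_ideal X C ds U a) (%i. sect C U i) (sec F U) (act F U)"
 by (rule ideal_action.intro) (auto simp: vanishing_ideal_def F.act_linear_right)

text \<open>Restriction preserves values, hence maps the ideal of a point to the ideal of the same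
  point; the action of a function graded commutes with the ideal.\<close>

lemma bullet_stable:
 assumes M: "graded_manifold X C ds"
 shows "stable_family X C F (bullet X C ds F)"
proof (intro stable_family.intro stable_family_axioms.intro F.graded_module_presheaf_axioms C.graded_algebra_sheaf_axioms)
 let ?J = "vanishing_ideal X C ds"
 let ?p = "%U a q. (ideal_times (?J U a) (sec F U) (act F U) ^^ q) (%i. sect F U i)"
 have bl: "bullet X C ds F U j = {x \<in> sect F U j. \<forall>i\<in>UNIV \<times> U. x \<in> ?p U (snd i) (fst i) j}" for U j
  unfolding bullet_def by auto
 have full: "rsub (sect F U j) (sec F U j)" if "openin X U" for U j
  by (rule rsub_carrier[OF F.sec_rmod[OF that]])
 show "rsub (bullet X C ds F U j) (sec F U j)" if U: "openin X U" for U j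
  unfolding bl by (rule rsub_Inter_rm[OF F.sec_rmod[OF U]], rule ideal_action.ipow_rsub[OF ideal_action[OF U] full[OF U]])
 show "res F U V j x \<in> bullet X C ds F V j" if U: "openin X U" and V: "openin X V" "V <= U" and x: "x \<in> bullet X C ds F U j" for U V j x
  unfolding bullet_def
 proof (intro CollectI conjI allI ballI)
  have xc: "x : sect F U j" using x unfolding bullet_def by blast
  then show "res F U V j x : sect F V j" by (rule F.res_closed[OF U V])
  fix q a assume a: "a \<in> V"
  then have xa: "x \<in> ?p U a q j" using x V unfolding bullet_def by blast
  show "res F U V j x \<in> ?p V a q j"
  proof (rule ipow_map[where t = "%j. j" and s = "%i. 1" and \<rho> = "res C U V", OF ideal_action[OF U] ideal_action[OF V(1)]
     F.res_linear[OF U V] refl _ _ full[OF U] full[OF V(1)] _ xa])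
   show "res C U V i f \<in> ?J V a i" if "f \<in> ?J U a i" for i f
    using that C.res_closed[OF U V, of f i] fun_value_res[OF M U V a, of f i] by (simp add: vanishing_ideal_def)
   show "res F U V j x : sect F V j" if "x : sect F U j" for j x by (rule F.res_closed[OF U V that])
   show "res F U V (i + j) (act F U i j f x) = 1 \<odot>[sec F V (i + j)] act F V i j (res C U V i f) (res F U V j x)"
    if "f \<in> ?J U a i" "x : sect F U j" for i j f x
   proof -
    have f: "f : sect C U i" using that by (simp add: vanishing_ideal_def)
    show ?thesis
     using F.res_act[OF U V f that(2)] F.act_closed[OF V(1) C.res_closed[OF U V f] F.res_closed[OF U V that(2)] refl] V
     by simp
   qed
  qed
 qed
 show "act F U i j f x \<in> bullet X C ds F U (i + j)" if U: "openin X U" and f: "f : sect C U i" and x: "x \<in> bullet X C ds F U j" for U i j f x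
  unfolding bullet_def
 proof (intro CollectI conjI allI ballI)
  have xc: "x : sect F U j" using x unfolding bullet_def by blast
  then show "act F U i j f x : sect F U (i + j)" by (rule F.act_closed[OF U f _ refl])
  fix q a assume a: "a \<in> U"
  then have xa: "x \<in> ?p U a q j" using x unfolding bullet_def by blast
  show "act F U i j f x \<in> ?p U a q (i + j)"
  proof (rule ipow_map[where t = "%j. i + j" and s = "%m. koszul (i * m)" and h = "%j. act F U i j f" and \<rho> = "%i f. f",
     OF ideal_action[OF U] ideal_action[OF U] F.act_linear_right[OF U f] _ _ _ full[OF U] full[OF U] _ xa])
   show "act F U i (m + j) f (act F U m j g x) = koszul (i * m) \<odot>[sec F U (m + (i + j))] act F U m (i + j) g (act F U i j f x)"
    if "g \<in> ?J U a m" "x : sect F U j" for m j g x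
    by (rule act_act[OF U f _ that(2) refl refl]) (use that in \<open>simp_all add: vanishing_ideal_def\<close>)
  qed (auto intro: F.act_closed[OF U f])
 qed
qed

end


subsection \<open>Dual derivations\<close>

locale jet_frame = coordinate_algebra X C V ds z D J Z + jets X C E
 for X :: "'m topology" and C :: "('m, 'f) apsh" and V ds z D J Z and E :: "('m, 'f, 'e) mpsh" +
 fixes es :: "int list" and \<Phi> :: "nat => 'e"
 assumes frame: "freely_generates C E V {..<length es} ((!) es) \<Phi>"
begin

sublocale EM: graded_modules X C E ..

lemma \<Phi>_closed: "l < length es ==> \<Phi> l : sect E V (es ! l)"
 using frame unfolding freely_generates_def by blast

lemma \<Phi>_all: "\<forall>l\<in>{..<length es}. \<Phi> l : sect E V (es ! l)"
 using \<Phi>_closed by blast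

abbreviation "cf j \<psi> l == coeff C E V {..<length es} ((!) es) \<Phi> j \<psi> l"
abbreviation "lc == lincomb E V {..<length es} ((!) es) \<Phi>"

lemmas frame_facts = V_open finite_lessThan[of "length es"] \<Phi>_all
lemmas cf_closed = EM.coeff_closed[OF frame_facts frame]
lemmas cf_linear = EM.coeff_linear[OF frame_facts frame]
lemmas cf_act = EM.coeff_act[OF frame_facts frame]
lemmas lc_cf = EM.lincomb_coeff[OF frame_facts frame]
lemmas cf_lc = EM.coeff_lincomb[OF frame_facts frame]
lemmas lc_cong = EM.lincomb_cong[OF frame_facts]
lemmas lc_add = EM.lincomb_add[OF frame_facts]
lemmas lc_smult = EM.lincomb_smult[OF frame_facts]
lemmas lc_act = EM.lincomb_act[OF frame_facts]

lemma C_rmod [simp]: "rmod (sec C V j)" and E_rmod [simp]: "rmod (sec E V j)" and S_rmod [simp]: "rmod (S V j)"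
 using V_open by simp_all

lemma D_lin: "[|A < length ds; n = j - ds ! A|] ==> lin (sec C V j) (sec C V n) (D A j)"
 using D_linear by simp

lemma D_clo: "[|A < length ds; f : sect C V j; n = j - ds ! A|] ==> D A j f : sect C V n"
 by (rule rl_closed[OF D_lin])

lemma gunit_C: "gunit C V : sect C V 0"
 by (rule C.gunit_closed[OF V_open])

lemma gmul_gunit_right: "f : sect C V j ==> gmul C V j 0 f (gunit C V) = f"
 using C.gmul_commute[OF V_open _ gunit_C, of f j] C.gmul_gunit[OF V_open] by simp

text \<open>The Leibniz rule for \<open>1 = 1 \<cdot> 1\<close> gives
  \<open>u = u \<oplus> u\<close>.\<close>

lemma D_gunit: assumes A: "A < length ds" shows "D A 0 (gunit C V) = \<zero>[sec C V (- ds ! A)]"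
proof -
 let ?u = "D A 0 (gunit C V)"
 have u: "?u : sect C V (- ds ! A)" by (rule D_clo[OF A gunit_C]) simp
 have "?u = ?u \<oplus>[sec C V (- ds ! A)] ?u"
  using D_leibniz[OF A gunit_C gunit_C] u C.gmul_gunit[OF V_open gunit_C] C.gmul_gunit[OF V_open u] gmul_gunit_right[OF u]
  by simp
 then have "?u \<oplus>[sec C V (- ds ! A)] \<zero>[sec C V (- ds ! A)] = ?u \<oplus>[sec C V (- ds ! A)] ?u"
  using u by simp
 then show ?thesis using u by (simp del: rm_zero_right)
qed

lemma cf_\<Phi>:
 assumes "l < length es" "m < length es"
 shows "cf (es ! m) (\<Phi> m) l = (if l = m then gunit C V else \<zero>[sec C V (es ! m - es ! l)])"
proof -
 let ?c = "%l. if l = m then gunit C V else \<zero>[sec C V (es ! m - es ! l)]"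
 have c: "\<forall>l\<in>{..<length es}. ?c l : sect C V (es ! m - es ! l)" using gunit_C by simp
 have z: "act E V j (es ! l) \<zero>[sec C V j] (\<Phi> l) = \<zero>[sec E V (j + es ! l)]" if "l < length es" for j l
  by (rule rl_zero[OF C_rmod E_rmod E.act_linear_left[OF V_open \<Phi>_closed[OF that]]])
 have "lc (es ! m) ?c = act E V (es ! m - es ! m) (es ! m) (?c m) (\<Phi> m)"
  unfolding lincomb_def
 proof (rule finsum_single_rm)
  show "act E V (es ! m - es ! m) (es ! m) (?c m) (\<Phi> m) \<in> sect E V (es ! m)"
   by (rule EM.lincomb_terms[OF frame_facts c]) (use assms in simp)
  show "act E V (es ! m - es ! i) (es ! i) (?c i) (\<Phi> i) = \<zero>[sec E V (es ! m)]" if "i \<in> {..<length es}" "i ~= m" for i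
   using z[of i "es ! m - es ! i"] that by simp
 qed (use assms in simp_all)
 also have "\<dots> = \<Phi> m" using E.act_gunit[OF V_open \<Phi>_closed[OF assms(2)]] by simp
 finally have "\<Phi> m = lc (es ! m) ?c" ..
 then show ?thesis using cf_lc[OF c] assms by simp
qed

text \<open>The connection that kills the frame. Acting from the right, the derivation passes
  \<open>\<Phi> l\<close> before it reaches the coefficient, which costs the sign.\<close>

definition eD :: "nat => int => 'e => 'e" where
 "eD A j \<psi> = lc (j - ds ! A) (%l. koszul (ds ! A * es ! l) \<odot>[sec C V (j - ds ! A - es ! l)] D A (j - es ! l) (cf j \<psi> l))"

lemma eD_coeffs:
 assumes A: "A < length ds" and \<psi>: "\<psi> \<in> sect E V j" and l: "l \<in> {..<length es}"
 shows "D A (j - es ! l) (cf j \<psi> l) \<in> sect C V (j - ds ! A - es ! l)"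
 by (rule D_clo[OF A cf_closed[OF \<psi> l]]) simp

lemma eD_linear: assumes A: "A < length ds" and n: "n = j - ds ! A" shows "lin (sec E V j) (sec E V n) (eD A j)"
 unfolding eD_def lincomb_def n
proof (rule rl_fun_finsum[OF E_rmod])
 fix l assume l: "l \<in> {..<length es}"
 have 1: "lin (sec E V j) (sec C V (j - ds ! A - es ! l))
   (%\<psi>. koszul (ds ! A * es ! l) \<odot>[sec C V (j - ds ! A - es ! l)] D A (j - es ! l) (cf j \<psi> l))"
  by (rule rl_fun_smult[OF C_rmod rl_comp[OF cf_linear[OF l] D_lin[OF A]]]) simp
 have 2: "lin (sec C V (j - ds ! A - es ! l)) (sec E V (j - ds ! A)) (%f. act E V (j - ds ! A - es ! l) (es ! l) f (\<Phi> l))"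
  using E.act_linear_left[OF V_open \<Phi>_closed, of l "j - ds ! A - es ! l"] l by simp
 show "lin (sec E V j) (sec E V (j - ds ! A)) (%\<psi>. act E V (j - ds ! A - es ! l) (es ! l)
   (koszul (ds ! A * es ! l) \<odot>[sec C V (j - ds ! A - es ! l)] D A (j - es ! l) (cf j \<psi> l)) (\<Phi> l))"
  by (rule rl_comp[OF 1 2])
qed simp

lemma eD_closed: "[|A < length ds; \<psi> \<in> sect E V j; n = j - ds ! A|] ==> eD A j \<psi> \<in> sect E V n"
 by (rule rl_closed[OF eD_linear])

text \<open>The Leibniz rule of \<open>D A\<close> for each coefficient. The sign of passing
  \<open>\<Phi> l\<close> and that of passing the coefficient combine to the sign of passing
  \<open>\<psi>\<close>.\<close>

lemma eD_leibniz:
 assumes A: "A < length ds" and f: "f : sect C V i" and \<psi>: "\<psi> \<in> sect E V j"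
  and n: "m = i + j" "n = m - ds ! A" "j' = j - ds ! A" "i' = i - ds ! A"
 shows "eD A m (act E V i j f \<psi>) = act E V i j' f (eD A j \<psi>) \<oplus>[sec E V n]
  koszul (ds ! A * j) \<odot>[sec E V n] act E V i' j (D A i f) \<psi>"
proof -
 let ?d = "ds ! A"
 let ?u = "%l. koszul (?d * es ! l) \<odot>[sec C V (j - ?d - es ! l)] D A (j - es ! l) (cf j \<psi> l)"
 let ?v = "%l. gmul C V i (j - ?d - es ! l) f (?u l)"
 let ?w = "%l. gmul C V (i - ?d) (j - es ! l) (D A i f) (cf j \<psi> l)"
 have N: "i + (j - ?d) = n" "i - ?d + j = n" "i + j - ?d = n" "i' = i - ?d" "j' = j - ?d" using n by simp_all
 have Nl: "i + (j - ?d - es ! l) = n - es ! l" "i - ?d + (j - es ! l) = n - es ! l" "i + (j - es ! l) - ?d = n - es ! l"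
  "i + (j - es ! l - ?d) = n - es ! l" for l
  using n by simp_all
 have Df: "D A i f : sect C V (i - ?d)" by (rule D_clo[OF A f refl])
 have u: "\<forall>l\<in>{..<length es}. ?u l : sect C V (j - ?d - es ! l)"
  using eD_coeffs[OF A \<psi>] by simp
 have v: "\<forall>l\<in>{..<length es}. ?v l : sect C V (n - es ! l)"
  using u C.gmul_closed[OF V_open f] Nl by metis
 have w: "\<forall>l\<in>{..<length es}. ?w l : sect C V (n - es ! l)"
  using cf_closed[OF \<psi>] C.gmul_closed[OF V_open Df] Nl by metis
 have w': "\<forall>l\<in>{..<length es}. koszul (?d * j) \<odot>[sec C V (n - es ! l)] ?w l : sect C V (n - es ! l)"
  using w by simp
 have vw: "\<forall>l\<in>{..<length es}. ?v l \<oplus>[sec C V (n - es ! l)] koszul (?d * j) \<odot>[sec C V (n - es ! l)] ?w l : sect C V (n - es ! l)"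
  using v w' by simp
 have "eD A m (act E V i j f \<psi>) = lc n (%l. ?v l \<oplus>[sec C V (n - es ! l)] koszul (?d * j) \<odot>[sec C V (n - es ! l)] ?w l)"
  unfolding eD_def n(2)[symmetric]
 proof (rule lc_cong[OF vw])
  fix l assume l: "l \<in> {..<length es}"
  note c = cf_closed[OF \<psi> l] and Dc = D_clo[OF A cf_closed[OF \<psi> l] refl]
  have g: "gmul C V i (j - es ! l - ?d) f (D A (j - es ! l) (cf j \<psi> l)) \<in> sect C V (n - es ! l)"
   by (rule C.gmul_closed[OF V_open f Dc]) (simp add: Nl)
  have s: "gmul C V i (j - ?d - es ! l) f (?u l) = koszul (?d * es ! l) \<odot>[sec C V (n - es ! l)] gmul C V i (j - es ! l - ?d) f (D A (j - es ! l) (cf j \<psi> l))"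
   using rl_smult[OF C.gmul_linear_right[OF V_open f] Dc, of "koszul (?d * es ! l)"] Nl(4)
   by (simp add: algebra_simps)
  have e1: "D A (i + (j - es ! l)) (gmul C V i (j - es ! l) f (cf j \<psi> l)) =
    gmul C V i (j - es ! l - ?d) f (D A (j - es ! l) (cf j \<psi> l)) \<oplus>[sec C V (n - es ! l)]
    koszul (?d * (j - es ! l)) \<odot>[sec C V (n - es ! l)] ?w l"
   using D_leibniz[OF A f c] unfolding Nl .
  have e2: "cf m (act E V i j f \<psi>) l = gmul C V i (j - es ! l) f (cf j \<psi> l)"
   unfolding n(1) by (rule cf_act[OF f \<psi> l])
  have e3: "m - es ! l = i + (j - es ! l)" using n by simp
  have wl: "?w l : sect C V (n - es ! l)" using w l by blast
  show "koszul (?d * es ! l) \<odot>[sec C V (n - es ! l)] D A (m - es ! l) (cf m (act E V i j f \<psi>) l) =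
    ?v l \<oplus>[sec C V (n - es ! l)] koszul (?d * j) \<odot>[sec C V (n - es ! l)] ?w l"
   unfolding s e2 e3 e1 using g wl by (simp add: rm_smult_r right_diff_distrib koszul_diff mult.left_commute)
 qed
 also have "\<dots> = lc n ?v \<oplus>[sec E V n] lc n (%l. koszul (?d * j) \<odot>[sec C V (n - es ! l)] ?w l)"
  by (rule lc_add[OF v w'])
 also have "lc n (%l. koszul (?d * j) \<odot>[sec C V (n - es ! l)] ?w l) = koszul (?d * j) \<odot>[sec E V n] lc n ?w"
  by (rule lc_smult[OF w])
 also have "lc n ?w = act E V (i - ?d) j (D A i f) \<psi>"
  using lc_act[OF Df, of "cf j \<psi>" j] cf_closed[OF \<psi>] lc_cf[OF \<psi>] unfolding N by simp
 also have "lc n ?v = act E V i (j - ?d) f (eD A j \<psi>)"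
  unfolding eD_def using lc_act[OF f u] unfolding N .
 finally show ?thesis unfolding N(4,5) .
qed

lemma eD_\<Phi>: assumes A: "A < length ds" and l: "l < length es" shows "eD A (es ! l) (\<Phi> l) = \<zero>[sec E V (es ! l - ds ! A)]"
 unfolding eD_def lincomb_def
proof (rule finsum_zero_rm[OF E_rmod])
 fix m assume m: "m \<in> {..<length es}"
 have "D A (es ! l - es ! m) (cf (es ! l) (\<Phi> l) m) = \<zero>[sec C V (es ! l - ds ! A - es ! m)]"
  using D_gunit[OF A] rl_zero[OF C_rmod C_rmod D_lin[OF A], of "es ! l - ds ! A - es ! m" "es ! l - es ! m"] cf_\<Phi>[of m l] l m by auto
 moreover have "act E V (es ! l - ds ! A - es ! m) (es ! m) \<zero>[sec C V (es ! l - ds ! A - es ! m)] (\<Phi> m) = \<zero>[sec E V (es ! l - ds ! A)]"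
  using rl_zero[OF C_rmod E_rmod E.act_linear_left[OF V_open \<Phi>_closed, of m "es ! l - ds ! A - es ! m"]] m by simp
 ultimately show "act E V (es ! l - ds ! A - es ! m) (es ! m) (koszul (ds ! A * es ! m) \<odot>[sec C V (es ! l - ds ! A - es ! m)]
   D A (es ! l - es ! m) (cf (es ! l) (\<Phi> l) m)) (\<Phi> m) = \<zero>[sec E V (es ! l - ds ! A)]" by simp
qed

text \<open>
 The derivation \<open>D A\<close>, applied to the second tensor factor. It is \<open>\<triangleright>\<close>-linear, and its
 commutator with \<open>\<delta>\<close> of a coordinate function is a constant, as in a Weyl algebra.
\<close>

definition dd :: "nat => int => ('f, 'e) jet_tensor => ('f, 'e) jet_tensor" where
 "dd A j = tensor_lift (S V (j - ds ! A)) (%(p, g, \<psi>). tn V p (j - p - ds ! A) g (eD A (j - p) \<psi>))"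

lemma
 assumes A: "A < length ds"
 shows dd_linear: "n = j - ds ! A ==> lin (S V j) (S V n) (dd A j)"
  and dd_tens: "[|g : sect C V p; \<psi> \<in> sect E V q; p + q = j|] ==>
   dd A j (tn V p q g \<psi>) = tn V p (q - ds ! A) g (eD A q \<psi>)"
proof -
 let ?h = "%(p, g, \<psi>). tn V p (j - p - ds ! A) g (eD A (j - p) \<psi>)"
 have l: "lin (sec C V p) (S V (j - ds ! A)) (%a. ?h (p, a, b))" if "b : sect E V (j - p)" for p b
  using tS_left[OF V_open eD_closed[OF A that refl], where p = p and j = "j - ds ! A"] by simp
 have r: "lin (sec E V (j - p)) (S V (j - ds ! A)) (%b. ?h (p, a, b))" if "a : sect C V p" for p a
  using rl_comp[OF eD_linear[OF A refl] tS_right[OF V_open that, where j = "j - ds ! A" and q = "j - p - ds ! A"]] by simp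
 show "lin (S V j) (S V n) (dd A j)" if n: "n = j - ds ! A"
  unfolding dd_def n by (rule S_lift_linear[OF V_open S_rmod l r])
 show "dd A j (tn V p q g \<psi>) = tn V p (q - ds ! A) g (eD A q \<psi>)"
  if t: "g : sect C V p" "\<psi> \<in> sect E V q" "p + q = j"
 proof -
  have q: "q = j - p" using t by simp
  show ?thesis unfolding dd_def using S_lift_tens[OF V_open S_rmod l r t] unfolding q by simp
 qed
qed

lemma dd_closed: "[|A < length ds; x \<in> carrier (S V j); n = j - ds ! A|] ==> dd A j x \<in> carrier (S V n)"
 by (rule rl_closed[OF dd_linear])

lemma dd_L:
 assumes A: "A < length ds" and f: "f : sect C V i" and x: "x \<in> carrier (S V j)"
  and n: "m = i + j" "n = j - ds ! A"
 shows "dd A m (Lf V i j f x) = Lf V i n f (dd A j x)"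
 by (rule S_eqI[OF V_open S_rmod rl_comp[OF L_linear[OF V_open f n(1)] dd_linear[OF A]]
    rl_comp[OF dd_linear[OF A n(2)] L_linear[OF V_open f]] x, of "i + n"])
  (use V_open f A n in \<open>simp_all add: L_tens dd_tens C.gmul_closed eD_closed\<close>)

lemma dd_R:
 assumes A: "A < length ds" and f: "f : sect C V i" and x: "x \<in> carrier (S V j)"
  and n: "m = i + j" "n = j - ds ! A" "i' = i - ds ! A" "N = m - ds ! A"
 shows "dd A m (Rf V i j f x) = Rf V i n f (dd A j x) \<oplus>[S V N] koszul (ds ! A * j) \<odot>[S V N] Rf V i' j (D A i f) x"
proof -
 note Df = D_clo[OF A f n(3)]
 have N: "N = i + n" "N = i' + j" using n by simp_all
 show ?thesis
 proof (rule S_eqI[OF V_open S_rmod rl_comp[OF R_linear[OF V_open f n(1)] dd_linear[OF A n(4)]]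
    rl_fun_add[OF S_rmod rl_comp[OF dd_linear[OF A n(2)] R_linear[OF V_open f N(1)]]
     rl_fun_smult[OF S_rmod R_linear[OF V_open Df N(2)]]] x])
  fix p g \<psi> assume g: "g : sect C V p" and \<psi>: "\<psi> \<in> sect E V (j - p)"
  define q where "q = j - p"
  have q: "p + q = j" "p + (i + q) = m" "p + (q - ds ! A) = n" "i + q - ds ! A = i + (q - ds ! A)" "i' + q = i + (q - ds ! A)"
   "N = p + (i + (q - ds ! A))" "i + j = m" "i' + j = N" "i + n = N"
   using n by (simp_all add: q_def)
  note \<psi>' = \<psi>[folded q_def]
  note fp = E.act_closed[OF V_open f \<psi>' refl] and ep = eD_closed[OF A \<psi>' refl]
  note t1 = E.act_closed[OF V_open f ep refl] and t2 = E.act_closed[OF V_open Df \<psi>' q(5)[symmetric]]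
  have k: "koszul (ds ! A * j) * koszul (i' * p) = koszul (i * p) * koszul (ds ! A * q)"
   unfolding n(3) q(1)[symmetric] by (simp add: koszul_add koszul_diff ring_distribs mult_ac)
  have e: "eD A (i + q) (act E V i q f \<psi>) = act E V i (q - ds ! A) f (eD A q \<psi>) \<oplus>[sec E V (i + (q - ds ! A))]
    koszul (ds ! A * q) \<odot>[sec E V (i + (q - ds ! A))] act E V i' q (D A i f) \<psi>"
   by (rule eD_leibniz[OF A f \<psi>' refl _ refl n(3)]) simp
  have tr: "lin (sec E V (i + (q - ds ! A))) (S V N) (tn V p (i + (q - ds ! A)) g)"
   by (rule tS_right[OF V_open g q(6)])
  have "dd A m (Rf V i j f (tn V p q g \<psi>)) = koszul (i * p) \<odot>[S V N] tn V p (i + (q - ds ! A)) g (eD A (i + q) (act E V i q f \<psi>))"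
   unfolding R_tens[OF V_open f g \<psi>' q(1)] unfolding q(7)
   unfolding rl_smult[OF dd_linear[OF A n(4)] tS_closed[OF V_open g fp q(2)[symmetric]]] dd_tens[OF A g fp q(2)] q(4) ..
  also have "\<dots> = koszul (i * p) \<odot>[S V N] tn V p (i + (q - ds ! A)) g (act E V i (q - ds ! A) f (eD A q \<psi>)) \<oplus>[S V N]
    koszul (ds ! A * j) \<odot>[S V N] (koszul (i' * p) \<odot>[S V N] tn V p (i + (q - ds ! A)) g (act E V i' q (D A i f) \<psi>))"
   unfolding e rl_add[OF tr t1 rm_smult_closed[OF E_rmod t2]] rl_smult[OF tr t2]
   using rl_closed[OF tr t1] rl_closed[OF tr t2] by (simp add: rm_smult_r k)
  also have "koszul (i' * p) \<odot>[S V N] tn V p (i + (q - ds ! A)) g (act E V i' q (D A i f) \<psi>) = Rf V i' j (D A i f) (tn V p q g \<psi>)"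
   unfolding R_tens[OF V_open Df g \<psi>' q(1)] unfolding q(5,8) ..
  also have "koszul (i * p) \<odot>[S V N] tn V p (i + (q - ds ! A)) g (act E V i (q - ds ! A) f (eD A q \<psi>)) = Rf V i n f (dd A j (tn V p q g \<psi>))"
   unfolding dd_tens[OF A g \<psi>' q(1)] R_tens[OF V_open f g ep q(3)] unfolding q(9) ..
  finally show "dd A m (Rf V i j f (tn V p (j - p) g \<psi>)) = Rf V i n f (dd A j (tn V p (j - p) g \<psi>)) \<oplus>[S V N]
    koszul (ds ! A * j) \<odot>[S V N] Rf V i' j (D A i f) (tn V p (j - p) g \<psi>)"
   unfolding q_def .
 qed
qed

text \<open>The operator commutes with \<open>\<triangleright>\<close> and is a derivation for
  \<open>\<blacktriangleright>\<close>, so only the second part of \<delta> contributes to the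
  commutator.\<close>

lemma dd_d:
 assumes A: "A < length ds" and f: "f : sect C V i" and x: "x \<in> carrier (S V j)"
  and n: "m = i + j" "n = j - ds ! A" "i' = i - ds ! A" "N = m - ds ! A"
 shows "dd A m (df V i j f x) = df V i n f (dd A j x) \<oplus>[S V N] (- koszul (ds ! A * j)) \<odot>[S V N] Rf V i' j (D A i f) x"
proof -
 note Dl = dd_linear[OF A n(4)] and dx = dd_closed[OF A x n(2)]
 have N: "N = i + n" "N = i' + j" using n by simp_all
 note Lx = L_closed[OF V_open f x n(1)] and Rx = R_closed[OF V_open f x n(1)]
 show ?thesis
  unfolding d_eq[OF V_open f x n(1)] d_eq[OF V_open f dx N(1)] rl_add[OF Dl Lx rm_smult_closed[OF S_rmod Rx]]
   rl_smult[OF Dl Rx] dd_L[OF A f x n(1,2)] dd_R[OF A f x n]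
  using L_closed[OF V_open f dx N(1)] R_closed[OF V_open f dx N(1)] R_closed[OF V_open D_clo[OF A f n(3)] x N(2)]
  by (simp add: rm_smult_r rm_assoc)
qed

text \<open>The \<open>l\<close>-th coefficient of the product
  \<open>g \<cdot> \<psi>\<close>.\<close>

definition mu :: "nat => int => ('f, 'e) jet_tensor => 'f" where
 "mu l j = tensor_lift (sec C V (j - es ! l)) (%(p, g, \<psi>). gmul C V p (j - p - es ! l) g (cf (j - p) \<psi> l))"

lemma
 assumes l: "l < length es"
 shows mu_linear: "n = j - es ! l ==> lin (S V j) (sec C V n) (mu l j)"
  and mu_tens: "[|g : sect C V p; \<psi> \<in> sect E V q; p + q = j|] ==>
   mu l j (tn V p q g \<psi>) = gmul C V p (q - es ! l) g (cf q \<psi> l)"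
proof -
 let ?h = "%(p, g, \<psi>). gmul C V p (j - p - es ! l) g (cf (j - p) \<psi> l)"
 have l': "l \<in> {..<length es}" using l by simp
 have li: "lin (sec C V p) (sec C V (j - es ! l)) (%a. ?h (p, a, b))" if "b : sect E V (j - p)" for p b
  using C.gmul_linear_left[OF V_open cf_closed[OF that l'], of p] by simp
 have r: "lin (sec E V (j - p)) (sec C V (j - es ! l)) (%b. ?h (p, a, b))" if "a : sect C V p" for p a
  using rl_comp[OF cf_linear[OF l'] C.gmul_linear_right[OF V_open that], of "j - p"] by simp
 show "lin (S V j) (sec C V n) (mu l j)" if n: "n = j - es ! l"
  unfolding mu_def n by (rule S_lift_linear[OF V_open C_rmod li r])
 show "mu l j (tn V p q g \<psi>) = gmul C V p (q - es ! l) g (cf q \<psi> l)"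
  if t: "g : sect C V p" "\<psi> \<in> sect E V q" "p + q = j"
 proof -
  have q: "q = j - p" using t by simp
  show ?thesis unfolding mu_def using S_lift_tens[OF V_open C_rmod li r t] unfolding q by simp
 qed
qed

lemma mu_L:
 assumes l: "l < length es" and f: "f : sect C V i" and x: "x \<in> carrier (S V j)"
  and n: "m = i + j" "n = j - es ! l"
 shows "mu l m (Lf V i j f x) = gmul C V i n f (mu l j x)"
proof -
 have l': "l \<in> {..<length es}" using l by simp
 have N: "m - es ! l = i + n" using n by simp
 show ?thesis
  by (rule S_eqI[OF V_open C_rmod rl_comp[OF L_linear[OF V_open f n(1)] mu_linear[OF l]]
     rl_comp[OF mu_linear[OF l n(2)] C.gmul_linear_right[OF V_open f]] x])
   (use V_open l f n N C.gmul_assoc[OF V_open f _ cf_closed[OF _ l']] in \<open>simp_all add: L_tens mu_tens C.gmul_closed\<close>)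
qed

text \<open>After multiplying out, the two actions agree because functions graded commute.\<close>

lemma mu_d:
 assumes l: "l < length es" and f: "f : sect C V i" and x: "x \<in> carrier (S V j)"
  and n: "m = i + j" "n = m - es ! l"
 shows "mu l m (df V i j f x) = \<zero>[sec C V n]"
proof -
 have l': "l \<in> {..<length es}" using l by simp
 note M = mu_linear[OF l n(2)]
 have e: "mu l m (Lf V i j f x) = mu l m (Rf V i j f x)"
 proof (rule S_eqI[OF V_open C_rmod rl_comp[OF L_linear[OF V_open f n(1)] M] rl_comp[OF R_linear[OF V_open f n(1)] M] x])
  fix p g \<psi> assume g: "g : sect C V p" and \<psi>: "\<psi> \<in> sect E V (j - p)"
  define q where "q = j - p"
  have q: "p + q = j" "p + (i + q) = m" "i + p + q = m" "i + p + (q - es ! l) = n" "i + j = m" "i + q - es ! l = i + (q - es ! l)"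
   using n by (simp_all add: q_def)
  note \<psi>' = \<psi>[folded q_def]
  note c = cf_closed[OF \<psi>' l'] and fg = C.gmul_closed[OF V_open f g refl] and gf = C.gmul_closed[OF V_open g f add.commute]
  note fp = E.act_closed[OF V_open f \<psi>' refl]
  have "mu l m (Lf V i j f (tn V p q g \<psi>)) = gmul C V (i + p) (q - es ! l) (gmul C V i p f g) (cf q \<psi> l)"
   unfolding L_tens[OF V_open f g \<psi>' q(1)] mu_tens[OF l fg \<psi>' q(3)] ..
  also have "\<dots> = koszul (i * p) \<odot>[sec C V n] gmul C V (p + i) (q - es ! l) (gmul C V p i g f) (cf q \<psi> l)"
   unfolding C.gmul_commute[OF V_open f g] rl_smult[OF C.gmul_linear_left[OF V_open c] gf] q(4) by (simp add: add.commute)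
  also have "\<dots> = koszul (i * p) \<odot>[sec C V n] mu l m (tn V p (i + q) g (act E V i q f \<psi>))"
   unfolding mu_tens[OF l g fp q(2)] cf_act[OF f \<psi>' l'] C.gmul_assoc[OF V_open g f c] q(6) ..
  also have "\<dots> = mu l m (Rf V i j f (tn V p q g \<psi>))"
   unfolding R_tens[OF V_open f g \<psi>' q(1)] unfolding q(5) unfolding rl_smult[OF M tS_closed[OF V_open g fp q(2)[symmetric]]] ..
  finally show "mu l m (Lf V i j f (tn V p (j - p) g \<psi>)) = mu l m (Rf V i j f (tn V p (j - p) g \<psi>))" unfolding q_def .
 qed
 note Lx = L_closed[OF V_open f x n(1)] and Rx = R_closed[OF V_open f x n(1)]
 show ?thesis
  unfolding d_eq[OF V_open f x n(1)] rl_add[OF M Lx rm_smult_closed[OF S_rmod Rx]] rl_smult[OF M Rx] e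
  using rl_closed[OF M Rx] by simp
qed

end


subsection \<open>Words in the coordinate functions\<close>

context coordinate_algebra
begin

definition wdeg :: "nat list => int" where
 "wdeg w = (\<Sum>A\<leftarrow>w. ds ! A)"

lemma wdeg_simps [simp]: "wdeg [] = 0" "wdeg (A # w) = ds ! A + wdeg w"
 by (simp_all add: wdeg_def)

text \<open>Such words encode multi-indices, each \<open>A\<close> being listed as often as it
  occurs. In this form the outermost \<delta> is the head of a list, on which induction
  runs.\<close>

definition normal_word :: "nat list => bool" where
 "normal_word w \<longleftrightarrow> sorted w & set w <= {..<length ds} & (ALL A. odd (ds ! A) --> count_list w A <= 1)"

lemma normal_Nil [simp]: "normal_word []"
 by (simp add: normal_word_def)

lemma normal_ConsD:
 assumes "normal_word (A # w)"
 shows "normal_word w" "A < length ds" "\<forall>B\<in>set w. A <= B" "odd (ds ! A) ==> A \<notin> set w"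
proof -
 have c: "ALL B. odd (ds ! B) --> (if B = A then Suc (count_list w B) else count_list w B) <= 1"
  using assms by (auto simp: normal_word_def split: if_splits)
 then have "count_list w B <= 1" if "odd (ds ! B)" for B
  using that by (cases "B = A") auto
 then show "normal_word w" "A < length ds" "\<forall>B\<in>set w. A <= B"
  using assms by (auto simp: normal_word_def)
 show "A \<notin> set w" if "odd (ds ! A)"
  using c[rule_format, OF that] by (simp add: count_list_0_iff)
qed

lemma normal_ConsI:
 assumes w: "normal_word w" and A: "A < length ds" "\<forall>B\<in>set w. A <= B" "odd (ds ! A) ==> A \<notin> set w"
 shows "normal_word (A # w)"
proof -
 have "count_list (A # w) B <= 1" if "odd (ds ! B)" for B
  using w A(3) that by (cases "B = A") (auto simp: normal_word_def)
 then show ?thesis using w A by (auto simp: normal_word_def)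
qed

lemma normal_set: "normal_word w ==> set w <= {..<length ds}"
 by (simp add: normal_word_def)

lemma wdeg_insort: "wdeg (insort A w) = ds ! A + wdeg w"
 by (induction w) auto

end

section \<open>\<delta>-monomials and the derivations that remove their letters\<close>

context jet_frame
begin

abbreviation "en l == tn V 0 (es ! l) (gunit C V) (\<Phi> l)"

lemma en_closed: "l < length es ==> en l \<in> carrier (S V (es ! l))"
 using tS_closed[OF V_open gunit_C \<Phi>_closed] by simp

primrec dels :: "nat list => int => ('f, 'e) jet_tensor => ('f, 'e) jet_tensor" where
 "dels [] j x = x"
| "dels (A # w) j x = df V (ds ! A) (wdeg w + j) (z A) (dels w j x)"

lemma dels_closed:
 "[|x \<in> carrier (S V j); set w <= {..<length ds}; n = wdeg w + j|] ==> dels w j x \<in> carrier (S V n)"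
 by (induction w arbitrary: n) (auto intro!: d_closed[OF V_open z_closed])

lemma dels_jnull:
 "[|x \<in> carrier (S V j); set w <= {..<length ds}; n = wdeg w + j|] ==> dels w j x \<in> jnull V (length w) n"
proof (induction w arbitrary: n)
 case Nil
 then show ?case by (simp add: jnull_0[OF V_open])
next
 case (Cons A w)
 then show ?case using d_jnull[OF V_open z_closed Cons.IH[OF Cons.prems(1) _ refl], of A n] by (simp add: ac_simps)
qed

lemma d_zero: "f : sect C V i ==> n = i + j ==> df V i j f \<zero>[S V j] = \<zero>[S V n]"
 by (rule rl_zero[OF S_rmod S_rmod d_linear[OF V_open]])

lemma dd_d_diff:
 assumes A: "A < length ds" "B < length ds" "A ~= B" and x: "x \<in> carrier (S V j)"
  and n: "m = ds ! B + j" "n = j - ds ! A"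
 shows "dd A m (df V (ds ! B) j (z B) x) = df V (ds ! B) n (z B) (dd A j x)"
proof -
 have r: "Rf V (ds ! B - ds ! A) j (D A (ds ! B) (z B)) x = \<zero>[S V (m - ds ! A)]"
  unfolding D_coordinate[OF A(1,2)] using A(3) n
   rl_zero[OF C_rmod S_rmod R_linear_left[OF V_open x, of "m - ds ! A" "ds ! B - ds ! A"]] by simp
 show ?thesis
  unfolding dd_d[OF A(1) z_closed[OF A(2)] x n refl refl] r
  using d_closed[OF V_open z_closed[OF A(2)] dd_closed[OF A(1) x n(2)], of "m - ds ! A"] n by simp
qed

lemma dd_d_same:
 assumes A: "A < length ds" and x: "x \<in> carrier (S V j)" and n: "m = ds ! A + j" "n = j - ds ! A"
 shows "dd A m (df V (ds ! A) j (z A) x) =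
  df V (ds ! A) n (z A) (dd A j x) \<oplus>[S V j] (- koszul (ds ! A * j)) \<odot>[S V j] x"
proof -
 have "j = m - ds ! A" using n by simp
 then show ?thesis
  using dd_d[OF A(1) z_closed[OF A] x n, of 0 j] R_gunit[OF V_open x] unfolding D_coordinate[OF A A] by simp
qed

text \<open>The derivation passes every letter other than \<open>A\<close> and finally kills the
  frame element.\<close>

lemma dd_dels_skip:
 assumes A: "A < length ds" and l: "l < length es"
 shows "[|set w <= {..<length ds}; A \<notin> set w; m = wdeg w + es ! l; n = m - ds ! A|] ==>
  dd A m (dels w (es ! l) (en l)) = \<zero>[S V n]"
proof (induction w arbitrary: m n)
 case Nil
 have "lin (sec E V (es ! l - ds ! A)) (S V n) (tn V 0 (es ! l - ds ! A) (gunit C V))"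
  by (rule tS_right[OF V_open gunit_C]) (use Nil in simp)
 from rl_zero[OF E_rmod S_rmod this] show ?case
  using Nil dd_tens[OF A gunit_C \<Phi>_closed[OF l]] by (simp add: eD_\<Phi>[OF A l])
next
 case (Cons B w)
 then have B: "B < length ds" "A ~= B" "set w <= {..<length ds}" "A \<notin> set w" by auto
 have "dd A m (dels (B # w) (es ! l) (en l)) = df V (ds ! B) (wdeg w + es ! l - ds ! A) (z B) (dd A (wdeg w + es ! l) (dels w (es ! l) (en l)))"
  unfolding dels.simps by (rule dd_d_diff[OF A B(1,2) dels_closed[OF en_closed[OF l] B(3) refl]]) (use Cons.prems in simp_all)
 then show ?case unfolding Cons.IH[OF B(3,4) refl refl] using d_zero[OF z_closed[OF B(1)], of n "wdeg w + es ! l - ds ! A"] Cons.prems by simp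
qed

text \<open>Each occurrence of \<open>A\<close> contributes a constant. For even degree the letter
  may be repeated, and \<open>c < 0\<close> is carried along because it excludes cancellation; for
  odd degree the letter occurs once.\<close>

lemma dd_dels_hit:
 assumes l: "l < length es"
 shows "normal_word (A # w) ==> EX c. c ~= 0 & (even (ds ! A) --> c < 0) &
  (ALL m n. n = wdeg w + es ! l --> m = ds ! A + n -->
  dd A m (dels (A # w) (es ! l) (en l)) = c \<odot>[S V n] dels w (es ! l) (en l))"
proof (induction w)
 case Nil
 have A: "A < length ds" by (rule normal_ConsD[OF Nil])
 have e: "dd A (es ! l) (en l) = \<zero>[S V (es ! l - ds ! A)]" using dd_dels_skip[OF A l, of "[]"] by simp
 show ?case
  by (rule exI[of _ "- koszul (ds ! A * es ! l)"])
   (auto simp: koszul_def dd_d_same[OF A en_closed[OF l]] e d_zero[OF z_closed[OF A]] en_closed[OF l])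
next
 case (Cons B w)
 note N = normal_ConsD[OF Cons.prems]
 have A: "A < length ds" by (rule N)
 define k where "k = ds ! B + wdeg w + es ! l"
 let ?y = "dels (B # w) (es ! l) (en l)"
 have y: "?y \<in> carrier (S V k)" by (rule dels_closed[OF en_closed[OF l] normal_set[OF N(1)]]) (simp add: k_def)
 have s: "dd A (ds ! A + k) (dels (A # B # w) (es ! l) (en l)) =
   df V (ds ! A) (k - ds ! A) (z A) (dd A k ?y) \<oplus>[S V k] (- koszul (ds ! A * k)) \<odot>[S V k] ?y"
  unfolding dels.simps(2)[of A "B # w"] using dd_d_same[OF A y refl refl] by (simp add: k_def)
 show ?case
 proof (cases "A = B")
  case True
  then have ev: "even (ds ! A)" using N(4) by auto
  obtain c where c: "c ~= 0" "even (ds ! B) --> c < 0" "dd B k ?y = c \<odot>[S V (wdeg w + es ! l)] dels w (es ! l) (en l)"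
   using Cons.IH[unfolded True, OF N(1)] by (auto simp: k_def ac_simps)
  have dw: "dels w (es ! l) (en l) \<in> carrier (S V (wdeg w + es ! l))"
   by (rule dels_closed[OF en_closed[OF l] normal_set[OF normal_ConsD(1)[OF N(1)]] refl])
  have kk: "k - ds ! A = wdeg w + es ! l" "k = ds ! A + (wdeg w + es ! l)" using True by (simp_all add: k_def)
  have "df V (ds ! A) (k - ds ! A) (z A) (dd A k ?y) = c \<odot>[S V k] ?y"
   unfolding True c(3) unfolding True[symmetric] kk(1)
   using rl_smult[OF d_linear[OF V_open z_closed[OF A] kk(2)] dw] True by simp
  then have "dd A (ds ! A + k) (dels (A # B # w) (es ! l) (en l)) = (c - 1) \<odot>[S V k] ?y"
   unfolding s using y ev rm_smult_l[OF S_rmod y, of c "- 1"] by (simp add: koszul_def)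
  then show ?thesis
   using c ev True by (intro exI[of _ "c - 1"]) (auto simp: k_def add.assoc)
 next
  case False
  then have "A \<notin> set (B # w)" using N normal_ConsD(3)[OF N(1)] by fastforce
  from dd_dels_skip[OF A l normal_set[OF N(1)] this, of k "k - ds ! A"]
  have "dd A k ?y = \<zero>[S V (k - ds ! A)]" by (simp add: k_def)
  then have "dd A (ds ! A + k) (dels (A # B # w) (es ! l) (en l)) = (- koszul (ds ! A * k)) \<odot>[S V k] ?y"
   unfolding s using y d_zero[OF z_closed[OF A], of k "k - ds ! A"] by simp
  then show ?thesis
   by (intro exI[of _ "- koszul (ds ! A * k)"]) (auto simp: koszul_def k_def add.assoc)
 qed
qed

text \<open>The head of the word is treated first, so that it meets the outermost letter of
  \<open>dels\<close>.\<close>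

primrec Dw :: "nat list => int => ('f, 'e) jet_tensor => ('f, 'e) jet_tensor" where
 "Dw [] j x = x"
| "Dw (A # w) j x = Dw w (j - ds ! A) (dd A j x)"

lemma Dw_linear: "[|set w <= {..<length ds}; n = j - wdeg w|] ==> lin (S V j) (S V n) (Dw w j)"
proof (induction w arbitrary: j n)
 case Nil
 then show ?case by (simp add: rl_id)
next
 case (Cons A w)
 have "lin (S V (j - ds ! A)) (S V n) (Dw w (j - ds ! A))"
  by (rule Cons.IH) (use Cons.prems in simp_all)
 from rl_comp[OF dd_linear[OF _ refl] this] show ?case using Cons.prems by simp
qed

lemma Dw_closed: "[|set w <= {..<length ds}; x \<in> carrier (S V j); n = j - wdeg w|] ==> Dw w j x \<in> carrier (S V n)"
 by (rule rl_closed[OF Dw_linear])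

lemma Dw_L:
 "[|set w <= {..<length ds}; f : sect C V i; x \<in> carrier (S V j); m = i + j; n = j - wdeg w|] ==>
 Dw w m (Lf V i j f x) = Lf V i n f (Dw w j x)"
proof (induction w arbitrary: j x m n)
 case (Cons A w)
 have A: "A < length ds" using Cons.prems by simp
 have "Dw w (m - ds ! A) (Lf V i (j - ds ! A) f (dd A j x)) = Lf V i n f (Dw w (j - ds ! A) (dd A j x))"
  by (rule Cons.IH[OF _ Cons.prems(2) dd_closed[OF A Cons.prems(3) refl]]) (use Cons.prems in simp_all)
 then show ?case using dd_L[OF A Cons.prems(2,3,4) refl] by simp
qed simp

lemma Dw_d:
 "[|set w <= {..<length ds}; B < length ds; B \<notin> set w; x \<in> carrier (S V j); m = ds ! B + j; n = j - wdeg w|] ==>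
 Dw w m (df V (ds ! B) j (z B) x) = df V (ds ! B) n (z B) (Dw w j x)"
proof (induction w arbitrary: j x m n)
 case (Cons A w)
 have A: "A < length ds" "A ~= B" using Cons.prems by auto
 have "Dw w (m - ds ! A) (df V (ds ! B) (j - ds ! A) (z B) (dd A j x)) = df V (ds ! B) n (z B) (Dw w (j - ds ! A) (dd A j x))"
  by (rule Cons.IH[OF _ Cons.prems(2) _ dd_closed[OF A(1) Cons.prems(4) refl]]) (use Cons.prems in simp_all)
 then show ?case using dd_d_diff[OF A(1) Cons.prems(2) A(2) Cons.prems(4,5) refl] by simp
qed simp

text \<open>Passing a \<delta>-factor, the derivation either leaves it in place or turns it into an
  action \<open>\<blacktriangleright>\<close>, which preserves \<open>jnull\<close>. So at most one
  factor is lost.\<close>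

lemma dd_jnull:
 assumes A: "A < length ds"
 shows "x \<in> jnull V (Suc m) j ==> n = j - ds ! A ==> dd A j x \<in> jnull V m n"
proof (induction m arbitrary: j n x)
 case 0
 then have "x \<in> carrier (S V j)" using rsub_sub[OF S_rmod jnull_rsub[OF V_open]] by blast
 then show ?case using dd_closed[OF A _ 0(2)] by (simp add: jnull_0[OF V_open])
next
 case (Suc m)
 show ?case
 proof (rule jnull_map[OF V_open dd_linear[OF A Suc.prems(2)] S_rmod jnull_rsub[OF V_open] Suc.prems(1)])
  fix y assume "y \<in> delta_products C E V (Suc (Suc m)) j"
  then obtain i f w where y: "f : sect C V i" "w \<in> delta_products C E V (Suc m) (j - i)" "y = df V i (j - i) f w"
   by (rule dp_SucE[OF V_open])
  note wj = dp_jnull[OF V_open y(2)]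
  have 1: "df V i (j - i - ds ! A) f (dd A (j - i) w) \<in> jnull V (Suc m) n"
   by (rule d_jnull[OF V_open y(1) Suc.IH[OF wj refl]]) (use Suc.prems in simp)
  have 2: "Rf V (i - ds ! A) (j - i) (D A i f) w \<in> jnull V (Suc m) n"
   by (rule R_jnull[OF V_open D_clo[OF A y(1) refl] wj]) (use Suc.prems in simp)
  have "dd A j y = df V i (j - i - ds ! A) f (dd A (j - i) w) \<oplus>[S V n]
    (- koszul (ds ! A * (j - i))) \<odot>[S V n] Rf V (i - ds ! A) (j - i) (D A i f) w"
   unfolding y(3) by (rule dd_d[OF A y(1) dp_closed[OF V_open y(2)]]) (use Suc.prems in simp_all)
  then show "dd A j y \<in> jnull V (Suc m) n"
   using rsub_add[OF S_rmod jnull_rsub[OF V_open] 1 rsub_smult[OF S_rmod jnull_rsub[OF V_open] 2]] by simp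
 qed
qed

lemma Dw_jnull:
 "[|set w <= {..<length ds}; x \<in> jnull V (length w + m) j; n = j - wdeg w|] ==> Dw w j x \<in> jnull V m n"
proof (induction w arbitrary: j n x)
 case (Cons A w)
 have "dd A j x \<in> jnull V (length w + m) (j - ds ! A)"
  by (rule dd_jnull) (use Cons.prems in simp_all)
 then show ?case using Cons.IH[of "dd A j x" "j - ds ! A" n] Cons.prems by simp
qed simp

section \<open>Functionals dual to the generators\<close>

definition hat :: "nat list \<times> nat => int => ('f, 'e) jet_tensor => 'f" where
 "hat i j x = mu (snd i) (j - wdeg (fst i)) (Dw (fst i) j x)"

definition gdeg :: "nat list \<times> nat => int" where
 "gdeg i = wdeg (fst i) + es ! snd i"

definition gen :: "nat list \<times> nat => ('f, 'e) jet_tensor" where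
 "gen i = dels (fst i) (es ! snd i) (en (snd i))"

text \<open>Words of all lengths: the expansion of an arbitrary tensor produces \<delta>-monomials
  of unbounded length, and only \<open>kids k\<close> cuts off at \<open>k\<close>.\<close>

definition ids :: "(nat list \<times> nat) set" where
 "ids = {w. normal_word w} \<times> {..<length es}"

lemma idsD: "i \<in> ids ==> normal_word (fst i)" "i \<in> ids ==> set (fst i) <= {..<length ds}" "i \<in> ids ==> snd i < length es"
 by (auto simp: ids_def normal_word_def)

lemma gen_closed: "i \<in> ids ==> gen i \<in> carrier (S V (gdeg i))"
 unfolding gen_def gdeg_def by (rule dels_closed[OF en_closed]) (auto dest: idsD)

lemma hat_linear: "i \<in> ids ==> n = j - gdeg i ==> lin (S V j) (sec C V n) (hat i j)"
 unfolding hat_def gdeg_def by (rule rl_comp[OF Dw_linear[OF _ refl] mu_linear]) (auto dest: idsD)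

lemma hat_L:
 assumes i: "i \<in> ids" and f: "f : sect C V p" and x: "x \<in> carrier (S V j)" and n: "m = p + j" "n = j - gdeg i"
 shows "hat i m (Lf V p j f x) = gmul C V p n f (hat i j x)"
 unfolding hat_def Dw_L[OF idsD(2)[OF i] f x n(1) refl]
 by (rule mu_L[OF idsD(3)[OF i] f Dw_closed[OF idsD(2)[OF i] x refl]]) (use n in \<open>simp_all add: gdeg_def\<close>)

text \<open>Removing the letters costs at most \<open>k\<close> of the \<open>k + 1\<close> factors,
  and \<open>mu\<close> kills what still contains a \<delta>.\<close>

lemma hat_null:
 assumes i: "i \<in> ids" and k: "length (fst i) <= k" and x: "x \<in> jnull V (Suc k) j" and n: "n = j - gdeg i"
 shows "hat i j x = \<zero>[sec C V n]"
proof -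
 let ?j = "j - wdeg (fst i)"
 have nn: "n = ?j - es ! snd i" using n by (simp add: gdeg_def)
 note M = mu_linear[OF idsD(3)[OF i] nn]
 have "x \<in> jnull V (length (fst i) + 1) j" using jnull_mono[OF V_open, of "length (fst i) + 1" "Suc k"] k x by auto
 from Dw_jnull[OF idsD(2)[OF i] this refl] have y: "Dw (fst i) j x \<in> jnull V 1 ?j" .
 have "mu (snd i) ?j (Dw (fst i) j x) \<in> {\<zero>[sec C V n]}"
 proof (rule jnull_map[OF V_open M C_rmod _ y])
  show "rsub {\<zero>[sec C V n]} (sec C V n)" by (simp add: rsub_iff)
  fix u assume "u \<in> delta_products C E V 1 ?j"
  then obtain p f w where u: "f : sect C V p" "w \<in> delta_products C E V 0 (?j - p)" "u = df V p (?j - p) f w"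
   unfolding One_nat_def by (rule dp_SucE[OF V_open])
  show "mu (snd i) ?j u \<in> {\<zero>[sec C V n]}"
   unfolding u(3) using mu_d[OF idsD(3)[OF i] u(1) dp_closed[OF V_open u(2)] _ nn] by simp
 qed
 then show ?thesis by (simp add: hat_def)
qed

text \<open>Compare the first letters. If that of \<open>u\<close> is missing in \<open>w\<close>,
  the derivation gives 0; if both agree, they are stripped. Otherwise sortedness makes the first
  letter of \<open>w\<close> smaller than all letters of \<open>u\<close>, so its \<delta> passes
  all derivations and is killed by \<open>mu\<close>.\<close>

lemma hat_neq:
 "[|normal_word u; normal_word w; l < length es; m < length es; (u, l) ~= (w, m); j = wdeg w + es ! m; n = j - wdeg u - es ! l|] ==>
 mu l (j - wdeg u) (Dw u j (dels w (es ! m) (en m))) = \<zero>[sec C V n]"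
proof (induction u arbitrary: w j n)
 case Nil
 show ?case
 proof (cases w)
  case w: Nil
  then have lm: "l ~= m" using Nil by simp
  have "mu l (es ! m) (en m) = gmul C V 0 (es ! m - es ! l) (gunit C V) (cf (es ! m) (\<Phi> m) l)"
   by (rule mu_tens[OF Nil.prems(3) gunit_C \<Phi>_closed[OF Nil.prems(4)]]) simp
  then show ?thesis
   using C.gmul_gunit[OF V_open rm_zero_closed[OF C_rmod]] cf_\<Phi>[OF Nil.prems(3,4)] lm Nil.prems w by simp
 next
  case (Cons B v)
  note N = normal_ConsD[OF Nil.prems(2)[unfolded Cons]]
  show ?thesis
   unfolding Cons dels.simps Dw.simps
   by (rule mu_d[OF Nil.prems(3) z_closed[OF N(2)] dels_closed[OF en_closed[OF Nil.prems(4)] normal_set[OF N(1)] refl]])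
    (use Nil.prems Cons in simp_all)
 qed
next
 case (Cons A u)
 note N = normal_ConsD[OF Cons.prems(1)] and nw = normal_set[OF Cons.prems(2)]
 have A: "A < length ds" by (rule N)
 have DwA: "lin (S V (j - ds ! A)) (S V (j - wdeg (A # u))) (Dw u (j - ds ! A))"
  by (rule Dw_linear[OF normal_set[OF N(1)]]) simp
 have M: "lin (S V (j - wdeg (A # u))) (sec C V n) (mu l (j - wdeg (A # u)))"
  by (rule mu_linear[OF Cons.prems(3)]) (use Cons.prems in simp)
 note MD = rl_comp[OF DwA M]
 show ?case
 proof (cases "A \<in> set w")
  case False
  have "dd A j (dels w (es ! m) (en m)) = \<zero>[S V (j - ds ! A)]"
   by (rule dd_dels_skip[OF A Cons.prems(4) nw False Cons.prems(6) refl])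
  then show ?thesis using rl_zero[OF S_rmod C_rmod MD] by simp
 next
  case True
  then obtain B v where w: "w = B # v" by (cases w) auto
  note NB = normal_ConsD[OF Cons.prems(2)[unfolded w]]
  have v: "dels v (es ! m) (en m) \<in> carrier (S V (wdeg v + es ! m))"
   by (rule dels_closed[OF en_closed[OF Cons.prems(4)] normal_set[OF NB(1)] refl])
  show ?thesis
  proof (cases "A = B")
   case AB: True
   obtain c where c: "dd A j (dels w (es ! m) (en m)) = c \<odot>[S V (j - ds ! A)] dels v (es ! m) (en m)"
    using dd_dels_hit[OF Cons.prems(4) Cons.prems(2)[unfolded w]] AB Cons.prems(6) w by (auto simp: add.assoc)
   have v': "dels v (es ! m) (en m) \<in> carrier (S V (j - ds ! A))" using v AB Cons.prems(6) w by simp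
   have e: "j - wdeg (A # u) = j - ds ! A - wdeg u" by simp
   have "mu l (j - wdeg (A # u)) (Dw u (j - ds ! A) (dels v (es ! m) (en m))) = \<zero>[sec C V n]"
    unfolding e by (rule Cons.IH[OF N(1) NB(1) Cons.prems(3,4)]) (use Cons.prems(5,6,7) AB w in simp_all)
   then show ?thesis using c rl_smult[OF MD v', of c] by simp
  next
   case AB: False
   have lt: "B < A" using True NB(3) AB w by (auto simp: order_le_less)
   have Bu: "B \<notin> set (A # u)" using lt N(3) by auto
   have B: "B < length ds" by (rule NB)
   have "Dw (A # u) j (dels w (es ! m) (en m)) = df V (ds ! B) (wdeg v + es ! m - wdeg (A # u)) (z B) (Dw (A # u) (wdeg v + es ! m) (dels v (es ! m) (en m)))"
    unfolding w dels.simps(2)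
    by (rule Dw_d[OF normal_set[OF Cons.prems(1)] B Bu v]) (use Cons.prems w in simp_all)
   then show ?thesis
    using mu_d[OF Cons.prems(3) z_closed[OF B] Dw_closed[OF normal_set[OF Cons.prems(1)] v refl], of "j - wdeg (A # u)" n]
     Cons.prems w by simp
  qed
 qed
qed

text \<open>The letters are stripped one by one, each leaving the nonzero constant of
  \<open>dd_dels_hit\<close>.\<close>

lemma hat_eq:
 assumes l: "l < length es"
 shows "normal_word u ==> EX c. c ~= 0 & (ALL j. j = wdeg u + es ! l -->
  mu l (j - wdeg u) (Dw u j (dels u (es ! l) (en l))) = c \<odot>[sec C V 0] gunit C V)"
proof (induction u)
 case Nil
 have "mu l (es ! l) (en l) = gmul C V 0 (es ! l - es ! l) (gunit C V) (cf (es ! l) (\<Phi> l) l)"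
  by (rule mu_tens[OF l gunit_C \<Phi>_closed[OF l]]) simp
 then have "mu l (es ! l) (en l) = gunit C V"
  using C.gmul_gunit[OF V_open gunit_C] cf_\<Phi>[OF l l] by simp
 then show ?case by (intro exI[of _ 1]) (use gunit_C in simp)
next
 case (Cons A u)
 note N = normal_ConsD[OF Cons.prems]
 obtain c where c: "c ~= 0" "mu l (es ! l) (Dw u (wdeg u + es ! l) (dels u (es ! l) (en l))) = c \<odot>[sec C V 0] gunit C V"
  using Cons.IH[OF N(1)] by auto
 obtain c' where c': "c' ~= 0" "dd A (wdeg (A # u) + es ! l) (dels (A # u) (es ! l) (en l)) = c' \<odot>[S V (wdeg u + es ! l)] dels u (es ! l) (en l)"
  using dd_dels_hit[OF l Cons.prems] by (auto simp: add.assoc)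
 have y: "dels u (es ! l) (en l) \<in> carrier (S V (wdeg u + es ! l))"
  by (rule dels_closed[OF en_closed[OF l] normal_set[OF N(1)] refl])
 have MD: "lin (S V (wdeg u + es ! l)) (sec C V 0) (%x. mu l (es ! l) (Dw u (wdeg u + es ! l) x))"
  by (rule rl_comp[OF Dw_linear[OF normal_set[OF N(1)]] mu_linear[OF l]]) simp_all
 have "mu l (es ! l) (Dw (A # u) (wdeg (A # u) + es ! l) (dels (A # u) (es ! l) (en l))) = (c' * c) \<odot>[sec C V 0] gunit C V"
  unfolding Dw.simps c'(2) using rl_smult[OF MD y, of c'] c(2) gunit_C by (simp add: add.assoc)
 then show ?case using c(1) c'(1) by (intro exI[of _ "c' * c"]) simp
qed

text \<open>The scalar exists by \<open>hat_eq\<close>, which computes the diagonal of the pairing of \<open>hat\<close> with \<open>gen\<close>.\<close>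

definition dual :: "nat list \<times> nat => int => ('f, 'e) jet_tensor => 'f" where
 "dual i j x = inverse (SOME c. c ~= 0 & hat i (gdeg i) (gen i) = c \<odot>[sec C V 0] gunit C V)
  \<odot>[sec C V (j - gdeg i)] hat i j x"

lemma dual_linear: "i \<in> ids ==> n = j - gdeg i ==> lin (S V j) (sec C V n) (dual i j)"
 unfolding dual_def using rl_fun_smult[OF C_rmod hat_linear] by simp

lemma dual_closed: "i \<in> ids ==> x \<in> carrier (S V j) ==> n = j - gdeg i ==> dual i j x : sect C V n"
 by (rule rl_closed[OF dual_linear])

lemma dual_L:
 assumes i: "i \<in> ids" and f: "f : sect C V p" and x: "x \<in> carrier (S V j)" and n: "m = p + j" "n = j - gdeg i"
 shows "dual i m (Lf V p j f x) = gmul C V p n f (dual i j x)"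
proof -
 have e: "m - gdeg i = p + n" using n by simp
 show ?thesis
  unfolding dual_def hat_L[OF assms] e
  using rl_smult[OF C.gmul_linear_right[OF V_open f] rl_closed[OF hat_linear[OF i n(2)] x]] n by simp
qed

lemma dual_null:
 "[|i \<in> ids; length (fst i) <= k; x \<in> jnull V (Suc k) j; n = j - gdeg i|] ==> dual i j x = \<zero>[sec C V n]"
 unfolding dual_def by (simp add: hat_null)

lemma dual_gen_neq: "[|i \<in> ids; i' \<in> ids; i ~= i'; n = gdeg i' - gdeg i|] ==> dual i (gdeg i') (gen i') = \<zero>[sec C V n]"
 unfolding dual_def hat_def gen_def gdeg_def
 by (subst hat_neq[where n = n]) (auto dest: idsD simp: prod_eq_iff)

lemma dual_gen_eq:
 assumes i: "i \<in> ids"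
 shows "dual i (gdeg i) (gen i) = gunit C V"
proof -
 let ?P = "%c. c ~= 0 & hat i (gdeg i) (gen i) = c \<odot>[sec C V 0] gunit C V"
 have "EX c. ?P c"
  using hat_eq[OF idsD(3)[OF i] idsD(1)[OF i]] unfolding hat_def gen_def gdeg_def by blast
 then have P: "?P (SOME c. ?P c)" by (rule someI_ex)
 define c where "c = (SOME c. ?P c)"
 have c: "c ~= 0" "hat i (gdeg i) (gen i) = c \<odot>[sec C V 0] gunit C V"
  using P unfolding c_def by blast+
 have "dual i (gdeg i) (gen i) = inverse c \<odot>[sec C V 0] hat i (gdeg i) (gen i)"
  unfolding dual_def c_def by simp
 then show ?thesis unfolding c(2) using gunit_C c(1) by simp
qed

end


subsection \<open>The generators span up to the geometrization\<close>

context jet_frame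
begin

text \<open>The new letter moves to its sorted place because the \<delta>-operators graded commute.
  If it meets itself and is odd, the product equals its own negative and vanishes.\<close>

lemma d_dels:
 assumes A: "A < length ds" and l: "l < length es"
 shows "normal_word w ==> j = wdeg w + es ! l ==> n = ds ! A + j ==>
  df V (ds ! A) j (z A) (dels w (es ! l) (en l)) = \<zero>[S V n] \<or>
  normal_word (insort A w) & (EX c. df V (ds ! A) j (z A) (dels w (es ! l) (en l)) = c \<odot>[S V n] dels (insort A w) (es ! l) (en l))"
proof (induction w arbitrary: j n)
 case Nil
 have "normal_word [A]" by (rule normal_ConsI) (use A in auto)
 moreover have "df V (ds ! A) (es ! l) (z A) (en l) \<in> carrier (S V n)"
  by (rule d_closed[OF V_open z_closed[OF A] en_closed[OF l]]) (use Nil in simp)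
 ultimately show ?case using Nil by (intro disjI2 conjI exI[of _ 1]) simp_all
next
 case (Cons B w)
 note N = normal_ConsD[OF Cons.prems(1)]
 let ?y = "dels w (es ! l) (en l)" and ?x = "dels (B # w) (es ! l) (en l)" and ?j = "wdeg w + es ! l"
 have y: "?y \<in> carrier (S V ?j)" by (rule dels_closed[OF en_closed[OF l] normal_set[OF N(1)] refl])
 have x: "?x \<in> carrier (S V j)" by (rule dels_closed[OF en_closed[OF l] normal_set[OF Cons.prems(1)] Cons.prems(2)])
 have dx: "df V (ds ! A) j (z A) ?x \<in> carrier (S V n)" by (rule d_closed[OF V_open z_closed[OF A] x Cons.prems(3)])
 have j: "j = ds ! B + ?j" using Cons.prems by simp
 have sw: "df V (ds ! A) j (z A) ?x = koszul (ds ! A * ds ! B) \<odot>[S V n] df V (ds ! B) (ds ! A + ?j) (z B) (df V (ds ! A) ?j (z A) ?y)"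
  unfolding dels.simps(2) by (rule d_d[OF V_open z_closed[OF A] z_closed[OF N(2)] y j refl Cons.prems(3)])
 show ?case
 proof (cases "A < B \<or> A = B & even (ds ! A)")
  case True
  then have i: "insort A (B # w) = A # B # w" by auto
  have "normal_word (A # B # w)" by (rule normal_ConsI[OF Cons.prems(1) A]) (use True N(3) in auto)
  then show ?thesis
   unfolding i using dx Cons.prems(2) by (intro disjI2 conjI exI[of _ 1]) simp_all
 next
  case F: False
  show ?thesis
  proof (cases "A = B")
   case True
   then have o: "odd (ds ! A)" using F by simp
   have "df V (ds ! A) j (z A) ?x = (-1) \<odot>[S V n] df V (ds ! A) j (z A) ?x"
    using sw o True j by (simp add: koszul_def)
   then have "df V (ds ! A) j (z A) ?x \<oplus>[S V n] df V (ds ! A) j (z A) ?x = \<zero>[S V n]"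
    using rm_cancel_self(1)[OF S_rmod dx] by metis
   then have "(1 + 1) \<odot>[S V n] df V (ds ! A) j (z A) ?x = \<zero>[S V n]"
    unfolding rm_smult_l[OF S_rmod dx] using dx by simp
   then have "(1/2) \<odot>[S V n] ((1 + 1) \<odot>[S V n] df V (ds ! A) j (z A) ?x) = \<zero>[S V n]" by simp
   then show ?thesis using dx by simp
  next
   case False
   then have BA: "B < A" using F by auto
   then have i: "insort A (B # w) = B # insort A w" by auto
   show ?thesis
    using Cons.IH[OF N(1) refl refl]
   proof (elim disjE conjE exE)
    assume "df V (ds ! A) ?j (z A) ?y = \<zero>[S V (ds ! A + ?j)]"
    then have "df V (ds ! A) j (z A) ?x = \<zero>[S V n]"
     unfolding sw using d_zero[OF z_closed[OF N(2)], of n "ds ! A + ?j"] j Cons.prems(3) by simp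
    then show ?thesis ..
   next
    fix c assume n: "normal_word (insort A w)" and c: "df V (ds ! A) ?j (z A) ?y = c \<odot>[S V (ds ! A + ?j)] dels (insort A w) (es ! l) (en l)"
    have "normal_word (B # insort A w)"
     by (rule normal_ConsI[OF n N(2)]) (use BA N(3,4) in \<open>auto simp: set_insort_key\<close>)
    moreover have yi: "dels (insort A w) (es ! l) (en l) \<in> carrier (S V (ds ! A + ?j))"
     by (rule dels_closed[OF en_closed[OF l] normal_set[OF n]]) (simp add: wdeg_insort)
    have nn: "n = ds ! B + (ds ! A + ?j)" using j Cons.prems(3) by simp
    have "df V (ds ! B) (ds ! A + ?j) (z B) (c \<odot>[S V (ds ! A + ?j)] dels (insort A w) (es ! l) (en l)) =
      c \<odot>[S V n] dels (B # insort A w) (es ! l) (en l)"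
     using rl_smult[OF d_linear[OF V_open z_closed[OF N(2)] nn] yi, of c] by (simp add: wdeg_insort add.assoc)
    then have "df V (ds ! A) j (z A) ?x = (koszul (ds ! A * ds ! B) * c) \<odot>[S V n] dels (B # insort A w) (es ! l) (en l)"
     unfolding sw c using dels_closed[OF en_closed[OF l] normal_set[OF calculation], of n] nn by (simp add: wdeg_insort)
    ultimately show ?thesis unfolding i by blast
   qed
  qed
 qed
qed

text \<open>Combinations of \<delta>-monomials on the frame, of any length. They are stable under
  \<open>\<triangleright>\<close> and under \<delta> of coordinates; for
  \<open>\<blacktriangleright>\<close> of a general function, \<open>R_G\<close> provides a
  substitute up to a remainder.\<close>

definition G :: "int => ('f, 'e) jet_tensor set" where
 "G j = real_span (S V j) {Lf V (j - gdeg i) (gdeg i) f (gen i) | i f. i \<in> ids & f : sect C V (j - gdeg i)}"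

lemma G_rsub: "rsub (G j) (S V j)"
 unfolding G_def by (rule span_rsub[OF S_rmod]) (auto intro: L_closed[OF V_open _ gen_closed])

lemma G_closed: "x \<in> G j ==> x \<in> carrier (S V j)"
 using rsub_sub[OF S_rmod G_rsub] by blast

lemma G_gen: "i \<in> ids ==> f : sect C V p ==> n = p + gdeg i ==> Lf V p (gdeg i) f (gen i) \<in> G n"
 unfolding G_def by (rule subsetD[OF span_superset], rule CollectI, rule exI[of _ i], rule exI[of _ f]) simp

lemma G_map:
 assumes f: "lin (S V j) W h" and W: "rmod W" "rsub T W" and x: "x \<in> G j"
  and g: "!!i f p. i \<in> ids ==> f : sect C V p ==> j = p + gdeg i ==> h (Lf V p (gdeg i) f (gen i)) \<in> T"
 shows "h x \<in> T"
proof (rule rl_span[OF S_rmod W(1) f _ W(2) _ x[unfolded G_def]])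
 show "{Lf V (j - gdeg i) (gdeg i) f (gen i) |i f. i \<in> ids & f : sect C V (j - gdeg i)} <= carrier (S V j)"
  by (auto intro: L_closed[OF V_open _ gen_closed])
 fix y assume "y \<in> {Lf V (j - gdeg i) (gdeg i) f (gen i) |i f. i \<in> ids & f : sect C V (j - gdeg i)}"
 then obtain i f where "i \<in> ids" "f : sect C V (j - gdeg i)" "y = Lf V (j - gdeg i) (gdeg i) f (gen i)"
  unfolding mem_Collect_eq by (elim exE conjE)
 then show "h y \<in> T" using g[of i f "j - gdeg i"] by simp
qed

lemma G_d:
 assumes A: "A < length ds" and y: "y \<in> G j" and n: "n = ds ! A + j"
 shows "df V (ds ! A) j (z A) y \<in> G n"
proof (rule G_map[OF d_linear[OF V_open z_closed[OF A] n] S_rmod G_rsub y])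
 fix i f p assume i: "i \<in> ids" and f: "f : sect C V p" and j: "j = p + gdeg i"
 note g = gen_closed[OF i]
 have nn: "n = p + (ds ! A + gdeg i)" using n j by simp
 have dg: "df V (ds ! A) (gdeg i) (z A) (gen i) \<in> carrier (S V (ds ! A + gdeg i))"
  by (rule d_closed[OF V_open z_closed[OF A] g refl])
 have "Lf V p (ds ! A + gdeg i) f (df V (ds ! A) (gdeg i) (z A) (gen i)) \<in> G n"
  using d_dels[OF A idsD(3)[OF i] idsD(1)[OF i] gdeg_def refl]
  unfolding gen_def[symmetric]
 proof (elim disjE conjE exE)
  assume e: "df V (ds ! A) (gdeg i) (z A) (gen i) = \<zero>[S V (ds ! A + gdeg i)]"
  show ?thesis unfolding e rl_zero[OF S_rmod S_rmod L_linear[OF V_open f nn]] by (rule rsub_zero[OF S_rmod G_rsub])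
 next
  fix c assume nm: "normal_word (insort A (fst i))"
   and e: "df V (ds ! A) (gdeg i) (z A) (gen i) = c \<odot>[S V (ds ! A + gdeg i)] dels (insort A (fst i)) (es ! snd i) (en (snd i))"
  define i' where "i' = (insort A (fst i), snd i)"
  have i': "i' \<in> ids" using nm idsD(3)[OF i] by (simp add: i'_def ids_def)
  have gd: "gdeg i' = ds ! A + gdeg i" by (simp add: i'_def gdeg_def wdeg_insort)
  have e': "df V (ds ! A) (gdeg i) (z A) (gen i) = c \<odot>[S V (ds ! A + gdeg i)] gen i'"
   unfolding e by (simp add: gen_def i'_def)
  show ?thesis
   unfolding e' rl_smult[OF L_linear[OF V_open f nn] gen_closed[OF i', unfolded gd]]
   using rsub_smult[OF S_rmod G_rsub G_gen[OF i' f]] nn gd by simp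
 qed
 from rsub_smult[OF S_rmod G_rsub this, of "koszul (p * ds ! A)"]
 show "df V (ds ! A) j (z A) (Lf V p (gdeg i) f (gen i)) \<in> G n"
  unfolding L_d[OF V_open f z_closed[OF A] g refl j nn]
  using d_closed[OF V_open z_closed[OF A] L_closed[OF V_open f g j] n] by simp
qed

lemma G_L:
 assumes f: "f : sect C V m" and y: "y \<in> G j" and n: "n = m + j"
 shows "Lf V m j f y \<in> G n"
proof (rule G_map[OF L_linear[OF V_open f n] S_rmod G_rsub y])
 fix i g p assume i: "i \<in> ids" and g: "g : sect C V p" and j: "j = p + gdeg i"
 have "Lf V m j f (Lf V p (gdeg i) g (gen i)) = Lf V (m + p) (gdeg i) (gmul C V m p f g) (gen i)"
  unfolding j by (rule TP.act_assoc[OF V_open f g gen_closed[OF i], symmetric])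
 then show "Lf V m j f (Lf V p (gdeg i) g (gen i)) \<in> G n"
  using G_gen[OF i C.gmul_closed[OF V_open f g refl], of n] n j by (simp add: add.assoc)
qed

lemma G_R:
 assumes A: "A < length ds" and y: "y \<in> G j" and n: "n = ds ! A + j"
 shows "Rf V (ds ! A) j (z A) y \<in> G n"
 unfolding R_eq[OF V_open z_closed[OF A] G_closed[OF y] n]
 by (intro rsub_add[OF S_rmod G_rsub] rsub_smult[OF S_rmod G_rsub] G_L[OF z_closed[OF A] y n] G_d[OF A y n])

lemma R_shift:
 assumes f: "f : sect C V 0" and y: "y \<in> carrier (S V j)"
 shows "Rf V 0 j (f \<oplus>[sec C V 0] v \<odot>[sec C V 0] gunit C V) y = Rf V 0 j f y \<oplus>[S V j] v \<odot>[S V j] y"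
 using rl_add[OF R_linear_left[OF V_open y, of j 0] f rm_smult_closed[OF C_rmod gunit_C]]
  rl_smult[OF R_linear_left[OF V_open y, of j 0] gunit_C] R_gunit[OF V_open y] by simp

lemma G_R_shift:
 assumes A: "A < length ds" and y: "y \<in> G j" and n: "n = ds ! A + j"
 shows "Rf V (ds ! A) j (if ds ! A = 0 then z A \<oplus>[sec C V (ds ! A)] v \<odot>[sec C V (ds ! A)] gunit C V else z A) y \<in> G n"
proof (cases "ds ! A = 0")
 case True
 then have n': "n = j" and zc: "z A : sect C V 0" using n z_closed[OF A] by simp_all
 have 1: "Rf V 0 j (z A) y \<in> G j" using G_R[OF A y n] True n' by simp
 have "Rf V 0 j (z A) y \<oplus>[S V j] v \<odot>[S V j] y \<in> G j"
  by (rule rsub_add[OF S_rmod G_rsub 1 rsub_smult[OF S_rmod G_rsub y]])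
 then show ?thesis using True R_shift[OF zc G_closed[OF y], of v] n' by simp
next
 case False
 then show ?thesis using G_R[OF A y n] by simp
qed

section \<open>Expansion of an arbitrary tensor at a point\<close>

context
 fixes a :: 'm assumes a: "a \<in> V"
begin

lemma J_ideal: "ideal_action (J a) (%i. sect C V i) (sec (tensor_psh C E) V) (act (tensor_psh C E) V)"
 by (rule ideal_action.intro) (auto intro: L_linear[OF V_open] J_subset[OF a, THEN subsetD])

interpretation I: ideal_action "J a" "%i. sect C V i" "sec (tensor_psh C E) V" "act (tensor_psh C E) V"
 by (rule J_ideal)

lemma J_C: "f \<in> J a i ==> f : sect C V i"
 using J_subset[OF a] by blast

text \<open>Remainders with \<open>N\<close> factors altogether, each either an element of the ideal
  of the point or a \<delta>. For \<open>N = 0\<close> this is everything.\<close>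

definition FF :: "nat => int => ('f, 'e) jet_tensor set" where
 "FF N j = real_span (S V j) (\<Union>p\<le>N. I.ipow p (jnull V (N - p)) j)"

lemma ip_rsub: "rsub (I.ipow p (jnull V m) j) (S V j)"
 by (rule I.ipow_rsub[OF jnull_rsub[OF V_open]])

lemma FF_sub: "(\<Union>p\<le>N. I.ipow p (jnull V (N - p)) j) <= carrier (S V j)"
 using rsub_sub[OF S_rmod ip_rsub] by blast

lemma FF_rsub: "rsub (FF N j) (S V j)"
 unfolding FF_def by (rule span_rsub[OF S_rmod FF_sub])

lemma FF_gen: "p <= N ==> x \<in> I.ipow p (jnull V (N - p)) j ==> x \<in> FF N j"
 unfolding FF_def by (rule subsetD[OF span_superset]) blast

text \<open>The \<delta> passes the ideal factors up to sign and joins the \<delta>-factors behind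
  them.\<close>

lemma ip_d:
 assumes f: "f : sect C V i" and x: "x \<in> I.ipow p (jnull V m) j"
 shows "df V i j f x \<in> I.ipow p (jnull V (Suc m)) (i + j)"
proof (rule ipow_map[where t = "%j. i + j" and h = "%j. df V i j f" and \<rho> = "%i f. f" and s = "%m. koszul (m * i)",
   OF J_ideal J_ideal d_linear[OF V_open f refl] _ _ d_jnull[OF V_open f _ refl] jnull_rsub[OF V_open] jnull_rsub[OF V_open] _ x])
 fix n j g x assume g: "g \<in> J a n" and x: "x \<in> carrier (S V j)"
 have "df V i (n + j) f (Lf V n j g x) \<in> carrier (S V (n + (i + j)))"
  by (rule d_closed[OF V_open f L_closed[OF V_open J_C[OF g] x refl]]) simp
 then show "df V i (n + j) f (Lf V n j g x) = koszul (n * i) \<odot>[S V (n + (i + j))] Lf V n (i + j) g (df V i j f x)"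
  unfolding L_d[OF V_open J_C[OF g] f x refl refl refl] by simp
qed auto

text \<open>By \<open>R_eq\<close> the operator is \<open>\<triangleright>\<close> of
  \<open>f\<close>, which adds an ideal factor, minus \<delta> of \<open>f\<close>, which adds a
  \<delta>-factor.\<close>

lemma FF_R:
 assumes f: "f \<in> J a i" and x: "x \<in> FF N j" and n: "n = i + j"
 shows "Rf V i j f x \<in> FF (Suc N) n"
proof (rule rl_span[OF S_rmod S_rmod R_linear[OF V_open J_C[OF f] n] FF_sub FF_rsub _ x[unfolded FF_def]])
 fix y assume "y \<in> (\<Union>p\<le>N. I.ipow p (jnull V (N - p)) j)"
 then obtain p where p: "p <= N" "y \<in> I.ipow p (jnull V (N - p)) j" by blast
 have yc: "y \<in> carrier (S V j)" using rsub_sub[OF S_rmod ip_rsub] p(2) by blast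
 have 1: "Lf V i j f y \<in> FF (Suc N) n"
  by (rule FF_gen[of "Suc p"]) (use p(1) I.ipow_Suc[OF f p(2) n] in simp_all)
 have "df V i j f y \<in> I.ipow p (jnull V (Suc N - p)) n"
  using ip_d[OF J_C[OF f] p(2)] p(1) by (simp add: Suc_diff_le n)
 from FF_gen[OF _ this] p(1) have 2: "df V i j f y \<in> FF (Suc N) n" by simp
 show "Rf V i j f y \<in> FF (Suc N) n"
  unfolding R_eq[OF V_open J_C[OF f] yc n] by (rule rsub_add[OF S_rmod FF_rsub 1 rsub_smult[OF S_rmod FF_rsub 2]])
qed

definition GF :: "nat => int => ('f, 'e) jet_tensor set" where
 "GF N j = real_span (S V j) (G j Un FF N j)"

lemma GF_sub: "G j Un FF N j <= carrier (S V j)"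
 using rsub_sub[OF S_rmod FF_rsub] rsub_sub[OF S_rmod G_rsub] by blast

lemma GF_rsub: "rsub (GF N j) (S V j)"
 unfolding GF_def by (rule span_rsub[OF S_rmod GF_sub])

lemma GF_I: "x \<in> G j ==> x \<in> GF N j" "x \<in> FF N j ==> x \<in> GF N j"
 unfolding GF_def by (rule subsetD[OF span_superset], blast)+

text \<open>The induction on \<open>N\<close> can start because \<open>FF\<close> is everything for
  \<open>N = 0\<close>. A function \<open>f\<close> in the ideal is a sum of shifted coordinates
  times functions \<open>F A\<close>. The action of \<open>F A\<close> is covered by the induction
  hypothesis, and a shifted coordinate preserves \<open>G\<close> and raises \<open>FF\<close> by
  one factor.\<close>

lemma R_G:
 "[|f : sect C V i; y \<in> G j; n = i + j|] ==> Rf V i j f y \<in> GF N n"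
proof (induction N arbitrary: i f n)
 case 0
 have "Rf V i j f y \<in> I.ipow 0 (jnull V (0 - 0)) n"
  using R_closed[OF V_open 0(1) G_closed[OF 0(2)] 0(3)] by (simp add: jnull_0[OF V_open])
 from GF_I(2)[OF FF_gen[OF _ this]] show ?case by simp
next
 case (Suc N)
 note y = G_closed[OF Suc.prems(2)]
 have *: "Rf V i j f y \<in> GF (Suc N) n" if f: "f \<in> J a i" and n: "n = i + j" for i f n
 proof -
  obtain v F where F0: "\<forall>A<length ds. F A : sect C V (i - ds ! A) &
    (if ds ! A = 0 then z A \<oplus>[sec C V (ds ! A)] v A \<odot>[sec C V (ds ! A)] gunit C V else z A) \<in> J a (ds ! A)"
   and F1: "f = finsum (sec C V i) (%A. gmul C V (ds ! A) (i - ds ! A)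
    (if ds ! A = 0 then z A \<oplus>[sec C V (ds ! A)] v A \<odot>[sec C V (ds ! A)] gunit C V else z A) (F A)) {..<length ds}"
   using J_hadamard[OF a f] by (elim exE conjE)
  define Z' where "Z' A = (if ds ! A = 0 then z A \<oplus>[sec C V (ds ! A)] v A \<odot>[sec C V (ds ! A)] gunit C V else z A)" for A
  have F: "F A : sect C V (i - ds ! A)" "Z' A \<in> J a (ds ! A)" if "A < length ds" for A
   using F0 that unfolding Z'_def by blast+
  have f': "f = finsum (sec C V i) (%A. gmul C V (ds ! A) (i - ds ! A) (Z' A) (F A)) {..<length ds}"
   unfolding F1 Z'_def ..
  have gc: "(%A. gmul C V (ds ! A) (i - ds ! A) (Z' A) (F A)) \<in> {..<length ds} \<rightarrow> sect C V i"
   by (rule Pi_I, rule C.gmul_closed[OF V_open J_C[OF F(2)] F(1)]) simp_all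
  have "Rf V i j f y = finsum (S V n) (%A. Rf V i j (gmul C V (ds ! A) (i - ds ! A) (Z' A) (F A)) y) {..<length ds}"
   unfolding f' by (rule rl_finsum[OF C_rmod S_rmod R_linear_left[OF V_open y n] finite_lessThan gc])
  also have "\<dots> \<in> GF (Suc N) n"
  proof (rule rsub_finsum[OF S_rmod GF_rsub], rule Pi_I)
   fix A assume "A \<in> {..<length ds}"
   then have A: "A < length ds" by simp
   define m where "m = i - ds ! A + j"
   have nm: "n = ds ! A + m" using n by (simp add: m_def)
   have "Rf V i j (gmul C V (ds ! A) (i - ds ! A) (Z' A) (F A)) y = Rf V (ds ! A) m (Z' A) (Rf V (i - ds ! A) j (F A) y)"
    by (rule R_gmul[OF V_open J_C[OF F(2)[OF A]] F(1)[OF A] y _ m_def]) simp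
   moreover have w: "Rf V (i - ds ! A) j (F A) y \<in> GF N m" by (rule Suc.IH[OF F(1)[OF A] Suc.prems(2) m_def])
   have "Rf V (ds ! A) m (Z' A) (Rf V (i - ds ! A) j (F A) y) \<in> GF (Suc N) n"
   proof (rule rl_span[OF S_rmod S_rmod R_linear[OF V_open J_C[OF F(2)[OF A]] nm] GF_sub GF_rsub _ w[unfolded GF_def]])
    fix u assume "u \<in> G m Un FF N m"
    then show "Rf V (ds ! A) m (Z' A) u \<in> GF (Suc N) n"
    proof
     assume "u \<in> G m"
     from GF_I(1)[OF G_R_shift[OF A this nm]] show ?thesis unfolding Z'_def .
    next
     assume "u \<in> FF N m"
     from GF_I(2)[OF FF_R[OF F(2)[OF A] this nm]] show ?thesis .
    qed
   qed
   ultimately show "Rf V i j (gmul C V (ds ! A) (i - ds ! A) (Z' A) (F A)) y \<in> GF (Suc N) n" by simp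
  qed
  finally show ?thesis .
 qed
 show ?case
 proof (cases "i = 0")
  case False
  show ?thesis by (rule *[OF J_degree[OF a False Suc.prems(1)] Suc.prems(3)])
 next
  case True
  then have f: "f : sect C V 0" and n: "n = j" using Suc.prems by simp_all
  \<comment> \<open>In degree 0 the function is first moved into the ideal by a constant, whose
    action on \<open>y\<close> is a multiple of \<open>y\<close> and hence stays in
    \<open>G\<close>.\<close>
  obtain v where v: "f \<oplus>[sec C V 0] v \<odot>[sec C V 0] gunit C V \<in> J a 0" using J_shift[OF a f] by blast
  have Rf: "Rf V 0 j f y \<in> carrier (S V j)" by (rule R_closed[OF V_open f y]) simp
  have "Rf V 0 j f y \<oplus>[S V j] v \<odot>[S V j] y \<in> GF (Suc N) j"
   using *[OF v, of j] unfolding R_shift[OF f y] by simp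
  from rsub_add[OF S_rmod GF_rsub this rsub_smult[OF S_rmod GF_rsub GF_I(1)[OF Suc.prems(2)], of "- v"]]
  have "Rf V 0 j f y \<in> GF (Suc N) j"
   using Rf y by (simp add: rm_assoc[OF S_rmod])
  then show ?thesis using True n by simp
 qed
qed

text \<open>Expanding \<open>\<psi>\<close> in the frame turns \<open>g \<otimes> \<psi>\<close>, up
  to signs, into the sum of the actions \<open>\<blacktriangleright>\<close> of its coefficients on
  \<open>g \<otimes> \<Phi> l\<close>, and \<open>g \<otimes> \<Phi> l\<close> lies in
  \<open>G\<close>.\<close>

lemma GF_all: assumes x: "x \<in> carrier (S V j)" shows "x \<in> GF N j"
proof (rule S_induct[OF V_open x GF_rsub])
 fix p g \<psi> assume g: "g : sect C V p" and \<psi>: "\<psi> \<in> sect E V (j - p)"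
 have tr: "lin (sec E V (j - p)) (S V j) (tn V p (j - p) g)" by (rule tS_right[OF V_open g]) simp
 have ac: "(%l. act E V (j - p - es ! l) (es ! l) (cf (j - p) \<psi> l) (\<Phi> l)) \<in> {..<length es} \<rightarrow> sect E V (j - p)"
  by (rule Pi_I, rule E.act_closed[OF V_open cf_closed[OF \<psi>] \<Phi>_closed]) simp_all
 have "tn V p (j - p) g \<psi> = tn V p (j - p) g (lc (j - p) (cf (j - p) \<psi>))" by (simp add: lc_cf[OF \<psi>])
 also have "\<dots> = finsum (S V j) (%l. tn V p (j - p) g (act E V (j - p - es ! l) (es ! l) (cf (j - p) \<psi> l) (\<Phi> l))) {..<length es}"
  unfolding lincomb_def by (rule rl_finsum[OF E_rmod S_rmod tr finite_lessThan ac])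
 also have "\<dots> \<in> GF N j"
 proof (rule rsub_finsum[OF S_rmod GF_rsub], rule Pi_I)
  fix l assume l': "l \<in> {..<length es}"
  then have l: "l < length es" by simp
  define i where "i = j - p - es ! l"
  define e where "e = es ! l"
  have d: "j - p = i + e" "i + (p + e) = j" by (simp_all add: i_def e_def)
  note c = cf_closed[OF \<psi> l', folded i_def]
  have idl: "([], l) \<in> ids" using l by (simp add: ids_def)
  have en: "Lf V p e g (en l) \<in> G (p + e)"
   using G_gen[OF idl g, of "p + e"] by (simp add: gdeg_def gen_def e_def)
  have "Lf V p e g (en l) = tn V p e g (\<Phi> l)"
   using L_tens[OF V_open g gunit_C \<Phi>_closed[OF l], of e] gmul_gunit_right[OF g] by (simp add: e_def)
  then have tG: "tn V p e g (\<Phi> l) \<in> G (p + e)" using en by simp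
  have "Rf V i (p + e) (cf (j - p) \<psi> l) (tn V p e g (\<Phi> l)) = koszul (i * p) \<odot>[S V j] tn V p (i + e) g (act E V i e (cf (j - p) \<psi> l) (\<Phi> l))"
   using R_tens[OF V_open c g \<Phi>_closed[OF l, folded e_def] refl] unfolding d(2) .
  moreover have "Rf V i (p + e) (cf (j - p) \<psi> l) (tn V p e g (\<Phi> l)) \<in> GF N j"
   by (rule R_G[OF c tG]) (simp add: d)
  moreover have "tn V p (i + e) g (act E V i e (cf (j - p) \<psi> l) (\<Phi> l)) \<in> carrier (S V j)"
   by (rule tS_closed[OF V_open g E.act_closed[OF V_open c \<Phi>_closed[OF l, folded e_def] refl]]) (simp add: d(2)[symmetric])
  ultimately have "tn V p (i + e) g (act E V i e (cf (j - p) \<psi> l) (\<Phi> l)) \<in> GF N j"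
   using rsub_smult[OF S_rmod GF_rsub, of "koszul (i * p) \<odot>[S V j] tn V p (i + e) g (act E V i e (cf (j - p) \<psi> l) (\<Phi> l))" N j "koszul (i * p)"]
   by simp
  then show "tn V p (j - p) g (act E V (j - p - es ! l) (es ! l) (cf (j - p) \<psi> l) (\<Phi> l)) \<in> GF N j"
   unfolding i_def[symmetric] e_def[symmetric] d(1) by (simp add: d(1))
 qed
 finally show "tn V p (j - p) g \<psi> \<in> GF N j" .
qed

end

end


section \<open>Multi-indices as normal words\<close>

lemma count_list_concat_replicate: "count_list (concat (map (%A. replicate (I A) A) [0..<n])) B = (if B < n then I B else 0)"
proof (induction n)
 case (Suc n)
 have "count_list (replicate m n) B = (if B = n then m else 0)" for m by (induction m) auto
 then show ?case using Suc by auto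
qed simp

lemma set_concat_replicate: "set (concat (map (%A. replicate (I A) A) [0..<n])) <= {..<n}"
 by auto

lemma sorted_concat_replicate: "sorted (concat (map (%A. replicate (I A) A) [0..<n]))"
 by (induction n) (auto simp: sorted_append)

lemma sum_list_concat_replicate:
 "(\<Sum>x\<leftarrow>concat (map (%A. replicate (I A) (f A)) [0..<n]). x) = (\<Sum>A<n. int (I A) * f A)"
 by (induction n) (simp_all add: sum_list_replicate)

lemma length_concat_replicate: "length (concat (map (%A. replicate (I A) (f A)) [0..<n])) = (\<Sum>A<n. I A)"
 by (induction n) simp_all

definition word :: "int list => (nat => nat) => nat list" where
 "word ds I = concat (map (%A. replicate (I A) A) [0..<length ds])"

lemma map_word: "map f (word ds I) = concat (map (%A. replicate (I A) (f A)) [0..<length ds])"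
 by (simp add: word_def map_concat comp_def)

context coordinate_algebra
begin

lemma wdeg_word: "wdeg (word ds I) = mi_degree ds I"
 unfolding wdeg_def map_word mi_degree_def using sum_list_concat_replicate[of I "%A. ds ! A"] by simp

text \<open>The inverse counts letters: a sorted word is determined by its multiplicities.\<close>

lemma word_bij:
 "bij_betw (word ds) (\<Union>q\<in>{0..k}. multiindices_of_weight ds q) {w. normal_word w & length w <= k}"
proof -
 have mi: "(\<Union>q\<in>{0..k}. multiindices_of_weight ds q) = {I \<in> multiindices ds. mi_weight ds I <= k}"
  by (auto simp: multiindices_of_weight_def)
 have len: "length (word ds I) = mi_weight ds I" for I
  by (simp add: word_def length_concat_replicate mi_weight_def)
 have cnt: "count_list (word ds I) A = (if A < length ds then I A else 0)" for I A
  by (simp add: word_def count_list_concat_replicate)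
 show ?thesis
  unfolding mi
 proof (rule bij_betw_imageI)
  show "inj_on (word ds) {I \<in> multiindices ds. mi_weight ds I <= k}"
  proof (rule inj_onI, rule ext)
   fix I I' A assume I: "I \<in> {I \<in> multiindices ds. mi_weight ds I <= k}" "I' \<in> {I \<in> multiindices ds. mi_weight ds I <= k}"
    and e: "word ds I = word ds I'"
   show "I A = I' A"
    using cnt[of I A] cnt[of I' A] I unfolding e by (cases "A < length ds") (auto simp: multiindices_def)
  qed
  show "word ds ` {I \<in> multiindices ds. mi_weight ds I <= k} = {w. normal_word w & length w <= k}"
  proof (intro equalityI subsetI)
   fix w assume "w \<in> word ds ` {I \<in> multiindices ds. mi_weight ds I <= k}"
   then obtain I where I: "I \<in> multiindices ds" "mi_weight ds I <= k" "w = word ds I" by blast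
   have "count_list w A <= 1" if "odd (ds ! A)" for A
    unfolding I(3) cnt using I(1) that by (auto simp: multiindices_def)
   then have "normal_word w"
    unfolding normal_word_def using sorted_concat_replicate set_concat_replicate I(3) by (auto simp: word_def)
   then show "w \<in> {w. normal_word w & length w <= k}" using I len by simp
  next
   fix w assume "w \<in> {w. normal_word w & length w <= k}"
   then have w: "normal_word w" "length w <= k" by auto
   have out: "count_list w A = 0" if "\<not> A < length ds" for A
    using normal_set[OF w(1)] that by (auto simp: count_list_0_iff)
   \<comment> \<open>Both words have the same letters with the same multiplicities, and both are
     sorted.\<close>
   have "mset w = mset (word ds (count_list w))"
    by (rule multiset_eqI) (simp add: count_mset cnt out)
   then have "sort (word ds (count_list w)) = w"
    using w(1) by (intro properties_for_sort) (simp_all add: normal_word_def)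
   then have e: "w = word ds (count_list w)"
    using sorted_sort_id[OF sorted_concat_replicate[of "count_list w" "length ds"]] by (simp only: word_def)
   have "count_list w \<in> multiindices ds"
    unfolding multiindices_def using out w(1) by (auto simp: normal_word_def le_Suc_eq)
   moreover have "mi_weight ds (count_list w) <= k" using len[of "count_list w"] e w(2) by simp
   ultimately show "w \<in> word ds ` {I \<in> multiindices ds. mi_weight ds I <= k}" using e by blast
  qed
 qed
qed

end

section \<open>Truncation at \<open>k\<close> letters\<close>

context jet_frame
begin

definition kids :: "nat => (nat list \<times> nat) set" where
 "kids k = {w. normal_word w & length w <= k} \<times> {..<length es}"

lemma kids_ids: "i \<in> kids k ==> i \<in> ids" "i \<in> kids k ==> length (fst i) <= k"
 by (auto simp: kids_def ids_def)

lemma kids_finite: "finite (kids k)"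
proof -
 have "{w. normal_word w & length w <= k} <= {w. set w <= {..<length ds} & length w <= k}" using normal_set by blast
 then show ?thesis unfolding kids_def by (intro finite_SigmaI finite_lessThan) (rule finite_subset[OF _ finite_lists_length_le[OF finite_lessThan]])
qed

lemma gen_all: "\<forall>i\<in>kids k. gen i \<in> carrier (S V (gdeg i))"
 using gen_closed kids_ids by blast

lemmas kids_facts = V_open kids_finite gen_all

text \<open>The projection onto the span of the generators with at most \<open>k\<close> letters,
  along the common kernel of their dual functionals.\<close>

definition Pr :: "nat => int => ('f, 'e) jet_tensor => ('f, 'e) jet_tensor" where
 "Pr k j x = lincomb (tensor_psh C E) V (kids k) gdeg gen j (%i. dual i j x)"

lemma dual_coeffs: "x \<in> carrier (S V j) ==> \<forall>i\<in>kids k. dual i j x : sect C V (j - gdeg i)"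
 using dual_closed kids_ids by blast

lemma L_gen_linear: "i \<in> ids ==> lin (sec C V (j - gdeg i)) (S V j) (%f. Lf V (j - gdeg i) (gdeg i) f (gen i))"
 using TP.act_linear_left[OF V_open gen_closed, of i "j - gdeg i"] by simp

lemma Pr_linear: "lin (S V j) (S V j) (Pr k j)"
 unfolding Pr_def lincomb_def
 by (rule rl_fun_finsum[OF S_rmod rl_comp[OF dual_linear[OF _ refl] L_gen_linear] kids_finite])
  (auto dest: kids_ids)

lemma Pr_closed: "x \<in> carrier (S V j) ==> Pr k j x \<in> carrier (S V j)"
 by (rule rl_closed[OF Pr_linear])

lemma Pr_L:
 assumes f: "f : sect C V p" and x: "x \<in> carrier (S V j)"
 shows "Pr k (p + j) (Lf V p j f x) = Lf V p j f (Pr k j x)"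
proof -
 have e: "p + j - gdeg i = p + (j - gdeg i)" for i by simp
 have "Lf V p j f (Pr k j x) = lincomb (tensor_psh C E) V (kids k) gdeg gen (p + j) (%i. gmul C V p (j - gdeg i) f (dual i j x))"
  unfolding Pr_def by (rule TPm.lincomb_act[OF kids_facts f dual_coeffs[OF x], symmetric])
 also have "\<dots> = Pr k (p + j) (Lf V p j f x)"
  unfolding Pr_def
  by (rule TPm.lincomb_cong[OF kids_facts dual_coeffs[OF L_closed[OF V_open f x refl]]])
   (rule dual_L[OF _ f x refl refl, symmetric], rule kids_ids)
 finally show ?thesis ..
qed

lemma Pr_null: "x \<in> jnull V (Suc k) j ==> Pr k j x = \<zero>[S V j]"
 unfolding Pr_def lincomb_def
 by (rule finsum_zero_rm[OF S_rmod]) (simp add: dual_null[OF kids_ids] rl_zero[OF C_rmod S_rmod L_gen_linear[OF kids_ids(1)]])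

lemma dual_lincomb:
 assumes c: "\<forall>i\<in>kids k. c i : sect C V (j - gdeg i)" and i: "i \<in> kids k"
 shows "dual i j (lincomb (tensor_psh C E) V (kids k) gdeg gen j c) = c i"
proof -
 note id = kids_ids(1)[OF i]
 have ci: "c i : sect C V (j - gdeg i)" using c i by blast
 have t: "(%i. Lf V (j - gdeg i) (gdeg i) (c i) (gen i)) \<in> kids k \<rightarrow> carrier (S V j)"
  using TPm.lincomb_terms[OF kids_facts c] by blast
 have g: "dual i j (Lf V (j - gdeg m) (gdeg m) (c m) (gen m)) = gmul C V (j - gdeg m) (gdeg m - gdeg i) (c m) (dual i (gdeg m) (gen m))"
  if m: "m \<in> kids k" for m
  by (rule dual_L[OF id _ gen_closed[OF kids_ids(1)[OF m]]]) (use c m in simp_all)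
 have gi: "dual i j (Lf V (j - gdeg i) (gdeg i) (c i) (gen i)) = c i"
  unfolding g[OF i] dual_gen_eq[OF id] using gmul_gunit_right[OF ci] by simp
 have "dual i j (lincomb (tensor_psh C E) V (kids k) gdeg gen j c) =
   finsum (sec C V (j - gdeg i)) (%m. dual i j (Lf V (j - gdeg m) (gdeg m) (c m) (gen m))) (kids k)"
  unfolding lincomb_def by (rule rl_finsum[OF S_rmod C_rmod dual_linear[OF id refl] kids_finite t])
 also have "\<dots> = dual i j (Lf V (j - gdeg i) (gdeg i) (c i) (gen i))"
 proof (rule finsum_single_rm[OF C_rmod kids_finite i])
  show "dual i j (Lf V (j - gdeg i) (gdeg i) (c i) (gen i)) \<in> sect C V (j - gdeg i)" unfolding gi by (rule ci)
  fix m assume m: "m \<in> kids k" "m ~= i"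
  have "c m : sect C V (j - gdeg m)" using c m by blast
  from rl_zero[OF C_rmod C_rmod C.gmul_linear_right[OF V_open this], of "gdeg m - gdeg i"]
  show "dual i j (Lf V (j - gdeg m) (gdeg m) (c m) (gen m)) = \<zero>[sec C V (j - gdeg i)]"
   unfolding g[OF m(1)] dual_gen_neq[OF id kids_ids(1)[OF m(1)] m(2)[symmetric] refl] by simp
 qed
 finally show ?thesis unfolding gi .
qed

lemma Pr_gen: assumes i: "i \<in> kids k" shows "Pr k (gdeg i) (gen i) = gen i"
proof -
 have "Pr k (gdeg i) (gen i) = Lf V (gdeg i - gdeg i) (gdeg i) (dual i (gdeg i) (gen i)) (gen i)"
  unfolding Pr_def lincomb_def
 proof (rule finsum_single_rm[OF S_rmod kids_finite i])
  note id = kids_ids(1)[OF i]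
  show "Lf V (gdeg i - gdeg i) (gdeg i) (dual i (gdeg i) (gen i)) (gen i) \<in> carrier (S V (gdeg i))"
   by (rule L_closed[OF V_open dual_closed[OF id gen_closed[OF id] refl] gen_closed[OF id]]) simp
  show "Lf V (gdeg i - gdeg m) (gdeg m) (dual m (gdeg i) (gen i)) (gen m) = \<zero>[S V (gdeg i)]" if m: "m \<in> kids k" "m ~= i" for m
   unfolding dual_gen_neq[OF kids_ids(1)[OF m(1)] id m(2) refl] by (rule rl_zero[OF C_rmod S_rmod L_gen_linear[OF kids_ids(1)[OF m(1)]]])
 qed
 then show ?thesis using dual_gen_eq[OF kids_ids(1)[OF i]] TP.act_gunit[OF V_open gen_closed[OF kids_ids(1)[OF i]]] by simp
qed

definition dif :: "nat => int => ('f, 'e) jet_tensor => ('f, 'e) jet_tensor" where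
 "dif k j x = x \<oplus>[S V j] (-1) \<odot>[S V j] Pr k j x"

lemma dif_linear: "lin (S V j) (S V j) (dif k j)"
 using rl_fun_add[OF S_rmod rl_id rl_fun_smult[OF S_rmod Pr_linear]] by (simp add: dif_def[abs_def])

lemma dif_null: "x \<in> jnull V (Suc k) j ==> dif k j x = x"
 using rsub_sub[OF S_rmod jnull_rsub[OF V_open], of "Suc k" j] by (auto simp: dif_def Pr_null)

text \<open>A generator with at most \<open>k\<close> letters is fixed by \<open>Pr\<close>; a
  longer one is a product of more than \<open>k\<close> \<delta>-factors, and \<open>Pr\<close>
  kills it.\<close>

lemma dif_G: assumes x: "x \<in> G j" shows "dif k j x \<in> jnull V (Suc k) j"
proof (rule G_map[OF dif_linear S_rmod jnull_rsub[OF V_open] x])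
 fix i f p assume i: "i \<in> ids" and f: "f : sect C V p" and j: "j = p + gdeg i"
 note g = gen_closed[OF i]
 have gn: "dif k (gdeg i) (gen i) \<in> jnull V (Suc k) (gdeg i)"
 proof (cases "length (fst i) <= k")
  case True
  then have "i \<in> kids k" using i by (auto simp: kids_def ids_def)
  then have "dif k (gdeg i) (gen i) = \<zero>[S V (gdeg i)]" using g by (simp add: dif_def Pr_gen)
  then show ?thesis using rsub_zero[OF S_rmod jnull_rsub[OF V_open]] by simp
 next
  case False
  have "gen i \<in> jnull V (length (fst i)) (gdeg i)"
   unfolding gen_def gdeg_def by (rule dels_jnull[OF en_closed[OF idsD(3)[OF i]] idsD(2)[OF i] refl])
  then have "gen i \<in> jnull V (Suc k) (gdeg i)" using jnull_mono[OF V_open, of "Suc k" "length (fst i)"] False by auto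
  then show ?thesis by (simp add: dif_null)
 qed
 have "dif k j (Lf V p (gdeg i) f (gen i)) = Lf V p (gdeg i) f (dif k (gdeg i) (gen i))"
  unfolding dif_def j Pr_L[OF f g]
  using rl_add[OF L_linear[OF V_open f refl] g rm_smult_closed[OF S_rmod Pr_closed[OF g]]] rl_smult[OF L_linear[OF V_open f refl] Pr_closed[OF g]]
  by simp
 then show "dif k j (Lf V p (gdeg i) f (gen i)) \<in> jnull V (Suc k) j"
  using L_jnull[OF V_open f gn j] by simp
qed

context
 fixes a :: 'm assumes a: "a \<in> V"
begin

interpretation I: ideal_action "J a" "%i. sect C V i" "sec (tensor_psh C E) V" "act (tensor_psh C E) V"
 by (rule J_ideal[OF a])

text \<open>\<open>Pr\<close> is linear for \<open>\<triangleright>\<close>, so it respects the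
  powers of the ideal.\<close>

lemma Pr_ipow: assumes x: "x \<in> I.ipow q (%j. carrier (S V j)) j" shows "Pr k j x \<in> I.ipow q (%j. carrier (S V j)) j"
proof (rule ipow_map[where t = "%j. j" and h = "Pr k" and \<rho> = "%i f. f" and s = "%m. 1",
   OF J_ideal[OF a] J_ideal[OF a] Pr_linear _ _ _ rsub_carrier[OF S_rmod] rsub_carrier[OF S_rmod] _ x])
 fix n j f x assume f: "f \<in> J a n" and x: "x \<in> carrier (S V j)"
 note fc = J_C[OF a f]
 show "Pr k (n + j) (Lf V n j f x) = 1 \<odot>[S V (n + j)] Lf V n j f (Pr k j x)"
  unfolding Pr_L[OF fc x] using L_closed[OF V_open fc Pr_closed[OF x] refl] by simp
qed (auto intro: Pr_closed)

lemma dif_span: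
 assumes x: "x \<in> carrier (S V j)"
 shows "dif k j x \<in> real_span (S V j) (I.ipow q (%j. carrier (S V j)) j Un jnull V (Suc k) j)"
proof -
 let ?P = "I.ipow q (%j. carrier (S V j)) j"
 let ?T = "real_span (S V j) (?P Un jnull V (Suc k) j)"
 have Pr: "rsub ?P (S V j)" by (rule I.ipow_rsub[OF rsub_carrier[OF S_rmod]])
 have sub: "?P Un jnull V (Suc k) j <= carrier (S V j)"
  using rsub_sub[OF S_rmod Pr] rsub_sub[OF S_rmod jnull_rsub[OF V_open]] by blast
 have T: "rsub ?T (S V j)" by (rule span_rsub[OF S_rmod sub])
 have inT: "y \<in> ?T" if "y \<in> ?P Un jnull V (Suc k) j" for y by (rule subsetD[OF span_superset that])
 \<comment> \<open>The expansion is taken with \<open>q + k\<close> factors: then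
   \<open>q \<le> p\<close>, or the number \<open>q + k - p\<close> of \<delta>-factors is at least
   \<open>k + 1\<close>.\<close>
 show ?thesis
 proof (rule rl_span[OF S_rmod S_rmod dif_linear GF_sub[OF a] T _ GF_all[OF a x, of "q + k", unfolded GF_def[OF a]]])
  fix y assume "y \<in> G j Un FF a (q + k) j"
  then show "dif k j y \<in> ?T"
  proof
   assume "y \<in> G j"
   from dif_G[OF this] show ?thesis using inT by blast
  next
   assume y: "y \<in> FF a (q + k) j"
   show ?thesis
   proof (rule rl_span[OF S_rmod S_rmod dif_linear FF_sub[OF a] T _ y[unfolded FF_def[OF a]]])
    fix u assume "u \<in> (\<Union>p\<le>q + k. I.ipow p (jnull V (q + k - p)) j)"
    then obtain p where p: "p <= q + k" "u \<in> I.ipow p (jnull V (q + k - p)) j" by blast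
    have jr: "rsub (jnull V m j) (S V j)" for m j by (rule jnull_rsub[OF V_open])
    show "dif k j u \<in> ?T"
    proof (cases "q <= p")
     case True
     have "u \<in> ?P" by (rule I.ipow_full_antimono[OF True I.ipow_mono[OF jr p(2)]])
     from this Pr_ipow[OF this, of k] have "dif k j u \<in> ?P"
      unfolding dif_def by (intro rsub_add[OF S_rmod Pr] rsub_smult[OF S_rmod Pr])
     then show ?thesis using inT by blast
    next
     case False
     have "u \<in> jnull V (q + k - p) j"
      by (rule I.ipow_sub[OF jr L_jnull[OF V_open J_C[OF a] _ refl] p(2)])
     moreover have "Suc k <= q + k - p" using False by simp
     ultimately have "u \<in> jnull V (Suc k) j" using jnull_mono[OF V_open] by blast
     then show ?thesis using inT by (simp add: dif_null)
    qed
   qed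
  qed
 qed
qed

end

end

subsection \<open>Classes in the geometrization\<close>

locale jets_manifold = jets X C E
 for X :: "'m topology" and C :: "('m, 'f) apsh" and E :: "('m, 'f, 'e) mpsh" +
 fixes ds :: "int list" and k :: nat
 assumes manifold: "graded_manifold X C ds"
begin

sublocale PM: graded_modules X C "pJet C E k" ..

sublocale bul: stable_family X C "pJet C E k" "bullet X C ds (pJet C E k)"
 by (rule PM.bullet_stable[OF manifold])

sublocale GM: graded_modules X C "gpJet X C ds E k"
 unfolding gpJet_def Geo_def using C.graded_algebra_sheaf_axioms bul.quotient_module_presheaf
 by (rule graded_modules.intro)

text \<open>\<open>cl\<close> and \<open>cl2\<close> are the classes of a tensor in
  \<open>pJet\<close> and in \<open>gpJet\<close>; the calculations are done with
  representatives.\<close>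

definition cl :: "'m set => int => ('f, 'e) jet_tensor => ('f, 'e) jet_tensor set" where
 "cl U j x = jet_null C E k U j +>\<^bsub>S U j\<^esub> x"

definition cl2 :: "'m set => int => ('f, 'e) jet_tensor => ('f, 'e) jet_tensor set set" where
 "cl2 U j x = bullet X C ds (pJet C E k) U j +>\<^bsub>sec (pJet C E k) U j\<^esub> cl U j x"

lemma cl_linear: "openin X U ==> lin (S U j) (sec (pJet C E k) U j) (cl U j)"
 unfolding cl_def[abs_def] pJet_def by (rule null.q_proj)

lemma cl_closed: "openin X U ==> x \<in> carrier (S U j) ==> cl U j x : sect (pJet C E k) U j"
 by (rule rl_closed[OF cl_linear])

lemma cl_surj: "openin X U ==> sect (pJet C E k) U j = cl U j ` carrier (S U j)"
 unfolding cl_def[abs_def] pJet_def qp_sel by (rule null.q_carrier)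

lemma cl_eq_iff:
 "openin X U ==> x \<in> carrier (S U j) ==> y \<in> carrier (S U j) ==>
 cl U j x = cl U j y \<longleftrightarrow> x \<oplus>[S U j] (-1) \<odot>[S U j] y \<in> jet_null C E k U j"
 unfolding cl_def by (rule coset_eq_iff[OF TP.sec_rmod null.N_rsub])

lemma cl_act: "[|openin X U; f : sect C U i; x \<in> carrier (S U j)|] ==>
  act (pJet C E k) U i j f (cl U j x) = cl U (i + j) (Lf U i j f x)"
 unfolding cl_def pJet_def by (rule null.q_act)

lemma cl_res: "[|openin X U; openin X V; V <= U; x \<in> carrier (S U j)|] ==>
  res (pJet C E k) U V j (cl U j x) = cl V j (res (tensor_psh C E) U V j x)"
 unfolding cl_def pJet_def by (rule null.q_res)

lemma cl2_linear: "openin X U ==> lin (S U j) (sec (gpJet X C ds E k) U j) (cl2 U j)"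
 unfolding cl2_def[abs_def] gpJet_def Geo_def by (rule rl_comp[OF cl_linear bul.q_proj])

lemma cl2_closed: "openin X U ==> x \<in> carrier (S U j) ==> cl2 U j x : sect (gpJet X C ds E k) U j"
 by (rule rl_closed[OF cl2_linear])

lemma cl2_surj: "openin X U ==> sect (gpJet X C ds E k) U j = cl2 U j ` carrier (S U j)"
 unfolding cl2_def[abs_def] gpJet_def Geo_def qp_sel by (simp add: bul.q_carrier cl_surj image_image)

lemma cl2_zero_iff:
 assumes "openin X U" "x \<in> carrier (S U j)"
 shows "cl2 U j x = \<zero>[sec (gpJet X C ds E k) U j] \<longleftrightarrow> cl U j x \<in> bullet X C ds (pJet C E k) U j"
 unfolding cl2_def gpJet_def Geo_def qp_sel quotient_zero[OF pj.sec_rmod[OF assms(1)] bul.N_rsub[OF assms(1)]]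
 by (rule coset_zero[OF pj.sec_rmod[OF assms(1)] bul.N_rsub[OF assms(1)] cl_closed[OF assms]])

lemma cl2_act: "[|openin X U; f : sect C U i; x \<in> carrier (S U j)|] ==>
  act (gpJet X C ds E k) U i j f (cl2 U j x) = cl2 U (i + j) (Lf U i j f x)"
 unfolding cl2_def gpJet_def Geo_def by (simp add: bul.q_act cl_closed cl_act del: qp_sel)

lemma cl2_res: "[|openin X U; openin X V; V <= U; x \<in> carrier (S U j)|] ==>
  res (gpJet X C ds E k) U V j (cl2 U j x) = cl2 V j (res (tensor_psh C E) U V j x)"
 unfolding cl2_def gpJet_def Geo_def by (simp add: bul.q_res cl_closed cl_res del: qp_sel)

text \<open>The lift of \<open>pjet_deltas\<close> to representatives.\<close>

primrec jdeltas :: "'m set => (int \<times> 'f) list => int => ('f, 'e) jet_tensor => ('f, 'e) jet_tensor" where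
 "jdeltas U [] j x = x"
| "jdeltas U (w # ws) j x = df U (fst w) (sum_list (map fst ws) + j) (snd w) (jdeltas U ws j x)"

lemma jdeltas_closed:
 "[|openin X U; \<forall>w\<in>set ws. snd w : sect C U (fst w); x \<in> carrier (S U j); n = sum_list (map fst ws) + j|] ==>
 jdeltas U ws j x \<in> carrier (S U n)"
 by (induction ws arbitrary: n) (auto intro!: d_closed)

lemma jdeltas_res:
 assumes U: "openin X U" "openin X V" "V <= U" and x: "x \<in> carrier (S U j)"
 shows "\<forall>w\<in>set ws. snd w : sect C U (fst w) ==> n = sum_list (map fst ws) + j ==>
  res (tensor_psh C E) U V n (jdeltas U ws j x) =
   jdeltas V (map (%w. (fst w, res C U V (fst w) (snd w))) ws) j (res (tensor_psh C E) U V j x)"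
proof (induction ws arbitrary: n)
 case (Cons w ws)
 have "res (tensor_psh C E) U V n (jdeltas U (w # ws) j x) = df V (fst w) (sum_list (map fst ws) + j) (res C U V (fst w) (snd w))
   (res (tensor_psh C E) U V (sum_list (map fst ws) + j) (jdeltas U ws j x))"
  unfolding jdeltas.simps by (rule res_d[OF U _ jdeltas_closed[OF U(1) _ x refl]]) (use Cons.prems in auto)
 then show ?case using Cons by (simp add: comp_def)
qed simp

lemma pjet_deltas_cl:
 assumes U: "openin X U" and x: "x \<in> carrier (S U j)"
 shows "\<forall>w\<in>set ws. snd w : sect C U (fst w) ==> n = sum_list (map fst ws) + j ==>
  pjet_deltas C E k U ws j (cl U j x) = cl U n (jdeltas U ws j x)"
proof (induction ws arbitrary: n)
 case (Cons w ws)
 have w: "snd w : sect C U (fst w)" and ws: "\<forall>w\<in>set ws. snd w : sect C U (fst w)" using Cons.prems by auto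
 have n: "fst w + (sum_list (map fst ws) + j) = n" using Cons.prems by simp
 have dn: "df U (fst w) (sum_list (map fst ws) + j) (snd w) y \<in> jet_null C E k U (fst w + (sum_list (map fst ws) + j))"
  if "y \<in> jet_null C E k U (sum_list (map fst ws) + j)" for y
  using d_jnull[OF U w that[unfolded jet_null_eq] refl] jnull_Suc[OF U] unfolding jet_null_eq by blast
 have "pjet_deltas C E k U (w # ws) j (cl U j x) = pjet_delta C E k U (fst w) (sum_list (map fst ws) + j) (snd w)
   (cl U (sum_list (map fst ws) + j) (jdeltas U ws j x))"
  using Cons.IH[OF ws refl] by simp
 also have "\<dots> = cl U n (jdeltas U (w # ws) j x)"
  unfolding pjet_delta_def cl_def jdeltas.simps n[symmetric]
  by (rule descend_coset[OF TP.sec_rmod[OF U] TP.sec_rmod[OF U] null.N_rsub[OF U] null.N_rsub[OF U] d_linear[OF U w refl] dn jdeltas_closed[OF U ws x refl]])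
 finally show ?case .
qed simp

text \<open>Gives the generators by representatives and words, the form in which their restriction
  is computed.\<close>

lemma jet_generator_eq:
 assumes U: "openin X U" and z: "\<forall>A<length ds. z A : sect C U (ds ! A)" and \<Phi>: "\<Phi> l : sect E U (es ! l)"
 shows "jet_generator X C ds E es k U z \<Phi> (I, l) = cl2 U (gen_degree ds es (I, l))
  (jdeltas U (map (%A. (ds ! A, z A)) (word ds I)) (es ! l) (tn U 0 (es ! l) (gunit C U) (\<Phi> l)))"
proof -
 have t: "tn U 0 (es ! l) (gunit C U) (\<Phi> l) \<in> carrier (S U (es ! l))"
  by (rule tS_closed[OF U C.gunit_closed[OF U] \<Phi>]) simp
 have j: "jet_tens C E k U 0 (es ! l) (gunit C U) (\<Phi> l) = cl U (es ! l) (tn U 0 (es ! l) (gunit C U) (\<Phi> l))"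
  unfolding jet_tens_def cl_def by simp
 have "map fst (map (%A. (ds ! A, z A)) (word ds I)) = map (%A. ds ! A) (word ds I)" by simp
 then have s: "sum_list (map fst (map (%A. (ds ! A, z A)) (word ds I))) = mi_degree ds I"
  using sum_list_concat_replicate[of I "%A. ds ! A" "length ds"] unfolding map_word mi_degree_def by simp
 have m: "\<forall>w\<in>set (map (%A. (ds ! A, z A)) (word ds I)). snd w : sect C U (fst w)"
  using z set_concat_replicate[of I "length ds"] by (auto simp: word_def)
 show ?thesis
  unfolding jet_generator_def prod.case map_word[symmetric] j cl2_def
  using pjet_deltas_cl[OF U t m, of "gen_degree ds es (I, l)"] s by (simp add: gen_degree_def)
qed

end


section \<open>Free generation over one open subset of a chart\<close>

locale jet_chart = jet_frame X C V ds z D "vanishing_ideal X C ds V" Z E es \<Phi> + jets_manifold X C E ds k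
 for X :: "'m topology" and C :: "('m, 'f) apsh" and V ds z D Z and E :: "('m, 'f, 'e) mpsh" and es \<Phi> k
begin

lemma pJet_rmod: "rmod (sec (pJet C E k) V j)"
 by (rule pj.sec_rmod[OF V_open])

lemma cl_null: assumes x: "x \<in> jnull V (Suc k) j" shows "cl V j x = \<zero>[sec (pJet C E k) V j]"
proof -
 have xc: "x \<in> carrier (S V j)" using rsub_sub[OF S_rmod jnull_rsub[OF V_open]] x by blast
 have "cl V j x = cl V j \<zero>[S V j]"
  unfolding cl_eq_iff[OF V_open xc rm_zero_closed[OF S_rmod]] using x xc by (simp add: jet_null_eq)
 then show ?thesis using rl_zero[OF S_rmod pJet_rmod cl_linear[OF V_open]] by simp
qed

text \<open>For every point and every \<open>q\<close>, \<open>dif_span\<close> puts the difference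
  into the q-th power plus \<open>jnull\<close>, and the latter is zero in \<open>pJet\<close>. So a
  tensor and its projection have the same class in the geometrization.\<close>

lemma cl_dif_bullet:
 assumes x: "x \<in> carrier (S V j)"
 shows "cl V j (dif k j x) \<in> bullet X C ds (pJet C E k) V j"
 unfolding bullet_def
proof (intro CollectI conjI allI ballI)
 show "cl V j (dif k j x) \<in> sect (pJet C E k) V j" by (rule cl_closed[OF V_open rl_closed[OF dif_linear x]])
 fix q a assume a: "a \<in> V"
 interpret I: ideal_action "vanishing_ideal X C ds V a" "%i. sect C V i" "sec (tensor_psh C E) V" "act (tensor_psh C E) V"
  by (rule J_ideal[OF a])
 interpret P: ideal_action "vanishing_ideal X C ds V a" "%i. sect C V i" "sec (pJet C E k) V" "act (pJet C E k) V"
  by (rule PM.ideal_action[OF V_open])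
 have Pr: "rsub (P.ipow q (%j. sect (pJet C E k) V j) j) (sec (pJet C E k) V j)"
  by (rule P.ipow_rsub[OF rsub_carrier[OF pJet_rmod]])
 have sub: "I.ipow q (%j. carrier (S V j)) j Un jnull V (Suc k) j <= carrier (S V j)"
  using rsub_sub[OF S_rmod I.ipow_rsub[OF rsub_carrier[OF S_rmod]]] rsub_sub[OF S_rmod jnull_rsub[OF V_open]] by blast
 show "cl V j (dif k j x) \<in> P.ipow q (%j. sect (pJet C E k) V j) j"
 proof (rule rl_span[OF S_rmod pJet_rmod cl_linear[OF V_open] sub Pr _ dif_span[OF a x]])
  fix y assume "y \<in> I.ipow q (%j. carrier (S V j)) j Un jnull V (Suc k) j"
  then show "cl V j y \<in> P.ipow q (%j. sect (pJet C E k) V j) j"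
  proof
   assume y: "y \<in> I.ipow q (%j. carrier (S V j)) j"
   show ?thesis
   proof (rule ipow_map[where t = "%j. j" and h = "cl V" and \<rho> = "%i f. f" and s = "%m. 1",
     OF I.ideal_action_axioms P.ideal_action_axioms cl_linear[OF V_open] _ _ _ rsub_carrier[OF S_rmod] rsub_carrier[OF pJet_rmod] _ y])
    fix n j f x assume f: "f \<in> vanishing_ideal X C ds V a n" and x: "x \<in> carrier (S V j)"
    note fc = J_C[OF a f]
    show "cl V (n + j) (Lf V n j f x) = 1 \<odot>[sec (pJet C E k) V (n + j)] act (pJet C E k) V n j f (cl V j x)"
     unfolding cl_act[OF V_open fc x] using pJet_rmod cl_closed[OF V_open L_closed[OF V_open fc x refl]] by simp
   qed (auto intro: cl_closed[OF V_open])
  next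
   assume "y \<in> jnull V (Suc k) j"
   then show ?thesis using rsub_zero[OF pJet_rmod Pr] by (simp only: cl_null)
  qed
 qed
qed

text \<open>An element of the q-th power has a representative on which the functional takes a value
  in \<open>Z a q\<close>, and by \<open>dual_null\<close> the value does not depend on the
  representative. As this holds for all \<open>a\<close> and \<open>q\<close>, the value is
  0.\<close>

lemma dual_bullet:
 assumes y: "y \<in> carrier (S V j)" and b: "cl V j y \<in> bullet X C ds (pJet C E k) V j" and i: "i \<in> kids k"
 shows "dual i j y = \<zero>[sec C V (j - gdeg i)]"
proof (rule Z_separated)
 note id = kids_ids(1)[OF i]
 show dc: "dual i j y : sect C V (j - gdeg i)" by (rule dual_closed[OF id y refl])
 fix a q assume a: "a \<in> V"
 interpret P: ideal_action "vanishing_ideal X C ds V a" "%i. sect C V i" "sec (pJet C E k) V" "act (pJet C E k) V"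
  by (rule PM.ideal_action[OF V_open])
 \<comment> \<open>The functional lives on tensors, so the filtration on classes asks for one
   suitable representative.\<close>
 let ?T = "%q j. cl V j ` {x \<in> carrier (S V j). dual i j x \<in> Z a q (j - gdeg i)}"
 have yq: "cl V j y \<in> P.ipow q (%j. sect (pJet C E k) V j) j" using b a unfolding bullet_def by blast
 have "cl V j y \<in> ?T q j"
 proof (rule P.ipow_le[where T = ?T, OF _ _ _ yq])
  show "rsub (?T q j) (sec (pJet C E k) V j)" for q j
   by (rule rsub_image[OF S_rmod pJet_rmod cl_linear[OF V_open] rsub_vimage[OF S_rmod C_rmod dual_linear[OF id refl] Z_rsub[OF a]]])
  show "sect (pJet C E k) V j <= ?T 0 j" for j
   unfolding cl_surj[OF V_open] Z_0[OF a] using dual_closed[OF id _ refl] by blast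
  fix q m j f A assume f: "f \<in> vanishing_ideal X C ds V a m" and "A \<in> ?T q j"
  then obtain x where x: "x \<in> carrier (S V j)" "dual i j x \<in> Z a q (j - gdeg i)" "A = cl V j x" by blast
  note fc = J_C[OF a f]
  have e: "m + (j - gdeg i) = m + j - gdeg i" by simp
  have "dual i (m + j) (Lf V m j f x) \<in> Z a (Suc q) (m + j - gdeg i)"
   unfolding dual_L[OF id fc x(1) refl refl] using Z_Suc[OF a f x(2)] unfolding e .
  then show "act (pJet C E k) V m j f A \<in> ?T (Suc q) (m + j)"
   unfolding x(3) cl_act[OF V_open fc x(1)] using L_closed[OF V_open fc x(1) refl] by blast
 qed
 then obtain x where x: "x \<in> carrier (S V j)" "dual i j x \<in> Z a q (j - gdeg i)" "cl V j y = cl V j x" by blast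
 have "y \<oplus>[S V j] (-1) \<odot>[S V j] x \<in> jnull V (Suc k) j"
  using x(3) unfolding cl_eq_iff[OF V_open y x(1)] jet_null_eq .
 from dual_null[OF id kids_ids(2)[OF i] this refl]
 have "dual i j y \<oplus>[sec C V (j - gdeg i)] (-1) \<odot>[sec C V (j - gdeg i)] dual i j x = \<zero>[sec C V (j - gdeg i)]"
  using rl_add[OF dual_linear[OF id refl] y rm_smult_closed[OF S_rmod x(1)]] rl_smult[OF dual_linear[OF id refl] x(1)] by simp
 then have "dual i j y = dual i j x"
  by (rule iffD1[OF rm_minus_eq_zero[OF C_rmod dc dual_closed[OF id x(1) refl]]])
 then show "dual i j y \<in> Z a q (j - gdeg i)" using x(2) by simp
qed

lemma cl2_gen_all: "\<forall>i\<in>kids k. cl2 V (gdeg i) (gen i) \<in> sect (gpJet X C ds E k) V (gdeg i)"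
 using cl2_closed[OF V_open] gen_all by blast

lemma cl2_lincomb:
 assumes c: "\<forall>i\<in>kids k. c i : sect C V (j - gdeg i)"
 shows "lincomb (gpJet X C ds E k) V (kids k) gdeg (%i. cl2 V (gdeg i) (gen i)) j c =
  cl2 V j (lincomb (tensor_psh C E) V (kids k) gdeg gen j c)"
proof -
 note gr = GM.F.sec_rmod[OF V_open]
 have t: "(%i. Lf V (j - gdeg i) (gdeg i) (c i) (gen i)) \<in> kids k \<rightarrow> carrier (S V j)"
  using TPm.lincomb_terms[OF kids_facts c] by blast
 show ?thesis
  unfolding lincomb_def rl_finsum[OF S_rmod gr cl2_linear[OF V_open] kids_finite t]
 proof (rule sum_cong_rm[OF gr refl])
  show "(%i. cl2 V j (Lf V (j - gdeg i) (gdeg i) (c i) (gen i))) \<in> kids k \<rightarrow> sect (gpJet X C ds E k) V j"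
   using t cl2_closed[OF V_open] by blast
  fix i assume i: "i \<in> kids k"
  then have "c i : sect C V (j - gdeg i)" "gen i \<in> carrier (S V (gdeg i))" using c gen_all by blast+
  from cl2_act[OF V_open this]
  show "act (gpJet X C ds E k) V (j - gdeg i) (gdeg i) (c i) (cl2 V (gdeg i) (gen i)) = cl2 V j (Lf V (j - gdeg i) (gdeg i) (c i) (gen i))"
   by simp
 qed
qed

text \<open>Generation holds because a class equals that of its projection by
  \<open>cl_dif_bullet\<close>. Independence holds because the functionals recover the coefficients
  and vanish on what the geometrization removes.\<close>

theorem gpJet_free: "freely_generates C (gpJet X C ds E k) V (kids k) gdeg (%i. cl2 V (gdeg i) (gen i))"
proof (rule GM.freely_generatesI[OF V_open kids_finite cl2_gen_all])
 fix j A assume "A : sect (gpJet X C ds E k) V j"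
 then obtain x where x: "x \<in> carrier (S V j)" "A = cl2 V j x" unfolding cl2_surj[OF V_open] by blast
 note gr = GM.F.sec_rmod[OF V_open] and L = cl2_linear[OF V_open]
 have "cl2 V j (dif k j x) = \<zero>[sec (gpJet X C ds E k) V j]"
  using cl2_zero_iff[OF V_open rl_closed[OF dif_linear x(1)]] cl_dif_bullet[OF x(1)] by simp
 then have "cl2 V j x \<oplus>[sec (gpJet X C ds E k) V j] (-1) \<odot>[sec (gpJet X C ds E k) V j] cl2 V j (Pr k j x) = \<zero>[sec (gpJet X C ds E k) V j]"
  unfolding dif_def rl_add[OF L x(1) rm_smult_closed[OF S_rmod Pr_closed[OF x(1)]]] rl_smult[OF L Pr_closed[OF x(1)]] .
 then have "cl2 V j x = cl2 V j (Pr k j x)"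
  by (rule iffD1[OF rm_minus_eq_zero[OF gr cl2_closed[OF V_open x(1)] cl2_closed[OF V_open Pr_closed[OF x(1)]]]])
 then have "A = lincomb (gpJet X C ds E k) V (kids k) gdeg (%i. cl2 V (gdeg i) (gen i)) j (%i. dual i j x)"
  unfolding x(2) cl2_lincomb[OF dual_coeffs[OF x(1)]] Pr_def .
 then show "EX c. (\<forall>i\<in>kids k. c i : sect C V (j - gdeg i)) &
   A = lincomb (gpJet X C ds E k) V (kids k) gdeg (%i. cl2 V (gdeg i) (gen i)) j c"
  by (intro exI[of _ "%i. dual i j x"] conjI dual_coeffs[OF x(1)])
next
 fix j c i assume c: "\<forall>i\<in>kids k. c i : sect C V (j - gdeg i)" and i: "i \<in> kids k"
  and 0: "lincomb (gpJet X C ds E k) V (kids k) gdeg (%i. cl2 V (gdeg i) (gen i)) j c = \<zero>[sec (gpJet X C ds E k) V j]"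
 have y: "lincomb (tensor_psh C E) V (kids k) gdeg gen j c \<in> carrier (S V j)"
  by (rule TPm.lincomb_closed[OF kids_facts c])
 have "cl V j (lincomb (tensor_psh C E) V (kids k) gdeg gen j c) \<in> bullet X C ds (pJet C E k) V j"
  using 0 unfolding cl2_lincomb[OF c] cl2_zero_iff[OF V_open y] .
 from dual_bullet[OF y this i] show "c i = \<zero>[sec C V (j - gdeg i)]" unfolding dual_lincomb[OF c i] .
qed

lemma jdeltas_dels: "jdeltas V (map (%A. (ds ! A, z A)) w) j x = dels w j x"
proof (induction w)
 case (Cons A w)
 have "sum_list (map fst (map (%A. (ds ! A, z A)) w)) = wdeg w" by (simp add: wdeg_def comp_def)
 then show ?case using Cons by simp
qed simp

end

section \<open>Frames over charts and the sheaf of jets\<close>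

lemma (in graded_modules) freely_generates_on_cong:
 assumes gen: "freely_generates_on X C F U L d b" and d: "!!l. l \<in> L ==> d' l = d l" and b: "!!l. l \<in> L ==> b' l = b l"
 shows "freely_generates_on X C F U L d' b'"
 unfolding freely_generates_on_def
proof (intro conjI ballI allI impI)
 show U: "openin X U" by (rule fg_onD(1)[OF gen])
 have bU: "\<forall>l\<in>L. b l : sect F U (d l)" using gen unfolding freely_generates_on_def by blast
 then show "b' l : sect F U (d' l)" if "l \<in> L" for l using d b that by simp
 fix V assume "openin X V & V <= U"
 then have V: "openin X V" "V <= U" by auto
 note g = fg_onD(2)[OF gen V]
 have L: "finite L" using g unfolding freely_generates_def by blast
 have bV: "\<forall>l\<in>L. res F U V (d l) (b l) \<in> sect F V (d l)" using bU F.res_closed[OF U V] by blast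
 let ?b = "%l. res F U V (d' l) (b' l)"
 have g': "freely_generates C F V L d ?b"
  by (rule freely_generates_cong[OF V(1) L bV _ g]) (use d b in simp)
 have bV': "\<forall>l\<in>L. ?b l : sect F V (d l)" using bV d b by simp
 have "(c \<in> (\<Pi>\<^sub>E l\<in>L. sect C V (j - d' l)) & \<psi> = finsum (sec F V j) (%l. act F V (j - d' l) (d' l) (c l) (?b l)) L) \<longleftrightarrow>
   (c \<in> (\<Pi>\<^sub>E l\<in>L. sect C V (j - d l)) & \<psi> = finsum (sec F V j) (%l. act F V (j - d l) (d l) (c l) (?b l)) L)" for c j \<psi>
 proof -
  have e: "(\<Pi>\<^sub>E l\<in>L. sect C V (j - d' l)) = (\<Pi>\<^sub>E l\<in>L. sect C V (j - d l))"
   by (rule PiE_cong) (simp add: d)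
  have "finsum (sec F V j) (%l. act F V (j - d' l) (d' l) (c l) (?b l)) L = finsum (sec F V j) (%l. act F V (j - d l) (d l) (c l) (?b l)) L"
   if c: "c \<in> (\<Pi>\<^sub>E l\<in>L. sect C V (j - d l))"
  proof (rule sum_cong_rm[OF F.sec_rmod[OF V(1)] refl])
   have "\<forall>l\<in>L. c l : sect C V (j - d l)" using c by blast
   from lincomb_terms[OF V(1) L bV' this]
   show "(%l. act F V (j - d l) (d l) (c l) (?b l)) \<in> L \<rightarrow> sect F V j" by blast
  qed (simp add: d)
  then show ?thesis unfolding e by auto
 qed
 then show "freely_generates C F V L d' ?b"
  using g' d unfolding freely_generates_def by simp
qed

text \<open>Over each open \<open>V\<close> in the chart, the restricted chart and frame give free
  generation by \<open>gpJet_free\<close>. The generators over \<open>V\<close> are the restrictions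
  of those over \<open>U\<close>, because \<delta>, the coordinates and the frame restrict.\<close>

theorem gpJet_frame:
 fixes X :: "'m topology" and C :: "('m, 'f) apsh" and E :: "('m, 'f, 'e) mpsh"
 assumes M: "graded_manifold X C ds" and E: "graded_module_presheaf X C E"
  and ch: "graded_chart X C ds U \<phi> \<theta>" and fr: "local_frame X C E es U \<Phi>"
 shows "freely_generates_on X C (gpJet X C ds E k) U
  ((\<Union>q\<in>{0..k}. multiindices_of_weight ds q) \<times> {..<length es}) (gen_degree ds es)
  (jet_generator X C ds E es k U (chart_coordinate ds U \<phi> \<theta>) \<Phi>)"
proof -
 have C: "graded_algebra_sheaf X C" using M by (simp add: graded_manifold_def)
 interpret jets_manifold X C E ds k
  by (intro jets_manifold.intro jets_manifold_axioms.intro jets.intro C E M)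
 interpret EM: graded_modules X C E ..
 let ?z = "chart_coordinate ds U \<phi> \<theta>"
 let ?L = "(\<Union>q\<in>{0..k}. multiindices_of_weight ds q) \<times> {..<length es}"
 let ?b = "%(w, l). cl2 U (coordinate_algebra.wdeg ds w + es ! l)
  (jdeltas U (map (%A. (ds ! A, ?z A)) w) (es ! l) (tn U 0 (es ! l) (gunit C U) (\<Phi> l)))"
 let ?K = "jet_frame.kids ds es k" and ?d = "jet_frame.gdeg ds es"
 note fr' = fr[unfolded local_frame_def]
 have U: "openin X U" by (rule EM.fg_onD(1)[OF fr'])
 have \<Phi>: "\<Phi> l : sect E U (es ! l)" if "l < length es" for l
  using fr' that unfolding freely_generates_on_def by blast
 interpret chU: chart X C ds U \<phi> \<theta> by (intro chart.intro chart_axioms.intro C ch)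
 have zU: "?z A = chU.z A" for A by (simp add: chart_coordinate_def chU.z_def)
 have z: "?z A : sect C U (ds ! A)" if "A < length ds" for A
  unfolding zU by (rule chU.z_closed[OF that])
 have tU: "tn U 0 (es ! l) (gunit C U) (\<Phi> l) \<in> carrier (S U (es ! l))" if "l < length es" for l
  by (rule tS_closed[OF U C.gunit_closed[OF U] \<Phi>[OF that]]) simp
 \<comment> \<open>\<open>kids\<close> and \<open>gdeg\<close> are determined by \<open>ds\<close>,
   \<open>es\<close> and \<open>k\<close>, so the index set and the degrees are the same for all
   \<open>V\<close>.\<close>
 have at_V: "freely_generates C (gpJet X C ds E k) V ?K ?d (%i. res (gpJet X C ds E k) U V (?d i) (?b i)) &
   bij_betw (word ds) (\<Union>q\<in>{0..k}. multiindices_of_weight ds q) {w. coordinate_algebra.normal_word ds w & length w <= k} &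
   ?K = {w. coordinate_algebra.normal_word ds w & length w <= k} \<times> {..<length es} &
   (ALL i. ?d i = coordinate_algebra.wdeg ds (fst i) + es ! snd i) &
   (ALL I. coordinate_algebra.wdeg ds (word ds I) = mi_degree ds I) &
   (\<forall>i\<in>?K. ?b i : sect (gpJet X C ds E k) U (?d i))"
  if V: "openin X V" "V <= U" for V
 proof -
  interpret chV: chart X C ds V \<phi> \<theta> by (intro chart.intro chart_axioms.intro C chart_restrict[OF ch V])
  interpret jc: jet_chart X C V ds chV.z chV.D chV.Z E es "%l. res E U V (es ! l) (\<Phi> l)" k
   by (intro jet_chart.intro jet_frame.intro jet_frame_axioms.intro chV.coordinate_algebra jets_axioms jets_manifold_axioms
     EM.fg_onD(2)[OF fr' V])
  have zV: "res C U V (ds ! A) (?z A) = chV.z A" if A: "A < length ds" for A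
  proof -
   have "(%I x. if x \<in> \<phi> ` V then model_coordinate ds (\<phi> ` U) A I x else 0) = model_coordinate ds (\<phi> ` V) A"
    using V(2) by (auto simp: model_coordinate_def fun_eq_iff)
   then have "res (model_sheaf ds) (\<phi> ` U) (\<phi> ` V) (ds ! A) (model_coordinate ds (\<phi> ` U) A) = model_coordinate ds (\<phi> ` V) A"
    by (simp add: model_sheaf_def)
   then show ?thesis
    using chU.\<theta>_res[OF V msec_coordinate[OF chU.W_open A]] by (simp add: chart_coordinate_def chV.z_def)
  qed
  have mz: "\<forall>w\<in>set (map (%A. (ds ! A, ?z A)) w). snd w : sect C U (fst w)" if "set w <= {..<length ds}" for w
   using that z by auto
  have sw: "coordinate_algebra.wdeg ds w + es ! l = sum_list (map fst (map (%A. (ds ! A, ?z A)) w)) + es ! l" for w l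
   by (simp add: jc.wdeg_def comp_def)
  have r: "?b i : sect (gpJet X C ds E k) U (?d i) &
    res (gpJet X C ds E k) U V (?d i) (?b i) = cl2 V (?d i) (jc.gen i)" if i: "i \<in> ?K" for i
  proof -
   obtain w l where wl: "i = (w, l)" by (cases i)
   have l: "l < length es" and w: "set w <= {..<length ds}"
    using jc.idsD(2,3)[OF jc.kids_ids(1)[OF i]] wl by simp_all
   have d: "?d i = coordinate_algebra.wdeg ds w + es ! l" by (simp add: jc.gdeg_def wl)
   note cU = jdeltas_closed[OF U mz[OF w] tU[OF l] sw]
   have mm: "map (%w. (fst w, res C U V (fst w) (snd w))) (map (%A. (ds ! A, ?z A)) w) = map (%A. (ds ! A, chV.z A)) w"
    using w zV by auto
   have tt: "res (tensor_psh C E) U V (es ! l) (tn U 0 (es ! l) (gunit C U) (\<Phi> l)) =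
     tn V 0 (es ! l) (gunit C V) (res E U V (es ! l) (\<Phi> l))"
    using res_tens[OF U V C.gunit_closed[OF U] \<Phi>[OF l]] C.res_gunit[OF U V] by simp
   have "res (tensor_psh C E) U V (?d i) (jdeltas U (map (%A. (ds ! A, ?z A)) w) (es ! l) (tn U 0 (es ! l) (gunit C U) (\<Phi> l))) = jc.gen i"
    unfolding d jdeltas_res[OF U V tU[OF l] mz[OF w] sw] mm tt jc.jdeltas_dels by (simp add: jc.gen_def wl)
   then show ?thesis
    using cl2_closed[OF U cU] cl2_res[OF U V cU] unfolding wl d[unfolded wl] by simp
  qed
  have "freely_generates C (gpJet X C ds E k) V ?K ?d (%i. res (gpJet X C ds E k) U V (?d i) (?b i))"
   by (rule GM.freely_generates_cong[OF V(1) jc.kids_finite jc.cl2_gen_all _ jc.gpJet_free]) (use r in blast)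
  then show ?thesis
   using r jc.word_bij[of k] jc.kids_def jc.gdeg_def jc.wdeg_word by blast
 qed
 note at_U = at_V[OF U subset_refl]
 have on: "freely_generates_on X C (gpJet X C ds E k) U ?K ?d ?b"
  unfolding freely_generates_on_def using U at_U at_V by blast
 let ?h = "%(I, l). (word ds I, l)"
 have K: "?K = {w. coordinate_algebra.normal_word ds w & length w <= k} \<times> {..<length es}"
  and bij: "bij_betw (word ds) (\<Union>q\<in>{0..k}. multiindices_of_weight ds q) {w. coordinate_algebra.normal_word ds w & length w <= k}"
  and deg: "?d (w, l) = coordinate_algebra.wdeg ds w + es ! l" "coordinate_algebra.wdeg ds (word ds I) = mi_degree ds I" for w l I
  using at_U by simp_all
 have h: "bij_betw ?h ?L ?K"
  unfolding K
 proof (rule bij_betw_imageI)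
  show "inj_on ?h ?L"
  proof (rule inj_onI)
   fix x y assume x: "x \<in> ?L" and y: "y \<in> ?L" and e: "?h x = ?h y"
   then have e': "word ds (fst x) = word ds (fst y)" "snd x = snd y" by (simp_all add: case_prod_unfold)
   show "x = y"
    using inj_onD[OF bij_betw_imp_inj_on[OF bij], of "fst x" "fst y"] x y e' by (simp only: mem_Times_iff prod_eq_iff)
  qed
  have "?h ` ?L = word ds ` (\<Union>q\<in>{0..k}. multiindices_of_weight ds q) \<times> {..<length es}"
   using image_paired_Times[of "word ds" "%l. l" _ "{..<length es}"] by simp
  then show "?h ` ?L = {w. coordinate_algebra.normal_word ds w & length w <= k} \<times> {..<length es}"
   unfolding bij_betw_imp_surj_on[OF bij] .
 qed
 show ?thesis
 proof (rule GM.freely_generates_on_cong[OF GM.freely_generates_on_reindex[OF on h]])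
  fix i assume "i \<in> ?L"
  then obtain I l where i: "i = (I, l)" "l < length es" by blast
  show "gen_degree ds es i = ?d (?h i)" unfolding i by (simp add: gen_degree_def deg)
  show "jet_generator X C ds E es k U ?z \<Phi> i = ?b (?h i)"
   unfolding i using jet_generator_eq[where U = U and z = ?z and \<Phi> = \<Phi> and l = l and es = es and I = I, OF U _ \<Phi>[OF i(2)]] z by (simp add: gen_degree_def deg)
 qed
qed

theorem theorem7p6:
  fixes X :: "'m topology" and C :: "('m, 'f) apsh" and ds :: "int list"
    and E :: "('m, 'f, 'e) mpsh" and es :: "int list" and k :: nat
  assumes "graded_manifold X C ds" and "graded_vector_bundle X C E es"
  shows "(\<forall>U \<phi> \<theta> \<Phi>. graded_chart X C ds U \<phi> \<theta> \<and> local_frame X C E es U \<Phi> \<longrightarrow>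
            freely_generates_on X C (gpJet X C ds E k) U
              ((\<Union>q\<in>{0..k}. multiindices_of_weight ds q) \<times> {..<length es})
              (gen_degree ds es)
              (jet_generator X C ds E es k U (chart_coordinate ds U \<phi> \<theta>) \<Phi>) \<and>
            graded_module_sheaf (subtopology X U) C (gpJet X C ds E k)) \<and>
         graded_module_sheaf X C (Jet X C ds E k) \<and>
         (\<exists>js. locally_freely_generated X C (Jet X C ds E k) js \<and>
               graded_vector_bundle X C (Jet X C ds E k) js)"
proof -
 note M = assms(1)
 have C: "graded_algebra_sheaf X C" using M by (simp add: graded_manifold_def)
 have E: "graded_module_presheaf X C E" using assms(2) by (simp add: graded_vector_bundle_def graded_module_sheaf_def)
 interpret jets_manifold X C E ds k
  by (intro jets_manifold.intro jets_manifold_axioms.intro jets.intro C E M)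
 interpret EM: graded_modules X C E ..
 note fr = gpJet_frame[OF M E]
 let ?L = "(\<Union>q\<in>{0..k}. multiindices_of_weight ds q) \<times> {..<length es}"
 have 1: "freely_generates_on X C (gpJet X C ds E k) U ?L (gen_degree ds es)
    (jet_generator X C ds E es k U (chart_coordinate ds U \<phi> \<theta>) \<Phi>) &
   graded_module_sheaf (subtopology X U) C (gpJet X C ds E k)"
  if "graded_chart X C ds U \<phi> \<theta> & local_frame X C E es U \<Phi>" for U \<phi> \<theta> \<Phi>
  using fr[OF conjunct1[OF that] conjunct2[OF that]] GM.frame_sheaf by blast
 have J: "graded_module_sheaf X C (Jet X C ds E k)"
  unfolding Jet_def by (rule GM.sheafification_module_sheaf)
 interpret JM: graded_modules X C "Jet X C ds E k"
  using C J by (simp add: graded_modules_def graded_module_sheaf_def)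
 have std: "graded_modules X C (tensor_psh C (constant_psh (coord_gvs es')))" for es'
  by (rule graded_modules.intro[OF C tensor_setting.tensor_module_presheaf[OF tensor_setting.intro[OF C constant_presheaf]]])
 \<comment> \<open>On the intersection of a chart domain with a set that trivialises
   \<open>E\<close>, the generators form a frame. Their index set and degrees do not depend on the
   point, which makes the rank constant.\<close>
 have loc: "EX U b. m \<in> U & freely_generates_on X C (Jet X C ds E k) U ?L (gen_degree ds es) b" if m: "m \<in> topspace X" for m
 proof -
  obtain U1 \<tau> where 1: "openin X U1" "m \<in> U1" "module_iso_on X C (tensor_psh C (constant_psh (coord_gvs es))) E U1 \<tau>"
   using assms(2) m unfolding graded_vector_bundle_def by blast
  obtain U2 \<phi> \<theta> where 2: "m \<in> U2" "graded_chart X C ds U2 \<phi> \<theta>"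
   using M m unfolding graded_manifold_def by blast
  have o2: "openin X U2" using 2 unfolding graded_chart_def by blast
  let ?W = "U1 Int U2"
  have W: "openin X ?W" using 1(1) o2 by (rule openin_Int)
  obtain b where "freely_generates_on X C (tensor_psh C (constant_psh (coord_gvs es))) U1 {..<length es} ((!) es) b"
   using standard_frame[OF C 1(1)] by blast
  from EM.freely_generates_on_restrict[OF frame_transfer[OF std EM.graded_modules_axioms 1(3) this] W Int_lower1]
  obtain \<Phi> where \<Phi>: "local_frame X C E es ?W \<Phi>" unfolding local_frame_def by blast
  note g = fr[OF chart_restrict[OF 2(2) W Int_lower2] \<Phi>, of k]
  obtain \<tau>' where "module_iso_on X C (gpJet X C ds E k) (Jet X C ds E k) ?W \<tau>'"
   using GM.sheafification_iso[OF W GM.frame_sheaf[OF g]] unfolding Jet_def by blast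
  from frame_transfer[OF GM.graded_modules_axioms JM.graded_modules_axioms this g] show ?thesis
   using 1(2) 2(1) by blast
 qed
 \<comment> \<open>Finiteness of \<open>?L\<close> is read off from a local frame, which needs a
   point. Over an empty space any \<open>N\<close> and \<open>h\<close> will do, as the later claims
   about frames concern points.\<close>
 obtain N :: nat and h where h: "bij_betw h {..<N} ?L" if "topspace X ~= {}"
 proof (cases "topspace X = {}")
  case False
  then obtain m U b where "freely_generates_on X C (Jet X C ds E k) U ?L (gen_degree ds es) b" using loc by blast
  then have "finite ?L" unfolding freely_generates_on_def freely_generates_def by blast
  then show ?thesis using ex_bij_betw_nat_finite[of ?L] that unfolding atLeast0LessThan by blast
 qed blast
 define js where "js = map (%i. gen_degree ds es (h i)) [0..<N]"
 have lf: "EX U \<Psi>. m \<in> U & local_frame X C (Jet X C ds E k) js U \<Psi>" if m: "m \<in> topspace X" for m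
 proof -
  obtain U b where U: "m \<in> U" and g: "freely_generates_on X C (Jet X C ds E k) U ?L (gen_degree ds es) b" using loc[OF m] by blast
  have "topspace X ~= {}" using m by blast
  from JM.freely_generates_on_cong[OF JM.freely_generates_on_reindex[OF g h[OF this]], of "(!) js" "%i. b (h i)"]
  have "local_frame X C (Jet X C ds E k) js U (%i. b (h i))"
   unfolding local_frame_def by (simp add: js_def)
  then show ?thesis using U by blast
 qed
 have vb: "EX U \<tau>. openin X U & m \<in> U & module_iso_on X C (tensor_psh C (constant_psh (coord_gvs js))) (Jet X C ds E k) U \<tau>"
  if m: "m \<in> topspace X" for m
 proof -
  obtain U \<Psi> where U: "m \<in> U" and g: "freely_generates_on X C (Jet X C ds E k) U {..<length js} ((!) js) \<Psi>"
   using lf[OF m] unfolding local_frame_def by blast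
  have o: "openin X U" by (rule JM.fg_onD(1)[OF g])
  obtain b where "freely_generates_on X C (tensor_psh C (constant_psh (coord_gvs js))) U {..<length js} ((!) js) b"
   using standard_frame[OF C o] by blast
  from frames_iso[OF std JM.graded_modules_axioms this g] show ?thesis using o U by blast
 qed
 have "locally_freely_generated X C (Jet X C ds E k) js & graded_vector_bundle X C (Jet X C ds E k) js"
  unfolding locally_freely_generated_def graded_vector_bundle_def using J lf vb by blast
 then show ?thesis using 1 J by blast
qed

end
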